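(* Let $A$ be the ring of integers of a number field $K$. Let $G \subseteq GL_2(A)$ be a finite group, acting linearly on the polynomial ring $R = A[X,Y]$ (fixing $A$). Assume that for every prime $p$ dividing $|G|$, the Sylow $p$-subgroup of $G$ has exponent $p$. Then the ring of invariants $R^G$ is Cohen-Macaulay.
   Context: A subgroup $G \subseteq GL_2(A)$ acts on $A[X,Y]$ by $A$-algebra automorphisms, via the linear action of matrices on the free $A$-module $AX \oplus AY$ with basis $X, Y$. $R^G$ denotes the subring of elements of $R$ fixed by every element of $G$. *)

theory Defs
  imports
    "HOL-Algebra.Algebra"
    "HOL-Algebra.Algebraic_Closure_Type"
    "HOL-Analysis.Finite_Cartesian_Product"
    "HOL-Library.Extended_Nat"
begin

no_notation fps_nth (infixl \<open>$\<close> 75)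

hide_const (open) Divisibility.prime

section \<open>Cohen-Macaulay rings\<close>

subsection \<open>Localization\<close>

text \<open>The fraction \<open>a/s\<close> is the class of \<open>(a, s)\<close> under
  \<open>(a, s) \<sim> (b, t) \<longleftrightarrow> u (t a - s b) = 0\<close> for some \<open>u \<in> S\<close>; the factor \<open>u\<close> is needed
  because \<open>R\<close> may have zero divisors. \<open>S\<close> is meant to be multiplicatively closed.\<close>

definition frac_class :: "('a, 'b) ring_scheme \<Rightarrow> 'a set \<Rightarrow> 'a \<Rightarrow> 'a \<Rightarrow> ('a \<times> 'a) set" where
  "frac_class R S a s =
     {(b, t). b \<in> carrier R \<and> t \<in> S \<and>
        (\<exists>u\<in>S. u \<otimes>\<^bsub>R\<^esub> ((t \<otimes>\<^bsub>R\<^esub> a) \<ominus>\<^bsub>R\<^esub> (s \<otimes>\<^bsub>R\<^esub> b)) = \<zero>\<^bsub>R\<^esub>)}"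

definition localization :: "('a, 'b) ring_scheme \<Rightarrow> 'a set \<Rightarrow> ('a \<times> 'a) set ring" where
  "localization R S =
    \<lparr>carrier = {frac_class R S a s | a s. a \<in> carrier R \<and> s \<in> S},
     monoid.mult = (\<lambda>x y. \<Union>(a, s)\<in>x. \<Union>(b, t)\<in>y. frac_class R S (a \<otimes>\<^bsub>R\<^esub> b) (s \<otimes>\<^bsub>R\<^esub> t)),
     one = frac_class R S \<one>\<^bsub>R\<^esub> \<one>\<^bsub>R\<^esub>,
     ring.zero = frac_class R S \<zero>\<^bsub>R\<^esub> \<one>\<^bsub>R\<^esub>,
     ring.add = (\<lambda>x y. \<Union>(a, s)\<in>x. \<Union>(b, t)\<in>y.
              frac_class R S ((t \<otimes>\<^bsub>R\<^esub> a) \<oplus>\<^bsub>R\<^esub> (s \<otimes>\<^bsub>R\<^esub> b)) (s \<otimes>\<^bsub>R\<^esub> t))\<rparr>"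

definition localization_at :: "('a, 'b) ring_scheme \<Rightarrow> 'a set \<Rightarrow> ('a \<times> 'a) set ring" where
  "localization_at R P = localization R (carrier R - P)"

subsection \<open>Dimension and depth\<close>

text \<open>A chain \<open>P\<^sub>0 \<subset> \<dots> \<subset> P\<^sub>n\<close> of \<open>n + 1\<close> prime ideals has length \<open>n\<close>.\<close>

definition krull_dim :: "('a, 'b) ring_scheme \<Rightarrow> enat" where
  "krull_dim R = Sup {enat n | n. \<exists>P :: nat \<Rightarrow> 'a set.
     (\<forall>i\<le>n. primeideal (P i) R) \<and> (\<forall>i<n. P i \<subset> P (Suc i))}"

definition regular_sequence :: "('a, 'b) ring_scheme \<Rightarrow> 'a list \<Rightarrow> bool" where
  "regular_sequence R xs \<longleftrightarrow>
     set xs \<subseteq> carrier R \<and>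
     (\<forall>i<length xs. let I = Idl\<^bsub>R\<^esub> (set (take i xs)) in
        \<forall>z\<in>carrier (R Quot I).
          (I +>\<^bsub>R\<^esub> xs ! i) \<otimes>\<^bsub>R Quot I\<^esub> z = \<zero>\<^bsub>R Quot I\<^esub> \<longrightarrow> z = \<zero>\<^bsub>R Quot I\<^esub>) \<and>
     Idl\<^bsub>R\<^esub> (set xs) \<noteq> carrier R"

definition ideal_depth :: "('a, 'b) ring_scheme \<Rightarrow> 'a set \<Rightarrow> enat" where
  "ideal_depth R I = Sup {enat (length xs) | xs. regular_sequence R xs \<and> set xs \<subseteq> I}"

subsection \<open>The Cohen-Macaulay property\<close>

definition cohen_macaulay_local :: "('a, 'b) ring_scheme \<Rightarrow> bool" where
  "cohen_macaulay_local R \<longleftrightarrow> cring R \<and> noetherian_ring R \<and>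
     (\<exists>m. (\<forall>J. maximalideal J R \<longleftrightarrow> J = m) \<and> ideal_depth R m = krull_dim R)"

definition cohen_macaulay :: "('a, 'b) ring_scheme \<Rightarrow> bool" where
  "cohen_macaulay R \<longleftrightarrow> cring R \<and> noetherian_ring R \<and>
     (\<forall>m. maximalideal m R \<longrightarrow> cohen_macaulay_local (localization_at R m))"

section \<open>Sylow subgroups and the exponent of a group\<close>

definition sylow_subgroup :: "nat \<Rightarrow> 'a set \<Rightarrow> ('a, 'b) monoid_scheme \<Rightarrow> bool" where
  "sylow_subgroup p P G \<longleftrightarrow> subgroup P G \<and> card P = p ^ multiplicity p (Coset.order G)"

text \<open>Only meaningful for groups of finite exponent, in particular for finite groups.\<close>

definition group_exponent :: "('a, 'b) monoid_scheme \<Rightarrow> nat" where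
  "group_exponent G = (LEAST n. n > 0 \<and> (\<forall>x\<in>carrier G. x [^]\<^bsub>G\<^esub> n = \<one>\<^bsub>G\<^esub>))"

section \<open>Number fields and linear actions on two variables\<close>

text \<open>A number field is modelled as a whole type of class \<open>field_char_0\<close>; such a field
  contains \<open>\<rat>\<close> through \<^const>\<open>of_rat\<close>.\<close>

definition number_field :: "'k :: field_char_0 itself \<Rightarrow> bool" where
  "number_field _ \<longleftrightarrow>
     (\<exists>B :: 'k set. finite B \<and> module.span (\<lambda>(q :: rat) x. of_rat q * x) B = UNIV)"

definition ring_of_integers :: "'k :: field_char_0 set" where
  "ring_of_integers = {x. algebraic_int x}"

definition GL2 :: "'k :: comm_ring_1 set \<Rightarrow> ('k^2^2) monoid" where
  "GL2 A =
    \<lparr>carrier = {M. (\<forall>i j. M $ i $ j \<in> A) \<and>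
        (\<exists>N. (\<forall>i j. N $ i $ j \<in> A) \<and> M ** N = mat 1 \<and> N ** M = mat 1)},
     monoid.mult = (**), one = mat 1\<rparr>"

text \<open>The polynomial ring \<open>A[X,Y]\<close> is \<open>A[X][Y]\<close>: the inner variable of \<^typ>\<open>'k poly poly\<close> is
  \<open>X\<close>, the outer one is \<open>Y\<close>.\<close>

definition var_X :: "'k :: comm_ring_1 poly poly" where "var_X = [:[:0, 1:]:]"

definition var_Y :: "'k :: comm_ring_1 poly poly" where "var_Y = [:0, 1:]"

definition poly_ring_XY :: "'k :: comm_ring_1 set \<Rightarrow> 'k poly poly ring" where
  "poly_ring_XY A =
     ring_of_type_algebra\<lparr>carrier := {f. \<forall>i j. poly.coeff (poly.coeff f j) i \<in> A}\<rparr>"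

text \<open>\<open>subst_XY u v f\<close> is \<open>f(u, v)\<close>.\<close>

definition subst_XY ::
  "'k :: comm_ring_1 poly poly \<Rightarrow> 'k poly poly \<Rightarrow> 'k poly poly \<Rightarrow> 'k poly poly" where
  "subst_XY u v f = poly (map_poly (\<lambda>q. poly (map_poly (\<lambda>c. [:[:c:]:]) q) u) f) v"

text \<open>The columns of \<open>M\<close> are the images of the basis vectors \<open>X\<close> and \<open>Y\<close>, which makes this a
  left action.\<close>

definition linear_action :: "'k :: comm_ring_1^2^2 \<Rightarrow> 'k poly poly \<Rightarrow> 'k poly poly" where
  "linear_action M =
     subst_XY (smult [:M $ 1 $ 1:] var_X + smult [:M $ 2 $ 1:] var_Y)
              (smult [:M $ 1 $ 2:] var_X + smult [:M $ 2 $ 2:] var_Y)"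

definition invariant_ring :: "'k :: comm_ring_1 set \<Rightarrow> ('k^2^2) set \<Rightarrow> 'k poly poly ring" where
  "invariant_ring A G = (poly_ring_XY A)
     \<lparr>carrier := {f \<in> carrier (poly_ring_XY A). \<forall>M\<in>G. linear_action M f = f}\<rparr>"

end

theory Submission
 imports Defs "Jordan_Normal_Form.Char_Poly" "HOL-Analysis.Cartesian_Space"
begin

hide_const (open) up_ring.coeff

text \<open>
  Fix a maximal ideal \<open>m\<close> of \<open>S = R\<^sup>G\<close>. Let \<open>L\<close> be the algebraic closure of \<open>K\<close> and extend \<open>m\<close> to a
  maximal ideal \<open>M\<close> of \<open>B[X,Y]\<close>, where \<open>B\<close> is the ring of algebraic integers of \<open>L\<close>. By the
  Nullstellensatz \<open>M\<close> contains a prime number \<open>p\<close>, and \<open>X\<close>, \<open>X + Y\<^sup>2\<close> are roots of \<open>T\<^sup>q - T\<close> modulo \<open>M\<close>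
  for a power \<open>q\<close> of \<open>p\<close>. Hence \<open>m\<close> contains \<open>p\<close> and the orbit products
  \<open>f = \<Prod>((gX)\<^sup>q - gX)\<close> and \<open>g\<close> (the same with \<open>X + Y\<^sup>2\<close>). As \<open>S\<close> has dimension at most 3, it suffices
  that \<open>p, f, g\<close> is a regular sequence in \<open>S\<^sub>m\<close>.

  Let \<open>V\<close> be the valuation ring of \<open>L\<close> at \<open>M \<inter> B\<close> and \<open>P\<close> a Sylow \<open>p\<close>-subgroup of \<open>G\<close>. Either \<open>P\<close> consists of
  scalars or it contains a nonscalar central element. So over \<open>V\<close> there are coordinates in which \<open>P\<close> is
  diagonal in the basis \<open>X\<close>, \<open>Y + u X\<close> of \<open>L X + L Y\<close>. As all eigenvalues are \<open>p\<close>-th roots of unity,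
  \<open>V[X,Y]\<^sup>P\<close> is spanned over \<open>V[X\<^sup>p, N]\<close>, \<open>N = (Y + u X)\<^sup>p - u\<^sup>p X\<^sup>p\<close>, by primitive elements, one for
  each character; this makes \<open>p, F(X\<^sup>p), H(N)\<close> a regular sequence on \<open>V[X,Y]\<^sup>P\<close> for monic integer
  polynomials \<open>F\<close>, \<open>H\<close>. Some such \<open>F(X\<^sup>p)\<close>, \<open>H(N)\<close> lie in \<open>(p, f, g)\<close>, so \<open>p, f, g\<close> is regular there too.
  A \<open>K\<close>-linear retraction \<open>L \<rightarrow> K\<close> that maps finitely many given elements of \<open>V\<close> into \<open>V\<close> and the transfer from
  \<open>P\<close> to \<open>G\<close>, whose index is prime to \<open>p\<close>, bring the relations down to \<open>S\<^sub>m\<close>.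
\<close>

section \<open>Subrings and ideals as subsets of a commutative ring type\<close>

text \<open>Averaging over \<open>P\<close> would divide by \<open>p\<close>, which lies in the
  maximal ideal; only the transfer from \<open>P\<close> to \<open>G\<close> is harmless, so the
  depth must be found in the \<open>P\<close>-invariants themselves. \<open>L\<close> supplies the
  eigenvectors of \<open>P\<close>. The obstacle is that the eigenvalues, being \<open>p\<close>-th
  roots of unity, coincide modulo the maximal ideal of \<open>V\<close>: the eigenforms
  \<open>X\<close> and \<open>Y + u X\<close> need not span \<open>V X + V Y\<close>, and
  \<open>u\<close> may have a denominator. Three facts repair this. First, if \<open>w\<close> is
  the quotient of two distinct eigenvalues of a central element, then \<open>u (1 - w)\<close> is
  integral and \<open>(1 - w)^(p-1)\<close> divides \<open>p\<close>; so \<open>p u^(p-1)\<close> is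
  integral, and with it \<open>N\<close>. Second, on invariants a component by exponents modulo
  \<open>p\<close> in the eigenforms is zero or a component by total degree modulo \<open>p\<close>;
  total degree does not see the change of coordinates, so the component is again integral. Third,
  \<open>N\<close> is monic in \<open>Y\<close> over \<open>V[X]\<close>, so a polynomial in
  \<open>X^p\<close> and \<open>N\<close> that is integral already has coefficients in
  \<open>V\<close>, and Gauss's lemma over \<open>V\<close> splits a primitive factor off each
  component. Exponent \<open>p\<close> makes exponents matter only modulo \<open>p\<close>.\<close>

definition subring_set :: "'a :: comm_ring_1 set => bool" where
 "subring_set D \<longleftrightarrow> 1 : D & (\<forall>x\<in>D. \<forall>y\<in>D. x - y : D & x * y : D)"

lemma subringD:
 assumes "subring_set D"
 shows "1 : D" "0 : D" "x : D ==> y : D ==> x - y : D" "x : D ==> y : D ==> x * y : D"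
  "x : D ==> - x : D" "x : D ==> y : D ==> x + y : D"
proof -
 show 1: "1 : D" and diff: "!!x y. x : D ==> y : D ==> x - y : D"
  and "x : D ==> y : D ==> x * y : D"
  using assms unfolding subring_set_def by blast+
 show 0: "0 : D" using diff[OF 1 1] by simp
 show neg: "!!x. x : D ==> - x : D" using diff[OF 0] by (metis diff_0)
 show "x : D ==> y : D ==> x + y : D" using diff[OF _ neg, of x y] by simp
qed

lemma subringI:
 assumes "1 : D" "!!x y. x : D ==> y : D ==> x - y : D" "!!x y. x : D ==> y : D ==> x * y : D"
 shows "subring_set D"
 using assms unfolding subring_set_def by blast

lemma subring_sum:
 assumes "subring_set D" "!!i. i : I ==> f i : D"
 shows "sum f I : D"
 using assms(2) by (induction I rule: infinite_finite_induct) (auto intro: subringD[OF assms(1)])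

lemma subring_prod:
 assumes "subring_set D" "!!i. i : I ==> f i : D"
 shows "prod f I : D"
 using assms(2) by (induction I rule: infinite_finite_induct) (auto intro: subringD[OF assms(1)])

lemma subring_power: "subring_set D ==> x : D ==> x ^ n : D"
 by (induction n) (auto intro: subringD)

lemma subring_of_nat: "subring_set D ==> of_nat n : D"
 by (induction n) (auto intro: subringD)

lemma subring_of_int: "subring_set D ==> of_int n : D"
 by (cases n rule: int_cases2) (auto intro: subring_of_nat subringD)

lemmas subring_intros = subringD subring_sum subring_prod subring_power subring_of_nat subring_of_int

section \<open>Submodules, ideals and prime ideals\<close>

definition submod :: "'a :: comm_ring_1 set => 'a set => bool" where
 "submod D N \<longleftrightarrow> 0 : N & (\<forall>x\<in>N. \<forall>y\<in>N. x + y : N) & (\<forall>d\<in>D. \<forall>x\<in>N. d * x : N)"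

lemma submodD:
 assumes "submod D N"
 shows "0 : N" "x : N ==> y : N ==> x + y : N" "d : D ==> x : N ==> d * x : N"
 using assms unfolding submod_def by blast+

lemma submod_diff:
 assumes "subring_set D" "submod D N" "x : N" "y : N"
 shows "x - y : N"
proof -
 have "(-1) * y : N" using assms by (intro submodD(3)[OF assms(2)] subring_intros) auto
 then show ?thesis using submodD(2)[OF assms(2,3)] by fastforce
qed

lemma submod_sum:
 assumes "submod D N" "!!i. i : I ==> f i : N"
 shows "sum f I : N"
 using assms(2) by (induction I rule: infinite_finite_induct) (auto intro: submodD[OF assms(1)])

lemma submod_mono: "submod D N ==> E <= D ==> submod E N"
 unfolding submod_def by blast

definition ideal_in :: "'a :: comm_ring_1 set => 'a set => bool" where
 "ideal_in D I \<longleftrightarrow> I <= D & submod D I"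

definition prime_in :: "'a :: comm_ring_1 set => 'a set => bool" where
 "prime_in D Q \<longleftrightarrow> ideal_in D Q & 1 ~: Q & (\<forall>x\<in>D. \<forall>y\<in>D. x * y : Q --> x : Q \<or> y : Q)"

lemma prime_inD:
 assumes "prime_in D Q"
 shows "Q <= D" "submod D Q" "1 ~: Q" "x : D ==> y : D ==> x * y : Q ==> x : Q \<or> y : Q"
 using assms unfolding prime_in_def ideal_in_def by blast+

lemma prime_in_power:
 assumes "subring_set D" "prime_in D Q" "x : D" "x ^ n : Q"
 shows "x : Q"
 using assms(4)
proof (induction n)
 case (Suc n)
 then show ?case using prime_inD(4)[OF assms(2,3) subring_power[OF assms(1,3)], of n] by auto
qed (use prime_inD(3)[OF assms(2)] in simp)

lemma prime_in_prod:
 assumes "subring_set D" "prime_in D Q" "!!i. i : I ==> f i : D" "prod f I : Q"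
 shows "\<exists>i\<in>I. f i : Q"
 using assms(3,4)
proof (induction I rule: infinite_finite_induct)
 case (insert i F)
 have "prod f F : D" using insert by (intro subring_prod[OF assms(1)]) auto
 then show ?case using prime_inD(4)[OF assms(2), of "f i" "prod f F"] insert by auto
qed (use prime_inD(3)[OF assms(2)] in auto)

text \<open>Rings are handled as subsets of an ambient type, so that the arithmetic, sums and powers
  of the type classes apply. This converts such a subset into a ring record where the notions of the
  statement are concerned.\<close>

abbreviation RD :: "'a :: comm_ring_1 set => 'a ring" where
 "RD D \<equiv> ring_of_type_algebra\<lparr>carrier := D\<rparr>"

lemma RD_simps [simp]:
 "carrier (RD D) = D" "monoid.mult (RD D) = (*)" "one (RD D) = 1" "ring.zero (RD D) = 0" "ring.add (RD D) = (+)"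
 by (auto simp: ring_of_type_algebra_def)

lemma cring_RD:
 assumes "subring_set D"
 shows "cring (RD D)"
proof (rule cringI)
 show "abelian_group (RD D)"
 proof (rule abelian_groupI)
  show "\<exists>y\<in>carrier (RD D). y \<oplus>\<^bsub>RD D\<^esub> x = \<zero>\<^bsub>RD D\<^esub>" if "x : carrier (RD D)" for x
   using that subringD[OF assms] by (intro bexI[of _ "- x"]) auto
 qed (auto intro: subring_intros[OF assms])
 show "comm_monoid (RD D)"
  by (rule comm_monoidI) (auto intro: subring_intros[OF assms] simp: mult.assoc mult.commute)
qed (auto simp: algebra_simps)

lemma a_minus_RD:
 assumes "subring_set D" "x : D" "y : D"
 shows "x \<ominus>\<^bsub>RD D\<^esub> y = x - y"
proof -
 interpret cring "RD D" by (rule cring_RD[OF assms(1)])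
 have "\<ominus>\<^bsub>RD D\<^esub> y = - y"
  using assms subringD[OF assms(1)] by (intro minus_equality) auto
 then show ?thesis by (simp add: a_minus_def)
qed

lemma ideal_RD:
 assumes "subring_set D"
 shows "ideal I (RD D) \<longleftrightarrow> ideal_in D I"
proof
 interpret cring "RD D" by (rule cring_RD[OF assms])
 assume "ideal I (RD D)"
 then interpret I: ideal I "RD D" .
 show "ideal_in D I" unfolding ideal_in_def submod_def
  using I.a_subset I.zero_closed I.a_closed I.I_l_closed by auto
next
 interpret cring "RD D" by (rule cring_RD[OF assms])
 assume *: "ideal_in D I"
 then have sub: "I <= D" and m: "submod D I" by (auto simp: ideal_in_def)
 show "ideal I (RD D)"
 proof (rule idealI[OF ring_axioms])
  show "subgroup I (add_monoid (RD D))"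
  proof (rule group.subgroupI)
   show "Group.group (add_monoid (RD D))" by (rule a_group)
   show "inv\<^bsub>add_monoid (RD D)\<^esub> a : I" if "a : I" for a
   proof -
    have "\<ominus>\<^bsub>RD D\<^esub> a = - a"
     using that sub subringD[OF assms] by (intro minus_equality) auto
    moreover have "0 - a : I" using submod_diff[OF assms m submodD(1)[OF m] that] .
    ultimately show ?thesis by (simp add: a_inv_def)
   qed
  qed (use sub submodD[OF m] in auto)
 qed (use submodD(3)[OF m] in "simp_all, metis mult.commute")
qed

lemma primeideal_RD:
 assumes "subring_set D"
 shows "primeideal Q (RD D) \<longleftrightarrow> prime_in D Q"
proof -
 have "D = Q \<longleftrightarrow> 1 : Q" if "ideal_in D Q"
  using that subringD(1)[OF assms] unfolding ideal_in_def submod_def by (metis mult.right_neutral subset_antisym subsetI)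
 then show ?thesis
  using cring_RD[OF assms] ideal_RD[OF assms, of Q]
  unfolding primeideal_def primeideal_axioms_def prime_in_def by auto
qed

text \<open>By Zorn's lemma some ideal is maximal among those containing \<open>I\<close> and
  missing \<open>M\<close>, and such an ideal is prime. The last clause records the maximality,
  which the proof of lying over uses.\<close>

lemma (in cring) exists_primeideal_avoiding:
 assumes I: "ideal I R" and M: "M <= carrier R" "\<one> : M" "!!x y. x : M ==> y : M ==> x \<otimes> y : M"
  and IM: "I \<inter> M = {}"
 shows "\<exists>Q. primeideal Q R & I <= Q & Q \<inter> M = {} \<and>
      (\<forall>x\<in>carrier R - Q. \<exists>q\<in>Q. \<exists>r\<in>carrier R. q \<oplus> r \<otimes> x : M)"
proof -
 define \<A> where "\<A> = {J. ideal J R & I <= J & J \<inter> M = {}}"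
 have "\<exists>Q\<in>\<A>. \<forall>U\<in>\<A>. Q <= U --> U = Q"
 proof (rule subset_Zorn_nonempty)
  show "\<A> ~= {}" using I IM by (auto simp: \<A>_def)
  fix C assume C: "C ~= {}" "subset.chain \<A> C"
  then have "subset.chain {J. ideal J R} C" by (auto simp: pred_on.chain_def \<A>_def)
  from chain_Union_is_ideal[OF this] C show "\<Union>C\<in>\<A>"
   by (auto simp: pred_on.chain_def \<A>_def)
 qed
 then obtain Q where Q_mem: "Q : \<A>" and Q_max: "\<forall>U\<in>\<A>. Q <= U --> U = Q" ..
 then have Q: "ideal Q R" "I <= Q" "Q \<inter> M = {}" by (auto simp: \<A>_def)
 have max: "U = Q" if "ideal U R" "U \<inter> M = {}" "Q <= U" for U
  using Q_max[rule_format, of U] that Q(2) by (simp add: \<A>_def)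
 interpret Q: ideal Q R by (rule Q(1))
 have ex: "\<exists>q\<in>Q. \<exists>r\<in>carrier R. q \<oplus> r \<otimes> x : M" if x: "x : carrier R" "x ~: Q" for x
 proof (rule ccontr)
  assume no: "\<not> ?thesis"
  let ?U = "Q <+>\<^bsub>R\<^esub> PIdl x"
  have idl: "ideal ?U R" by (intro add_ideals Q(1) cgenideal_ideal x)
  have mem: "y : ?U \<longleftrightarrow> (\<exists>q\<in>Q. \<exists>r\<in>carrier R. y = q \<oplus> r \<otimes> x)" for y
   unfolding set_add_defs cgenideal_def by auto
  have "?U \<inter> M = {}"
  proof (rule equals0I)
   fix y assume "y : ?U \<inter> M"
   then show False using no unfolding Int_iff mem by metis
  qed
  moreover have "Q <= ?U"
  proof
   fix q assume "q : Q"
   then show "q : ?U" unfolding mem using x Q.Icarr by (intro bexI[of _ q] bexI[of _ \<zero>]) auto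
  qed
  ultimately have "?U = Q" using max idl by blast
  moreover have "x : ?U" unfolding mem using x Q.zero_closed by (intro bexI[of _ \<zero>] bexI[of _ \<one>]) auto
  ultimately show False using x by simp
 qed
 have "primeideal Q R"
 proof (rule primeidealI[OF Q(1) cring_axioms])
  show "carrier R ~= Q" using M Q by auto
  fix a b assume ab: "a : carrier R" "b : carrier R" "a \<otimes> b : Q"
  show "a : Q \<or> b : Q"
  proof (rule ccontr)
   assume "\<not> ?thesis"
   then obtain q r q' r' where *: "q : Q" "r : carrier R" "q \<oplus> r \<otimes> a : M" "q' : Q" "r' : carrier R"
    "q' \<oplus> r' \<otimes> b : M" using ex ab by metis
   then have "(q \<oplus> r \<otimes> a) \<otimes> (q' \<oplus> r' \<otimes> b) : M" using M by blast
   moreover have "(q \<oplus> r \<otimes> a) \<otimes> (q' \<oplus> r' \<otimes> b) =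
     q \<otimes> (q' \<oplus> r' \<otimes> b) \<oplus> ((r \<otimes> a) \<otimes> q' \<oplus> (r \<otimes> r') \<otimes> (a \<otimes> b))"
    using * ab Q.Icarr by (simp add: r_distr l_distr m_ac a_ac)
   moreover have "q \<otimes> (q' \<oplus> r' \<otimes> b) : Q" using * ab Q.Icarr by (intro Q.I_r_closed) auto
   moreover have "(r \<otimes> a) \<otimes> q' : Q" by (rule Q.I_l_closed) (use * ab in auto)
   moreover have "(r \<otimes> r') \<otimes> (a \<otimes> b) : Q" by (rule Q.I_l_closed) (use * ab in auto)
   ultimately have "(q \<oplus> r \<otimes> a) \<otimes> (q' \<oplus> r' \<otimes> b) : Q \<inter> M" by (simp add: Q.a_closed)
   then show False using Q by simp
  qed
 qed
 then show ?thesis using Q ex by blast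
qed

lemma exists_prime_in_avoiding:
 assumes D: "subring_set D" and I: "ideal_in D I"
  and M: "M <= D" "1 : M" "!!x y. x : M ==> y : M ==> x * y : M"
  and IM: "I \<inter> M = {}"
 shows "\<exists>Q. prime_in D Q & I <= Q & Q \<inter> M = {} & (\<forall>x\<in>D - Q. \<exists>q\<in>Q. \<exists>r\<in>D. q + r * x : M)"
 using cring.exists_primeideal_avoiding[OF cring_RD[OF D], of I M] assms
 by (simp add: ideal_RD[OF D] primeideal_RD[OF D])

section \<open>Integral elements\<close>

definition polys_over :: "'a :: comm_ring_1 set => 'a poly set" where
 "polys_over D = {p. \<forall>i. coeff p i : D}"

lemma polys_overI: "(!!i. coeff p i : D) ==> p : polys_over D"
 and polys_overD: "p : polys_over D ==> coeff p i : D"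
 by (auto simp: polys_over_def)

lemma subring_polys_over:
 assumes "subring_set D"
 shows "subring_set (polys_over D)"
 by (rule subringI)
  (auto simp: polys_over_def coeff_mult coeff_1 intro!: subring_intros[OF assms])

lemma pCons_polys_over:
 assumes "subring_set D"
 shows "pCons a p : polys_over D \<longleftrightarrow> a : D & p : polys_over D"
 unfolding polys_over_def using coeff_pCons_0 coeff_pCons_Suc
 by (auto simp: coeff_pCons split: nat.splits)

lemma monom_polys_over: "subring_set D ==> a : D ==> monom a n : polys_over D"
 by (auto simp: polys_over_def intro: subring_intros)

lemma const_polys_over: "subring_set D ==> a : D ==> [:a:] : polys_over D"
 by (auto simp: polys_over_def coeff_pCons split: nat.splits intro: subring_intros)

lemma poly_in_submod:
 assumes "submod D N" "p : polys_over D" "!!i. i <= degree p ==> x ^ i : N"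
 shows "poly p x : N"
 unfolding poly_altdef using assms polys_overD by (intro submod_sum[OF assms(1)] submodD) auto

lemma poly_in_subring:
 assumes "subring_set D" "p : polys_over D" "x : D"
 shows "poly p x : D"
 unfolding poly_altdef using assms polys_overD by (intro subring_intros) auto

definition integral_over :: "'a :: comm_ring_1 set => 'a => bool" where
 "integral_over D x \<longleftrightarrow> (\<exists>p\<in>polys_over D. lead_coeff p = 1 & poly p x = 0)"

lemma integral_overI: "p : polys_over D ==> lead_coeff p = 1 ==> poly p x = 0 ==> integral_over D x"
 unfolding integral_over_def by blast

lemma integral_over_mono:
 assumes "integral_over D x" "D <= E"
 shows "integral_over E x"
 using assms unfolding integral_over_def polys_over_def by blast

lemma integral_over_self:
 assumes "subring_set D" "x : D"
 shows "integral_over D x"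
 by (rule integral_overI[of "[:-x, 1:]"])
  (auto simp: pCons_polys_over[OF assms(1)] assms intro: subring_intros[OF assms(1)] subring_intros[OF subring_polys_over[OF assms(1)]])

text \<open>Meant for finite \<open>B\<close>.\<close>

definition lspan :: "'a :: comm_ring_1 set => 'a set => 'a set" where
 "lspan D B = {\<Sum>v\<in>B. c v * v | c. \<forall>v\<in>B. c v : D}"

lemma submod_lspan:
 assumes "subring_set D"
 shows "submod D (lspan D B)"
 unfolding submod_def
proof (intro conjI ballI)
 show "0 : lspan D B" unfolding lspan_def using subringD[OF assms]
  by (intro CollectI exI[of _ "\<lambda>_. 0"]) auto
 fix x y assume "x : lspan D B" "y : lspan D B"
 then obtain c c' where "x = (\<Sum>v\<in>B. c v * v)" "y = (\<Sum>v\<in>B. c' v * v)" "\<forall>v\<in>B. c v : D" "\<forall>v\<in>B. c' v : D"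
  unfolding lspan_def by blast
 then show "x + y : lspan D B" unfolding lspan_def
  by (intro CollectI exI[of _ "\<lambda>v. c v + c' v"]) (auto simp: sum.distrib algebra_simps intro: subring_intros[OF assms])
next
 fix d x assume d: "d : D" and "x : lspan D B"
 then obtain c where "x = (\<Sum>v\<in>B. c v * v)" "\<forall>v\<in>B. c v : D"
  unfolding lspan_def by blast
 then show "d * x : lspan D B" unfolding lspan_def
  by (intro CollectI exI[of _ "\<lambda>v. d * c v"]) (auto simp: sum_distrib_left mult.assoc d intro: subring_intros[OF assms])
qed

lemma lspan_base:
 assumes "subring_set D" "finite B" "v : B"
 shows "v : lspan D B"
 unfolding lspan_def
proof (intro CollectI exI[of _ "\<lambda>w. if w = v then 1 else 0"] conjI)
 have "(\<Sum>w\<in>B. (if w = v then 1 else 0) * w) = (\<Sum>w\<in>B. if w = v then w else 0)"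
  by (intro sum.cong) auto
 then show "v = (\<Sum>w\<in>B. (if w = v then 1 else 0) * w)" using assms by simp
qed (use subringD[OF assms(1)] in auto)

lemma lspan_minimal:
 assumes "submod D N" "B <= N"
 shows "lspan D B <= N"
 unfolding lspan_def using assms by (auto intro!: submod_sum[OF assms(1)] submodD)

lemma lspan_mult:
 assumes "submod D N" "!!v. v : B ==> x * v : N" "y : lspan D B"
 shows "x * y : N"
proof -
 have "submod D {y. x * y : N}" using assms(1) unfolding submod_def
  by (auto simp: distrib_left mult.left_commute)
 from lspan_minimal[OF this, of B] assms show ?thesis by blast
qed

text \<open>The monic relation rewrites a power of exponent at least \<open>degree p\<close> through
  lower powers. The factor \<open>w\<close> allows powers of a second element to be held fixed
  meanwhile.\<close>

lemma integral_power_in_submod: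
 assumes D: "subring_set D" and N: "submod D N" and p: "p : polys_over D" "lead_coeff p = 1" "poly p x = 0"
  and w: "!!i. i < degree p ==> x ^ i * w : N"
 shows "x ^ k * w : N"
proof (induction k rule: less_induct)
 case (less k)
 show ?case
 proof (cases "k < degree p")
  case False
  let ?n = "degree p"
  have "poly p x = (\<Sum>i<?n. coeff p i * x ^ i) + x ^ ?n"
   unfolding poly_altdef using p(2) by (simp add: lessThan_Suc_atMost[symmetric])
  then have eq: "x ^ ?n = - (\<Sum>i<?n. coeff p i * x ^ i)" using p(3) by (metis add.inverse_unique add.commute)
  have "x ^ k * w = x ^ (k - ?n) * x ^ ?n * w" using False by (simp add: power_add[symmetric])
  also have "\<dots> = - (\<Sum>i<?n. coeff p i * (x ^ (k - ?n + i) * w))"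
   unfolding eq by (simp add: sum_distrib_left sum_distrib_right power_add algebra_simps sum_negf)
  also have "\<dots> = (\<Sum>i<?n. (- coeff p i) * (x ^ (k - ?n + i) * w))" by (simp add: sum_negf)
  also have "\<dots> : N"
   using False polys_overD[OF p(1)] subringD(5)[OF D]
   by (intro submod_sum[OF N] submodD(3)[OF N] less) auto
  finally show ?thesis .
 qed (use w in auto)
qed

text \<open>The Cayley-Hamilton argument: on the module generated by \<open>B\<close>,
  multiplication by \<open>z\<close> is given by a matrix over \<open>D\<close>, whose
  characteristic polynomial is the monic relation. The nonzero \<open>w\<close> makes the vector of
  generators a nonzero kernel vector, so that the determinant vanishes.\<close>

lemma integral_if_stable:
 fixes D :: "'a :: idom set"
 assumes D: "subring_set D" and B: "finite B" "w : B" "w ~= 0"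
  and stable: "!!v. v : B ==> z * v : lspan D B"
 shows "integral_over D z"
proof -
 obtain h where h: "bij_betw h {0..<card B} B" using ex_bij_betw_nat_finite[OF B(1)] by blast
 define n where "n = card B"
 have "\<forall>v\<in>B. \<exists>c. z * v = (\<Sum>u\<in>B. c u * u) & (\<forall>u\<in>B. c u : D)"
  using stable unfolding lspan_def by blast
 then obtain a where a: "!!v. v : B ==> z * v = (\<Sum>u\<in>B. a v u * u)" "!!v u. v : B ==> u : B ==> a v u : D"
  by metis
 have hB: "h i : B" if "i < n" for i using h that unfolding n_def bij_betw_def by auto
 define A where "A = Matrix.mat n n (\<lambda>(i, j). a (h i) (h j))"
 have A: "A : carrier_mat n n" by (simp add: A_def)
 have eqn: "z * h i = (\<Sum>j = 0..<n. a (h i) (h j) * h j)" if "i < n" for i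
  using a(1)[OF hB[OF that]] sum.reindex_bij_betw[OF h, of "\<lambda>u. a (h i) u * u"] unfolding n_def by simp
 have ev: "comm_ring_hom (\<lambda>p. poly p z)" by unfold_locales auto
 let ?C = "map_mat (\<lambda>p. poly p z) (char_poly_matrix A)"
 have C: "?C : carrier_mat n n" using A by simp
 have Cij: "?C $$ (i, j) = (if i = j then z else 0) - a (h i) (h j)" if "i < n" "j < n" for i j
  using that unfolding char_poly_matrix_def A_def by simp
 define v where "v = Matrix.vec n h"
 have "?C *\<^sub>v v = 0\<^sub>v n"
 proof (rule eq_vecI)
  fix i assume "i < dim_vec (0\<^sub>v n :: 'a Matrix.vec)"
  then have i: "i < n" by simp
  have "vec_index (?C *\<^sub>v v) i = (\<Sum>j = 0..<n. ((if i = j then z else 0) - a (h i) (h j)) * h j)"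
   using i C Cij by (simp add: scalar_prod_def v_def)
  also have "\<dots> = (\<Sum>j = 0..<n. (if i = j then z * h j else 0)) - (\<Sum>j = 0..<n. a (h i) (h j) * h j)"
   unfolding sum_subtractf[symmetric] by (intro sum.cong) (auto simp: algebra_simps)
  also have "\<dots> = 0" using i eqn by simp
  finally show "vec_index (?C *\<^sub>v v) i = vec_index (0\<^sub>v n) i" using i by simp
 qed (use C in auto)
 moreover have "v ~= 0\<^sub>v n"
 proof -
  obtain i where i: "i < n" "h i = w" using B(2) h unfolding n_def bij_betw_def by force
  then have "vec_index v i ~= 0" using B(3) by (simp add: v_def)
  then show ?thesis using i by auto
 qed
 ultimately have "Determinant.det ?C = 0"
  using det_0_iff_vec_prod_zero[OF C] by (metis v_def vec_carrier)
 then have "poly (char_poly A) z = 0" unfolding char_poly_def using comm_ring_hom.hom_det[OF ev, of "char_poly_matrix A"] by simp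
 moreover have "lead_coeff (char_poly A) = 1" using degree_monic_char_poly[OF A] by simp
 moreover have "char_poly A : polys_over D"
 proof -
  have "char_poly_matrix A $$ (i, j) : polys_over D" if "i < n" "j < n" for i j
   using that a(2) hB unfolding char_poly_matrix_def A_def
   by (auto simp: pCons_polys_over[OF D] intro!: subring_intros[OF D] subring_intros[OF subring_polys_over[OF D]])
  moreover have "signof p : polys_over D" for p :: "nat => nat"
   by (cases p rule: sign_cases) (auto intro: subring_intros[OF subring_polys_over[OF D]])
  ultimately have "signof p * (\<Prod>i = 0..<n. char_poly_matrix A $$ (i, p i)) : polys_over D"
   if "p permutes {0..<n}" for p
   using permutes_in_image[OF that] by (intro subringD(4) subring_prod subring_polys_over D) auto
  then show ?thesis unfolding char_poly_def det_def'[OF char_poly_matrix_closed[OF A]]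
   by (intro subring_sum subring_polys_over D) blast
 qed
 ultimately show ?thesis by (intro integral_overI)
qed

text \<open>The products \<open>x ^ i * y ^ j\<close> with exponents below the two degrees span a
  module that contains \<open>1\<close> and is stable under \<open>x\<close> and \<open>y\<close>,
  hence under \<open>x - y\<close> and \<open>x * y\<close>.\<close>

lemma subring_integral_closure:
 fixes D :: "'a :: idom set"
 assumes D: "subring_set D"
 shows "subring_set {x. integral_over D x}"
proof (rule subringI)
 show "1 : {x. integral_over D x}" using integral_over_self[OF D] subringD(1)[OF D] by simp
 fix x y assume "x : {x. integral_over D x}" "y : {x. integral_over D x}"
 then obtain p q where p: "p : polys_over D" "lead_coeff p = 1" "poly p x = 0"
  and q: "q : polys_over D" "lead_coeff q = 1" "poly q y = 0" unfolding integral_over_def by blast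
 have pos: "degree p > 0" "degree q > 0"
  using p(2,3) q(2,3) by (metis degree_eq_zeroE lead_coeff_pCons(2) poly_const_conv gr0I one_neq_zero)+
 define B where "B = (\<lambda>(i, j). x ^ i * y ^ j) ` ({..<degree p} \<times> {..<degree q})"
 have fin: "finite B" by (simp add: B_def)
 note N = submod_lspan[OF D, of B]
 have base: "x ^ i * y ^ j : lspan D B" if "i < degree p" "j < degree q" for i j
  by (rule lspan_base[OF D fin]) (use that in "auto simp: B_def")
 have 1: "x ^ i * y ^ j : lspan D B" if "j < degree q" for i j
  by (rule integral_power_in_submod[OF D N p]) (use base that in auto)
 have "y ^ j * x ^ i : lspan D B" for i j
  by (rule integral_power_in_submod[OF D N q]) (use 1 in "auto simp: mult.commute")
 then have all: "x ^ i * y ^ j : lspan D B" for i j by (simp add: mult.commute)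
 have B1: "1 : B" unfolding B_def using pos by (intro image_eqI[of _ _ "(0,0)"]) auto
 have int: "integral_over D z" if "!!i j. z * (x ^ i * y ^ j) : lspan D B" for z
  by (rule integral_if_stable[OF D fin B1]) (use that in "auto simp: B_def")
 have e1: "(x - y) * (x ^ i * y ^ j) = x ^ Suc i * y ^ j - x ^ i * y ^ Suc j" for i j by (simp add: algebra_simps)
 have "(x - y) * (x ^ i * y ^ j) : lspan D B" for i j
  unfolding e1 by (rule submod_diff[OF D N all all])
 then show "x - y : {x. integral_over D x}" using int by blast
 have e2: "(x * y) * (x ^ i * y ^ j) = x ^ Suc i * y ^ Suc j" for i j by (simp add: algebra_simps)
 have "(x * y) * (x ^ i * y ^ j) : lspan D B" for i j unfolding e2 by (rule all)
 then show "x * y : {x. integral_over D x}" using int by blast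
qed

text \<open>A prime \<open>Q\<close> of \<open>E\<close> maximal among the ideals missing
  \<open>D - q\<close> works. If some \<open>x\<close> in \<open>q\<close> were outside
  \<open>Q\<close>, maximality would give \<open>s = y + r * x\<close> in \<open>D - q\<close> with
  \<open>y\<close> in \<open>Q\<close>, and the integral equation of \<open>r\<close> would put a
  power of \<open>s\<close> into \<open>q\<close>.\<close>

lemma lying_over:
 assumes D: "subring_set D" and E: "subring_set E" and DE: "D <= E" and int: "!!x. x : E ==> integral_over D x"
  and q: "prime_in D q"
 shows "\<exists>Q. prime_in E Q & Q \<inter> D = q"
proof -
 have "1 ~: q" "q <= D" using prime_inD[OF q] by auto
 have z: "ideal_in E {0}" using subringD[OF E] by (auto simp: ideal_in_def submod_def)
 obtain Q where Q: "prime_in E Q" "Q \<inter> (D - q) = {}" "!!x. x : E ==> x ~: Q ==> \<exists>y\<in>Q. \<exists>r\<in>E. y + r * x : D - q"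
 proof -
  have "D - q <= E" "1 : D - q" "{0} \<inter> (D - q) = {}"
   using DE prime_inD(3)[OF q] subringD(1)[OF D] submodD(1)[OF prime_inD(2)[OF q]] by auto
  moreover have "x * y : D - q" if "x : D - q" "y : D - q" for x y
   using that prime_inD(4)[OF q, of x y] subringD(4)[OF D] by blast
  ultimately have "\<exists>Q. prime_in E Q & {0} <= Q & Q \<inter> (D - q) = {} & (\<forall>x\<in>E - Q. \<exists>y\<in>Q. \<exists>r\<in>E. y + r * x : D - q)"
   using exists_prime_in_avoiding[OF E z, of "D - q"] by blast
  then show thesis using that by (metis DiffI)
 qed
 have "x : Q" if x: "x : q" for x
 proof (rule ccontr)
  assume "x ~: Q"
  have xD: "x : D" using x prime_inD(1)[OF q] by auto
  then obtain y r where yr: "y : Q" "r : E" "y + r * x : D - q" using Q(3)[of x] DE `x ~: Q` by auto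
  define s where "s = y + r * x"
  obtain p where p: "p : polys_over D" "lead_coeff p = 1" "poly p r = 0"
   using int[OF yr(2)] unfolding integral_over_def by blast
  let ?n = "degree p"
  \<comment> \<open>This is \<open>x ^ ?n\<close> times the polynomial \<open>p\<close> at
    \<open>s / x\<close>. Modulo \<open>x\<close>, hence modulo \<open>q\<close>, it is
    \<open>s ^ ?n\<close>; modulo \<open>Q\<close> it is \<open>0\<close>, because \<open>s\<close>
    agrees there with \<open>r * x\<close> and \<open>p\<close> vanishes at
    \<open>r\<close>.\<close>
  define t where "t = (\<Sum>i\<le>?n. coeff p i * s ^ i * x ^ (?n - i))"
  have sD: "s : D" using yr by (simp add: s_def)
  have "t = s ^ ?n + (\<Sum>i<?n. coeff p i * s ^ i * x ^ (?n - i))"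
   using p(2) by (simp add: t_def lessThan_Suc_atMost[symmetric])
  moreover have "(\<Sum>i<?n. coeff p i * s ^ i * x ^ (?n - i)) : q"
  proof (intro submod_sum[OF prime_inD(2)[OF q]])
   fix i assume "i : {..<?n}"
   then obtain k where "?n - i = Suc k" by (cases "?n - i") auto
   then have "coeff p i * s ^ i * x ^ (?n - i) = (coeff p i * s ^ i * x ^ k) * x"
    by (simp add: mult.assoc mult.commute)
   then show "coeff p i * s ^ i * x ^ (?n - i) : q"
    using polys_overD[OF p(1)] sD xD x
    by (auto intro!: submodD(3)[OF prime_inD(2)[OF q]] subring_intros[OF D])
  qed
  moreover have "t : q"
  proof -
   have sy: "s - r * x : Q" using yr by (simp add: s_def)
   have rxE: "r * x : E" and sE: "s : E" and xE: "x : E" using yr xD sD DE subringD[OF E] by auto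
   have dv: "a ^ i - b ^ i : Q" if "a - b : Q" "a : E" "b : E" for a b i
   proof (induction i)
    case (Suc i)
    have "a ^ Suc i - b ^ Suc i = a * (a ^ i - b ^ i) + b ^ i * (a - b)" by (simp add: algebra_simps)
    then show ?case using Suc that submodD[OF prime_inD(2)[OF Q(1)]] subring_power[OF E] by simp
   qed (use submodD[OF prime_inD(2)[OF Q(1)]] in simp)
   have "0 = x ^ ?n * poly p r" using p by simp
   also have "\<dots> = (\<Sum>i\<le>?n. coeff p i * (r * x) ^ i * x ^ (?n - i))"
    unfolding poly_altdef sum_distrib_left
    by (intro sum.cong refl) (simp add: power_mult_distrib power_add[symmetric] mult.assoc mult.left_commute)
   finally have "t = t - (\<Sum>i\<le>?n. coeff p i * (r * x) ^ i * x ^ (?n - i))" by simp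
   also have "\<dots> = (\<Sum>i\<le>?n. (coeff p i * x ^ (?n - i)) * (s ^ i - (r * x) ^ i))"
    unfolding t_def sum_subtractf[symmetric] by (intro sum.cong) (auto simp: algebra_simps)
   also have "\<dots> : Q"
    using polys_overD[OF p(1)] xE DE dv[OF sy sE rxE]
    by (intro submod_sum[OF prime_inD(2)[OF Q(1)]] submodD(3)[OF prime_inD(2)[OF Q(1)]] subring_intros[OF E]) auto
   finally have "t : Q" .
   moreover have "t : D" unfolding t_def using polys_overD[OF p(1)] sD xD by (intro subring_intros[OF D]) auto
   ultimately show ?thesis using Q(2) by blast
  qed
  ultimately have "s ^ ?n : q" using submod_diff[OF D prime_inD(2)[OF q]] by (metis add_diff_cancel_right')
  then have "s : q" using prime_in_power[OF D q sD] by blast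
  then show False using yr by (simp add: s_def)
 qed
 then have "Q \<inter> D = q" using Q(2) `q <= D` by blast
 then show ?thesis using Q(1) by blast
qed

section \<open>Noetherian rings\<close>

text \<open>Here \<open>N\<close> may be any set: quantifying over the submodules inside it makes
  the property pass to subsets at once. As \<open>F\<close> lies in the submodule \<open>U\<close>,
  the inclusion \<open>U <= lspan D F\<close> is an equality.\<close>

definition noeth_mod :: "'a :: comm_ring_1 set => 'a set => bool" where
 "noeth_mod D N \<longleftrightarrow> (\<forall>U. submod D U & U <= N --> (\<exists>F. finite F & F <= U & U <= lspan D F))"

lemma noeth_modD:
 assumes "noeth_mod D N" "submod D U" "U <= N"
 obtains F where "finite F" "F <= U" "U <= lspan D F"
proof -
 from assms(1)[unfolded noeth_mod_def, rule_format, OF conjI[OF assms(2,3)]] that show thesis by auto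
qed

lemma noeth_mod_mono:
 assumes "noeth_mod D N" "N' <= N"
 shows "noeth_mod D N'"
 unfolding noeth_mod_def
proof (intro allI impI)
 fix U assume "submod D U & U <= N'"
 then have "submod D U" "U <= N" using assms(2) by auto
 then show "\<exists>F. finite F & F <= U & U <= lspan D F" using assms(1) unfolding noeth_mod_def by simp
qed

lemma lspan_mono:
 assumes "subring_set E" "D <= E" "finite G" "F <= G"
 shows "lspan D F <= lspan E G"
 using assms lspan_base[OF assms(1,3)]
 by (intro lspan_minimal submod_mono[OF submod_lspan]) auto

lemma submod_Int: "submod D N ==> submod D M ==> submod D (N \<inter> M)"
 unfolding submod_def by blast

lemma submod_self: "subring_set D ==> submod D D"
 unfolding submod_def by (auto intro: subringD)

text \<open>The coefficients \<open>d\<close> of the elements \<open>n + d * w\<close> of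
  \<open>U\<close> form an ideal of \<open>D\<close>. Lifts of its generators, together with
  generators of the intersection of \<open>U\<close> with \<open>N\<close>, generate
  \<open>U\<close>.\<close>

lemma noeth_mod_add_cyclic:
 assumes D: "subring_set D" "noeth_mod D D" and N: "submod D N" "noeth_mod D N"
 shows "noeth_mod D {n + d * w | n d. n : N & d : D}"
 unfolding noeth_mod_def
proof (intro allI impI)
 fix U assume "submod D U & U <= {n + d * w | n d. n : N & d : D}"
 then have U: "submod D U" "!!x. x : U ==> \<exists>n d. x = n + d * w & n : N & d : D" by blast+
 define I where "I = {d : D. \<exists>n\<in>N. n + d * w : U}"
 have "submod D I" unfolding submod_def
 proof (intro conjI ballI)
  show "0 : I" unfolding I_def using subringD(2)[OF D(1)] submodD(1)[OF N(1)] submodD(1)[OF U(1)] by force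
  fix x y assume "x : I" "y : I"
  then obtain n m where *: "x : D" "y : D" "n : N" "m : N" "n + x * w : U" "m + y * w : U" unfolding I_def by blast
  have "(n + x * w) + (m + y * w) : U" using * submodD(2)[OF U(1)] by blast
  then have "(n + m) + (x + y) * w : U" by (simp add: algebra_simps)
  then show "x + y : I" unfolding I_def using * subringD(6)[OF D(1)] submodD(2)[OF N(1)] by blast
 next
  fix d x assume "d : D" "x : I"
  then obtain n where *: "x : D" "n : N" "n + x * w : U" unfolding I_def by blast
  have "d * (n + x * w) : U" using * `d : D` submodD(3)[OF U(1)] by blast
  then have "d * n + (d * x) * w : U" by (simp add: algebra_simps)
  then show "d * x : I" unfolding I_def using * `d : D` subringD(4)[OF D(1)] submodD(3)[OF N(1)] by blast
 qed
 then obtain F1 where F1: "finite F1" "F1 <= I" "I <= lspan D F1"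
  using noeth_modD[OF D(2)] unfolding I_def by blast
 obtain n where n: "!!d. d : F1 ==> n d : N" "!!d. d : F1 ==> n d + d * w : U"
 proof -
  have "\<forall>d\<in>F1. \<exists>n. n : N & n + d * w : U" using F1(2) unfolding I_def by blast
  from bchoice[OF this] show thesis using that by blast
 qed
 obtain F2 where F2: "finite F2" "F2 <= U \<inter> N" "U \<inter> N <= lspan D F2"
  using noeth_modD[OF N(2) submod_Int[OF U(1) N(1)]] by blast
 let ?F = "(\<lambda>d. n d + d * w) ` F1 \<union> F2"
 have fin: "finite ?F" using F1 F2 by simp
 note sp = submod_lspan[OF D(1), of ?F]
 have "x : lspan D ?F" if x: "x : U" for x
 proof -
  obtain m d where md: "x = m + d * w" "m : N" "d : D" using U(2)[OF x] by blast
  then have "d : I" using x unfolding I_def by blast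
  then obtain c where c: "d = (\<Sum>e\<in>F1. c e * e)" "!!e. e : F1 ==> c e : D" using F1(3) unfolding lspan_def by blast
  define y where "y = (\<Sum>e\<in>F1. c e * (n e + e * w))"
  have eq: "x - y = m - (\<Sum>e\<in>F1. c e * n e)"
   unfolding y_def md c(1) by (simp add: sum_distrib_left sum_distrib_right sum.distrib algebra_simps)
  have "y : U" unfolding y_def using c n by (intro submod_sum[OF U(1)] submodD(3)[OF U(1)]) auto
  then have "x - y : U" using submod_diff[OF D(1) U(1) x] by blast
  moreover have "x - y : N" unfolding eq using c n md
   by (intro submod_diff[OF D(1) N(1)] submod_sum[OF N(1)] submodD(3)[OF N(1)]) auto
  ultimately have "x - y : lspan D ?F" using F2(3) lspan_mono[OF D(1) order_refl fin, of F2] by blast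
  moreover have "y : lspan D ?F" unfolding y_def using c lspan_base[OF D(1) fin]
   by (intro submod_sum[OF sp] submodD(3)[OF sp]) auto
  ultimately show ?thesis using submodD(2)[OF sp] by fastforce
 qed
 then show "\<exists>F. finite F & F <= U & U <= lspan D F" using fin n(2) F2(2) by (intro exI[of _ ?F]) auto
qed

lemma noeth_mod_lspan:
 assumes D: "subring_set D" "noeth_mod D D" and "finite B"
 shows "noeth_mod D (lspan D B)"
 using `finite B`
proof (induction B)
 case empty
 have "lspan D {} = {0}" by (auto simp: lspan_def)
 then show ?case unfolding noeth_mod_def by (auto simp: lspan_def intro!: exI[of _ "{}"])
next
 case (insert w B)
 have "lspan D (insert w B) <= {n + d * w | n d. n : lspan D B & d : D}"
 proof
  fix x assume "x : lspan D (insert w B)"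
  then obtain c where c: "x = (\<Sum>v\<in>insert w B. c v * v)" "\<forall>v\<in>insert w B. c v : D" unfolding lspan_def by auto
  have "x = (\<Sum>v\<in>B. c v * v) + c w * w" using c(1) insert(1,2) by simp
  moreover have "(\<Sum>v\<in>B. c v * v) : lspan D B" using c(2) unfolding lspan_def by auto
  ultimately show "x : {n + d * w | n d. n : lspan D B & d : D}" using c(2) by auto
 qed
 then show ?case by (rule noeth_mod_mono[OF noeth_mod_add_cyclic[OF D submod_lspan[OF D(1)] insert(3)]])
qed

lemma subring_adjoin:
 assumes "subring_set D"
 shows "subring_set {poly q x | q. q : polys_over D}"
proof (rule subringI)
 show "1 : {poly q x | q. q : polys_over D}"
  using subringD(1)[OF subring_polys_over[OF assms]] by (intro CollectI exI[of _ 1]) auto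
 fix a b assume "a : {poly q x | q. q : polys_over D}" "b : {poly q x | q. q : polys_over D}"
 then obtain q r where *: "a = poly q x" "b = poly r x" "q : polys_over D" "r : polys_over D" by blast
 show "a - b : {poly q x | q. q : polys_over D}"
  using * subringD(3)[OF subring_polys_over[OF assms]] by (intro CollectI exI[of _ "q - r"]) simp
 show "a * b : {poly q x | q. q : polys_over D}"
  using * subringD(4)[OF subring_polys_over[OF assms]] by (intro CollectI exI[of _ "q * r"]) simp
qed

text \<open>Hilbert's basis theorem: \<open>L\<close> is the ideal of leading coefficients of polynomials whose
 value at \<open>x\<close> lies in the given ideal; \<open>x\<close> need not be transcendental.\<close>

lemma noeth_adjoin:
 fixes x :: "'a :: comm_ring_1"
 assumes D: "subring_set D" "noeth_mod D D"
 defines "E \<equiv> {poly q x | q. q : polys_over D}"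
 shows "noeth_mod E E"
 unfolding noeth_mod_def
proof (intro allI impI)
 fix U assume "submod E U & U <= E"
 then have U: "submod E U" "U <= E" by auto
 have E: "subring_set E" unfolding E_def by (rule subring_adjoin[OF D(1)])
 note P = subring_polys_over[OF D(1)]
 have PE: "poly q x : E" if "q : polys_over D" for q using that E_def by blast
 have DE: "D <= E" using PE[OF const_polys_over[OF D(1)]] by auto
 have xE: "x ^ k : E" for k
  using PE[OF monom_polys_over[OF D(1) subringD(1)[OF D(1)]]] by (simp add: poly_monom)
 note UD = submod_mono[OF U(1) DE]
 define J where "J = {q : polys_over D. poly q x : U}"
 have J: "submod (polys_over D) J" unfolding submod_def J_def
  using submodD[OF U(1)] PE subringD[OF P] by auto
 have mono_mem: "monom 1 k : polys_over D" for k using monom_polys_over D subringD(1) by blast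
 define L where "L = {d. \<exists>q\<in>J. \<exists>n. degree q <= n & coeff q n = d}"
 have "submod D L" unfolding submod_def
 proof (intro conjI ballI)
  show "0 : L" unfolding L_def using submodD(1)[OF J] by force
  fix a b assume "a : L" "b : L"
  then obtain q n r m where *: "q : J" "degree q <= n" "coeff q n = a" "r : J" "degree r <= m" "coeff r m = b"
   unfolding L_def by blast
  let ?s = "monom 1 m * q + monom 1 n * r"
  have "?s : J" using * mono_mem submodD[OF J] by blast
  moreover have "degree ?s <= n + m" using *
   by (intro degree_add_le order_trans[OF degree_mult_le] order_trans[OF add_mono[OF degree_monom_le]]) auto
  moreover have "coeff ?s (n + m) = a + b" using * by (simp add: coeff_monom_mult)
  ultimately show "a + b : L" unfolding L_def by blast
 next
  fix d a assume "d : D" "a : L"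
  then obtain q n where *: "q : J" "degree q <= n" "coeff q n = a" unfolding L_def by blast
  have "[:d:] * q : J" using * `d : D` const_polys_over[OF D(1)] submodD(3)[OF J] by blast
  moreover have "degree ([:d:] * q) <= n" using * by (simp add: order_trans[OF degree_smult_le])
  ultimately show "d * a : L" unfolding L_def using * by (intro CollectI bexI[of _ "[:d:] * q"] exI[of _ n]) auto
 qed
 moreover have "L <= D" unfolding L_def J_def using polys_overD by blast
 ultimately obtain F1 where F1: "finite F1" "F1 <= L" "L <= lspan D F1" using noeth_modD[OF D(2)] by blast
 have "\<forall>d\<in>F1. \<exists>q n. q : J & degree q <= n & coeff q n = d" using F1(2) unfolding L_def by blast
 then obtain q0 n0 where q0: "!!d. d : F1 ==> q0 d : J" "!!d. d : F1 ==> degree (q0 d) <= n0 d"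
  "!!d. d : F1 ==> coeff (q0 d) (n0 d) = d" by metis
 \<comment> \<open>A common bound for the \<open>n0 d\<close>: multiplication by monomials brings
   the polynomials with the generating leading coefficients to the same degree \<open>n\<close>, and
   values of polynomials of degree below \<open>n\<close> lie in the finite \<open>D\<close>-module
   spanned by \<open>B\<close>.\<close>
 define n where "n = (\<Sum>d\<in>F1. n0 d)"
 have n0: "n0 d <= n" if "d : F1" for d unfolding n_def using that F1(1) by (simp add: member_le_sum)
 define g where "g d = monom 1 (n - n0 d) * q0 d" for d
 have g: "g d : J" "degree (g d) <= n" "coeff (g d) n = d" if "d : F1" for d
 proof -
  show "g d : J" unfolding g_def using q0(1)[OF that] mono_mem submodD(3)[OF J] by blast
  show "degree (g d) <= n" unfolding g_def using n0[OF that] q0(2)[OF that]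
   by (intro order_trans[OF degree_mult_le] order_trans[OF add_mono[OF degree_monom_le]]) auto
  show "coeff (g d) n = d" unfolding g_def using n0[OF that] q0(3)[OF that] by (simp add: coeff_monom_mult)
 qed
 define B where "B = (\<lambda>i. x ^ i) ` {..<n}"
 have B: "finite B" by (simp add: B_def)
 obtain F2 where F2: "finite F2" "F2 <= U \<inter> lspan D B" "U \<inter> lspan D B <= lspan D F2"
  using noeth_modD[OF noeth_mod_lspan[OF D B] submod_Int[OF UD submod_lspan[OF D(1)]]] by blast
 let ?F = "(\<lambda>d. poly (g d) x) ` F1 \<union> F2"
 have fin: "finite ?F" using F1 F2 by simp
 note sp = submod_lspan[OF E, of ?F]
 have "poly q x : lspan E ?F" if "q : J" for q
  using that
 proof (induction "degree q" arbitrary: q rule: less_induct)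
  case less
  then have q: "q : polys_over D" "poly q x : U" unfolding J_def by auto
  show ?case
  proof (cases "degree q < n")
   case True
   have "poly q x : lspan D B"
    using True by (intro poly_in_submod[OF submod_lspan[OF D(1)] q(1)] lspan_base[OF D(1) B]) (auto simp: B_def)
   then show ?thesis using F2(3) q lspan_mono[OF E DE fin, of F2] by blast
  next
   case False
   define m where "m = degree q"
   have "lead_coeff q : L" unfolding L_def using less(2) by blast
   then obtain c where c: "lead_coeff q = (\<Sum>e\<in>F1. c e * e)" "!!e. e : F1 ==> c e : D"
    using F1(3) unfolding lspan_def by blast
   define h where "h = (\<Sum>e\<in>F1. monom (c e) (m - n) * g e)"
   have ch: "monom (c e) (m - n) : polys_over D" if "e : F1" for e using monom_polys_over[OF D(1)] c(2) that by blast
   have hJ: "h : J" unfolding h_def using g(1) ch by (intro submod_sum[OF J] submodD(3)[OF J]) auto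
   have "degree (monom (c e) (m - n) * g e) <= m" if "e : F1" for e
    using order_trans[OF degree_mult_le add_mono[OF degree_monom_le g(2)[OF that]], of "c e" "m - n"] False m_def by simp
   then have dh: "degree h <= m" unfolding h_def by (intro degree_sum_le F1)
   have "coeff h m = lead_coeff q" unfolding h_def c(1) coeff_sum using g(3) False m_def
    by (intro sum.cong) (auto simp: coeff_monom_mult)
   then have z: "coeff (q - h) m = 0" by (simp add: m_def)
   have dq: "degree (q - h) <= m" using dh m_def by (simp add: degree_diff_le)
   have "q - h : J" using submod_diff[OF P J less(2) hJ] .
   have "poly (q - h) x : lspan E ?F"
   proof (cases "q - h = 0")
    case True
    then show ?thesis using submodD(1)[OF sp] by simp
   next
    case False
    then have "degree (q - h) ~= m" using z by (metis leading_coeff_0_iff)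
    then show ?thesis using less(1)[of "q - h"] dq `q - h : J` m_def by simp
   qed
   moreover have "poly h x = (\<Sum>e\<in>F1. (c e * x ^ (m - n)) * poly (g e) x)"
    unfolding h_def by (simp add: poly_sum poly_monom)
   moreover have "(\<Sum>e\<in>F1. (c e * x ^ (m - n)) * poly (g e) x) : lspan E ?F"
    using c(2) DE xE by (intro submod_sum[OF sp] submodD(3)[OF sp] lspan_base[OF E fin] subringD(4)[OF E]) auto
   ultimately show ?thesis using submodD(2)[OF sp, of "poly (q - h) x" "poly h x"] by simp
  qed
 qed
 then have "U <= lspan E ?F" using U(2) unfolding E_def J_def by blast
 moreover have "?F <= U" using g(1) F2(2) unfolding J_def by blast
 ultimately show "\<exists>F. finite F & F <= U & U <= lspan E F" using fin by blast
qed

text \<open>\<open>E\<close> is the subring generated by \<open>D\<close> and \<open>C\<close>. It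
  is described by minimality because this is what later places it inside the ring of
  invariants.\<close>

lemma noeth_adjoin_finite:
 assumes D: "subring_set D" "noeth_mod D D" and C: "finite C"
 shows "\<exists>E. subring_set E & D <= E & C <= E & noeth_mod E E & (\<forall>S. subring_set S & D <= S & C <= S --> E <= S)"
 using C
proof induction
 case empty
 then show ?case using D by auto
next
 case (insert x C)
 obtain E where E: "subring_set E" "D <= E" "C <= E" "noeth_mod E E"
  and E_min: "\<forall>S. subring_set S & D <= S & C <= S --> E <= S" using insert(3) by (elim exE conjE)
 let ?E = "{poly q x | q. q : polys_over E}"
 have "subring_set ?E" by (rule subring_adjoin[OF E(1)])
 moreover have "E <= ?E"
 proof
  fix e assume "e : E"
  then show "e : ?E" using const_polys_over[OF E(1)] by (intro CollectI exI[of _ "[:e:]"]) auto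
 qed
 moreover have "x : ?E"
  using subringD[OF E(1)] by (intro CollectI exI[of _ "[:0, 1:]"]) (auto simp: pCons_polys_over[OF E(1)] subringD[OF subring_polys_over[OF E(1)]])
 moreover have "?E <= S" if "subring_set S" "D <= S" "insert x C <= S" for S
 proof -
  have ES: "E <= S" using E_min that by simp
  show ?thesis
  proof
   fix y assume "y : ?E"
   then obtain q where "y = poly q x" "q : polys_over S" using ES unfolding polys_over_def by auto
   then show "y : S" using that(3) poly_in_subring[OF that(1)] by simp
  qed
 qed
 ultimately show ?case using noeth_adjoin[OF E(1,4), of x] E(2,3) by (intro exI[of _ ?E] conjI) auto
qed

text \<open>An ideal of \<open>S\<close> is an \<open>E\<close>-submodule of a finite
  \<open>E\<close>-module, and its generators over \<open>E\<close> also generate it over the larger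
  ring \<open>S\<close>.\<close>

lemma noeth_mod_between:
 assumes E: "subring_set E" "noeth_mod E E" and S: "subring_set S" "E <= S" "S <= lspan E B" and B: "finite B"
 shows "noeth_mod S S"
 unfolding noeth_mod_def
proof (intro allI impI)
 fix U assume U: "submod S U & U <= S"
 then have "submod E U" "U <= lspan E B" using submod_mono[OF _ S(2), of U] S(3) by auto
 then obtain F where F: "finite F" "F <= U" "U <= lspan E F" by (rule noeth_modD[OF noeth_mod_lspan[OF E B]])
 then have "U <= lspan S F" using lspan_mono[OF S(1,2) F(1) order_refl] by (rule_tac order_trans)
 then show "\<exists>F. finite F & F <= U & U <= lspan S F" using F by (intro exI[of _ F]) simp
qed

lemma noetherian_ring_RD:
 assumes D: "subring_set D" "noeth_mod D D"
 shows "noetherian_ring (RD D)"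
proof -
 interpret cring "RD D" by (rule cring_RD[OF D(1)])
 show ?thesis
 proof (rule noetherian_ringI)
  fix I assume I: "ideal I (RD D)"
  then have I': "I <= D" "submod D I" using ideal_RD[OF D(1)] ideal_in_def by blast+
  then obtain F where F: "finite F" "F <= I" "I <= lspan D F" using noeth_modD[OF D(2)] by blast
  have FD: "F <= carrier (RD D)" using F I' by simp
  have "submod D (Idl\<^bsub>RD D\<^esub> F)" using genideal_ideal[OF FD] ideal_RD[OF D(1)] ideal_in_def by blast
  then have "lspan D F <= Idl\<^bsub>RD D\<^esub> F" using genideal_self[OF FD] by (intro lspan_minimal) auto
  then have "I = Idl\<^bsub>RD D\<^esub> F" using F genideal_minimal[OF I F(2)] by blast
  then show "\<exists>A\<subseteq>carrier (RD D). finite A & I = Idl\<^bsub>RD D\<^esub> A" using F FD by blast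
 qed
qed

section \<open>Rings of algebraic integers\<close>

lemma algebraic_int_iff_integral: "algebraic_int x \<longleftrightarrow> integral_over \<int> x"
 unfolding algebraic_int.simps integral_over_def polys_over_def by auto

lemma subring_Ints: "subring_set (\<int> :: 'a :: comm_ring_1 set)"
 by (rule subringI) auto

lemma subring_algebraic_ints: "subring_set {x :: 'a :: field. algebraic_int x}"
 using subring_integral_closure[OF subring_Ints] by (simp add: algebraic_int_iff_integral)

text \<open>The constant term of an integer polynomial vanishing at \<open>x\<close> is
  \<open>x\<close> times an algebraic integer. If it is zero, the polynomial is divisible by the
  variable and the quotient still vanishes at \<open>x\<close>.\<close>

lemma nonzero_int_multiple:
 fixes x :: "'a :: field_char_0"
 assumes "algebraic_int x" "x ~= 0"
 shows "\<exists>n y. n ~= (0::int) & algebraic_int y & of_int n = x * y"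
proof -
 note A = subring_algebraic_ints[where ?'a = 'a]
 have "p ~= 0 ==> (!!i. coeff p i : \<int>) ==> poly p x = 0 ==> ?thesis" for p
 proof (induction p)
  case (pCons a p)
  have pi: "coeff p i : \<int>" for i using pCons(4)[of "Suc i"] by simp
  show ?case
  proof (cases "a = 0")
   case True
   then show ?thesis using pCons pi assms(2) by simp
  next
   case False
   obtain n where n: "a = of_int n" using pCons(4)[of 0] by (auto elim: Ints_cases)
   have "p : polys_over {x. algebraic_int x}"
    using pi by (auto simp: polys_over_def intro: int_imp_algebraic_int)
   then have "algebraic_int (- poly p x)" using poly_in_subring[OF A, of p x] assms(1) by simp
   moreover have "of_int n = x * (- poly p x)" using pCons(5) n by (simp add: eq_neg_iff_add_eq_0)
   moreover have "n ~= 0" using n False by simp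
   ultimately show ?thesis by (intro exI[of _ n] exI[of _ "- poly p x"] conjI)
  qed
 qed simp
 then show ?thesis using assms(1) unfolding algebraic_int.simps by (metis leading_coeff_0_iff zero_neq_one)
qed

section \<open>Rational and integer linear relations\<close>

lemma (in vector_space) family_dependent:
 assumes "finite I" "finite B" "f ` I <= span B" "card B < card I"
 shows "\<exists>c. (\<exists>i\<in>I. c i ~= 0) & (\<Sum>i\<in>I. scale (c i) (f i)) = 0"
proof (cases "inj_on f I")
 case False
 then obtain i j where ij: "i : I" "j : I" "i ~= j" "f i = f j" by (auto simp: inj_on_def)
 let ?c = "\<lambda>k. if k = i then 1 else if k = j then - 1 else (0 :: 'a)"
 have "(\<Sum>k\<in>I. ?c k *s f k) = (\<Sum>k\<in>{i, j}. ?c k *s f k)"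
  using ij assms(1) by (intro sum.mono_neutral_right) auto
 also have "\<dots> = 0" using ij by simp
 finally show ?thesis using ij by (intro exI[of _ ?c]) auto
next
 case True
 have "dependent (f ` I)"
 proof (rule ccontr)
  assume "\<not> ?thesis"
  from independent_span_bound[OF assms(2) this assms(3)] assms(4) card_image[OF True] show False by simp
 qed
 then obtain u where u: "\<exists>v\<in>f ` I. u v ~= 0" "(\<Sum>v\<in>f ` I. scale (u v) v) = 0"
  using dependent_finite[of "f ` I"] assms(1) by auto
 then show ?thesis using True by (intro exI[of _ "u \<circ> f"]) (auto simp: sum.reindex)
qed

text \<open>A rational relation exists for reasons of dimension; clearing denominators and dividing
  by the greatest common divisor keeps it nontrivial modulo every prime. \<open>scale\<close> is a
  parameter so that the lemma serves both the number field and its polynomial ring.\<close>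

lemma primitive_integer_relation:
 fixes scale :: "rat => 'b => 'b :: {idom, ring_char_0}"
 assumes "vector_space scale" and scale: "!!n x. scale (of_int n) x = of_int n * x"
  and I: "finite I" and B: "finite B" "f ` I <= module.span scale B" "card B < card I"
 shows "\<exists>c :: 'i => int. (\<forall>p. prime p --> (\<exists>i\<in>I. \<not> p dvd c i)) & (\<Sum>i\<in>I. of_int (c i) * f i) = 0"
proof -
 interpret vector_space scale by fact
 obtain c where c: "\<exists>i\<in>I. c i ~= 0" "(\<Sum>i\<in>I. scale (c i) (f i)) = 0" using family_dependent[OF I B] by blast
 define d where "d i = snd (quotient_of (c i))" for i
 define a where "a i = fst (quotient_of (c i)) * (\<Prod>j\<in>I - {i}. d j)" for i
 have d0: "d i ~= 0" for i unfolding d_def using quotient_of_denom_pos' by (metis less_irrefl)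
 have a: "of_int (a i) = of_int (\<Prod>j\<in>I. d j) * c i" if "i : I" for i
 proof -
  have "c i * of_int (d i) = of_int (fst (quotient_of (c i)))"
   using quotient_of_div[of "c i"] d0[of i] unfolding d_def by (metis divide_eq_eq of_int_0_eq_iff prod.collapse)
  then show ?thesis using prod.remove[OF I that, of d] by (simp add: a_def ac_simps)
 qed
 have sum_a: "(\<Sum>i\<in>I. of_int (a i) * f i) = 0"
 proof -
  have "(\<Sum>i\<in>I. of_int (a i) * f i) = (\<Sum>i\<in>I. scale (of_int (\<Prod>j\<in>I. d j)) (scale (c i) (f i)))"
   using a by (intro sum.cong) (auto simp: scale[symmetric])
  also have "\<dots> = scale (of_int (\<Prod>j\<in>I. d j)) (\<Sum>i\<in>I. scale (c i) (f i))" by (rule scale_sum_right[symmetric])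
  also have "\<dots> = 0" unfolding c(2) by (rule scale_zero_right)
  finally show ?thesis .
 qed
 define g where "g = Gcd (a ` I)"
 have "\<exists>i\<in>I. a i ~= 0"
 proof -
  obtain i where i: "i : I" "c i ~= 0" using c(1) by blast
  then have "of_int (a i) ~= (0 :: rat)" using a[OF i(1)] d0 I by simp
  then show ?thesis using i by auto
 qed
 then have g0: "g ~= 0" unfolding g_def by auto
 have ga: "a i = g * (a i div g)" if "i : I" for i
  using that unfolding g_def by (metis Gcd_dvd dvd_mult_div_cancel image_eqI)
 have "of_int g * (\<Sum>i\<in>I. of_int (a i div g) * f i) = (\<Sum>i\<in>I. of_int (a i) * f i)"
  unfolding sum_distrib_left using ga by (intro sum.cong refl) (metis mult.assoc of_int_mult)
 then have "(\<Sum>i\<in>I. of_int (a i div g) * f i) = 0" using sum_a g0 by simp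
 moreover have "\<exists>i\<in>I. \<not> p dvd a i div g" if "prime p" for p
 proof (rule ccontr)
  assume no: "\<not> ?thesis"
  have "g * p dvd a i" if "i : I" for i using no ga[OF that] that by (metis dvd_refl mult_dvd_mono)
  then have "g * p dvd g" unfolding g_def by (intro Gcd_greatest) (auto simp: g_def[symmetric])
  then have "p dvd 1" using g0 by (metis dvd_mult_cancel_left mult.right_neutral)
  then show False using that by auto
 qed
 ultimately show ?thesis by (intro exI[of _ "\<lambda>i. a i div g"]) auto
qed

lemma vector_space_of_rat: "vector_space (\<lambda>(q :: rat) (x :: 'a :: field_char_0). of_rat q * x)"
 by unfold_locales (auto simp: algebra_simps of_rat_add of_rat_mult)

text \<open>Algebraic integers independent modulo \<open>p\<close> are independent over the
  rationals, as a rational relation can be taken primitive. So there is a largest such set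
  \<open>E\<close>, and its combinations with coefficients from \<open>0\<close> to
  \<open>p - 1\<close> represent all classes.\<close>

lemma finite_mod_prime:
 assumes "number_field TYPE('k :: field_char_0)" and p: "prime (p :: int)"
 defines "A \<equiv> {x :: 'k. algebraic_int x}"
 shows "\<exists>F. finite F & (\<forall>x\<in>A. \<exists>f\<in>F. \<exists>y\<in>A. x = f + of_int p * y)"
proof -
 note A = subring_algebraic_ints[where ?'a = 'k, folded A_def]
 obtain B :: "'k set" where B: "finite B" "module.span (\<lambda>q x. of_rat q * x) B = UNIV"
  using assms(1) unfolding number_field_def by blast
 define ind where "ind E \<longleftrightarrow> finite E & E <= A \<and>
  (\<forall>c :: 'k => int. (\<Sum>e\<in>E. of_int (c e) * e) : (\<lambda>y. of_int p * y) ` A --> (\<forall>e\<in>E. p dvd c e))" for E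
 have bound: "card E <= card B" if "ind E" for E
 proof (rule ccontr)
  assume "\<not> ?thesis"
  then have "card B < card E" by simp
  moreover have "finite E" using that ind_def by blast
  moreover have "(\<lambda>e. e) ` E <= module.span (\<lambda>q x. of_rat q * x) B" using B by simp
  ultimately obtain c where c: "!!p. prime p ==> \<exists>i\<in>E. \<not> p dvd c i" "(\<Sum>i\<in>E. of_int (c i) * i) = (0 :: 'k)"
   using primitive_integer_relation[OF vector_space_of_rat _ _ B(1), of E "\<lambda>e. e"] by auto
  have "0 : (\<lambda>y. of_int p * y) ` A" using subringD(2)[OF A] by (intro image_eqI[of _ _ 0]) auto
  then show False using that c p unfolding ind_def by metis
 qed
 have "ind {}" by (simp add: ind_def)
 then obtain E where E: "ind E" "!!E'. ind E' ==> card E' <= card E"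
  using ex_has_greatest_nat[of ind "{}" card "card B + 1"] bound by (metis less_Suc_eq_le Suc_eq_plus1)
 have finE: "finite E" "E <= A" using E(1) ind_def by auto
 define F where "F = (\<lambda>c. \<Sum>e\<in>E. of_int (c e) * e) ` (E \<rightarrow>\<^sub>E {0..<p})"
 have "finite F" unfolding F_def using finE by (intro finite_imageI finite_PiE) auto
 moreover have "\<exists>f\<in>F. \<exists>y\<in>A. x = f + of_int p * y" if x: "x : A" for x
 proof -
  have reduce: "\<exists>f\<in>F. \<exists>y\<in>A. x = f + of_int p * y"
   if xe: "x = (\<Sum>e\<in>E. of_int (c e) * e) + of_int p * z" and z: "z : A" for c z
  proof -
   let ?c = "restrict (\<lambda>e. c e mod p) E"
   have "?c : E \<rightarrow>\<^sub>E {0..<p}" using prime_gt_0_int[OF p] by auto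
   moreover have "of_int (c e) = of_int (?c e) + of_int p * (of_int (c e div p) :: 'k)" if "e : E" for e
    using that by (simp flip: of_int_mult of_int_add)
   then have "x = (\<Sum>e\<in>E. of_int (?c e) * e) + of_int p * (z + (\<Sum>e\<in>E. of_int (c e div p) * e))"
    unfolding xe by (simp add: distrib_left distrib_right sum.distrib sum_distrib_left mult.assoc cong: sum.cong)
   moreover have "z + (\<Sum>e\<in>E. of_int (c e div p) * e) : A" using z finE by (intro subring_intros[OF A]) auto
   ultimately show ?thesis unfolding F_def by blast
  qed
  show ?thesis
  proof (cases "x : E")
   case True
   have "x = (\<Sum>e\<in>E. of_int (if e = x then 1 else 0) * e) + of_int p * 0"
   proof -
    have "(\<Sum>e\<in>E. of_int (if e = x then 1 else 0) * e) = (\<Sum>e\<in>E. if e = x then e else 0)" by (intro sum.cong) auto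
    then show ?thesis using True finE by simp
   qed
   from reduce[OF this subringD(2)[OF A]] show ?thesis .
  next
   case False
   have "\<not> ind (insert x E)" using E(2)[of "insert x E"] False finE by auto
   then obtain c where c: "(\<Sum>e\<in>insert x E. of_int (c e) * e) : (\<lambda>y. of_int p * y) ` A" "\<exists>e\<in>insert x E. \<not> p dvd c e"
    unfolding ind_def using finE x by blast
   then obtain y where y: "y : A" "of_int (c x) * x + (\<Sum>e\<in>E. of_int (c e) * e) = of_int p * y" using False finE by auto
   have "\<not> p dvd c x"
   proof
    assume "p dvd c x"
    then obtain k where "c x = p * k" by blast
    then have "(\<Sum>e\<in>E. of_int (c e) * e) = of_int p * (y - of_int k * x)" using y(2) by (simp add: algebra_simps eq_diff_eq)
    moreover have "y - of_int k * x : A" using y x by (intro subring_intros[OF A])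
    ultimately have "\<forall>e\<in>E. p dvd c e" using E(1) unfolding ind_def by blast
    then show False using c(2) `p dvd c x` by blast
   qed
   then have "coprime p (c x)" by (rule prime_imp_coprime[OF p])
   then have "coprime (c x) p" by (subst coprime_commute)
   \<comment> \<open>These invert the coefficient \<open>c x\<close> modulo \<open>p\<close>, so
     that the relation can be solved for \<open>x\<close>.\<close>
   then obtain u v where uv: "u * c x + v * p = 1" using bezout_int[of "c x" p] by (metis coprime_iff_gcd_eq_1)
   have "x = of_int (u * c x + v * p) * x" using uv by simp
   also have "\<dots> = of_int u * (of_int p * y - (\<Sum>e\<in>E. of_int (c e) * e)) + of_int (v * p) * x"
    unfolding y(2)[symmetric] by (simp add: algebra_simps)
   also have "\<dots> = (\<Sum>e\<in>E. of_int (- u * c e) * e) + of_int p * (of_int u * y + of_int v * x)"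
    by (simp add: algebra_simps sum_distrib_left sum_negf)
   finally show ?thesis by (rule reduce) (use y x in "intro subring_intros[OF A]")
  qed
 qed
 ultimately show ?thesis by blast
qed

lemma finite_mod_int:
 assumes "number_field TYPE('k :: field_char_0)" and "n > (0 :: int)"
 defines "A \<equiv> {x :: 'k. algebraic_int x}"
 shows "\<exists>F. finite F & (\<forall>x\<in>A. \<exists>f\<in>F. \<exists>y\<in>A. x = f + of_int n * y)"
 using assms(2)
proof (induction "nat n" arbitrary: n rule: less_induct)
 case less
 show ?case
 proof (cases "n = 1")
  case True
  then show ?thesis by (intro exI[of _ "{0}"]) auto
 next
  case False
  then obtain p where p: "prime p" "p dvd n" using less(2) prime_divisor_exists[of n] by (auto simp: zdvd1_eq)
  then obtain m where m: "n = p * m" by blast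
  have pos: "m > 0" using less(2) m prime_gt_0_int[OF p(1)] by (simp add: zero_less_mult_iff)
  have "m < n" using prime_gt_1_int[OF p(1)] pos m by simp
  then obtain F where F: "finite F" "!!x. x : A ==> \<exists>f\<in>F. \<exists>y\<in>A. x = f + of_int m * y"
   using less(1)[of m] pos by auto
  obtain F' where F': "finite F'" "!!x. x : A ==> \<exists>f\<in>F'. \<exists>y\<in>A. x = f + of_int p * y"
   using finite_mod_prime[OF assms(1) p(1)] unfolding A_def by blast
  let ?F = "(\<lambda>(f, f'). f + of_int m * f') ` (F \<times> F')"
  have "\<exists>f\<in>?F. \<exists>y\<in>A. x = f + of_int n * y" if x: "x : A" for x
  proof -
   obtain f y where y: "f : F" "y : A" "x = f + of_int m * y" using F(2)[OF x] by blast
   obtain f' z where z: "f' : F'" "z : A" "y = f' + of_int p * z" using F'(2)[OF y(2)] by blast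
   have "x = (f + of_int m * f') + of_int n * z" unfolding y(3) z(3) m by (simp add: algebra_simps)
   then show ?thesis using y z by force
  qed
  then show ?thesis using F(1) F'(1) by (intro exI[of _ ?F]) auto
 qed
qed

text \<open>A nonzero ideal contains a positive integer \<open>m\<close>, and there are finitely
  many classes modulo \<open>m\<close>. The ideal is generated by \<open>m\<close> and those of the
  chosen representatives that it contains.\<close>

lemma noeth_algebraic_ints:
 assumes "number_field TYPE('k :: field_char_0)"
 defines "A \<equiv> {x :: 'k. algebraic_int x}"
 shows "noeth_mod A A"
 unfolding noeth_mod_def
proof (intro allI impI)
 fix U assume "submod A U & U <= A"
 then have U: "submod A U" "U <= A" by auto
 note A = subring_algebraic_ints[where ?'a = 'k, folded A_def]
 show "\<exists>F. finite F & F <= U & U <= lspan A F"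
 proof (cases "U <= {0}")
  case True
  then show ?thesis by (intro exI[of _ "{}"]) (auto simp: lspan_def)
 next
  case False
  then obtain x where x: "x : U" "x ~= 0" by blast
  have "algebraic_int x" using x(1) U(2) unfolding A_def by auto
  from nonzero_int_multiple[OF this x(2)]
  obtain n y where n: "n ~= 0" "y : A" "of_int n = x * y" unfolding A_def by auto
  \<comment> \<open>The square is positive whatever the sign of \<open>n\<close>.\<close>
  define m where "m = n * n"
  have "of_int m = (of_int n * y) * x" using n(3) by (simp add: m_def algebra_simps)
  moreover have "(of_int n * y) * x : U" using x(1) n(2) by (intro submodD(3)[OF U(1)] subringD(4)[OF A] subring_of_int[OF A])
  ultimately have mU: "of_int m : U" by simp
  have "m > 0" using n(1) unfolding m_def by (cases "n > 0") (auto simp: zero_less_mult_iff)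
  from finite_mod_int[OF assms(1) this, folded A_def]
  obtain F where F: "finite F" "\<forall>x\<in>A. \<exists>f\<in>F. \<exists>y\<in>A. x = f + of_int m * y" by (elim exE conjE)
  let ?F = "insert (of_int m) (F \<inter> U)"
  have fin: "finite ?F" using F by simp
  note sp = submod_lspan[OF A, of ?F]
  have "u : lspan A ?F" if u: "u : U" for u
  proof -
   obtain f y where fy: "f : F" "y : A" "u = f + of_int m * y" using F(2)[rule_format, of u] u U(2) by auto
   have ym: "y * of_int m : U" using fy(2) mU submodD(3)[OF U(1)] by blast
   then have "f : U" using submod_diff[OF A U(1) u ym] fy(3) by (simp add: mult.commute)
   then have "f + y * of_int m : lspan A ?F"
    using fy by (intro submodD(2,3)[OF sp] lspan_base[OF A fin]) auto
   then show ?thesis using fy(3) by (simp add: mult.commute)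
  qed
  then show ?thesis using fin mU by (intro exI[of _ ?F]) auto
 qed
qed

hide_const (open) Matrix.mat
no_notation vec_index (infixl \<open>$\<close> 100)

section \<open>Linear actions on polynomials in two variables\<close>

abbreviation polys2 :: "'a :: comm_ring_1 set => 'a poly poly set" where
 "polys2 D \<equiv> polys_over (polys_over D)"

definition cc :: "'a :: comm_ring_1 => 'a poly poly" where "cc c = [:[:c:]:]"

lemma comm_ring_hom_cc: "comm_ring_hom (cc :: 'a :: comm_ring_1 => _)"
 by unfold_locales (auto simp: cc_def one_pCons)

interpretation cc: comm_ring_hom "cc :: 'a :: comm_ring_1 => _" by (rule comm_ring_hom_cc)

lemma cc_eq_iff [simp]: "cc a = cc b \<longleftrightarrow> a = b"
 by (simp add: cc_def)

lemma cc_eq_0_iff [simp]: "cc a = 0 \<longleftrightarrow> a = 0"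
 by (simp add: cc_def)

lemma coeff_cc_mult [simp]: "coeff (coeff (cc c * f) j) i = c * coeff (coeff f j) i"
 by (simp add: cc_def)

lemma poly2_eqI: "(!!i j. coeff (coeff f j) i = coeff (coeff g j) i) ==> f = g"
 by (intro poly_eqI)

lemma polys2_iff: "f : polys2 D \<longleftrightarrow> (\<forall>i j. coeff (coeff f j) i : D)"
 by (auto simp: polys_over_def)

lemma subring_polys2: "subring_set D ==> subring_set (polys2 D)"
 by (intro subring_polys_over)

lemma cc_polys2: "subring_set D ==> cc c : polys2 D \<longleftrightarrow> c : D"
 by (auto simp: cc_def pCons_polys_over subring_polys_over subringD)

lemma var_polys2: 
 assumes "subring_set D"
 shows "var_X : polys2 D" "var_Y : polys2 D"
 using subringD[OF assms] subringD[OF subring_polys_over[OF assms]] subringD[OF subring_polys2[OF assms]]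
 by (auto simp: var_X_def var_Y_def pCons_polys_over subring_polys_over assms)

lemma poly2_expand:
 "f = (\<Sum>j\<le>degree f. \<Sum>i\<le>degree (coeff f j). cc (coeff (coeff f j) i) * var_X ^ i * var_Y ^ j)"
proof -
 have X: "(var_X :: 'a poly poly) ^ i = [:[:0, 1:] ^ i:]" for i
  by (induction i) (auto simp: var_X_def one_pCons)
 have "(\<Sum>i\<le>degree q. cc (coeff q i) * var_X ^ i) = [:q:]" for q :: "'a poly"
 proof -
  have "(\<Sum>i\<le>degree q. cc (coeff q i) * var_X ^ i) = (\<Sum>i\<le>degree q. [:monom (coeff q i) i:])"
   by (intro sum.cong refl) (simp add: X cc_def monom_altdef)
  also have "\<dots> = [:\<Sum>i\<le>degree q. monom (coeff q i) i:]"
   by (induction "{..degree q}" rule: infinite_finite_induct) (auto simp flip: sum_to_poly)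
  finally show ?thesis by (simp add: poly_as_sum_of_monoms)
 qed
 then have "(\<Sum>i\<le>degree (coeff f j). cc (coeff (coeff f j) i) * var_X ^ i * var_Y ^ j) = monom (coeff f j) j" for j
  by (simp add: sum_distrib_right[symmetric] var_Y_def monom_altdef)
 then show ?thesis by (simp add: poly_as_sum_of_monoms)
qed

lemma polys2_induct:
 assumes "f : polys2 D" "subring_set B" "!!c. c : D ==> cc c : B" "var_X : B" "var_Y : B"
 shows "f : B"
 by (subst poly2_expand) (use assms in "auto simp: polys2_iff intro!: subring_intros[OF assms(2)]")

lemma hom2_expand:
 assumes "comm_ring_hom h"
 shows "h f = (\<Sum>j\<le>degree f. \<Sum>i\<le>degree (coeff f j). h (cc (coeff (coeff f j) i)) * h var_X ^ i * h var_Y ^ j)"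
proof -
 interpret h: comm_ring_hom h by fact
 show ?thesis by (subst poly2_expand) (simp add: h.hom_sum h.hom_mult h.hom_power)
qed

lemma hom2_eqI:
 assumes "comm_ring_hom h" "comm_ring_hom h'" "!!c. h (cc c) = h' (cc c)" "h var_X = h' var_X" "h var_Y = h' var_Y"
 shows "h f = h' f"
 by (simp add: hom2_expand[OF assms(1), of f] hom2_expand[OF assms(2), of f] assms(3-5))

lemma comm_ring_hom_comp:
 assumes "comm_ring_hom h" "comm_ring_hom h'"
 shows "comm_ring_hom (\<lambda>x. h (h' x))"
proof -
 interpret h: comm_ring_hom h by fact
 interpret h': comm_ring_hom h' by fact
 show ?thesis by unfold_locales (simp_all add: h.hom_add h.hom_mult h'.hom_add h'.hom_mult)
qed

lemma comm_ring_hom_eval: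
 assumes "comm_ring_hom h"
 shows "comm_ring_hom (\<lambda>q. poly (map_poly h q) u)"
proof -
 interpret h: comm_ring_hom h by fact
 interpret m: map_poly_comm_ring_hom h ..
 show ?thesis by unfold_locales (simp_all add: m.hom_add m.hom_mult)
qed

lemma comm_ring_hom_map_poly:
 assumes "comm_ring_hom h"
 shows "comm_ring_hom (map_poly h)"
proof -
 interpret h: comm_ring_hom h by fact
 interpret m: map_poly_comm_ring_hom h ..
 show ?thesis by (rule m.comm_ring_hom_axioms)
qed

lemma comm_ring_hom_subst_XY: "comm_ring_hom (subst_XY u v)"
 unfolding subst_XY_def[abs_def]
 by (intro comm_ring_hom_eval comm_ring_hom_cc[unfolded cc_def[abs_def]])

lemma subst_XY_simps [simp]:
 "subst_XY u v (cc c) = cc c" "subst_XY u v var_X = u" "subst_XY u v var_Y = v"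
 by (simp_all add: subst_XY_def cc_def var_X_def var_Y_def Polynomial.map_poly_pCons pCons_one)

abbreviation "act \<equiv> linear_action"

lemma comm_ring_hom_act: "comm_ring_hom (act M)"
 unfolding linear_action_def by (rule comm_ring_hom_subst_XY)

interpretation act: comm_ring_hom "act M" for M by (rule comm_ring_hom_act)

lemma act_cc [simp]: "act M (cc c) = cc c"
 by (simp add: linear_action_def)

lemma act_X: "act M var_X = cc (M $ 1 $ 1) * var_X + cc (M $ 2 $ 1) * var_Y"
 and act_Y: "act M var_Y = cc (M $ 1 $ 2) * var_X + cc (M $ 2 $ 2) * var_Y"
 by (simp_all add: linear_action_def cc_def)

lemma act_mult: "act (M ** N) f = act M (act N f)"
proof (rule hom2_eqI[where h = "act (M ** N)" and h' = "\<lambda>f. act M (act N f)"])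
 show "comm_ring_hom (\<lambda>f. act M (act N f))"
  by (rule comm_ring_hom_comp[OF comm_ring_hom_act comm_ring_hom_act])
qed (simp_all add: comm_ring_hom_act act_X act_Y act.hom_add act.hom_mult matrix_matrix_mult_def sum_2
   cc.hom_add cc.hom_mult algebra_simps)

lemma comm_ring_hom_id: "comm_ring_hom (\<lambda>x. x)"
 by unfold_locales auto

lemma act_one [simp]: "act (mat 1) f = f"
 by (rule hom2_eqI[where h = "act (mat 1)", OF comm_ring_hom_act comm_ring_hom_id])
  (simp_all add: act_X act_Y Finite_Cartesian_Product.mat_def)

lemma act_polys2:
 assumes D: "subring_set D" and M: "!!i j. M $ i $ j : D" and f: "f : polys2 D"
 shows "act M f : polys2 D"
proof -
 have "f : {f. act M f : polys2 D}"
 proof (rule polys2_induct[OF f])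
  show "subring_set {f. act M f : polys2 D}"
   by (rule subringI) (auto simp: act.hom_minus act.hom_mult intro!: subring_intros[OF subring_polys2[OF D]])
 qed (use M in "auto simp: act_X act_Y cc_polys2[OF D] var_polys2[OF D] intro!: subring_intros[OF subring_polys2[OF D]]")
 then show ?thesis by simp
qed

text \<open>Coefficientwise application of a map, not necessarily multiplicative.\<close>

definition map_coeffs :: "('a :: comm_ring_1 => 'b :: comm_ring_1) => 'a poly poly => 'b poly poly" where
 "map_coeffs h = map_poly (map_poly h)"

lemma coeff_map_coeffs:
 assumes "h 0 = 0"
 shows "coeff (coeff (map_coeffs h f) j) i = h (coeff (coeff f j) i)"
 using assms by (simp add: map_coeffs_def coeff_map_poly)

lemma comm_ring_hom_map_coeffs: "comm_ring_hom h ==> comm_ring_hom (map_coeffs h)"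
 unfolding map_coeffs_def by (intro comm_ring_hom_map_poly)

definition map_entries :: "('a => 'b) => 'a^2^2 => 'b^2^2" where
 "map_entries h M = (\<chi> i j. h (M $ i $ j))"

lemma map_entries_nth [simp]: "map_entries h M $ i $ j = h (M $ i $ j)"
 by (simp add: map_entries_def)

lemma map_coeffs_simps:
 assumes "comm_ring_hom h"
 shows "map_coeffs h (cc c) = cc (h c)" "map_coeffs h var_X = var_X" "map_coeffs h var_Y = var_Y"
proof -
 interpret h: comm_ring_hom h by fact
 show "map_coeffs h (cc c) = cc (h c)" "map_coeffs h var_X = var_X" "map_coeffs h var_Y = var_Y"
  by (auto simp: map_coeffs_def cc_def var_X_def var_Y_def Polynomial.map_poly_pCons)
qed

lemma map_coeffs_act:
 assumes "comm_ring_hom h"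
 shows "map_coeffs h (act M f) = act (map_entries h M) (map_coeffs h f)"
proof -
 interpret h: comm_ring_hom h by fact
 interpret m: comm_ring_hom "map_coeffs h" by (rule comm_ring_hom_map_coeffs) fact
 note s = map_coeffs_simps[OF assms]
 show ?thesis
 proof (rule hom2_eqI[where h = "\<lambda>f. map_coeffs h (act M f)" and h' = "\<lambda>f. act (map_entries h M) (map_coeffs h f)"])
  show "comm_ring_hom (\<lambda>f. map_coeffs h (act M f))"
   by (rule comm_ring_hom_comp[OF comm_ring_hom_map_coeffs[OF assms] comm_ring_hom_act])
  show "comm_ring_hom (\<lambda>f. act (map_entries h M) (map_coeffs h f))"
   by (rule comm_ring_hom_comp[OF comm_ring_hom_act comm_ring_hom_map_coeffs[OF assms]])
 qed (simp_all add: s act_X act_Y m.hom_add m.hom_mult)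
qed

text \<open>A retraction \<open>rh\<close> of coefficient rings, applied coefficientwise, is linear
  over the smaller polynomial ring and commutes with matrices over the smaller ring. So it carries
  relations between invariants down to the smaller field.\<close>

lemma map_coeffs_linear:
 assumes h: "comm_ring_hom h" and add: "!!x y. rh (x + y) = rh x + rh y" and lin: "!!c x. rh (h c * x) = c * rh x"
 shows map_coeffs_linear_mult: "map_coeffs rh (map_coeffs h f * g) = f * map_coeffs rh g"
  and map_coeffs_linear_act: "map_coeffs rh (act (map_entries h M) g) = act M (map_coeffs rh g)"
  and map_coeffs_linear_add: "map_coeffs rh (f1 + f2) = map_coeffs rh f1 + map_coeffs rh f2"
proof -
 interpret h: comm_ring_hom h by fact
 interpret mh: comm_ring_hom "map_coeffs h" by (rule comm_ring_hom_map_coeffs) fact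
 have 0: "rh 0 = 0" using add[of 0 0] by simp
 have sum: "rh (sum a I) = (\<Sum>i\<in>I. rh (a i))" for a :: "nat => 'b" and I
  by (induction I rule: infinite_finite_induct) (auto simp: 0 add)
 note c = coeff_map_coeffs[of rh, OF 0] coeff_map_coeffs[of h, OF h.hom_zero]
 have add2: "map_coeffs rh (f1 + f2) = map_coeffs rh f1 + map_coeffs rh f2" for f1 f2
  by (rule poly2_eqI) (simp add: c add)
 show "map_coeffs rh (f1 + f2) = map_coeffs rh f1 + map_coeffs rh f2" by (rule add2)
 have m0: "map_coeffs rh 0 = 0" by (simp add: map_coeffs_def)
 have sum2: "map_coeffs rh (sum a I) = (\<Sum>i\<in>I. map_coeffs rh (a i))" for a :: "nat => 'b poly poly" and I
  by (induction I rule: infinite_finite_induct) (auto simp: m0 add2)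
 show mult: "map_coeffs rh (map_coeffs h f * g) = f * map_coeffs rh g" for f g
  by (rule poly2_eqI) (simp add: c coeff_mult coeff_sum sum lin)
 have cc: "map_coeffs rh (cc x) = cc (rh x)" for x
  by (simp add: map_coeffs_def cc_def Polynomial.map_poly_pCons 0)
 define u v where "u = act M var_X" and "v = act M var_Y"
 have mon: "map_coeffs rh (cc x * map_coeffs h w) = cc (rh x) * w" for x w
  using mult[of w "cc x"] cc by (simp add: mult.commute)
 have uv: "act (map_entries h M) var_X = map_coeffs h u" "act (map_entries h M) var_Y = map_coeffs h v"
  using map_coeffs_act[OF h, of M] map_coeffs_simps[OF h] by (simp_all add: u_def v_def)
 have "map_coeffs rh (act (map_entries h M) g) =
   (\<Sum>j\<le>degree g. \<Sum>i\<le>degree (coeff g j). cc (rh (coeff (coeff g j) i)) * (u ^ i * v ^ j))"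
  unfolding hom2_expand[OF comm_ring_hom_act, of "map_entries h M" g] uv
  by (simp add: sum2 mon[symmetric] mh.hom_mult mh.hom_power mult.assoc)
 also have "\<dots> = act M (map_coeffs rh g)"
 proof -
  have "map_coeffs rh g = (\<Sum>j\<le>degree g. \<Sum>i\<le>degree (coeff g j).
    map_coeffs rh (cc (coeff (coeff g j) i) * map_coeffs h (var_X ^ i * var_Y ^ j)))"
   by (subst poly2_expand) (simp add: sum2 mh.hom_mult mh.hom_power map_coeffs_simps[OF h] mult.assoc)
  then show ?thesis by (simp add: mon act.hom_sum act.hom_mult act.hom_power u_def v_def)
 qed
 finally show "map_coeffs rh (act (map_entries h M) g) = act M (map_coeffs rh g)" .
qed

section \<open>Invariants of finite matrix groups\<close>

locale finite_matrix_group =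
 fixes G :: "('a :: field^2^2) set"
 assumes finite: "finite G"
  and one: "mat 1 : G"
  and closed: "M : G ==> N : G ==> M ** N : G"
  and inverse: "M : G ==> \<exists>N\<in>G. N ** M = mat 1 & M ** N = mat 1"
begin

lemma bij_mult:
 assumes M: "M : G"
 shows "bij_betw (\<lambda>N. M ** N) G G"
proof -
 obtain K where K: "K : G" "K ** M = mat 1" "M ** K = mat 1"
  using inverse[OF M] by blast
 show ?thesis
  by (rule bij_betwI[of _ _ _ "\<lambda>N. K ** N"]) (use K M closed in "auto simp: matrix_mul_assoc")
qed

lemma act_prod_orbit:
 assumes "M : G" "!!x. act M (ph x) = ph (act M x)"
 shows "act M (\<Prod>N\<in>G. ph (act N th)) = (\<Prod>N\<in>G. ph (act N th))"
proof -
 have "act M (\<Prod>N\<in>G. ph (act N th)) = (\<Prod>N\<in>G. ph (act (M ** N) th))"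
  by (simp add: act.hom_prod assms(2) act_mult)
 also have "\<dots> = (\<Prod>N\<in>G. ph (act N th))"
  by (rule prod.reindex_bij_betw[OF bij_mult[OF assms(1)]])
 finally show ?thesis .
qed

definition invariants :: "'a set => 'a poly poly set" where
 "invariants D = {f : polys2 D. \<forall>M\<in>G. act M f = f}"

lemma subring_invariants:
 assumes "subring_set D"
 shows "subring_set (invariants D)"
 by (rule subringI) (auto simp: invariants_def act.hom_minus act.hom_mult intro!: subring_intros[OF subring_polys2[OF assms]])

lemma cc_invariants: "subring_set D ==> c : D ==> cc c : invariants D"
 by (simp add: invariants_def cc_polys2)

definition orbit_poly :: "'a poly poly => 'a poly poly poly" where
 "orbit_poly th = (\<Prod>N\<in>G. [:- act N th, 1:])"

lemma orbit_poly:
 assumes D: "subring_set D" and G: "!!M i j. M : G ==> M $ i $ j : D" and th: "th : polys2 D"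
 shows "orbit_poly th : polys_over (invariants D)" "lead_coeff (orbit_poly th) = 1" "poly (orbit_poly th) th = 0"
proof -
 show "lead_coeff (orbit_poly th) = 1" unfolding orbit_poly_def by (simp add: lead_coeff_prod)
 show "poly (orbit_poly th) th = 0" unfolding orbit_poly_def poly_prod
  using finite one by (intro prod_zero bexI[of _ "mat 1"]) auto
 note P = subring_polys_over[OF subring_polys2[OF D]]
 have "orbit_poly th : polys_over (polys2 D)" unfolding orbit_poly_def
  using act_polys2[OF D G th] subring_polys2[OF D] subringD[OF subring_polys2[OF D]] subringD[OF P]
  by (intro subring_prod[OF P]) (auto simp: pCons_polys_over)
 moreover have "act M (coeff (orbit_poly th) i) = coeff (orbit_poly th) i" if "M : G" for M i
 proof -
  interpret m: comm_ring_hom "map_poly (act M)" by (intro comm_ring_hom_map_poly comm_ring_hom_act)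
  have "map_poly (act M) (orbit_poly th) = (\<Prod>N\<in>G. [:- act (M ** N) th, 1:])"
   unfolding orbit_poly_def by (simp add: m.hom_prod Polynomial.map_poly_pCons act_mult act.hom_uminus)
  also have "\<dots> = orbit_poly th" unfolding orbit_poly_def
   by (rule prod.reindex_bij_betw[OF bij_mult[OF that], of "\<lambda>N. [:- act N th, 1:]"])
  finally show ?thesis by (metis act.hom_zero coeff_map_poly)
 qed
 ultimately show "orbit_poly th : polys_over (invariants D)"
  unfolding polys_over_def invariants_def by auto
qed

lemma integral_over_invariants:
 assumes "subring_set D" "!!M i j. M : G ==> M $ i $ j : D" "th : polys2 D"
 shows "integral_over (invariants D) th"
 using orbit_poly[OF assms] by (intro integral_overI)

text \<open>The coefficients of the orbit polynomials of \<open>X\<close> and \<open>Y\<close>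
  generate a Noetherian ring \<open>E\<close> over the constants. By these monic equations finitely
  many monomials span the polynomial ring over \<open>E\<close>, and the invariants lie in
  between.\<close>

lemma noeth_invariants:
 assumes D: "subring_set D" "noeth_mod D D" and G: "!!M i j. M : G ==> M $ i $ j : D"
 shows "noeth_mod (invariants D) (invariants D)"
proof -
 have D': "subring_set (cc ` D)"
  by (rule subringI)
   (auto simp flip: cc.hom_minus cc.hom_mult cc.hom_one intro!: imageI subring_intros[OF D(1)] image_eqI[of _ cc])
 have nD': "noeth_mod (cc ` D) (cc ` D)" unfolding noeth_mod_def
 proof (intro allI impI)
  fix U assume U: "submod (cc ` D) U & U <= cc ` D"
  define W where "W = {a : D. cc a : U}"
  have "submod D W" using U unfolding submod_def W_def
   by (auto simp: cc.hom_add cc.hom_mult intro: subringD[OF D(1)])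
  moreover have "W <= D" by (auto simp: W_def)
  ultimately obtain F where F: "finite F" "F <= W" "W <= lspan D F" by (rule noeth_modD[OF D(2)])
  have "U <= lspan (cc ` D) (cc ` F)"
  proof
   fix x assume "x : U"
   then obtain a where a: "x = cc a" "a : W" using U unfolding W_def by auto
   then obtain c where c: "a = (\<Sum>v\<in>F. c v * v)" "\<forall>v\<in>F. c v : D" using F(3) unfolding lspan_def by auto
   have "x = (\<Sum>v\<in>F. cc (c v) * cc v)" unfolding a(1) c(1) by (simp add: cc.hom_sum cc.hom_mult)
   also have "\<dots> : lspan (cc ` D) (cc ` F)"
    using c(2) F(1) by (intro submod_sum[OF submod_lspan[OF D']] submodD(3)[OF submod_lspan[OF D']] lspan_base[OF D']) auto
   finally show "x : lspan (cc ` D) (cc ` F)" .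
  qed
  then show "\<exists>F. finite F & F <= U & U <= lspan (cc ` D) F"
   using F by (intro exI[of _ "cc ` F"]) (auto simp: W_def)
 qed
 let ?S = "invariants D"
 note S = subring_invariants[OF D(1)]
 note vX = var_polys2(1)[OF D(1)] and vY = var_polys2(2)[OF D(1)]
 define px py where "px = orbit_poly var_X" and "py = orbit_poly var_Y"
 note px = orbit_poly[OF D(1) G vX, folded px_def] and py = orbit_poly[OF D(1) G vY, folded py_def]
 define C where "C = coeff px ` {..degree px} \<union> coeff py ` {..degree py}"
 have "finite C" by (simp add: C_def)
 obtain E where E: "subring_set E" "cc ` D <= E" "C <= E" "noeth_mod E E"
  and E_min: "\<forall>S. subring_set S & cc ` D <= S & C <= S --> E <= S"
  using noeth_adjoin_finite[OF D' nD' `finite C`] by (elim exE conjE)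
 have "cc ` D <= ?S" using cc_invariants[OF D(1)] by auto
 moreover have "C <= ?S" using px(1) py(1) polys_overD unfolding C_def by auto
 ultimately have ES: "E <= ?S" using E_min S by simp
 have pxE: "px : polys_over E" and pyE: "py : polys_over E"
  using E(3) subringD(2)[OF E(1)] unfolding polys_over_def C_def
  by (auto simp: image_subset_iff) (metis atMost_iff coeff_eq_0 not_le)+
 define B where "B = (\<lambda>(i, j). var_X ^ i * (var_Y :: 'a poly poly) ^ j) ` ({..<degree px} \<times> {..<degree py})"
 have B: "finite B" by (simp add: B_def)
 note N = submod_lspan[OF E(1), of B]
 have base: "var_X ^ i * var_Y ^ j : lspan E B" if "i < degree px" "j < degree py" for i j
  by (rule lspan_base[OF E(1) B]) (use that in "auto simp: B_def")
 have 1: "var_X ^ i * var_Y ^ j : lspan E B" if "j < degree py" for i j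
  by (rule integral_power_in_submod[OF E(1) N pxE px(2,3)]) (use base that in auto)
 have "var_Y ^ j * var_X ^ i : lspan E B" for i j
  by (rule integral_power_in_submod[OF E(1) N pyE py(2,3)]) (use 1 in "auto simp: mult.commute")
 then have all: "var_X ^ i * var_Y ^ j : lspan E B" for i j by (simp add: mult.commute)
 have "?S <= lspan E B"
 proof
  fix f assume "f : ?S"
  then have f: "f : polys2 D" by (simp add: invariants_def)
  have "cc (coeff (coeff f j) i) * (var_X ^ i * var_Y ^ j) : lspan E B" for i j
   by (rule submodD(3)[OF N _ all]) (use f E(2) in "auto simp: polys2_iff")
  then show "f : lspan E B"
   by (subst poly2_expand) (unfold mult.assoc, intro submod_sum[OF N])
 qed
 then show ?thesis by (rule noeth_mod_between[OF E(1,4) S ES _ B])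
qed

end

section \<open>Depth and dimension\<close>

lemma (in cring) nonzerodivisor_Quot_iff:
 assumes I: "ideal I R" and x: "x : carrier R"
 shows "(\<forall>z\<in>carrier (R Quot I). (I +> x) \<otimes>\<^bsub>R Quot I\<^esub> z = \<zero>\<^bsub>R Quot I\<^esub> --> z = \<zero>\<^bsub>R Quot I\<^esub>) \<longleftrightarrow>
  (\<forall>y\<in>carrier R. x \<otimes> y : I --> y : I)"
proof -
 interpret I: ideal I R by fact
 have "I +> y = I \<longleftrightarrow> y : I" if "y : carrier R" for y
  using that I.a_rcos_const[of y] I.a_rcos_self[of y] by auto
 then show ?thesis
  using x by (auto simp: FactRing_def A_RCOSETS_def' I.rcoset_mult_add)
qed

lemma (in cring) regular_sequence_iff:
 "regular_sequence R xs \<longleftrightarrow> set xs <= carrier R \<and>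
  (\<forall>i<length xs. \<forall>y\<in>carrier R. xs ! i \<otimes> y : Idl (set (take i xs)) --> y : Idl (set (take i xs))) \<and>
  Idl (set xs) ~= carrier R"
proof -
 show ?thesis
 proof (cases "set xs <= carrier R")
  case True
  have "ideal (Idl (set (take i xs))) R" for i
   using True set_take_subset[of i xs] by (intro genideal_ideal) auto
  moreover have "xs ! i : carrier R" if "i < length xs" for i using True nth_mem[OF that] by auto
  ultimately show ?thesis
   unfolding regular_sequence_def Let_def by (simp add: nonzerodivisor_Quot_iff)
 qed (simp add: regular_sequence_def)
qed

text \<open>The products of elements outside \<open>Q\<close> with powers of \<open>x\<close> form a
  multiplicative set, which misses \<open>I\<close> because \<open>x\<close> is a nonzerodivisor
  modulo \<open>I\<close>. A prime avoiding this set lies in \<open>Q\<close> and omits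
  \<open>x\<close>.\<close>

lemma (in cring) exists_smaller_primeideal:
 assumes Q: "primeideal Q R" and I: "ideal I R" "I <= Q" and x: "x : Q"
  and nzd: "!!y. y : carrier R ==> x \<otimes> y : I ==> y : I"
 shows "\<exists>Q'. primeideal Q' R & I <= Q' & Q' \<subset> Q"
proof -
 interpret Q: primeideal Q R by fact
 have xR: "x : carrier R" using x Q.Icarr by blast
 define M where "M = {s \<otimes> x [^] (k::nat) | s k. s : carrier R - Q}"
 have oneQ: "\<one> ~: Q" using Q.I_notcarr Q.one_imp_carrier by blast
 have M: "s \<otimes> x [^] (k::nat) : M" if "s : carrier R" "s ~: Q" for s k using that unfolding M_def by blast
 have *: "s : I" if "s \<otimes> x [^] (k::nat) : I" "s : carrier R" for s k
  using that
 proof (induction k)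
  case (Suc k)
  have "x \<otimes> (s \<otimes> x [^] k) = s \<otimes> x [^] Suc k" using xR Suc(3) by (simp add: m_ac)
  then show ?case using nzd[of "s \<otimes> x [^] k"] Suc xR by simp
 qed simp
 have "\<exists>Q'. primeideal Q' R & I <= Q' & Q' \<inter> M = {} \<and>
   (\<forall>x\<in>carrier R - Q'. \<exists>q\<in>Q'. \<exists>r\<in>carrier R. q \<oplus> r \<otimes> x : M)"
 proof (rule exists_primeideal_avoiding[OF I(1)])
  show "M <= carrier R" unfolding M_def using xR by auto
  show "\<one> : M" using M[of \<one> 0] oneQ by simp
  show "I \<inter> M = {}" unfolding M_def using * I(2) by blast
  fix a b assume "a : M" "b : M"
  then obtain s k t l where st: "a = s \<otimes> x [^] (k::nat)" "b = t \<otimes> x [^] (l::nat)" "s : carrier R" "s ~: Q" "t : carrier R" "t ~: Q"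
   unfolding M_def by blast
  then have "a \<otimes> b = (s \<otimes> t) \<otimes> x [^] (k + l)" using xR by (simp add: nat_pow_mult[symmetric] m_ac)
  then show "a \<otimes> b : M" using M[of "s \<otimes> t" "k + l"] Q.I_prime[of s t] st by auto
 qed
 then obtain Q' where Q': "primeideal Q' R" "I <= Q'" "Q' \<inter> M = {}" by (elim exE conjE)
 interpret Q': primeideal Q' R by fact
 have "Q' <= Q"
 proof
  fix y assume y: "y : Q'"
  then have "y : carrier R" using Q'.Icarr by blast
  then show "y : Q" using M[of y 0] y Q'(3) by auto
 qed
 moreover have "x ~: Q'" using M[of \<one> 1] oneQ xR Q'(3) by auto
 ultimately show ?thesis using Q' x by blast
qed

text \<open>The chain is built from the top: below a prime over the ideal of the first
  \<open>j + 1\<close> elements there is a strictly smaller prime over the ideal of the first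
  \<open>j\<close>. This is why depth is at most dimension.\<close>

lemma (in cring) regular_sequence_prime_chain:
 assumes "regular_sequence R xs"
 shows "\<exists>P. (\<forall>i\<le>length xs. primeideal (P i) R) & (\<forall>i<length xs. P i \<subset> P (Suc i))"
proof -
 define n where "n = length xs"
 define I where "I i = Idl (set (take i xs))" for i
 have xs: "set xs <= carrier R" and reg: "!!i y. i < n ==> y : carrier R ==> xs ! i \<otimes> y : I i ==> y : I i"
  and ne: "I n ~= carrier R"
  using assms unfolding regular_sequence_iff I_def n_def by auto
 have tk: "set (take i xs) <= carrier R" for i using xs set_take_subset[of i xs] by auto
 have I: "ideal (I i) R" for i unfolding I_def using tk by (rule genideal_ideal)
 have mono: "I i <= I (Suc i)" for i unfolding I_def
  by (intro genideal_minimal genideal_ideal tk order_trans[OF _ genideal_self[OF tk]] set_take_subset_set_take) simp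
 have mem: "xs ! i : I (Suc i)" if "i < n" for i
  unfolding I_def using genideal_self[OF tk[of "Suc i"]] that by (auto simp: n_def take_Suc_conv_app_nth)
 have "\<exists>P. (\<forall>i. n - k <= i & i <= n --> primeideal (P i) R) & (\<forall>i. n - k <= i & i < n --> P i \<subset> P (Suc i)) & I (n - k) <= P (n - k)"
  if "k <= n" for k
  using that
 proof (induction k)
  case 0
  interpret In: ideal "I n" R by (rule I)
  have "I n \<inter> {\<one>} = {}" using ne In.one_imp_carrier by auto
  then obtain Q where "primeideal Q R" "I n <= Q"
   using exists_primeideal_avoiding[OF I, of "{\<one>}" n] by auto
  then show ?case by (intro exI[of _ "\<lambda>_. Q"]) auto
 next
  case (Suc k)
  then have "k <= n" by simp
  from Suc(1)[OF this] obtain P where P': "\<forall>i. n - k <= i & i <= n --> primeideal (P i) R"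
   "\<forall>i. n - k <= i & i < n --> P i \<subset> P (Suc i)" and P3: "I (n - k) <= P (n - k)" by (elim exE conjE)
  have P: "primeideal (P i) R" "i < n ==> P i \<subset> P (Suc i)" if "n - k <= i" "i <= n" for i
   using P'[rule_format, OF conjI[OF that(1)]] that by blast+
  define j where "j = n - Suc k"
  have j: "n - k = Suc j" "j < n" using Suc(2) by (auto simp: j_def)
  have "I j <= P (Suc j)" "xs ! j : P (Suc j)" using P3 mono[of j] mem[OF j(2)] unfolding j(1) by auto
  then obtain Q where Q: "primeideal Q R" "I j <= Q" "Q \<subset> P (Suc j)"
   using exists_smaller_primeideal[of "P (Suc j)" "I j" "xs ! j"] P(1)[of "Suc j"] I reg[OF j(2)] j by auto
  have "primeideal ((P(j := Q)) i) R" if "j <= i" "i <= n" for i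
   using that Q(1) P(1)[of i] j by (cases "i = j") auto
  moreover have "(P(j := Q)) i \<subset> (P(j := Q)) (Suc i)" if "j <= i" "i < n" for i
   using that Q(3) P(2)[of i] j by (cases "i = j") auto
  ultimately show ?case unfolding j_def[symmetric] using Q(2) by (intro exI[of _ "P(j := Q)"]) simp
 qed
 from this[OF order_refl] obtain P where P: "\<forall>i. n - n <= i & i <= n --> primeideal (P i) R"
  "\<forall>i. n - n <= i & i < n --> P i \<subset> P (Suc i)" by (elim exE conjE)
 show ?thesis
 proof (intro exI conjI allI impI)
  fix i assume "i <= length xs"
  then have "n - n <= i & i <= n" unfolding n_def by simp
  then show "primeideal (P i) R" by (rule P(1)[rule_format])
 next
  fix i assume "i < length xs"
  then have "n - n <= i & i < n" unfolding n_def by simp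
  then show "P i \<subset> P (Suc i)" by (rule P(2)[rule_format])
 qed
qed

lemma (in cring) ideal_depth_le_krull_dim: "ideal_depth R I <= krull_dim R"
 unfolding ideal_depth_def krull_dim_def
proof (rule Sup_mono)
 fix a assume "a : {enat (length xs) | xs. regular_sequence R xs & set xs <= I}"
 then obtain xs where "a = enat (length xs)" "regular_sequence R xs" by blast
 then show "\<exists>b\<in>{enat n | n. \<exists>P. (\<forall>i\<le>n. primeideal (P i) R) & (\<forall>i<n. P i \<subset> P (Suc i))}. a <= b"
  using regular_sequence_prime_chain[of xs] by blast
qed

section \<open>Localization of a domain at a prime ideal\<close>

text \<open>The operations of \<open>localization\<close> are unions over all representatives; once
  the result is independent of the representatives, the union collapses to a single class.\<close>

lemma UN_pairs_const:
 assumes "A ~= {}" "B ~= {}" "!!a s b t. (a, s) : A ==> (b, t) : B ==> f a s b t = c"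
 shows "(\<Union>(a, s)\<in>A. \<Union>(b, t)\<in>B. f a s b t) = c"
proof (rule SUP_eq_const[OF assms(1)])
 fix p assume "p : A"
 then show "(case p of (a, s) => \<Union>(b, t)\<in>B. f a s b t) = c"
  using assms(3) by (cases p) (simp, intro SUP_eq_const[OF assms(2)], auto)
qed

locale domain_localization =
 fixes D m :: "'a :: idom set"
 assumes D: "subring_set D" and m: "prime_in D m"
begin

definition fr :: "'a => 'a => ('a \<times> 'a) set" where
 "fr a s = frac_class (RD D) (D - m) a s"

abbreviation Loc where "Loc \<equiv> localization_at (RD D) m"

lemmas mult_D = subringD(4)[OF D] and add_D = subringD(6)[OF D] and one_D = subringD(1)[OF D]
 and zero_D = subringD(2)[OF D] and uminus_D = subringD(5)[OF D]

lemmas one_m = prime_inD(3)[OF m] and zero_m = submodD(1)[OF prime_inD(2)[OF m]]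

lemma m_D: "a : m ==> a : D"
 using prime_inD(1)[OF m] by (rule subsetD)

lemma mult_m: "s : D ==> t : D ==> s ~: m ==> t ~: m ==> s * t ~: m"
 using prime_inD(4)[OF m, of s t] by auto

lemma nonzero: "s ~: m ==> s ~= 0"
 using zero_m by blast

lemmas intros = mult_D add_D one_D zero_D uminus_D one_m mult_m

text \<open>The multiplier in \<open>frac_class\<close> lies outside \<open>m\<close>, hence is
  nonzero and cancels in a domain.\<close>

lemma mem_fr:
 assumes "a : D" "s : D"
 shows "(b, t) : fr a s \<longleftrightarrow> b : D & t : D & t ~: m & t * a = s * b"
proof -
 have "(\<exists>u\<in>D - m. u * (t * a - s * b) = 0) \<longleftrightarrow> t * a = s * b"
  using nonzero one_D one_m by force
 moreover have "(t * a) \<ominus>\<^bsub>RD D\<^esub> (s * b) = t * a - s * b" if "b : D" "t : D"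
  using that assms by (intro a_minus_RD[OF D]) (auto intro: intros)
 ultimately show ?thesis unfolding fr_def frac_class_def by auto
qed

lemma fr_eq_iff:
 assumes "a : D" "s : D" "s ~: m" "b : D" "t : D" "t ~: m"
 shows "fr a s = fr b t \<longleftrightarrow> t * a = s * b"
proof
 have "(b, t) : fr b t" using assms by (simp add: mem_fr)
 moreover assume "fr a s = fr b t"
 ultimately have "(b, t) : fr a s" by simp
 then show "t * a = s * b" unfolding mem_fr[OF assms(1,2)] by blast
next
 assume eq: "t * a = s * b"
 have "v * a = s * c \<longleftrightarrow> v * b = t * c" for c v
 proof -
  have "v * a = s * c \<longleftrightarrow> t * (v * a) = t * (s * c)" using nonzero[OF assms(6)] by simp
  also have "\<dots> \<longleftrightarrow> s * (v * b) = s * (t * c)" using eq by (metis mult.left_commute)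
  also have "\<dots> \<longleftrightarrow> v * b = t * c" using nonzero[OF assms(3)] by simp
  finally show ?thesis .
 qed
 then show "fr a s = fr b t" using assms by (auto simp: mem_fr)
qed

lemma fr_nonempty: "a : D ==> s : D ==> s ~: m ==> fr a s ~= {}"
 using mem_fr[of a s a s] by auto

lemma carrier_Loc: "carrier Loc = {fr a s | a s. a : D & s : D & s ~: m}"
 by (simp add: localization_at_def localization_def fr_def)

lemma fr_carrier [simp]: "a : D ==> s : D ==> s ~: m ==> fr a s : carrier Loc"
 unfolding carrier_Loc by blast

lemma carrier_LocE:
 assumes "x : carrier Loc"
 obtains a s where "x = fr a s" "a : D" "s : D" "s ~: m"
 using assms unfolding carrier_Loc by blast

lemma one_Loc: "\<one>\<^bsub>Loc\<^esub> = fr 1 1" and zero_Loc: "\<zero>\<^bsub>Loc\<^esub> = fr 0 1"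
 by (simp_all add: localization_at_def localization_def fr_def)

lemma mult_Loc:
 assumes "a : D" "s : D" "s ~: m" "b : D" "t : D" "t ~: m"
 shows "fr a s \<otimes>\<^bsub>Loc\<^esub> fr b t = fr (a * b) (s * t)"
proof -
 have "fr (a' * b') (s' * t') = fr (a * b) (s * t)" if "(a', s') : fr a s" "(b', t') : fr b t" for a' s' b' t'
 proof -
  have *: "a' : D" "s' : D" "s' ~: m" "b' : D" "t' : D" "t' ~: m" "s' * a = s * a'" "t' * b = t * b'"
   using that assms by (auto simp: mem_fr)
  have "(s * t) * (a' * b') = (s * a') * (t * b')" by (simp add: mult_ac)
  also have "\<dots> = (s' * t') * (a * b)" unfolding *(7,8)[symmetric] by (simp add: mult_ac)
  finally show ?thesis using * assms by (subst fr_eq_iff) (simp_all add: intros)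
 qed
 then have "(\<Union>(a', s')\<in>fr a s. \<Union>(b', t')\<in>fr b t. fr (a' * b') (s' * t')) = fr (a * b) (s * t)"
  using fr_nonempty[OF assms(1-3)] fr_nonempty[OF assms(4-6)] by (intro UN_pairs_const)
 then show ?thesis by (simp add: localization_at_def localization_def fr_def)
qed

lemma add_Loc:
 assumes "a : D" "s : D" "s ~: m" "b : D" "t : D" "t ~: m"
 shows "fr a s \<oplus>\<^bsub>Loc\<^esub> fr b t = fr (t * a + s * b) (s * t)"
proof -
 have "fr (t' * a' + s' * b') (s' * t') = fr (t * a + s * b) (s * t)" if "(a', s') : fr a s" "(b', t') : fr b t" for a' s' b' t'
 proof -
  have *: "a' : D" "s' : D" "s' ~: m" "b' : D" "t' : D" "t' ~: m" "s' * a = s * a'" "t' * b = t * b'"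
   using that assms by (auto simp: mem_fr)
  have "(s * t) * (t' * a' + s' * b') = (s * a') * (t * t') + (t * b') * (s * s')" by (simp add: algebra_simps)
  also have "\<dots> = (s' * t') * (t * a + s * b)" unfolding *(7,8)[symmetric] by (simp add: algebra_simps)
  finally show ?thesis using * assms by (subst fr_eq_iff) (simp_all add: intros)
 qed
 then have "(\<Union>(a', s')\<in>fr a s. \<Union>(b', t')\<in>fr b t. fr (t' * a' + s' * b') (s' * t')) = fr (t * a + s * b) (s * t)"
  using fr_nonempty[OF assms(1-3)] fr_nonempty[OF assms(4-6)] by (intro UN_pairs_const)
 then show ?thesis by (simp add: localization_at_def localization_def fr_def)
qed

lemma cring_Loc: "cring Loc"
proof (rule cringI)
 show "abelian_group Loc"
 proof (rule abelian_groupI)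
  fix x y z assume "x : carrier Loc" "y : carrier Loc" "z : carrier Loc"
  then show "x \<oplus>\<^bsub>Loc\<^esub> y \<oplus>\<^bsub>Loc\<^esub> z = x \<oplus>\<^bsub>Loc\<^esub> (y \<oplus>\<^bsub>Loc\<^esub> z)"
   by (elim carrier_LocE) (simp add: add_Loc intros fr_eq_iff algebra_simps)
 next
  fix x y assume "x : carrier Loc" "y : carrier Loc"
  then show "x \<oplus>\<^bsub>Loc\<^esub> y : carrier Loc" "x \<oplus>\<^bsub>Loc\<^esub> y = y \<oplus>\<^bsub>Loc\<^esub> x"
   by (elim carrier_LocE; simp add: add_Loc intros fr_eq_iff algebra_simps)+
 next
  fix x assume "x : carrier Loc"
  then show "\<zero>\<^bsub>Loc\<^esub> \<oplus>\<^bsub>Loc\<^esub> x = x"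
   by (elim carrier_LocE) (simp add: zero_Loc add_Loc intros fr_eq_iff algebra_simps)
  obtain a s where x: "x = fr a s" "a : D" "s : D" "s ~: m" using `x : carrier Loc` by (rule carrier_LocE)
  show "\<exists>y\<in>carrier Loc. y \<oplus>\<^bsub>Loc\<^esub> x = \<zero>\<^bsub>Loc\<^esub>"
   by (rule bexI[of _ "fr (- a) s"]) (simp_all add: x zero_Loc add_Loc intros fr_eq_iff algebra_simps)
 qed (simp add: zero_Loc intros)
 show "comm_monoid Loc"
 proof (rule comm_monoidI)
  fix x y z assume "x : carrier Loc" "y : carrier Loc" "z : carrier Loc"
  then show "x \<otimes>\<^bsub>Loc\<^esub> y \<otimes>\<^bsub>Loc\<^esub> z = x \<otimes>\<^bsub>Loc\<^esub> (y \<otimes>\<^bsub>Loc\<^esub> z)"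
   by (elim carrier_LocE) (simp add: mult_Loc intros fr_eq_iff algebra_simps)
 next
  fix x y assume "x : carrier Loc" "y : carrier Loc"
  then show "x \<otimes>\<^bsub>Loc\<^esub> y : carrier Loc" "x \<otimes>\<^bsub>Loc\<^esub> y = y \<otimes>\<^bsub>Loc\<^esub> x"
   by (elim carrier_LocE; simp add: mult_Loc intros fr_eq_iff algebra_simps)+
 next
  fix x assume "x : carrier Loc"
  then show "\<one>\<^bsub>Loc\<^esub> \<otimes>\<^bsub>Loc\<^esub> x = x"
   by (elim carrier_LocE) (simp add: one_Loc mult_Loc intros fr_eq_iff algebra_simps)
 qed (simp add: one_Loc intros)
 fix x y z assume "x : carrier Loc" "y : carrier Loc" "z : carrier Loc"
 then show "(x \<oplus>\<^bsub>Loc\<^esub> y) \<otimes>\<^bsub>Loc\<^esub> z = x \<otimes>\<^bsub>Loc\<^esub> z \<oplus>\<^bsub>Loc\<^esub> y \<otimes>\<^bsub>Loc\<^esub> z"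
  by (elim carrier_LocE) (simp add: mult_Loc add_Loc intros fr_eq_iff algebra_simps)
qed

text \<open>The contraction of an ideal along the map that sends \<open>a\<close> to
  \<open>a / 1\<close>.\<close>

definition cont :: "('a \<times> 'a) set set => 'a set" where
 "cont J = {a : D. fr a 1 : J}"

lemma fr_mem_ideal_iff:
 assumes "ideal J Loc" "a : D" "s : D" "s ~: m"
 shows "fr a s : J \<longleftrightarrow> a : cont J"
proof -
 interpret ideal J Loc by fact
 have "fr s 1 \<otimes>\<^bsub>Loc\<^esub> fr a s = fr a 1" "fr 1 s \<otimes>\<^bsub>Loc\<^esub> fr a 1 = fr a s"
  using assms by (simp_all add: mult_Loc intros fr_eq_iff mult_ac)
 moreover have "fr s 1 : carrier Loc" "fr 1 s : carrier Loc" using assms by (simp_all add: intros)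
 ultimately show ?thesis using I_l_closed assms(2) unfolding cont_def
  by (metis (mono_tags, lifting) mem_Collect_eq)
qed

lemma ideal_in_cont:
 assumes "ideal J Loc"
 shows "ideal_in D (cont J)"
proof -
 interpret cring Loc by (rule cring_Loc)
 interpret J: ideal J Loc by fact
 have "fr 0 1 : J" using J.zero_closed by (simp add: zero_Loc)
 moreover have "fr (x + y) 1 : J" if "x : D" "y : D" "fr x 1 : J" "fr y 1 : J" for x y
  using J.a_closed[OF that(3,4)] that by (simp add: add_Loc intros)
 moreover have "fr (d * x) 1 : J" if "x : D" "d : D" "fr x 1 : J" for x d
  using J.I_l_closed[OF that(3), of "fr d 1"] that by (simp add: mult_Loc intros)
 ultimately show ?thesis unfolding ideal_in_def submod_def cont_def by (auto intro: intros)
qed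

lemma prime_in_cont:
 assumes "primeideal J Loc"
 shows "prime_in D (cont J)"
proof -
 interpret primeideal J Loc by fact
 have "fr 1 1 ~: J" using I_notcarr one_imp_carrier by (auto simp: one_Loc)
 moreover have "x : cont J \<or> y : cont J" if "x : D" "y : D" "x * y : cont J" for x y
 proof -
  have "fr x 1 \<otimes>\<^bsub>Loc\<^esub> fr y 1 : J" using that by (simp add: mult_Loc intros cont_def)
  then show ?thesis using I_prime[of "fr x 1" "fr y 1"] that by (auto simp: cont_def intros)
 qed
 ultimately show ?thesis using ideal_in_cont[OF ideal_axioms] unfolding prime_in_def by (auto simp: cont_def)
qed

lemma cont_psubset:
 assumes "ideal J Loc" "ideal J' Loc" "J \<subset> J'"
 shows "cont J \<subset> cont J'"
proof -
 obtain x where x: "x : J'" "x ~: J" using assms(3) by blast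
 then have "x : carrier Loc" using ideal.Icarr[OF assms(2)] by blast
 then obtain a s where "x = fr a s" "a : D" "s : D" "s ~: m" by (rule carrier_LocE)
 then have "a : cont J'" "a ~: cont J" using x fr_mem_ideal_iff[OF assms(1)] fr_mem_ideal_iff[OF assms(2)] by auto
 moreover have "cont J <= cont J'" using assms(3) by (auto simp: cont_def)
 ultimately show ?thesis by blast
qed

lemma ideal_ext:
 assumes I: "ideal_in D I"
 shows "ideal {fr a s | a s. a : D & s : D & s ~: m & (\<exists>t\<in>D - m. t * a : I)} Loc" (is "ideal ?J Loc")
proof -
 interpret cring Loc by (rule cring_Loc)
 have sI: "submod D I" using I by (simp add: ideal_in_def)
 have J: "fr a s : ?J" if "a : D" "s : D" "s ~: m" "t : D" "t ~: m" "t * a : I" for a s t using that by blast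
 have l: "y \<otimes>\<^bsub>Loc\<^esub> x : ?J" if xJ: "x : ?J" and yL: "y : carrier Loc" for x y
 proof -
  obtain a s t where a: "x = fr a s" "a : D" "s : D" "s ~: m" "t : D" "t ~: m" "t * a : I" using xJ by blast
  obtain b u where b: "y = fr b u" "b : D" "u : D" "u ~: m" using yL by (rule carrier_LocE)
  have tba: "t * (b * a) : I" using submodD(3)[OF sI b(2) a(7)] by (simp add: mult_ac)
  show ?thesis unfolding a(1) b(1) mult_Loc[OF b(2-4) a(2-4)]
   by (rule J[OF _ _ _ a(5,6) tba]) (use a b in "simp_all add: intros")
 qed
 show ?thesis
 proof (rule idealI[OF ring_axioms])
  show "subgroup ?J (add_monoid Loc)"
  proof (rule add.subgroupI)
   show "?J <= carrier Loc" unfolding carrier_Loc by blast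
   have "fr 0 1 : ?J" using submodD(1)[OF sI] by (intro J[of _ _ 1]) (auto simp: intros)
   then show "?J ~= {}" by blast
   fix x assume x: "x : ?J"
   then have xc: "x : carrier Loc" unfolding carrier_Loc by blast
   have "(\<ominus>\<^bsub>Loc\<^esub> \<one>\<^bsub>Loc\<^esub>) \<otimes>\<^bsub>Loc\<^esub> x : ?J" using l[OF x] by simp
   then show "\<ominus>\<^bsub>Loc\<^esub> x : ?J" using xc by (simp add: l_minus)
   fix y assume "y : ?J"
   then obtain b u v where b: "y = fr b u" "b : D" "u : D" "u ~: m" "v : D" "v ~: m" "v * b : I" by blast
   obtain a s t where a: "x = fr a s" "a : D" "s : D" "s ~: m" "t : D" "t ~: m" "t * a : I" using `x : ?J` by blast
   have "(v * u) * (t * a) + (t * s) * (v * b) : I" 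
    using a b by (intro submodD(2)[OF sI] submodD(3)[OF sI _ a(7)] submodD(3)[OF sI _ b(7)]) (simp_all add: intros)
   then have tv: "(t * v) * (u * a + s * b) : I" by (simp add: algebra_simps)
   show "x \<oplus>\<^bsub>Loc\<^esub> y : ?J" unfolding a(1) b(1) add_Loc[OF a(2-4) b(2-4)]
    by (rule J[OF _ _ _ _ _ tv]) (use a b in "simp_all add: intros")
  qed
  show "x \<otimes>\<^bsub>Loc\<^esub> a : ?J" if "a : ?J" "x : carrier Loc" for a x using l that by blast
  show "a \<otimes>\<^bsub>Loc\<^esub> x : ?J" if "a : ?J" "x : carrier Loc" for a x
  proof -
   have "a : carrier Loc" using that(1) unfolding carrier_Loc by blast
   then show ?thesis using l[OF that] that(2) m_comm by simp
  qed
 qed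
qed

text \<open>This allows regularity in the localization to be tested in \<open>D\<close>, at the
  price of a factor \<open>t\<close> outside \<open>m\<close>.\<close>

lemma fr_mem_Idl_iff:
 assumes F: "finite F" "F <= D" and a: "a : D" "s : D" "s ~: m"
 shows "fr a s : Idl\<^bsub>Loc\<^esub> ((\<lambda>x. fr x 1) ` F) \<longleftrightarrow> (\<exists>t\<in>D - m. t * a : lspan D F)"
proof -
 interpret cring Loc by (rule cring_Loc)
 have FD: "(\<lambda>x. fr x 1) ` F <= carrier Loc" using F(2) by (auto intro!: fr_carrier one_D one_m)
 note idl = genideal_ideal[OF FD]
 have iF: "ideal_in D (lspan D F)" unfolding ideal_in_def
  using submod_lspan[OF D] lspan_minimal[OF submod_self[OF D] F(2)] by blast
 show ?thesis
 proof
  let ?J = "{fr a s | a s. a : D & s : D & s ~: m & (\<exists>t\<in>D - m. t * a : lspan D F)}"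
  have "(\<lambda>x. fr x 1) ` F <= ?J"
  proof
   fix y assume "y : (\<lambda>x. fr x 1) ` F"
   then obtain x where "y = fr x 1" "x : F" by blast
   moreover have "1 * x : lspan D F" using lspan_base[OF D F(1) `x : F`] by simp
   ultimately show "y : ?J" using F(2) one_D one_m by blast
  qed
  then have "Idl\<^bsub>Loc\<^esub> ((\<lambda>x. fr x 1) ` F) <= ?J" using genideal_minimal[OF ideal_ext[OF iF]] by blast
  moreover assume "fr a s : Idl\<^bsub>Loc\<^esub> ((\<lambda>x. fr x 1) ` F)"
  ultimately have "fr a s : ?J" by blast
  then obtain b u t where b: "fr a s = fr b u" "b : D" "u : D" "u ~: m" "t : D" "t ~: m" "t * b : lspan D F" by blast
  then have eq: "u * a = s * b" using a by (simp add: fr_eq_iff)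
  have "s * (t * b) : lspan D F" using submodD(3)[OF submod_lspan[OF D] a(2) b(7)] .
  then have "(u * t) * a : lspan D F" using eq by (metis mult.assoc mult.commute)
  then show "\<exists>t\<in>D - m. t * a : lspan D F" using b by (intro bexI[of _ "u * t"]) (simp_all add: intros)
 next
  let ?I = "Idl\<^bsub>Loc\<^esub> ((\<lambda>x. fr x 1) ` F)"
  assume "\<exists>t\<in>D - m. t * a : lspan D F"
  then obtain t where t: "t : D" "t ~: m" "t * a : lspan D F" by blast
  have "F <= cont ?I" using genideal_self[OF FD] F(2) by (auto simp: cont_def)
  then have "lspan D F <= cont ?I" using ideal_in_cont[OF idl] lspan_minimal unfolding ideal_in_def by blast
  then have "t * a : cont ?I" using t(3) by (rule subsetD)
  then have "fr (t * a) (t * s) : ?I" using t a by (subst fr_mem_ideal_iff[OF idl]) (simp_all add: intros)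
  moreover have "fr (t * a) (t * s) = fr a s" using t a by (simp add: fr_eq_iff intros mult_ac)
  ultimately show "fr a s : ?I" by simp
 qed
qed

lemma noetherian_Loc:
 assumes "noeth_mod D D"
 shows "noetherian_ring Loc"
proof -
 interpret cring Loc by (rule cring_Loc)
 show ?thesis
 proof (rule noetherian_ringI)
  fix J assume J: "ideal J Loc"
  then have "submod D (cont J)" "cont J <= D" using ideal_in_cont unfolding ideal_in_def by auto
  then obtain F where F: "finite F" "F <= cont J" "cont J <= lspan D F" by (rule noeth_modD[OF assms])
  have FD: "F <= D" using F(2) by (auto simp: cont_def)
  let ?A = "(\<lambda>x. fr x 1) ` F"
  have "J <= Idl\<^bsub>Loc\<^esub> ?A"
  proof
   fix x assume x: "x : J"
   then have "x : carrier Loc" using ideal.Icarr[OF J] by blast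
   then obtain a s where a: "x = fr a s" "a : D" "s : D" "s ~: m" by (rule carrier_LocE)
   then have "1 * a : lspan D F" using x fr_mem_ideal_iff[OF J] F(3) by auto
   then show "x : Idl\<^bsub>Loc\<^esub> ?A" unfolding a(1) using fr_mem_Idl_iff[OF F(1) FD] a one_D one_m by blast
  qed
  moreover have "Idl\<^bsub>Loc\<^esub> ?A <= J" by (intro genideal_minimal J) (use F(2) in "auto simp: cont_def")
  ultimately show "\<exists>A\<subseteq>carrier Loc. finite A & J = Idl\<^bsub>Loc\<^esub> A"
   using F(1) FD by (intro exI[of _ ?A]) (auto intro!: fr_carrier one_D one_m)
 qed
qed

section \<open>The maximal ideal of the localization, dimension and depth\<close>

definition mm where "mm = {fr a s | a s. a : m & s : D & s ~: m}"

lemma fr_mem_mm: "a : D ==> s : D ==> s ~: m ==> fr a s : mm \<longleftrightarrow> a : m"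
proof
 assume a: "a : D" "s : D" "s ~: m"
 assume "fr a s : mm"
 then obtain b t where b: "fr a s = fr b t" "b : m" "t : D" "t ~: m" unfolding mm_def by blast
 then have "t * a = s * b" using a m_D by (simp add: fr_eq_iff)
 then have "t * a : m" using submodD(3)[OF prime_inD(2)[OF m] a(2) b(2)] by simp
 then show "a : m" using prime_inD(4)[OF m b(3) a(1)] b(4) by blast
qed (auto simp: mm_def)

lemma ideal_mm: "ideal mm Loc"
proof -
 have "mm = {fr a s | a s. a : D & s : D & s ~: m & (\<exists>t\<in>D - m. t * a : m)}"
  unfolding mm_def using prime_inD(4)[OF m] m_D one_D one_m by (metis (no_types, lifting) DiffD1 DiffD2 DiffI mult_1)
 then show ?thesis using ideal_ext[of m] m unfolding prime_in_def by simp
qed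

lemma maximalideal_Loc_iff: "maximalideal J Loc \<longleftrightarrow> J = mm"
proof -
 interpret cring Loc by (rule cring_Loc)
 interpret mm: ideal mm Loc by (rule ideal_mm)
 have ne: "carrier Loc ~= mm"
  using fr_mem_mm[OF one_D one_D one_m] one_m by (metis fr_carrier one_D)
 have sub: "J <= mm" if J: "ideal J Loc" "J ~= carrier Loc" for J
 proof
  fix x assume x: "x : J"
  then have "x : carrier Loc" using ideal.Icarr[OF J(1)] by blast
  then obtain a s where a: "x = fr a s" "a : D" "s : D" "s ~: m" by (rule carrier_LocE)
  have "a : m"
  proof (rule ccontr)
   assume "a ~: m"
   then have "fr s a \<otimes>\<^bsub>Loc\<^esub> fr a s = \<one>\<^bsub>Loc\<^esub>" using a by (simp add: mult_Loc one_Loc fr_eq_iff intros mult_ac)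
   moreover have "fr s a \<otimes>\<^bsub>Loc\<^esub> fr a s : J" using ideal.I_l_closed[OF J(1)] x a `a ~: m` by simp
   ultimately have "\<one>\<^bsub>Loc\<^esub> : J" by simp
   then show False using ideal.one_imp_carrier[OF J(1)] J(2) by blast
  qed
  then show "x : mm" using a by (simp add: fr_mem_mm)
 qed
 show ?thesis
 proof
  assume "maximalideal J Loc"
  then interpret J: maximalideal J Loc .
  have "J <= mm" using sub[OF J.ideal_axioms] J.I_notcarr by blast
  then show "J = mm" using J.I_maximal[OF ideal_mm] ne mm.a_subset by blast
 next
  assume "J = mm"
  moreover have "maximalideal mm Loc"
   by (rule maximalidealI[OF ideal_mm ne]) (use sub in blast)
  ultimately show "maximalideal J Loc" by simp
 qed
qed

lemma krull_dim_Loc_le: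
 assumes "!!P. \<lbrakk>!!i. i <= Suc d ==> prime_in D (P i); !!i. i < Suc d ==> P i \<subset> P (Suc i)\<rbrakk> \<Longrightarrow> False"
 shows "krull_dim Loc <= enat d"
 unfolding krull_dim_def
proof (rule Sup_least)
 fix x assume "x : {enat n | n. \<exists>P. (\<forall>i\<le>n. primeideal (P i) Loc) & (\<forall>i<n. P i \<subset> P (Suc i))}"
 then obtain n P where x: "x = enat n" and P: "!!i. i <= n ==> primeideal (P i) Loc" "!!i. i < n ==> P i \<subset> P (Suc i)" by auto
 have "n <= d"
 proof (rule ccontr)
  assume "\<not> ?thesis"
  then have "Suc d <= n" by simp
  show False
  proof (rule assms[of "\<lambda>i. cont (P i)"])
   fix i assume "i <= Suc d"
   then have "i <= n" using `Suc d <= n` by simp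
   then show "prime_in D (cont (P i))" by (intro prime_in_cont P(1))
  next
   fix i assume "i < Suc d"
   then have i: "i < n" "i <= n" "Suc i <= n" using `Suc d <= n` by simp_all
   show "cont (P i) \<subset> cont (P (Suc i))"
    by (rule cont_psubset[OF primeideal.axioms(1)[OF P(1)[OF i(2)]] primeideal.axioms(1)[OF P(1)[OF i(3)]] P(2)[OF i(1)]])
  qed
 qed
 then show "x <= enat d" using x by simp
qed

text \<open>Depth never exceeds dimension. So a regular sequence of length 3 in the maximal ideal
  and the absence of chains of five primes in \<open>D\<close> force both numbers to be 3.\<close>

lemma cohen_macaulay_local_Loc:
 assumes noeth: "noeth_mod D D"
  and dim: "!!P. \<lbrakk>!!i. i <= 4 ==> prime_in D (P i); !!i. i < 4 ==> P i \<subset> P (Suc i)\<rbrakk> \<Longrightarrow> False"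
  and x: "x0 : m" "x1 : m" "x2 : m" "x0 ~= 0"
  and reg1: "!!a b. a : D ==> b : D ==> x1 * a = x0 * b ==> \<exists>t\<in>D - m. \<exists>c\<in>D. t * a = x0 * c"
  and reg2: "!!a b c. a : D ==> b : D ==> c : D ==> x2 * a = x0 * b + x1 * c ==> \<exists>t\<in>D - m. \<exists>d\<in>D. \<exists>e\<in>D. t * a = x0 * d + x1 * e"
 shows "cohen_macaulay_local Loc"
proof -
 interpret cring Loc by (rule cring_Loc)
 note xD = x(1-3)[THEN m_D]
 have span0: "y : lspan D {} \<longleftrightarrow> y = 0" for y by (auto simp: lspan_def)
 have span1: "y : lspan D {x0} \<longleftrightarrow> (\<exists>c\<in>D. y = x0 * c)" for y
  by (auto simp: lspan_def mult.commute intro: exI[of _ "\<lambda>_. c" for c])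
 have span2: "y : lspan D {x0, x1} \<longleftrightarrow> (\<exists>d\<in>D. \<exists>e\<in>D. y = x0 * d + x1 * e)" for y
 proof
  have "submod D {y. \<exists>d\<in>D. \<exists>e\<in>D. y = x0 * d + x1 * e}" unfolding submod_def
  proof (intro conjI ballI CollectI)
   show "\<exists>d\<in>D. \<exists>e\<in>D. 0 = x0 * d + x1 * e" by (intro bexI[of _ 0]) (auto intro: intros)
   fix y z assume "y : {y. \<exists>d\<in>D. \<exists>e\<in>D. y = x0 * d + x1 * e}" "z : {y. \<exists>d\<in>D. \<exists>e\<in>D. y = x0 * d + x1 * e}"
   then obtain d e d' e' where "y = x0 * d + x1 * e" "z = x0 * d' + x1 * e'" "d : D" "e : D" "d' : D" "e' : D" by auto
   then show "\<exists>d\<in>D. \<exists>e\<in>D. y + z = x0 * d + x1 * e"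
    by (intro bexI[of _ "d + d'"] bexI[of _ "e + e'"]) (auto intro: intros simp: algebra_simps)
  next
   fix k y assume "k : D" "y : {y. \<exists>d\<in>D. \<exists>e\<in>D. y = x0 * d + x1 * e}"
   then obtain d e where "y = x0 * d + x1 * e" "d : D" "e : D" by auto
   then show "\<exists>d\<in>D. \<exists>e\<in>D. k * y = x0 * d + x1 * e" using `k : D`
    by (intro bexI[of _ "k * d"] bexI[of _ "k * e"]) (auto intro: intros simp: algebra_simps)
  qed
  moreover have "\<exists>d\<in>D. \<exists>e\<in>D. x0 = x0 * d + x1 * e"
   by (rule bexI[OF _ one_D], rule bexI[OF _ zero_D]) simp
  moreover have "\<exists>d\<in>D. \<exists>e\<in>D. x1 = x0 * d + x1 * e"
   by (rule bexI[OF _ zero_D], rule bexI[OF _ one_D]) simp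
  ultimately have "lspan D {x0, x1} <= {y. \<exists>d\<in>D. \<exists>e\<in>D. y = x0 * d + x1 * e}"
   by (intro lspan_minimal) simp_all
  moreover assume "y : lspan D {x0, x1}"
  ultimately show "\<exists>d\<in>D. \<exists>e\<in>D. y = x0 * d + x1 * e" by (auto dest: subsetD)
 next
  assume "\<exists>d\<in>D. \<exists>e\<in>D. y = x0 * d + x1 * e"
  then obtain d e where de: "d : D" "e : D" "y = d * x0 + e * x1" by (auto simp: mult.commute)
  show "y : lspan D {x0, x1}" unfolding de(3)
   by (intro submodD(2,3)[OF submod_lspan[OF D]] lspan_base[OF D] de) simp_all
 qed
 define xs where "xs = [fr x0 1, fr x1 1, fr x2 1]"
 have tk: "set (take i xs) = (\<lambda>x. fr x 1) ` set (take i [x0, x1, x2])" for i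
  by (simp add: xs_def take_map[symmetric] flip: set_map)
 have subD: "set (take i [x0, x1, x2]) <= D" for i using set_take_subset[of i "[x0, x1, x2]"] xD by auto
 have step: "\<exists>t\<in>D - m. t * a : lspan D (set (take i [x0, x1, x2]))"
  if i3: "i < 3" and at: "a : D" "t : D" "t ~: m" and h: "t * ([x0, x1, x2] ! i * a) : lspan D (set (take i [x0, x1, x2]))" for i a t
 proof -
  have "i = 0 \<or> i = 1 \<or> i = 2" using i3 by linarith
  then consider "i = 0" | "i = 1" | "i = 2" by blast
  then show ?thesis
  proof cases
   case 1
   then have "a = 0" using at h x(4) nonzero by (simp add: span0)
   then show ?thesis using 1 one_D one_m by (auto simp: span0)
  next
   case 2
   then obtain c where "c : D" "x1 * (t * a) = x0 * c" using h by (auto simp: span1 mult_ac)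
   then obtain t' c' where "t' : D" "t' ~: m" "c' : D" "t' * (t * a) = x0 * c'" using reg1[of "t * a" c] at intros by blast
   then show ?thesis using 2 at by (intro bexI[of _ "t' * t"]) (auto simp: span1 mult_ac mult_D dest: mult_m)
  next
   case 3
   then have "x2 * (t * a) : lspan D {x0, x1}" using h by (simp add: mult_ac numeral_2_eq_2)
   then obtain b c where "b : D" "c : D" "x2 * (t * a) = x0 * b + x1 * c" by (auto simp: span2)
   then obtain t' d e where "t' : D" "t' ~: m" "d : D" "e : D" "t' * (t * a) = x0 * d + x1 * e"
    using reg2[of "t * a" b c] at intros by blast
   then have "(t' * t) * a : lspan D {x0, x1}" unfolding span2 by (auto simp: mult_ac)
   moreover have "t' * t : D - m" using `t' : D` `t' ~: m` at by (simp add: intros)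
   ultimately show ?thesis using 3 by (auto simp: numeral_2_eq_2)
  qed
 qed
 have reg: "regular_sequence Loc xs" unfolding regular_sequence_iff
 proof (intro conjI allI impI ballI)
  show "set xs <= carrier Loc" using xD by (simp add: xs_def intros)
  have "Idl\<^bsub>Loc\<^esub> (set xs) <= mm"
   by (rule genideal_minimal[OF ideal_mm]) (use x xD one_D one_m in "auto simp: xs_def fr_mem_mm")
  then show "Idl\<^bsub>Loc\<^esub> (set xs) ~= carrier Loc" using fr_mem_mm[OF one_D one_D one_m] one_m one_D fr_carrier by blast
  fix i y assume i: "i < length xs" and y: "y : carrier Loc" "xs ! i \<otimes>\<^bsub>Loc\<^esub> y : Idl\<^bsub>Loc\<^esub> set (take i xs)"
  have i3: "i < 3" using i by (simp add: xs_def)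
  obtain a s where a: "y = fr a s" "a : D" "s : D" "s ~: m" using y(1) by (rule carrier_LocE)
  have xi: "xs ! i = fr ([x0, x1, x2] ! i) 1" "[x0, x1, x2] ! i : D"
   using i3 xD by (auto simp: xs_def less_Suc_eq numeral_3_eq_3)
  have "fr ([x0, x1, x2] ! i * a) s : Idl\<^bsub>Loc\<^esub> set (take i xs)"
   using y(2) a xi by (simp add: mult_Loc intros)
  then obtain t where "t : D" "t ~: m" "t * ([x0, x1, x2] ! i * a) : lspan D (set (take i [x0, x1, x2]))"
   unfolding tk fr_mem_Idl_iff[OF finite_set subD mult_D[OF xi(2) a(2)] a(3,4)] by blast
  then show "y : Idl\<^bsub>Loc\<^esub> set (take i xs)"
   unfolding tk a(1) using fr_mem_Idl_iff[OF _ subD] a step[OF i3 a(2)] by auto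
 qed
 have "set xs <= mm" using x xD one_D one_m by (auto simp: xs_def fr_mem_mm)
 then have "enat 3 <= ideal_depth Loc mm" unfolding ideal_depth_def
  using reg by (intro Sup_upper CollectI exI[of _ xs]) (auto simp: xs_def)
 moreover have "krull_dim Loc <= enat 3"
 proof (rule krull_dim_Loc_le)
  fix P assume P: "!!i. i <= Suc 3 ==> prime_in D (P i)" "!!i. i < Suc 3 ==> P i \<subset> P (Suc i)"
  show False
  proof (rule dim[of P])
   show "prime_in D (P i)" if "i <= 4" for i by (rule P(1)) (use that in simp)
   show "P i \<subset> P (Suc i)" if "i < 4" for i by (rule P(2)) (use that in simp)
  qed
 qed
 ultimately have "ideal_depth Loc mm = krull_dim Loc" using ideal_depth_le_krull_dim[of mm] by order
 then show ?thesis unfolding cohen_macaulay_local_def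
  using cring_Loc noetherian_Loc[OF noeth] maximalideal_Loc_iff by blast
qed

end

section \<open>Chains of prime ideals\<close>

text \<open>\<open>eval_ints N ys c\<close> is the value at \<open>ys\<close> of the integer polynomial with coefficients \<open>c\<close>, indexed
 by exponent lists with entries below \<open>N\<close>.\<close>

fun eval_ints :: "nat => 'a :: comm_ring_1 list => (nat list => int) => 'a" where
 "eval_ints N [] c = of_int (c [])"
| "eval_ints N (y # ys) c = (\<Sum>i<N. y ^ i * eval_ints N ys (\<lambda>e. c (i # e)))"

definition exponents :: "nat => nat => nat list set" where
 "exponents N k = {e. length e = k & set e <= {..<N}}"

lemma finite_exponents: "finite (exponents N k)"
 using finite_lists_length_eq[of "{..<N}" k] by (simp add: exponents_def conj_commute)

lemma exponents_Suc: "i # e : exponents N (Suc k) \<longleftrightarrow> i < N & e : exponents N k"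
 by (auto simp: exponents_def)

text \<open>The relation is required to be nontrivial modulo \<open>P\<close>.\<close>

definition int_related :: "'a :: comm_ring_1 set => 'a list => bool" where
 "int_related P ys \<longleftrightarrow> (\<exists>N c. eval_ints N ys c : P & (\<exists>e\<in>exponents N (length ys). of_int (c e) ~: P))"

lemma eval_ints_closed: "subring_set S ==> set ys <= S ==> eval_ints N ys c : S"
 by (induction ys arbitrary: c) (auto intro!: subring_sum subringD(4) subring_power subring_of_int)

lemma eval_ints_mem_ideal:
 assumes S: "subring_set S" "submod S P" "set ys <= S" and c: "!!e. e : exponents N (length ys) ==> of_int (c e) : P"
 shows "eval_ints N ys c : P"
 using S(3) c
proof (induction ys arbitrary: c)
 case Nil
 then show ?case by (simp add: exponents_def)
next
 case (Cons y ys)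
 have "eval_ints N ys (\<lambda>e. c (i # e)) : P" if "i < N" for i
  using Cons that by (intro Cons(1)) (auto simp: exponents_Suc)
 then show ?case using Cons(2) by (auto intro!: submod_sum[OF S(2)] submodD(3)[OF S(2)] subring_power[OF S(1)])
qed

lemma eval_ints_cong:
 assumes "!!e. e : exponents N (length ys) ==> c e = c' e"
 shows "eval_ints N ys c = eval_ints N ys c'"
 using assms
proof (induction ys arbitrary: c c')
 case Nil
 then show ?case by (simp add: exponents_def)
next
 case (Cons y ys)
 have "eval_ints N ys (\<lambda>e. c (i # e)) = eval_ints N ys (\<lambda>e. c' (i # e))" if "i < N" for i
  by (rule Cons.IH, rule Cons.prems) (simp add: exponents_Suc that)
 then show ?case unfolding eval_ints.simps by (intro sum.cong refl) auto
qed

lemma eval_ints_scale: "eval_ints N ys (\<lambda>e. g * c e) = of_int g * eval_ints N ys c"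
 by (induction ys arbitrary: c) (auto simp: sum_distrib_left mult.left_commute)

lemma gcd_mem_ideal:
 assumes "subring_set S" "submod S P" "of_int a : P" "of_int b : P"
 shows "of_int (gcd a b) : P"
proof -
 obtain u v where uv: "u * a + v * b = gcd a b" using bezout_int by blast
 have "of_int u * of_int a + of_int v * of_int b : P"
  by (intro submodD(2)[OF assms(2)] submodD(3)[OF assms(2)] subring_of_int[OF assms(1)] assms(3,4))
 then show ?thesis unfolding uv[symmetric] by simp
qed

lemma Gcd_mem_ideal:
 assumes S: "subring_set S" "submod S P" and "finite E" "!!e. e : E ==> of_int (c e) : P"
 shows "of_int (Gcd (c ` E)) : P"
 using assms(3,4)
proof (induction E)
 case empty
 then show ?case using submodD(1)[OF S(2)] by simp
next
 case (insert e E)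
 then show ?case using gcd_mem_ideal[OF S, of "c e" "Gcd (c ` E)"] by simp
qed

text \<open>Sort the relation by powers of \<open>y\<close>. The terms below the first power with an
  integer coefficient outside \<open>P\<close> lie in \<open>P\<close>; the rest is divisible by
  that power of \<open>y\<close>, which can be cancelled modulo \<open>P\<close>. Since
  \<open>y\<close> vanishes modulo \<open>Q\<close>, a relation between \<open>ys\<close> remains,
  and \<open>char_eq\<close> keeps it nontrivial.\<close>

lemma int_related_step:
 assumes S: "subring_set S" and P: "prime_in S P" and Q: "prime_in S Q" and PQ: "P <= Q"
  and char_eq: "!!n. of_int n : Q ==> of_int n : P"
  and y: "y : Q" "y ~: P" and ys: "set ys <= S" and rel: "int_related P (y # ys)"
 shows "int_related Q ys"
proof -
 note p = prime_inD(2)[OF P] and q = prime_inD(2)[OF Q]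
 have yS: "y : S" using y(1) prime_inD(1)[OF Q] by blast
 obtain N c e0 where c: "eval_ints N (y # ys) c : P" "e0 : exponents N (Suc (length ys))" "of_int (c e0) ~: P"
  using rel unfolding int_related_def by auto
 define bad where "bad i \<longleftrightarrow> i < N & (\<exists>e\<in>exponents N (length ys). of_int (c (i # e)) ~: P)" for i
 have "\<exists>i. bad i"
 proof (cases e0)
  case Nil
  then show ?thesis using c(2) by (simp add: exponents_def)
 next
  case (Cons i e)
  then show ?thesis using c(2,3) unfolding bad_def by (auto simp: exponents_Suc)
 qed
 define i0 where "i0 = (LEAST i. bad i)"
 have "bad i0" unfolding i0_def using `\<exists>i. bad i` by (rule LeastI_ex)
 have not_bad: "\<not> bad i" if "i < i0" for i using that not_less_Least unfolding i0_def by blast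
 obtain e where e: "i0 < N" "e : exponents N (length ys)" "of_int (c (i0 # e)) ~: P" using `bad i0` unfolding bad_def by auto
 define g where "g i = eval_ints N ys (\<lambda>e. c (i # e))" for i
 have gS: "g i : S" for i unfolding g_def by (rule eval_ints_closed[OF S ys])
 have gP: "g i : P" if "i < i0" for i
  unfolding g_def using not_bad[OF that] e(1) that
  by (intro eval_ints_mem_ideal[OF S p ys]) (auto simp: bad_def)
 \<comment> \<open>The terms above \<open>i0\<close>, divided by \<open>y ^ Suc i0\<close>.\<close>
 define w where "w = (\<Sum>i\<in>{Suc i0..<N}. y ^ (i - Suc i0) * g i)"
 have wS: "w : S" unfolding w_def using gS yS by (intro subring_sum[OF S] subringD(4)[OF S] subring_power[OF S])
 have "(\<Sum>i<N. y ^ i * g i) = (\<Sum>i<i0. y ^ i * g i) + (\<Sum>i\<in>{i0..<N}. y ^ i * g i)"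
  using e(1) by (subst sum.union_disjoint[symmetric]) (auto intro!: sum.cong)
 also have "(\<Sum>i\<in>{i0..<N}. y ^ i * g i) = y ^ i0 * g i0 + (\<Sum>i\<in>{Suc i0..<N}. y ^ i * g i)"
  using e(1) by (simp add: sum.atLeast_Suc_lessThan)
 also have "(\<Sum>i\<in>{Suc i0..<N}. y ^ i * g i) = y ^ Suc i0 * w"
  unfolding w_def sum_distrib_left by (intro sum.cong refl) (simp add: power_add[symmetric] mult.assoc[symmetric] flip: power_Suc)
 finally have eq: "(\<Sum>i<N. y ^ i * g i) = (\<Sum>i<i0. y ^ i * g i) + y ^ i0 * (g i0 + y * w)"
  by (simp add: algebra_simps)
 have "(\<Sum>i<i0. y ^ i * g i) : P" using gP yS by (intro submod_sum[OF p] submodD(3)[OF p] subring_power[OF S]) auto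
 moreover have "(\<Sum>i<N. y ^ i * g i) : P" using c(1) by (simp add: g_def)
 ultimately have "y ^ i0 * (g i0 + y * w) : P" unfolding eq using submod_diff[OF S p] by (metis add_diff_cancel_left')
 moreover have "y ^ i0 ~: P" using prime_in_power[OF S P yS] y(2) by blast
 moreover have "g i0 + y * w : S" using gS yS wS by (intro subringD(6)[OF S] subringD(4)[OF S])
 ultimately have "g i0 + y * w : P" using prime_inD(4)[OF P subring_power[OF S yS]] by blast
 then have "g i0 + w * y : Q" using PQ by (auto simp: mult.commute)
 moreover have "w * y : Q" using submodD(3)[OF q wS y(1)] .
 ultimately have "g i0 : Q" using submod_diff[OF S q] by (metis add_diff_cancel_right')
 moreover have "of_int (c (i0 # e)) ~: Q" using e(3) char_eq by blast
 ultimately show ?thesis unfolding int_related_def g_def using e(2) by blast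
qed

text \<open>As no nonzero integer vanishes modulo \<open>P\<close>, the relation can be divided by
  the greatest common divisor of its coefficients. A primitive relation stays nontrivial modulo
  \<open>Q\<close>, even if a prime number lies in \<open>Q\<close>.\<close>

lemma int_related_reduce:
 assumes S: "subring_set S" and P: "prime_in S P" and Q: "prime_in S Q" and PQ: "P <= Q"
  and char0: "!!n. of_int n : P ==> n = 0" and ys: "set ys <= S" and rel: "int_related P ys"
 shows "int_related Q ys"
proof -
 obtain N c e0 where c: "eval_ints N ys c : P" "e0 : exponents N (length ys)" "of_int (c e0) ~: P"
  using rel unfolding int_related_def by auto
 let ?E = "exponents N (length ys)"
 define g where "g = Gcd (c ` ?E)"
 have "c e0 ~= 0" using c(3) submodD(1)[OF prime_inD(2)[OF P]] by auto
 then have g0: "g ~= 0" unfolding g_def using c(2) by auto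
 have gc: "c e = g * (c e div g)" if "e : ?E" for e
  using that unfolding g_def by (metis Gcd_dvd dvd_mult_div_cancel image_eqI)
 have "eval_ints N ys c = of_int g * eval_ints N ys (\<lambda>e. c e div g)"
  unfolding eval_ints_scale[symmetric] by (rule eval_ints_cong) (use gc in auto)
 then have "of_int g * eval_ints N ys (\<lambda>e. c e div g) : P" using c(1) by simp
 moreover have "of_int g ~: P" using char0 g0 by blast
 ultimately have "eval_ints N ys (\<lambda>e. c e div g) : P"
  using prime_inD(4)[OF P subring_of_int[OF S] eval_ints_closed[OF S ys]] by blast
 moreover have "\<exists>e\<in>?E. of_int (c e div g) ~: Q"
 proof (rule ccontr)
  assume "\<not> ?thesis"
  then have "of_int (Gcd ((\<lambda>e. c e div g) ` ?E)) : Q"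
   by (intro Gcd_mem_ideal[OF S prime_inD(2)[OF Q] finite_exponents]) auto
  moreover have "Gcd ((\<lambda>e. c e div g) ` ?E) = 1"
  proof -
   let ?h = "Gcd ((\<lambda>e. c e div g) ` ?E)"
   have "g * ?h dvd c e" if "e : ?E" for e
    by (subst gc[OF that]) (intro mult_dvd_mono dvd_refl Gcd_dvd imageI that)
   then have "g * ?h dvd g" unfolding g_def by (intro Gcd_greatest) (auto simp: g_def[symmetric])
   then have "?h dvd 1" using g0 by (metis dvd_mult_cancel_left mult.right_neutral)
   then show ?thesis by simp
  qed
  ultimately show False using prime_inD(3)[OF Q] by simp
 qed
 ultimately show ?thesis unfolding int_related_def using PQ by blast
qed

lemma not_int_related_Nil: "\<not> int_related P []"
 by (auto simp: int_related_def exponents_def)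

text \<open>Let \<open>k\<close> be such that all lists of length \<open>k\<close> are related
  modulo a member of the chain. Each inclusion lowers \<open>k\<close> by one, except the single one
  at which the residue characteristic becomes positive; there \<open>k\<close> is kept. As the empty
  list is never related, \<open>k\<close> stays positive, so at most \<open>d\<close> inclusions
  fit.\<close>

lemma no_long_prime_chain:
 assumes S: "subring_set S"
  and rel: "!!P ys. prime_in S P ==> length ys = d ==> set ys <= S ==> int_related P ys"
  and P: "!!i. i <= Suc d ==> prime_in S (P i)" "!!i. i < Suc d ==> P i \<subset> P (Suc i)"
 shows False
proof -
 define char0 where "char0 Q \<longleftrightarrow> (\<forall>n. of_int n : Q --> n = 0)" for Q :: "'a set"
 define dep where "dep k Q \<longleftrightarrow> (\<forall>ys. length ys = k --> set ys <= S --> int_related Q ys)" for k Q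
 have not_dep0: "\<not> dep 0 Q" for Q using not_int_related_Nil unfolding dep_def by auto
 \<comment> \<open>If \<open>I\<close> has positive residue characteristic, it contains a prime
   number \<open>p\<close>; an integer in \<open>J\<close> not divisible by \<open>p\<close> would
   then put \<open>1\<close> into \<open>J\<close>.\<close>
 have same_char: "of_int n : I" if I: "prime_in S I" and J: "prime_in S J" "I <= J" and ch: "char0 J \<or> \<not> char0 I" and n: "of_int n : J" for I J n
 proof (cases "char0 J")
  case True
  then show ?thesis using n submodD(1)[OF prime_inD(2)[OF I]] unfolding char0_def by (metis of_int_0)
 next
  case False
  then obtain m where m: "of_int m : I" "m ~= 0" using ch unfolding char0_def by blast
  have "\<exists>p. prime p & of_int p : I"
   using m
  proof (induction "nat \<bar>m\<bar>" arbitrary: m rule: less_induct)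
   case less
   have "\<not> m dvd 1"
   proof
    assume "m dvd 1"
    then have "m = 1 \<or> m = - 1" by auto
    moreover have "- (1 :: 'a) ~: I" using prime_inD(3)[OF I] submod_diff[OF S prime_inD(2)[OF I] submodD(1)[OF prime_inD(2)[OF I]], of "- 1"] by auto
    ultimately show False using less(2) prime_inD(3)[OF I] by auto
   qed
   then obtain p where p: "prime p" "p dvd m" using prime_divisor_exists[of m] less(3) by auto
   then obtain k where k: "m = p * k" by blast
   have "of_int p * of_int k : I" using less(2) by (simp add: k)
   then consider "of_int p : I" | "of_int k : I" using prime_inD(4)[OF I subring_of_int[OF S] subring_of_int[OF S]] by blast
   then show ?case
   proof cases
    case 1
    then show ?thesis using p by blast
   next
    case 2
    have "k ~= 0" using less(3) k by auto
    moreover have "\<bar>k\<bar> < \<bar>m\<bar>" using prime_gt_1_int[OF p(1)] `k ~= 0` unfolding k abs_mult by simp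
    ultimately show ?thesis using less(1)[of k] 2 by auto
   qed
  qed
  then obtain p where p: "prime p" "of_int p : I" by blast
  have "p dvd n"
  proof (rule ccontr)
   assume "\<not> p dvd n"
   then have "gcd p n = 1" using prime_imp_coprime[OF p(1)] by (simp add: coprime_iff_gcd_eq_1)
   moreover have "of_int (gcd p n) : J" using p(2) J(2) n by (intro gcd_mem_ideal[OF S prime_inD(2)[OF J(1)]]) auto
   ultimately show False using prime_inD(3)[OF J(1)] by simp
  qed
  then obtain k where "n = k * p" by (metis dvd_def mult.commute)
  then show ?thesis using submodD(3)[OF prime_inD(2)[OF I] subring_of_int[OF S] p(2)] by simp
 qed
 \<comment> \<open>The summand \<open>1\<close> pays for the one inclusion at which the residue
   characteristic changes.\<close>
 have "\<exists>k. dep k (P i) & k + i <= d + (if char0 (P i) then 0 else 1)" if "i <= Suc d" for i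
  using that
 proof (induction i)
  case 0
  have "dep d (P 0)" unfolding dep_def using rel[OF P(1)] by simp
  then show ?case by (intro exI[of _ d]) simp
 next
  case (Suc i)
  then have i: "i <= Suc d" "i < Suc d" by simp_all
  obtain k where k: "dep k (P i)" "k + i <= d + (if char0 (P i) then 0 else 1)" using Suc(1)[OF i(1)] by blast
  note Pi = P(1)[OF i(1)] and Ps = P(1)[OF Suc(2)]
  have sub: "P i <= P (Suc i)" using P(2)[OF i(2)] by blast
  show ?case
  proof (cases "char0 (P (Suc i)) \<or> \<not> char0 (P i)")
   case True
   obtain l where l: "k = Suc l" using not_dep0 k(1) by (cases k) auto
   obtain y where y: "y : P (Suc i)" "y ~: P i" using P(2)[OF i(2)] by blast
   have "dep l (P (Suc i))" unfolding dep_def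
   proof (intro allI impI)
    fix ys :: "'a list" assume ys: "length ys = l" "set ys <= S"
    have "int_related (P i) (y # ys)" using k(1) ys y(1) prime_inD(1)[OF Ps] unfolding dep_def l by auto
    then show "int_related (P (Suc i)) ys"
     using int_related_step[OF S Pi Ps sub _ y ys(2)] same_char[OF Pi Ps sub True] by blast
   qed
   moreover have "char0 (P (Suc i)) --> char0 (P i)" using sub unfolding char0_def by blast
   ultimately show ?thesis using k(2) True unfolding l by (intro exI[of _ l]) (auto split: if_splits)
  next
   case False
   then have ch: "char0 (P i)" "\<not> char0 (P (Suc i))" by auto
   have "dep k (P (Suc i))" unfolding dep_def
   proof (intro allI impI)
    fix ys :: "'a list" assume ys: "length ys = k" "set ys <= S"
    then have "int_related (P i) ys" using k(1) unfolding dep_def by blast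
    then show "int_related (P (Suc i)) ys"
     using int_related_reduce[OF S Pi Ps sub _ ys(2)] ch(1) unfolding char0_def by blast
   qed
   then show ?thesis using k(2) ch by (intro exI[of _ k]) simp
  qed
 qed
 from this[OF order_refl] obtain k where "dep k (P (Suc d))" "k + Suc d <= d + (if char0 (P (Suc d)) then 0 else 1)" by blast
 then show False using not_dep0 by (cases k) (auto split: if_splits)
qed

subsection \<open>Relations between three polynomials over a number field\<close>

text \<open>One bound for the degrees in both variables separately; it is additive under
  products.\<close>

definition bounded_degree :: "nat => 'a :: comm_ring_1 poly poly => bool" where
 "bounded_degree n f \<longleftrightarrow> degree f <= n & (\<forall>j. degree (coeff f j) <= n)"

lemma bounded_degree_exists: "\<exists>n. bounded_degree n f"
proof -
 have "degree (coeff f j) <= (\<Sum>i\<le>degree f. degree (coeff f i))" for j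
 proof (cases "j <= degree f")
  case True
  then show ?thesis using member_le_sum[of j "{..degree f}" "\<lambda>i. degree (coeff f i)"] by simp
 qed (simp add: coeff_eq_0)
 then show ?thesis unfolding bounded_degree_def
  by (intro exI[of _ "degree f + (\<Sum>i\<le>degree f. degree (coeff f i))"]) (auto intro: trans_le_add2)
qed

lemma bounded_degree_mono: "bounded_degree n f ==> n <= m ==> bounded_degree m f"
 unfolding bounded_degree_def by (meson order_trans)

lemma bounded_degree_mult:
 assumes "bounded_degree n f" "bounded_degree m g"
 shows "bounded_degree (n + m) (f * g)"
proof -
 have "degree (coeff (f * g) j) <= n + m" for j
  unfolding coeff_mult
 proof (intro degree_sum_le)
  fix i assume "i : {..j}"
  show "degree (coeff f i * coeff g (j - i)) <= n + m"
   using assms order_trans[OF degree_mult_le add_mono] unfolding bounded_degree_def by blast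
 qed simp
 moreover have "degree (f * g) <= n + m"
  using assms order_trans[OF degree_mult_le add_mono] unfolding bounded_degree_def by blast
 ultimately show ?thesis unfolding bounded_degree_def by blast
qed

lemma bounded_degree_power: "bounded_degree n f ==> bounded_degree (k * n) (f ^ k)"
proof (induction k)
 case 0
 then show ?case by (auto simp: bounded_degree_def one_pCons coeff_pCons split: nat.split)
next
 case (Suc k)
 then show ?case using bounded_degree_mult[of n f "k * n" "f ^ k"] by simp
qed

text \<open>The \<open>N^3\<close> monomials in \<open>y1\<close>, \<open>y2\<close>,
  \<open>y3\<close> with exponents below \<open>N\<close> lie in a rational vector space whose
  dimension grows only like \<open>N^2\<close>, because there are two variables and the number field
  has finite degree.\<close>

lemma three_polys_related:
 fixes y1 y2 y3 :: "'k :: field_char_0 poly poly"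
 assumes K: "number_field TYPE('k)" and S: "subring_set S" and P: "prime_in S P"
 shows "int_related P [y1, y2, y3]"
proof -
 obtain B :: "'k set" where B: "finite B" "module.span (\<lambda>q x. of_rat q * x) B = UNIV"
  using K unfolding number_field_def by blast
 obtain n1 n2 n3 where n: "bounded_degree n1 y1" "bounded_degree n2 y2" "bounded_degree n3 y3"
  using bounded_degree_exists by blast
 define n where "n = n1 + n2 + n3"
 \<comment> \<open>Chosen so that \<open>card B * (3 * n + 1)^2 * N^2 < N^3\<close>. The degrees of
   the monomials are at most \<open>3 * n * N\<close>, and
   \<open>3 * n * N + 1 <= (3 * n + 1) * N\<close>.\<close>
 define N where "N = Suc (card B * (3 * n + 1)\<^sup>2)"
 define I where "I = {..<N} \<times> {..<N} \<times> {..<N}"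
 define f where "f = (\<lambda>(i, j, k). y1 ^ i * y2 ^ j * y3 ^ k)"
 define scale :: "rat => 'k poly poly => 'k poly poly" where "scale q x = cc (of_rat q) * x" for q x
 interpret V: vector_space scale
  by unfold_locales (auto simp: scale_def algebra_simps of_rat_add of_rat_mult cc.hom_add cc.hom_mult)
 interpret K: vector_space "\<lambda>(q :: rat) (x :: 'k). of_rat q * x" by (rule vector_space_of_rat)
 define m where "m = 3 * n * N"
 define B' where "B' = (\<lambda>(b, i, j). cc b * var_X ^ i * var_Y ^ j) ` (B \<times> {..m} \<times> {..m})"
 have "card B' <= card (B \<times> {..m} \<times> {..m})" unfolding B'_def using B(1) by (intro card_image_le) auto
 also have "\<dots> = card B * (m + 1)\<^sup>2" by (simp add: card_cartesian_product power2_eq_square)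
 also have "\<dots> <= card B * ((3 * n + 1) * N)\<^sup>2"
 proof -
  have "m + 1 <= (3 * n + 1) * N" unfolding m_def N_def by simp
  then show ?thesis by (intro mult_le_mono2 power_mono) auto
 qed
 also have "\<dots> = (card B * (3 * n + 1)\<^sup>2) * N\<^sup>2" by (simp only: power_mult_distrib mult.assoc)
 also have "\<dots> < N * N\<^sup>2" by (intro mult_strict_right_mono) (auto simp: N_def)
 also have "\<dots> = card I" by (simp add: I_def card_cartesian_product power2_eq_square)
 finally have card: "card B' < card I" .
 have B'fin: "finite B'" unfolding B'_def using B(1) by auto
 have mon: "cc c * var_X ^ i * var_Y ^ j : V.span B'" if "i <= m" "j <= m" for c i j
 proof -
  have "K.subspace {c. cc c * var_X ^ i * var_Y ^ j : V.span B'}"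
  proof (rule K.subspaceI)
   show "0 : {c. cc c * var_X ^ i * var_Y ^ j : V.span B'}" using V.span_zero by simp
   show "x + y : {c. cc c * var_X ^ i * var_Y ^ j : V.span B'}"
    if "x : {c. cc c * var_X ^ i * var_Y ^ j : V.span B'}" "y : {c. cc c * var_X ^ i * var_Y ^ j : V.span B'}" for x y
    using V.span_add that by (simp add: cc.hom_add distrib_right)
   show "of_rat q * x : {c. cc c * var_X ^ i * var_Y ^ j : V.span B'}"
    if "x : {c. cc c * var_X ^ i * var_Y ^ j : V.span B'}" for q x
    using V.span_scale[of _ B' q] that by (simp add: scale_def cc.hom_mult mult.assoc)
  qed
  moreover have "B <= {c. cc c * var_X ^ i * var_Y ^ j : V.span B'}"
  proof
   fix b assume "b : B"
   then have "cc b * var_X ^ i * var_Y ^ j : B'" unfolding B'_def using that by (intro image_eqI[of _ _ "(b, i, j)"]) auto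
   then show "b : {c. cc c * var_X ^ i * var_Y ^ j : V.span B'}" using V.span_base by simp
  qed
  ultimately have "K.span B <= {c. cc c * var_X ^ i * var_Y ^ j : V.span B'}" by (intro K.span_minimal)
  then show ?thesis using B(2) by auto
 qed
 have "f t : V.span B'" if "t : I" for t
 proof -
  obtain i j k where t: "t = (i, j, k)" "i < N" "j < N" "k < N" using `t : I` unfolding I_def by auto
  have "bounded_degree (i * n1 + j * n2 + k * n3) (f t)"
   unfolding t(1) f_def using n by (auto intro!: bounded_degree_mult bounded_degree_power)
  moreover have "i * n1 + j * n2 + k * n3 <= m"
  proof -
   have "i * n1 <= N * n" "j * n2 <= N * n" "k * n3 <= N * n" using t by (auto intro!: mult_le_mono simp: n_def)
   then show ?thesis by (simp add: m_def mult_ac)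
  qed
  ultimately have bd: "bounded_degree m (f t)" by (rule bounded_degree_mono)
  show ?thesis
   by (subst poly2_expand, intro V.span_sum mon) (use bd in "auto simp: bounded_degree_def intro: order_trans")
 qed
 then have "f ` I <= V.span B'" by auto
 moreover have "scale (of_int z) x = of_int z * x" for z x by (simp add: scale_def cc.hom_of_int)
 moreover have "finite I" by (simp add: I_def)
 ultimately obtain c where c: "\<forall>p. prime p --> (\<exists>i\<in>I. \<not> p dvd c i)" "(\<Sum>i\<in>I. of_int (c i) * f i) = 0"
  using primitive_integer_relation[OF V.vector_space_axioms, of I B' f] B'fin card by auto
 define c' where "c' e = c (e ! 0, e ! 1, e ! 2)" for e
 have "eval_ints N [y1, y2, y3] c' = (\<Sum>i<N. \<Sum>j<N. \<Sum>k<N. of_int (c (i, j, k)) * f (i, j, k))"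
  by (simp add: c'_def f_def sum_distrib_left mult_ac)
 also have "\<dots> = (\<Sum>t\<in>I. of_int (c t) * f t)" unfolding I_def by (simp add: sum.cartesian_product split_beta)
 finally have ev: "eval_ints N [y1, y2, y3] c' = 0" using c(2) by simp
 have "\<exists>t\<in>I. of_int (c t) ~: P"
 proof (rule ccontr)
  assume "\<not> ?thesis"
  then have mem: "of_int (Gcd (c ` I)) : P"
   by (intro Gcd_mem_ideal[OF S prime_inD(2)[OF P] `finite I`]) auto
  have no: "\<not> p dvd Gcd (c ` I)" if "prime p" for p
   using c(1) that by (meson Gcd_dvd dvd_trans imageI)
  have "\<not> 2 dvd Gcd (c ` I)" by (rule no) simp
  then have "Gcd (c ` I) ~= 0" by (metis dvd_0_right)
  then have "Gcd (c ` I) dvd 1" using prime_divisor_exists no by blast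
  then have "Gcd (c ` I) = 1" by simp
  then show False using mem prime_inD(3)[OF P] by simp
 qed
 then obtain i j k where ijk: "(i, j, k) : I" "of_int (c (i, j, k)) ~: P" by auto
 then have "[i, j, k] : exponents N 3" "of_int (c' [i, j, k]) ~: P" by (auto simp: exponents_def I_def c'_def)
 moreover have "eval_ints N [y1, y2, y3] c' : P" using ev submodD(1)[OF prime_inD(2)[OF P]] by simp
 ultimately show ?thesis unfolding int_related_def by (intro exI[of _ N] exI[of _ c'] conjI bexI[of _ "[i, j, k]"]) (simp_all add: numeral_3_eq_3)
qed

lemma no_prime_chain_of_length_4:
 fixes S :: "'k :: field_char_0 poly poly set"
 assumes "number_field TYPE('k)" "subring_set S"
  and "!!i. i <= 4 ==> prime_in S (P i)" "!!i. i < 4 ==> P i \<subset> P (Suc i)"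
 shows False
proof (rule no_long_prime_chain[OF assms(2), of 3 P])
 fix Q and ys :: "'k poly poly list" assume "prime_in S Q" "length ys = 3"
 then show "int_related Q ys"
  using three_polys_related[OF assms(1,2)] by (auto simp: numeral_3_eq_3 length_Suc_conv)
next
 show "prime_in S (P i)" if "i <= Suc 3" for i by (rule assms(3)) (use that in simp)
 show "P i \<subset> P (Suc i)" if "i < Suc 3" for i by (rule assms(4)) (use that in simp)
qed

section \<open>Transitivity of integrality\<close>

lemma finite_extension_adjoin:
 assumes D: "subring_set D" and E: "subring_set E" "D <= E" "finite B" "E = lspan D B"
  and x: "integral_over E x"
 shows "\<exists>E' B'. subring_set E' & E <= E' & x : E' & finite B' & E' = lspan D B'"
proof -
 obtain p where p: "p : polys_over E" "lead_coeff p = 1" "poly p x = 0" using x unfolding integral_over_def by blast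
 let ?E = "{poly q x | q. q : polys_over E}"
 have E': "subring_set ?E" by (rule subring_adjoin[OF E(1)])
 define B' where "B' = (\<lambda>(i, b). x ^ i * b) ` ({..<degree p} \<times> B)"
 have fin: "finite B'" unfolding B'_def using E(3) by auto
 note N = submod_lspan[OF D, of B']
 have NE: "submod E (lspan D B')" unfolding submod_def
 proof (intro conjI ballI)
  show "0 : lspan D B'" "!!x y. x : lspan D B' ==> y : lspan D B' ==> x + y : lspan D B'" using submodD[OF N] by auto
  fix e y assume e: "e : E" and y: "y : lspan D B'"
  show "e * y : lspan D B'"
  proof (rule lspan_mult[OF N _ y])
   fix v assume "v : B'"
   then obtain i b where v: "v = x ^ i * b" "i < degree p" "b : B" unfolding B'_def by auto
   have "b : E" using E lspan_base[OF D E(3) v(3)] by simp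
   then have eb: "e * b : lspan D B" using e subringD(4)[OF E(1)] E(4) by simp
   have "x ^ i * (e * b) : lspan D B'"
   proof (rule lspan_mult[OF N _ eb])
    fix w assume "w : B"
    then show "x ^ i * w : lspan D B'" using v(2) by (intro lspan_base[OF D fin]) (auto simp: B'_def)
   qed
   then show "e * v : lspan D B'" by (simp add: v(1) mult.left_commute)
  qed
 qed
 have 1: "x ^ i * b : lspan D B'" if "i < degree p" "b : E" for i b
 proof -
  have b: "b : lspan D B" using that(2) E(4) by simp
  show ?thesis
  proof (rule lspan_mult[OF N _ b])
   fix w assume "w : B"
   then show "x ^ i * w : lspan D B'" using that(1) by (intro lspan_base[OF D fin]) (auto simp: B'_def)
  qed
 qed
 have 2: "x ^ k : lspan D B'" for k
  using integral_power_in_submod[OF E(1) NE p, of 1 k] 1[OF _ subringD(1)[OF E(1)]] by simp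
 have "?E <= lspan D B'" using poly_in_submod[OF NE _ 2] by auto
 moreover have EE': "E <= ?E"
 proof
  fix e assume "e : E"
  then show "e : ?E" using const_polys_over[OF E(1)] by (intro CollectI exI[of _ "[:e:]"]) auto
 qed
 moreover have xE': "x : ?E"
  using subringD[OF E(1)] by (intro CollectI exI[of _ "[:0, 1:]"]) (auto simp: pCons_polys_over[OF E(1)] subringD[OF subring_polys_over[OF E(1)]])
 moreover have "lspan D B' <= ?E"
 proof (rule lspan_minimal[OF submod_mono[OF submod_self[OF E']]])
  show "D <= ?E" using EE' E(2) by (rule subset_trans[rotated])
  have "B <= ?E" using EE' E(4) lspan_base[OF D E(3)] by auto
  show "B' <= ?E"
  proof
   fix v assume "v : B'"
   then obtain i b where v: "v = x ^ i * b" "b : B" unfolding B'_def by auto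
   have "b : ?E" using `B <= ?E` v(2) by (rule subsetD)
   then show "v : ?E" unfolding v(1) by (rule subringD(4)[OF E' subring_power[OF E' xE']])
  qed
 qed
 ultimately show ?thesis using E' fin by (intro exI[of _ ?E] exI[of _ B']) auto
qed

text \<open>Adjoining the coefficients of the equation of \<open>x\<close> one after another, and
  then \<open>x\<close> itself, keeps the ring a finite \<open>D\<close>-module, so
  \<open>integral_if_stable\<close> applies to \<open>x\<close>.\<close>

lemma integral_over_trans:
 fixes D :: "'a :: idom set"
 assumes D: "subring_set D" and x: "integral_over {y. integral_over D y} x"
 shows "integral_over D x"
proof -
 obtain p where p: "p : polys_over {y. integral_over D y}" "lead_coeff p = 1" "poly p x = 0" using x unfolding integral_over_def by blast
 have "\<exists>E B. subring_set E & D <= E & (\<forall>i<n. coeff p i : E) & finite B & E = lspan D B" for n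
 proof (induction n)
  case 0
  have "D <= lspan D {1}"
  proof
   fix d assume "d : D"
   from submodD(3)[OF submod_lspan[OF D] this lspan_base[OF D, of "{1}" 1]] show "d : lspan D {1}" by simp
  qed
  moreover have "lspan D {1} <= D" by (rule lspan_minimal[OF submod_self[OF D]]) (use subringD[OF D] in auto)
  ultimately have "D = lspan D {1}" by (rule equalityI)
  then show ?case by (intro exI[of _ D] exI[of _ "{1}"] conjI D order_refl) simp_all
 next
  case (Suc n)
  obtain E B where E: "subring_set E" "D <= E" "\<forall>i<n. coeff p i : E" "finite B" "E = lspan D B"
   using Suc by (elim exE conjE)
  have "integral_over E (coeff p n)" using integral_over_mono[OF _ E(2)] polys_overD[OF p(1), of n] by simp
  from finite_extension_adjoin[OF D E(1,2,4,5) this]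
  obtain E' B' where E': "subring_set E'" "E <= E'" "coeff p n : E'" "finite B'" "E' = lspan D B'" by (elim exE conjE)
  have "\<forall>i<Suc n. coeff p i : E'" using E(3) E'(2,3) by (auto simp: less_Suc_eq)
  then show ?case using E' E(2) by (intro exI[of _ E'] exI[of _ B']) auto
 qed
 from this[of "Suc (degree p)"] obtain E B where E: "subring_set E" "D <= E" "\<forall>i<Suc (degree p). coeff p i : E" "finite B" "E = lspan D B"
  by (elim exE conjE)
 have "coeff p i : E" for i
  using E(3) subringD(2)[OF E(1)] by (cases "i < Suc (degree p)") (auto simp: coeff_eq_0)
 then have "integral_over E x" using p by (intro integral_overI) (auto simp: polys_over_def)
 from finite_extension_adjoin[OF D E(1,2,4,5) this]
 obtain E' B' where E': "subring_set E'" "x : E'" "finite B'" "E' = lspan D B'" by (elim exE conjE)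
 have "1 : lspan D (insert 1 B')" using lspan_base[OF D, of "insert 1 B'"] E'(3) by simp
 have B'E': "v : E'" if "v : insert 1 B'" for v
  using that lspan_base[OF D E'(3)] E'(4) subringD(1)[OF E'(1)] by auto
 show ?thesis
 proof (rule integral_if_stable[OF D])
  \<comment> \<open>\<open>1\<close> is added to the generators because
    \<open>integral_if_stable\<close> asks for a nonzero one.\<close>
  show "finite (insert 1 B')" "1 : insert 1 B'" "(1 :: 'a) ~= 0" using E'(3) by auto
  fix v assume "v : insert 1 B'"
  then have "x * v : lspan D B'" using B'E' E'(2) subringD(4)[OF E'(1)] E'(4) by simp
  then show "x * v : lspan D (insert 1 B')" using lspan_mono[OF D order_refl, of "insert 1 B'" B'] E'(3) by auto
 qed
qed

lemma algebraic_int_integral_closed: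
 fixes x :: "'a :: field"
 assumes "integral_over {y. algebraic_int y} x"
 shows "algebraic_int x"
 using integral_over_trans[OF subring_Ints] assms by (simp add: algebraic_int_iff_integral)

section \<open>Valuation rings\<close>

text \<open>For two polynomials with coefficients outside \<open>N\<close>, the product of the first
  such coefficients is, modulo \<open>N\<close>, the only contribution to the corresponding
  coefficient of the product.\<close>

lemma prime_in_polys_over:
 assumes D: "subring_set D" and N: "prime_in D N"
 shows "prime_in (polys_over D) (polys_over N)"
proof -
 note n = prime_inD(2)[OF N]
 have "polys_over N <= polys_over D" using prime_inD(1)[OF N] unfolding polys_over_def by auto
 moreover have "submod (polys_over D) (polys_over N)" unfolding submod_def
 proof (intro conjI ballI)
  show "0 : polys_over N" using submodD(1)[OF n] by (auto simp: polys_over_def)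
  show "x + y : polys_over N" if "x : polys_over N" "y : polys_over N" for x y
   using that submodD(2)[OF n] by (auto simp: polys_over_def)
  show "d * x : polys_over N" if "d : polys_over D" "x : polys_over N" for d x
   using that by (auto simp: polys_over_def coeff_mult intro!: submod_sum[OF n] submodD(3)[OF n])
 qed
 moreover have "1 ~: polys_over N" using prime_inD(3)[OF N] polys_overD[of 1 N 0] by auto
 moreover have "f : polys_over N \<or> g : polys_over N" if fg: "f : polys_over D" "g : polys_over D" "f * g : polys_over N" for f g
 proof (rule ccontr)
  assume no: "\<not> ?thesis"
  then have "\<exists>i. coeff f i ~: N" "\<exists>j. coeff g j ~: N" by (auto simp: polys_over_def)
  then obtain i j where i: "coeff f i ~: N" and i': "\<forall>k<i. \<not> coeff f k ~: N"
   and j: "coeff g j ~: N" and j': "\<forall>k<j. \<not> coeff g k ~: N"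
   unfolding exists_least_iff[of "\<lambda>i. coeff _ i ~: N"] by (elim exE conjE)
  have fD: "coeff f k : D" and gD: "coeff g k : D" for k using fg polys_overD by auto
  have "coeff (f * g) (i + j) = coeff f i * coeff g j + (\<Sum>k\<in>{..i + j} - {i}. coeff f k * coeff g (i + j - k))"
   unfolding coeff_mult by (subst sum.remove[of _ i]) auto
  moreover have "(\<Sum>k\<in>{..i + j} - {i}. coeff f k * coeff g (i + j - k)) : N"
  proof (rule submod_sum[OF n])
   fix k assume k: "k : {..i + j} - {i}"
   show "coeff f k * coeff g (i + j - k) : N"
   proof (cases "k < i")
    case True
    then have "coeff f k : N" using i' by simp
     then show ?thesis using submodD(3)[OF n gD] by (simp add: mult.commute)
   next
    case False
    then have "i + j - k < j" using k by auto
    then have "coeff g (i + j - k) : N" using j' by simp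
     then show ?thesis by (rule submodD(3)[OF n fD])
   qed
  qed
  moreover have "coeff (f * g) (i + j) : N" using fg(3) polys_overD by blast
  ultimately have "coeff f i * coeff g j : N" using submod_diff[OF D n] by (metis add_diff_cancel_right')
  then show False using prime_inD(4)[OF N fD gD] i j by blast
 qed
 ultimately show ?thesis unfolding prime_in_def ideal_in_def by blast
qed

locale valuation_subring =
 fixes V :: "'a :: field set"
 assumes V: "subring_set V" and val: "x : V \<or> inverse x : V"
begin

text \<open>The maximal ideal of the valuation ring. Zero is listed separately because its inverse
  is \<open>0\<close> by convention and so lies in \<open>V\<close>.\<close>

definition mV where "mV = {x : V. inverse x ~: V \<or> x = 0}"

lemma not_mV: "x : V ==> x ~: mV ==> x ~= 0 & inverse x : V"
 by (auto simp: mV_def)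

lemma mV_mult:
 assumes "x : V" "y : mV"
 shows "x * y : mV"
proof (rule ccontr)
 assume no: "x * y ~: mV"
 have xy: "x * y : V" using assms subringD(4)[OF V] by (simp add: mV_def)
 from not_mV[OF xy no] have "x * y ~= 0" "inverse (x * y) : V" by auto
 then have "x * inverse (x * y) : V" "y ~= 0" "x ~= 0" using assms(1) subringD(4)[OF V] by auto
 then have "inverse y : V" by (simp add: inverse_mult_distrib mult.assoc[symmetric])
 then show False using assms(2) `y ~= 0` by (simp add: mV_def)
qed

lemma div_V_cases: "x / y : V \<or> y / x : V"
 using val[of "x / y"] by (simp add: inverse_divide)

lemma prime_mV: "prime_in V mV"
proof -
 have add': "x + y : mV" if "x : mV" "y : mV" "x / y : V" for x y
 proof (cases "y = 0")
  case False
  then have "x + y = (1 + x / y) * y" by (simp add: field_simps)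
  then show ?thesis using that mV_mult[of "1 + x / y" y] subringD(1,6)[OF V] by simp
 qed (use that in simp)
 have "submod V mV" unfolding submod_def
 proof (intro conjI ballI)
  show "0 : mV" using subringD(2)[OF V] by (simp add: mV_def)
  show "x + y : mV" if "x : mV" "y : mV" for x y
   using div_V_cases[of x y] add'[of x y] add'[of y x] that by (auto simp: add.commute)
 qed (rule mV_mult)
 moreover have "1 ~: mV" using subringD(1)[OF V] by (simp add: mV_def)
 moreover have "x : mV \<or> y : mV" if "x : V" "y : V" "x * y : mV" for x y
 proof (rule ccontr)
  assume "\<not> ?thesis"
  then have "x ~= 0" "y ~= 0" "inverse x * inverse y : V" using not_mV that subringD(4)[OF V] by auto
  then show False using that(3) by (auto simp: mV_def inverse_mult_distrib)
 qed
 ultimately show ?thesis unfolding prime_in_def ideal_in_def by (auto simp: mV_def)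
qed

text \<open>Of two elements of the field one divides the other over \<open>V\<close>, so finitely
  many elements, not all zero, include one that divides all of them.\<close>

lemma exists_max_divisor:
 assumes "finite E" "e0 : E" "e0 ~= 0"
 shows "\<exists>d\<in>E. d ~= 0 & (\<forall>x\<in>E. x / d : V)"
proof -
 have "finite E ==> E ~= {} ==> 0 ~: E ==> \<exists>d\<in>E. \<forall>x\<in>E. x / d : V" for E
 proof (induction E rule: finite_ne_induct)
  case (singleton x)
  then show ?case using subringD(1)[OF V] by auto
 next
  case (insert y E)
  then obtain d where d: "d : E" "!!x. x : E ==> x / d : V" by auto
  have nz: "d ~= 0" "y ~= 0" using insert d(1) by auto
  show ?case
  proof (cases "y / d : V")
   case True
   then show ?thesis using d by (intro bexI[of _ d]) auto
  next
   case False
   then have dy: "d / y : V" using div_V_cases by blast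
   have "x / y : V" if "x : E" for x
    using subringD(4)[OF V d(2)[OF that] dy] nz by simp
   then show ?thesis using nz subringD(1)[OF V] by (intro bexI[of _ y]) auto
  qed
 qed
 from this[of "E - {0}"] obtain d where d: "d : E - {0}" "!!x. x : E - {0} ==> x / d : V" using assms by auto
 have "x / d : V" if "x : E" for x using d(2)[of x] that subringD(2)[OF V] by (cases "x = 0") auto
 then show ?thesis using d(1) by auto
qed

text \<open>Some coefficient is a unit of \<open>V\<close>. In this form products of primitive
  polynomials are primitive simply because \<open>polys2 mV\<close> is prime.\<close>

definition primitive :: "'a poly poly => bool" where
 "primitive f \<longleftrightarrow> f : polys2 V & f ~: polys2 mV"

lemma prime_polys2: "prime_in (polys2 V) (polys2 mV)"
 by (intro prime_in_polys_over prime_mV V subring_polys_over)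

lemma primitive_mult: "primitive f ==> primitive g ==> primitive (f * g)"
 using prime_inD(4)[OF prime_polys2] subringD(4)[OF subring_polys2[OF V]] unfolding primitive_def by blast

lemma primitive_prod: "(!!i. i : I ==> primitive (f i)) ==> primitive (prod f I)"
proof (induction I rule: infinite_finite_induct)
 case empty
 then show ?case using prime_inD(3)[OF prime_polys2] subringD(1)[OF subring_polys2[OF V]] by (simp add: primitive_def)
next
 case (infinite A)
 then show ?case using prime_inD(3)[OF prime_polys2] subringD(1)[OF subring_polys2[OF V]] by (simp add: primitive_def)
qed (simp add: primitive_mult)

lemma primitiveI: "f : polys2 V ==> coeff (coeff f j) i = 1 ==> primitive f"
 using prime_inD(3)[OF prime_mV] unfolding primitive_def polys2_iff by metis

lemma exists_primitive_multiple:
 assumes "f ~= 0"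
 shows "\<exists>c. c ~= 0 & primitive (cc c * f)"
proof -
 define E where "E = (\<lambda>(j, i). coeff (coeff f j) i) ` (SIGMA j:{..degree f}. {..degree (coeff f j)})"
 have E0: "coeff (coeff f j) i : E \<or> coeff (coeff f j) i = 0" for i j
 proof (cases "j <= degree f & i <= degree (coeff f j)")
  case True
  then show ?thesis unfolding E_def by (intro disjI1 image_eqI[of _ _ "(j, i)"]) auto
 qed (auto simp: coeff_eq_0)
 have "finite E" by (simp add: E_def)
 moreover obtain j i where "coeff (coeff f j) i ~= 0" using assms by (metis leading_coeff_0_iff)
 then have "coeff (coeff f j) i : E" "coeff (coeff f j) i ~= 0" using E0[of j i] by auto
 ultimately obtain d where d: "d : E" "d ~= 0" "\<forall>x\<in>E. x / d : V" using exists_max_divisor by blast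
 have "cc (1 / d) * f : polys2 V" unfolding polys2_iff
 proof (intro allI)
  fix i j
  show "coeff (coeff (cc (1 / d) * f) j) i : V"
   using E0[of j i] d(3) subringD(2)[OF V] by auto
 qed
 moreover obtain j' i' where "d = coeff (coeff f j') i'" using d(1) unfolding E_def by auto
 then have "coeff (coeff (cc (1 / d) * f) j') i' = 1" using d(2) by simp
 ultimately have "primitive (cc (1 / d) * f)" by (rule primitiveI)
 then show ?thesis using d(2) by (intro exI[of _ "1 / d"]) simp
qed

text \<open>Scale \<open>k\<close> by \<open>c\<close> to a primitive polynomial. If
  \<open>c\<close> were in \<open>mV\<close>, the primitive product of \<open>h\<close> and
  \<open>c k\<close> would be \<open>c\<close> times an integral polynomial and vanish modulo
  \<open>mV\<close>. So \<open>1 / c\<close> is integral, and \<open>k\<close> is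
  \<open>1 / c\<close> times the primitive polynomial.\<close>

lemma gauss_lemma:
 assumes h: "primitive h" and hk: "h * k : polys2 V"
 shows "k : polys2 V"
proof (cases "k = 0")
 case True
 then show ?thesis using subringD(2)[OF subring_polys2[OF V]] by simp
next
 case False
 then obtain c where c: "c ~= 0" "primitive (cc c * k)" using exists_primitive_multiple by blast
 show ?thesis
 proof (cases "inverse c : V")
  case True
  then have "cc (inverse c) : polys2 V" by (simp add: cc_polys2[OF V])
  moreover have "cc c * k : polys2 V" using c(2) by (simp only: primitive_def)
  ultimately have "cc (inverse c) * (cc c * k) : polys2 V" by (rule subringD(4)[OF subring_polys2[OF V]])
  then show ?thesis using c(1) by (simp add: mult.assoc[symmetric] cc.hom_mult[symmetric])
 next
  case False
  then have "c : mV" using val by (auto simp: mV_def)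
  have "c * x : mV" if "x : V" for x using mV_mult[OF that `c : mV`] by (simp add: mult.commute)
  then have "cc c * (h * k) : polys2 mV" using hk unfolding polys2_iff coeff_cc_mult by auto
  moreover have "primitive (h * (cc c * k))" using primitive_mult[OF h c(2)] .
  ultimately show ?thesis by (simp add: primitive_def mult.left_commute)
 qed
qed

end

section \<open>Localizations of rings of algebraic integers\<close>

lemma integer_relation_if_algebraic:
 fixes x :: "'a :: field_char_0"
 assumes m: "m ~= (0 :: int)" "algebraic_int (of_int m * x)"
 shows "\<exists>p :: int poly. content p = 1 & poly (of_int_poly p) x = 0"
proof -
 obtain p where p: "poly (map_poly of_int p) (of_int m * x) = 0" "lead_coeff p = 1"
  using m(2) unfolding algebraic_int_altdef_ipoly by blast
 define q where "q = pcompose p [:0, m:]"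
 have "poly (of_int_poly q) x = 0"
  using p(1) by (simp add: q_def poly_pcompose of_int_hom.map_poly_pcompose mult.commute Polynomial.map_poly_pCons)
 moreover have "p ~= 0" using p(2) by (metis leading_coeff_0_iff zero_neq_one)
 then have "q ~= 0" unfolding q_def using m(1) by (simp add: pcompose_eq_0_iff)
 moreover have "of_int_poly q = smult (of_int (content q)) (of_int_poly (primitive_part q) :: 'a poly)"
  by (metis content_times_primitive_part of_int_hom.map_poly_hom_smult)
 ultimately show ?thesis
  by (intro exI[of _ "primitive_part q"]) (simp add: content_primitive_part)
qed

text \<open>The elements \<open>b\<close> are the Horner sums of an integer polynomial of content 1 vanishing at \<open>x\<close>.\<close>

lemma exists_integral_denominator:
 fixes x :: "'a :: field_char_0"
 defines "A \<equiv> {x :: 'a. algebraic_int x}"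
 assumes m: "m ~= (0 :: int)" "algebraic_int (of_int m * x)" and Q: "prime_in A Q"
 shows "\<exists>b\<in>A. b * x : A & (b ~: Q \<or> b * x ~: Q)"
proof (rule ccontr)
 assume no: "\<not> ?thesis"
 note A = subring_algebraic_ints[where ?'a = 'a, folded A_def]
 note q = prime_inD(2)[OF Q]
 obtain p where p: "content p = 1" "poly (of_int_poly p) x = 0" using integer_relation_if_algebraic[OF m] by blast
 define n where "n = degree p"
 define a where "a i = (of_int (coeff p i) :: 'a)" for i
 have aA: "a i : A" for i unfolding a_def by (rule subring_of_int[OF A])
 have rel: "(\<Sum>i\<le>n. a i * x ^ i) = 0" using p(2) by (simp add: poly_altdef a_def n_def)
 define b where "b j = (\<Sum>i\<in>{j..n}. a i * x ^ (i - j))" for j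
 have b_step: "b j = a j + b (Suc j) * x" if "j <= n" for j
 proof -
  have "b j = a j + (\<Sum>i\<in>{Suc j..n}. a i * x ^ (i - j))" unfolding b_def using that by (simp add: sum.atLeast_Suc_atMost)
  also have "(\<Sum>i\<in>{Suc j..n}. a i * x ^ (i - j)) = b (Suc j) * x"
   unfolding b_def sum_distrib_right by (intro sum.cong refl) (simp add: mult.assoc flip: power_Suc2 Suc_diff_Suc)
  finally show ?thesis .
 qed
 have bx: "b j * x : A" if bj: "b j : A" and j0: "0 < j" and jn: "j <= Suc n" for j
 proof -
  \<comment> \<open>This arises by multiplying the equation of \<open>x\<close> by
    \<open>b j ^ (j - 1)\<close>: its terms of index at least \<open>j\<close> combine to
    \<open>b j * x ^ j\<close>, so the result is monic in \<open>b j * x\<close>.\<close>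
  define r where "r = monom 1 j + (\<Sum>i<j. monom (a i * b j ^ (j - Suc i)) i)"
  have r: "r : polys_over A" unfolding r_def
   by (intro subringD(6) subring_sum subring_polys_over monom_polys_over A subringD(1)[OF A] subringD(4)[OF A] aA subring_power[OF A] bj)
  have cr: "coeff r i = (if i = j then 1 else if i < j then a i * b j ^ (j - Suc i) else 0)" for i
   unfolding r_def by (simp add: coeff_sum)
  have "degree r = j"
   by (rule antisym[OF degree_le le_degree]) (auto simp: cr)
  then have "lead_coeff r = 1" by (simp add: cr)
  moreover have "poly r (b j * x) = 0"
  proof -
   have split: "(\<Sum>i\<le>n. a i * x ^ i) = (\<Sum>i<j. a i * x ^ i) + b j * x ^ j"
   proof -
    have "(\<Sum>i\<le>n. a i * x ^ i) = (\<Sum>i<j. a i * x ^ i) + (\<Sum>i\<in>{j..n}. a i * x ^ i)"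
     using jn by (subst sum.union_disjoint[symmetric]) (auto intro!: sum.cong)
    also have "(\<Sum>i\<in>{j..n}. a i * x ^ i) = b j * x ^ j"
     unfolding b_def sum_distrib_right by (intro sum.cong refl) (simp add: power_add[symmetric] mult.assoc)
    finally show ?thesis .
   qed
   obtain k where k: "j = Suc k" using j0 by (cases j) auto
   have "poly r (b j * x) = b j ^ k * (b j * x ^ j) + (\<Sum>i<j. a i * b j ^ (j - Suc i) * (b j * x) ^ i)"
    unfolding r_def by (simp add: poly_sum poly_monom power_mult_distrib k)
   also have "(\<Sum>i<j. a i * b j ^ (j - Suc i) * (b j * x) ^ i) = b j ^ k * (\<Sum>i<j. a i * x ^ i)"
    unfolding sum_distrib_left
   proof (intro sum.cong refl)
    fix i assume "i : {..<j}"
    then have "b j ^ k = b j ^ (j - Suc i) * b j ^ i" by (simp add: k power_add[symmetric])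
    then show "a i * b j ^ (j - Suc i) * (b j * x) ^ i = b j ^ k * (a i * x ^ i)" by (simp add: power_mult_distrib mult_ac)
   qed
   also have "b j ^ k * (b j * x ^ j) + b j ^ k * (\<Sum>i<j. a i * x ^ i) = b j ^ k * (\<Sum>i\<le>n. a i * x ^ i)"
    unfolding split by (simp add: algebra_simps)
   finally show ?thesis using rel by simp
  qed
  ultimately have "integral_over A (b j * x)" using r by (intro integral_overI)
  then show ?thesis using algebraic_int_integral_closed unfolding A_def by simp
 qed
 \<comment> \<open>Descending induction from the empty sum \<open>b (Suc n) = 0\<close>, by
   \<open>b j = a j + b (Suc j) * x\<close>.\<close>
 have bA: "b (Suc n - k) : A" if "k <= n" for k
  using that
 proof (induction k)
  case 0
  then show ?case using subringD(2)[OF A] by (simp add: b_def)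
 next
  case (Suc k)
  have "b (Suc n - k) * x : A" using Suc by (intro bx) auto
  then have "a (n - k) + b (Suc (n - k)) * x : A" using aA Suc(2) by (intro subringD(6)[OF A]) (simp_all add: Suc_diff_le)
  then show ?case using b_step[of "n - k"] by simp
 qed
 have bA': "b j : A" if "0 < j" "j <= Suc n" for j using bA[of "Suc n - j"] that by simp
 have "b j : Q & b j * x : Q" if "0 < j" "j <= Suc n" for j using no bA'[OF that] bx[OF bA'[OF that] that] by blast
 moreover have b0: "b 0 = 0" using rel by (simp add: b_def atMost_atLeast0)
 ultimately have bQ: "b j : Q" "b (Suc j) * x : Q" if "j <= n" for j
  using that submodD(1)[OF q] by (cases j; simp)+
 \<comment> \<open>With all \<open>b j\<close> and \<open>b j * x\<close> in \<open>Q\<close>, the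
   coefficients \<open>a j = b j - b (Suc j) * x\<close> lie in \<open>Q\<close> as well, against
   content 1.\<close>
 have "a j : Q" for j
 proof (cases "j <= n")
  case True
  have "b j - b (Suc j) * x : Q" using submod_diff[OF A q bQ[OF True]] .
  then show ?thesis using b_step[OF True] by simp
 qed (use submodD(1)[OF q] in "simp add: a_def n_def coeff_eq_0")
 then have "of_int (Gcd (coeff p ` {..n})) : Q"
  by (intro Gcd_mem_ideal[OF A q]) (auto simp: a_def)
 moreover have "Gcd (coeff p ` {..n}) = 1"
 proof -
  have "Gcd (coeff p ` {..n}) dvd coeff p i" for i
   by (cases "i <= n") (auto intro!: Gcd_dvd simp: n_def coeff_eq_0)
  then have "[:Gcd (coeff p ` {..n}):] dvd p" by (simp add: const_poly_dvd_iff)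
  then have "Gcd (coeff p ` {..n}) dvd content p" by (simp add: const_poly_dvd_iff_dvd_content)
  then show ?thesis using p(1) by simp
 qed
 ultimately show False using prime_inD(3)[OF Q] by simp
qed

definition alg_localization :: "'a :: field set => 'a set" where
 "alg_localization Q = {x / s | x s. algebraic_int x & algebraic_int s & s ~: Q}"

text \<open>For every \<open>x\<close> there is an algebraic integer \<open>b\<close> with
  \<open>b * x\<close> integral and \<open>b\<close>, \<open>b * x\<close> not both in
  \<open>Q\<close>. Whichever of them is outside \<open>Q\<close> serves as denominator of
  \<open>x\<close> or of \<open>inverse x\<close>.\<close>

lemma alg_localization_valuation:
 fixes Q :: "'a :: field_char_0 set"
 defines "A \<equiv> {x :: 'a. algebraic_int x}"
 assumes alg: "!!x :: 'a. \<exists>m. m ~= (0 :: int) & algebraic_int (of_int m * x)" and Q: "prime_in A Q"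
 shows "valuation_subring (alg_localization Q)"
  and alg_localization_superset: "A <= alg_localization Q"
  and mem_mV_if_mem: "Q <= valuation_subring.mV (alg_localization Q)"
proof -
 note A = subring_algebraic_ints[where ?'a = 'a, folded A_def]
 let ?V = "alg_localization Q"
 have V: "x / s : ?V" if "x : A" "s : A" "s ~: Q" for x s
  using that unfolding alg_localization_def A_def by auto
 have VE: "\<exists>x s. y = x / s & x : A & s : A & s ~: Q" if "y : ?V" for y
  using that unfolding alg_localization_def A_def by auto
 have nz: "s ~= 0" if "s ~: Q" for s using that submodD(1)[OF prime_inD(2)[OF Q]] by auto
 have 1: "1 ~: Q" by (rule prime_inD(3)[OF Q])
 show sup: "A <= ?V"
 proof
  fix x assume "x : A"
  from V[OF this subringD(1)[OF A] 1] show "x : ?V" by simp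
 qed
 have sub: "subring_set ?V"
 proof (rule subringI)
  show "1 : ?V" using sup subringD(1)[OF A] by blast
  fix y z assume "y : ?V" "z : ?V"
  then obtain a s b t where *: "y = a / s" "a : A" "s : A" "s ~: Q" "z = b / t" "b : A" "t : A" "t ~: Q" using VE by metis
  have st: "s * t : A" "s * t ~: Q" using * prime_inD(4)[OF Q] subringD(4)[OF A] by auto
  have "y - z = (a * t - b * s) / (s * t)" "y * z = (a * b) / (s * t)" using * nz by (auto simp: field_simps)
  then show "y - z : ?V" "y * z : ?V" using V[OF _ st] * subringD(3,4)[OF A] by simp_all
 qed
 have val: "x : ?V \<or> inverse x : ?V" for x
 proof -
  obtain m where m: "m ~= (0 :: int)" "algebraic_int (of_int m * x)" using alg by blast
  obtain b where b: "b : A" "b * x : A" "b ~: Q \<or> b * x ~: Q"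
   using exists_integral_denominator[OF m Q[unfolded A_def]] unfolding A_def by blast
  from b(3) show ?thesis
  proof
   assume nb: "b ~: Q"
   then have "x = (b * x) / b" using nz[OF nb] by simp
   then show ?thesis using V[OF b(2,1) nb] by simp
  next
   assume nb: "b * x ~: Q"
   then have "inverse x = b / (b * x)" using nz[OF nb] by (simp add: field_simps)
   then show ?thesis using V[OF b(1,2) nb] by simp
  qed
 qed
 show vs: "valuation_subring ?V" using sub val by unfold_locales
 interpret valuation_subring ?V by (rule vs)
 show "Q <= mV"
 proof
  fix x assume x: "x : Q"
  then have xA: "x : A" using prime_inD(1)[OF Q] by blast
  have "x = 0" if inv: "inverse x : ?V"
  proof (rule ccontr)
   assume "x ~= 0"
   obtain y s where ys: "inverse x = y / s" "y : A" "s : A" "s ~: Q" using VE[OF inv] by blast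
   then have "s = y * x" using `x ~= 0` nz[OF ys(4)] by (simp add: field_simps)
   then show False using ys submodD(3)[OF prime_inD(2)[OF Q] ys(2) x] by simp
  qed
  then show "x : mV" using xA sup by (auto simp: mV_def)
 qed
qed

section \<open>Retractions onto a subfield compatible with a valuation ring\<close>

text \<open>Take a smallest finite \<open>E\<close> in \<open>V\<close> such that \<open>1\<close>
  and \<open>E\<close> generate \<open>F\<close> with coefficients that \<open>h\<close> maps into
  \<open>V\<close>. Then \<open>1\<close> and \<open>E\<close> are independent over the subfield:
  divide a relation by a coefficient that divides all others; if it stands at some \<open>e\<close>
  in \<open>E\<close>, then \<open>e\<close> is redundant, and if only the coefficient of
  \<open>1\<close> qualifies, then \<open>1\<close> lies in \<open>mV\<close>. The retraction fixes
  \<open>1\<close> and kills \<open>E\<close>.\<close>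

lemma valuation_retraction:
 fixes h :: "'k :: field => 'l :: field"
 assumes h: "comm_ring_hom h" and V: "valuation_subring V" and F: "finite F" "F <= V"
 shows "\<exists>rh. (\<forall>x y. rh (x + y) = rh x + rh y) & (\<forall>c x. rh (h c * x) = c * rh x) & rh 1 = 1 & (\<forall>x\<in>F. h (rh x) : V)"
proof -
 interpret h: comm_ring_hom h by fact
 interpret valuation_subring V by fact
 have h0: "h x = 0 \<longleftrightarrow> x = 0" for x
 proof
  assume x: "h x = 0"
  show "x = 0"
  proof (rule ccontr)
   assume "x ~= 0"
   then have "h x * h (inverse x) = 1" by (simp add: h.hom_mult[symmetric])
   then show False using x by simp
  qed
 qed simp
 have hdiv: "h (x / y) = h x / h y" for x y
 proof (cases "y = 0")
  case False
  then have "h (x / y) * h y = h x" by (simp add: h.hom_mult[symmetric])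
  then show ?thesis using False h0 by (simp add: field_simps)
 qed simp
 interpret L: vector_space "\<lambda>c x. h c * x"
  by unfold_locales (auto simp: h.hom_add h.hom_mult algebra_simps)
 interpret K: vector_space "(*) :: 'k => 'k => 'k"
  by unfold_locales (auto simp: algebra_simps)
 interpret LK: vector_space_pair "\<lambda>c x. h c * x" "(*) :: 'k => 'k => 'k" ..
 define gens where "gens E \<longleftrightarrow> finite E & E <= V \<and>
  (\<forall>x\<in>F. \<exists>c0 c. h c0 : V & (\<forall>e. h (c e) : V) & x = h c0 + (\<Sum>e\<in>E. h (c e) * e))" for E
 note v = subringD[OF V]
 have "gens F" unfolding gens_def
 proof (intro conjI F ballI)
  fix x assume x: "x : F"
  have "(\<Sum>e\<in>F. h (if e = x then 1 else 0) * e) = (\<Sum>e\<in>F. if e = x then e else 0)" by (intro sum.cong) auto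
  then have "x = h 0 + (\<Sum>e\<in>F. h (if e = x then 1 else 0) * e)" using x F(1) by simp
  then show "\<exists>c0 c. h c0 : V & (\<forall>e. h (c e) : V) & x = h c0 + (\<Sum>e\<in>F. h (c e) * e)"
   using v by (intro exI[of _ 0] exI[of _ "\<lambda>e. if e = x then 1 else 0"]) auto
 qed
 then obtain E where E: "gens E" "!!E'. gens E' ==> card E <= card E'"
  using ex_has_least_nat[of gens F card] by blast
 have fin: "finite E" and EV: "E <= V" using E(1) unfolding gens_def by auto
 have not_redundant: False
  if e: "e : E" and d: "h d0 : V" "!!v. h (d v) : V" "e = h d0 + (\<Sum>v\<in>E - {e}. h (d v) * v)" for e d0 d
 proof -
  have "gens (E - {e})" unfolding gens_def
  proof (intro conjI ballI)
   fix x assume "x : F"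
   then obtain c0 c where c: "h c0 : V" "!!e. h (c e) : V" "x = h c0 + (\<Sum>e\<in>E. h (c e) * e)"
    using E(1) unfolding gens_def by blast
   have "x = h c0 + (h (c e) * e + (\<Sum>v\<in>E - {e}. h (c v) * v))" using c(3) sum.remove[OF fin e, of "\<lambda>v. h (c v) * v"] by simp
   also have "h (c e) * e = h (c e) * (h d0 + (\<Sum>v\<in>E - {e}. h (d v) * v))" using d(3) by simp
   finally have "x = h (c0 + c e * d0) + (\<Sum>v\<in>E - {e}. h (c v + c e * d v) * v)"
    by (simp add: h.hom_add h.hom_mult algebra_simps sum.distrib sum_distrib_left)
   moreover have "h (c0 + c e * d0) : V" "h (c v + c e * d v) : V" for v using c d v by (simp_all add: h.hom_add h.hom_mult)
   ultimately show "\<exists>c0 c. h c0 : V & (\<forall>e. h (c e) : V) & x = h c0 + (\<Sum>v\<in>E - {e}. h (c v) * v)"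
    by (intro exI[of _ "c0 + c e * d0"] exI[of _ "\<lambda>v. c v + c e * d v"]) simp
  qed (use fin EV in auto)
  from E(2)[OF this] show False using card_Diff1_less[OF fin e] by simp
 qed
 have one_E: "1 ~: E"
 proof
  assume "1 : E"
  then show False by (rule not_redundant[of 1 1 "\<lambda>_. 0"]) (use v in auto)
 qed
 have "L.independent (insert 1 E)"
 proof
  assume "L.dependent (insert 1 E)"
  then obtain u where u: "\<exists>w\<in>insert 1 E. u w ~= 0" "(\<Sum>w\<in>insert 1 E. h (u w) * w) = 0"
   using L.dependent_finite[of "insert 1 E"] fin by auto
  have rel: "h (u 1) + (\<Sum>e\<in>E. h (u e) * e) = 0" using u(2) fin one_E by simp
  have "\<exists>d\<in>h ` u ` insert 1 E. d ~= 0 & (\<forall>x\<in>h ` u ` insert 1 E. x / d : V)"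
  proof -
   obtain w where "w : insert 1 E" "u w ~= 0" using u(1) by blast
   then have "h (u w) : h ` u ` insert 1 E" "h (u w) ~= 0" using h0 by auto
   then show ?thesis using fin by (intro exists_max_divisor[of _ "h (u w)"]) auto
  qed
  then obtain d where d: "d : h ` u ` insert 1 E" "d ~= 0" "\<forall>x\<in>h ` u ` insert 1 E. x / d : V" by blast
  then obtain w where w0: "w : insert 1 E" "d = h (u w)" by blast
  have w: "w : insert 1 E" "u w ~= 0" "!!x. x : insert 1 E ==> h (u x) / h (u w) : V" using d w0 h0 by auto
  show False
  proof (cases "\<exists>e\<in>E. u e ~= 0 & h (u w) / h (u e) : V")
   case True
   then obtain e where e: "e : E" "u e ~= 0" "h (u w) / h (u e) : V" by blast
   have quot: "h (u x / u e) : V" if "x : insert 1 E" for x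
    using v(4)[OF w(3)[OF that] e(3)] w(2) h0 by (simp add: hdiv)
   define d where "d x = (if x : E then - (u x / u e) else 0)" for x
   have hd: "h (d x) : V" for x unfolding d_def using quot[of x] v(2,5) by (auto simp: h.hom_uminus)
   have hd0: "h (- (u 1 / u e)) : V" using quot[of 1] v(5) by (simp add: h.hom_uminus)
   have "h (u e) * e = - h (u 1) - (\<Sum>x\<in>E - {e}. h (u x) * x)"
    using rel sum.remove[OF fin e(1), of "\<lambda>x. h (u x) * x"] by (simp add: algebra_simps eq_neg_iff_add_eq_0)
   then have "e = (- h (u 1) - (\<Sum>x\<in>E - {e}. h (u x) * x)) / h (u e)" using e(2) h0 by (simp add: field_simps)
   also have "\<dots> = h (- (u 1 / u e)) + (\<Sum>x\<in>E - {e}. h (- (u x / u e)) * x)"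
    by (simp add: hdiv h.hom_uminus diff_divide_distrib sum_divide_distrib sum_negf)
   also have "(\<Sum>x\<in>E - {e}. h (- (u x / u e)) * x) = (\<Sum>x\<in>E - {e}. h (d x) * x)" by (intro sum.cong) (auto simp: d_def)
   finally show False by (rule not_redundant[of e "- (u 1 / u e)" d, OF e(1) hd0 hd])
  next
   case False
   then have "w = 1" using w(1,2) v(1) h0 by auto
   have small: "h (u e / u 1) : mV" if "e : E" for e
   proof (cases "u e = 0")
    case True
    then show ?thesis using submodD(1)[OF prime_inD(2)[OF prime_mV]] by simp
   next
    case ne: False
    have "h (u e) / h (u 1) : V" using w(3)[of e] that `w = 1` by simp
    moreover have "inverse (h (u e) / h (u 1)) ~: V" using False that ne `w = 1` by (auto simp: inverse_divide)
    ultimately show ?thesis by (simp add: hdiv mV_def)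
   qed
   have u1: "h (u 1) ~= 0" using w(2) `w = 1` h0 by simp
   have "1 + (\<Sum>e\<in>E. h (u e / u 1) * e) = (h (u 1) + (\<Sum>e\<in>E. h (u e) * e)) / h (u 1)"
    using u1 by (simp add: hdiv add_divide_distrib sum_divide_distrib)
   then have "1 = - (\<Sum>e\<in>E. h (u e / u 1) * e)" unfolding rel by (simp add: eq_neg_iff_add_eq_0)
   moreover have "(\<Sum>e\<in>E. h (u e / u 1) * e) : mV"
   proof (rule submod_sum[OF prime_inD(2)[OF prime_mV]])
    fix e assume "e : E"
    then show "h (u e / u 1) * e : mV" using mV_mult[of e "h (u e / u 1)"] small EV by (auto simp: mult.commute)
   qed
   then have "0 - (\<Sum>e\<in>E. h (u e / u 1) * e) : mV"
    by (rule submod_diff[OF V prime_inD(2)[OF prime_mV] submodD(1)[OF prime_inD(2)[OF prime_mV]]])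
   ultimately show False using prime_inD(3)[OF prime_mV] by simp
  qed
 qed
 from LK.linear_independent_extend[OF this, of "\<lambda>x. if x = 1 then 1 else 0"]
 obtain rh where lin: "Vector_Spaces.linear (\<lambda>c x. h c * x) (*) rh" and rh: "\<forall>x\<in>insert 1 E. rh x = (if x = 1 then 1 else 0)" by blast
 interpret rh: Vector_Spaces.linear "\<lambda>c x. h c * x" "(*)" rh by (rule lin)
 have "h (rh x) : V" if x: "x : F" for x
 proof -
  obtain c0 c where c: "h c0 : V" "!!e. h (c e) : V" "x = h c0 + (\<Sum>e\<in>E. h (c e) * e)"
   using E(1) x unfolding gens_def by blast
  have "rh x = c0 * rh 1 + (\<Sum>e\<in>E. c e * rh e)"
   using rh.scale[of c0 1] by (simp add: c(3) rh.add rh.sum rh.scale)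
  also have "(\<Sum>e\<in>E. c e * rh e) = 0" using rh one_E by (intro sum.neutral) auto
  finally show ?thesis using rh c(1) by simp
 qed
 then show ?thesis using rh rh.add rh.scale by (intro exI[of _ rh]) auto
qed

section \<open>Components of polynomials with respect to a torus\<close>

lemma monomial_eq: "cc c * var_X ^ k * var_Y ^ l = monom (monom c k) l"
proof -
 have X: "(var_X :: 'a poly poly) ^ i = [:[:0, 1:] ^ i:]" for i
  by (induction i) (auto simp: var_X_def one_pCons)
 show ?thesis by (simp add: X cc_def var_Y_def monom_altdef)
qed

lemma coeff_monomial:
 "coeff (coeff (cc c * var_X ^ k * var_Y ^ l) l') k' = (if k = k' & l = l' then c else 0)"
 unfolding monomial_eq by auto

text \<open>Common form of a diagonal substitution and of the projection onto a set of exponents: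
  the coefficient of \<open>X^k Y^l\<close> is scaled by \<open>w k l\<close>.\<close>

definition weighted :: "(nat => nat => 'a) => 'a :: comm_ring_1 poly poly => 'a poly poly" where
 "weighted w f = (\<Sum>l\<le>degree f. \<Sum>k\<le>degree (coeff f l). cc (w k l * coeff (coeff f l) k) * var_X ^ k * var_Y ^ l)"

lemma coeff_weighted: "coeff (coeff (weighted w f) l) k = w k l * coeff (coeff f l) k"
proof -
 have "coeff (coeff (weighted w f) l) k = (\<Sum>l'\<le>degree f. \<Sum>k'\<le>degree (coeff f l').
   if l' = l then (if k' = k then w k l * coeff (coeff f l) k else 0) else 0)"
  unfolding weighted_def coeff_sum coeff_monomial by (intro sum.cong refl) auto
 also have "\<dots> = (\<Sum>l'\<le>degree f. if l' = l then (\<Sum>k'\<le>degree (coeff f l). if k' = k then w k l * coeff (coeff f l) k else 0) else 0)"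
  by (intro sum.cong refl) auto
 also have "\<dots> = w k l * coeff (coeff f l) k"
  by (auto simp: sum.delta' coeff_eq_0)
 finally show ?thesis .
qed

definition diag_act :: "'a :: comm_ring_1 => 'a => 'a poly poly => 'a poly poly" where
 "diag_act a b = subst_XY (cc a * var_X) (cc b * var_Y)"

lemma comm_ring_hom_diag_act: "comm_ring_hom (diag_act a b)"
 unfolding diag_act_def by (rule comm_ring_hom_subst_XY)

lemma diag_act_eq_weighted: "diag_act a b f = weighted (\<lambda>k l. a ^ k * b ^ l) f"
 unfolding hom2_expand[OF comm_ring_hom_diag_act, of a b f] weighted_def
 by (intro sum.cong refl) (simp add: diag_act_def power_mult_distrib cc.hom_mult cc.hom_power mult_ac)

lemma coeff_diag_act: "coeff (coeff (diag_act a b f) l) k = a ^ k * b ^ l * coeff (coeff f l) k"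
 by (simp add: diag_act_eq_weighted coeff_weighted)

definition part :: "(nat => nat => bool) => 'a :: comm_ring_1 poly poly => 'a poly poly" where
 "part R = weighted (\<lambda>k l. if R k l then 1 else 0)"

lemma coeff_part: "coeff (coeff (part R f) l) k = (if R k l then coeff (coeff f l) k else 0)"
 by (simp add: part_def coeff_weighted)

lemma part_polys2: "subring_set D ==> f : polys2 D ==> part R f : polys2 D"
 by (auto simp: polys2_iff coeff_part intro: subringD)

lemma part_add: "part R (f + g) = part R f + part R g"
 by (rule poly2_eqI) (simp add: coeff_part)

lemma part_sum: "part R (sum f I) = (\<Sum>i\<in>I. part R (f i))"
proof -
 have "part R 0 = 0" by (rule poly2_eqI) (simp add: coeff_part)
 then show ?thesis by (induction I rule: infinite_finite_induct) (auto simp: part_add)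
qed

text \<open>On such a component every diagonal matrix whose entries are \<open>p\<close>-th roots of
  unity acts by a scalar.\<close>

definition res_part :: "nat => nat => nat => 'a :: comm_ring_1 poly poly => 'a poly poly" where
 "res_part p i j = part (\<lambda>k l. k mod p = i & l mod p = j)"

definition deg_part :: "nat => nat => 'a :: comm_ring_1 poly poly => 'a poly poly" where
 "deg_part p d = part (\<lambda>k l. (k + l) mod p = d)"

lemma sum_res_part:
 assumes "p > 0"
 shows "(\<Sum>i<p. \<Sum>j<p. res_part p i j f) = f"
proof (rule poly2_eqI)
 fix k l
 let ?c = "coeff (coeff f l) k"
 have "coeff (coeff (\<Sum>i<p. \<Sum>j<p. res_part p i j f) l) k =
   (\<Sum>i<p. \<Sum>j<p. if k mod p = i & l mod p = j then ?c else 0)"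
  by (simp add: coeff_sum res_part_def coeff_part)
 also have "\<dots> = (\<Sum>i<p. if k mod p = i then ?c else 0)"
 proof (intro sum.cong refl)
  fix i
  show "(\<Sum>j<p. if k mod p = i & l mod p = j then ?c else 0) = (if k mod p = i then ?c else 0)"
   by (cases "k mod p = i") (use assms in simp_all)
 qed
 also have "\<dots> = ?c" using assms by simp
 finally show "coeff (coeff (\<Sum>i<p. \<Sum>j<p. res_part p i j f) l) k = ?c" .
qed

lemma sum_deg_part:
 assumes "p > 0"
 shows "(\<Sum>d<p. deg_part p d f) = f"
proof (rule poly2_eqI)
 fix k l
 have "coeff (coeff (\<Sum>d<p. deg_part p d f) l) k =
   (\<Sum>d<p. if (k + l) mod p = d then coeff (coeff f l) k else 0)"
  by (auto simp: coeff_sum deg_part_def coeff_part intro!: sum.cong)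
 then show "coeff (coeff (\<Sum>d<p. deg_part p d f) l) k = coeff (coeff f l) k"
  using assms by simp
qed

text \<open>The polynomials in \<open>X^p\<close> and \<open>Y^p\<close>.\<close>

definition pth_polys :: "nat => 'a :: comm_ring_1 poly poly set" where
 "pth_polys p = {f. \<forall>k l. coeff (coeff f l) k ~= 0 --> p dvd k & p dvd l}"

lemma res_part_mult:
 assumes "w : pth_polys p"
 shows "res_part p i j (w * f) = w * res_part p i j f"
proof (rule poly2_eqI)
 fix k l
 have *: "coeff (coeff w l') k' * (if (k - k') mod p = i & (l - l') mod p = j then c else 0) =
   (if k mod p = i & l mod p = j then coeff (coeff w l') k' * c else 0)" if le: "k' <= k" "l' <= l" for k' l' c
 proof (cases "coeff (coeff w l') k' = 0")
  case False
  then have "p dvd k'" "p dvd l'" using assms unfolding pth_polys_def by blast+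
  then have "(k - k') mod p = k mod p" "(l - l') mod p = l mod p"
   using le by (auto elim!: dvdE simp: mod_mult_self4 le_iff_add)
  then show ?thesis by simp
 qed simp
 have "coeff (coeff (w * res_part p i j f) l) k =
   (\<Sum>l'\<le>l. \<Sum>k'\<le>k. if k mod p = i & l mod p = j then coeff (coeff w l') k' * coeff (coeff f (l - l')) (k - k') else 0)"
  unfolding coeff_mult coeff_sum res_part_def coeff_part by (intro sum.cong refl) (use * in auto)
 then show "coeff (coeff (res_part p i j (w * f)) l) k = coeff (coeff (w * res_part p i j f) l) k"
  by (auto simp: res_part_def coeff_part coeff_mult coeff_sum)
qed

lemma subring_pth_polys: "subring_set (pth_polys p :: 'a :: idom poly poly set)"
proof (rule subringI)
 show "1 : pth_polys p" by (auto simp: pth_polys_def coeff_1)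
 fix f g :: "'a poly poly" assume fg: "f : pth_polys p" "g : pth_polys p"
 show "f - g : pth_polys p" unfolding pth_polys_def
 proof (intro CollectI allI impI)
  fix k l assume "coeff (coeff (f - g) l) k ~= 0"
  then have "coeff (coeff f l) k ~= 0 \<or> coeff (coeff g l) k ~= 0" by auto
  then show "p dvd k & p dvd l" using fg unfolding pth_polys_def by blast
 qed
 show "f * g : pth_polys p" unfolding pth_polys_def
 proof (intro CollectI allI impI)
  fix k l assume "coeff (coeff (f * g) l) k ~= 0"
  then have "(\<Sum>l'\<le>l. \<Sum>k'\<le>k. coeff (coeff f l') k' * coeff (coeff g (l - l')) (k - k')) ~= 0"
   by (simp add: coeff_mult coeff_sum)
  then obtain l' where l': "l' : {..l}" "(\<Sum>k'\<le>k. coeff (coeff f l') k' * coeff (coeff g (l - l')) (k - k')) ~= 0"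
   by (rule sum.not_neutral_contains_not_neutral)
  obtain k' where k': "k' : {..k}" "coeff (coeff f l') k' * coeff (coeff g (l - l')) (k - k') ~= 0"
   using l'(2) by (rule sum.not_neutral_contains_not_neutral)
  then have *: "l' <= l" "k' <= k" "coeff (coeff f l') k' ~= 0" "coeff (coeff g (l - l')) (k - k') ~= 0"
   using l' by auto
  then have dv: "p dvd k'" "p dvd l'" "p dvd k - k'" "p dvd l - l'" using fg unfolding pth_polys_def by blast+
  have "p dvd k' + (k - k')" "p dvd l' + (l - l')" by (rule dvd_add[OF dv(1,3)], rule dvd_add[OF dv(2,4)])
  then show "p dvd k & p dvd l" using *(1,2) by simp
 qed
qed

lemma monomial_pth_polys: "p dvd k ==> p dvd l ==> cc c * var_X ^ k * var_Y ^ l : pth_polys p"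
 by (auto simp: pth_polys_def coeff_monomial)

lemma res_part_divide:
 assumes "i < p" "j < p"
 shows "\<exists>w\<in>pth_polys p. res_part p i j f = var_X ^ i * var_Y ^ j * (w :: 'a :: idom poly poly)"
proof -
 let ?g = "res_part p i j f"
 let ?w = "\<Sum>l\<le>degree ?g. \<Sum>k\<le>degree (coeff ?g l).
  if k mod p = i & l mod p = j then cc (coeff (coeff ?g l) k) * var_X ^ (k - i) * var_Y ^ (l - j) else 0"
 have "?w : pth_polys p"
 proof (intro subring_sum subring_pth_polys)
  fix l k
  show "(if k mod p = i & l mod p = j then cc (coeff (coeff ?g l) k) * var_X ^ (k - i) * var_Y ^ (l - j) else 0) : pth_polys p"
   using subringD(2)[OF subring_pth_polys] by (auto intro!: monomial_pth_polys dvd_minus_mod)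
 qed
 moreover have "?g = var_X ^ i * var_Y ^ j * ?w"
 proof -
  have term_eq: "cc (coeff (coeff ?g l) k) * var_X ^ k * var_Y ^ l =
    var_X ^ i * var_Y ^ j * (if k mod p = i & l mod p = j then cc (coeff (coeff ?g l) k) * var_X ^ (k - i) * var_Y ^ (l - j) else 0)" for k l
  proof (cases "k mod p = i & l mod p = j")
   case True
   then have "i <= k" "j <= l" by (auto intro: mod_less_eq_dividend)
   then have "(var_X :: 'a poly poly) ^ k = var_X ^ i * var_X ^ (k - i)" "(var_Y :: 'a poly poly) ^ l = var_Y ^ j * var_Y ^ (l - j)"
    by (simp_all add: power_add[symmetric])
   then show ?thesis using True by (simp add: mult_ac)
  next
   case False
   then have "coeff (coeff ?g l) k = 0" by (auto simp: res_part_def coeff_part)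
   then show ?thesis using False by auto
  qed
  show ?thesis by (subst poly2_expand) (simp only: term_eq sum_distrib_left)
 qed
 ultimately show ?thesis by blast
qed

section \<open>Composition with a monic polynomial\<close>

lemma degree_lessI:
 assumes "degree r <= n" "coeff r n = 0" "0 < n"
 shows "degree r < n"
proof (rule ccontr)
 assume "\<not> ?thesis"
 then have "degree r = n" using assms(1) by simp
 then have "r = 0" using assms(2) leading_coeff_0_iff[of r] by simp
 then show False using `degree r = n` assms(3) by simp
qed

text \<open>As \<open>N\<close> is monic, the leading coefficient of \<open>pcompose q N\<close> is
  that of \<open>q\<close>. So the leading term of \<open>q\<close> can be subtracted and the degree
  goes down.\<close>

lemma monic_pcompose_integral:
 fixes N :: "'a :: idom poly"
 assumes D: "subring_set D" and N: "N : polys_over D" "lead_coeff N = 1" "degree N > 0"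
  and q: "pcompose q N : polys_over D"
 shows "q : polys_over D"
 using q
proof (induction "degree q" arbitrary: q rule: less_induct)
 case less
 note P = subring_polys_over[OF D]
 have lc: "lead_coeff (pcompose q N) = lead_coeff q" by (simp only: lead_coeff_comp[OF N(3)] N(2)) simp
 have lD: "lead_coeff q : D" using polys_overD[OF less(2), of "degree (pcompose q N)"] lc by simp
 define r where "r = q - monom (lead_coeff q) (degree q)"
 have "pcompose (monom c n) N = [:c:] * N ^ n" for c n
  by (simp add: monom_altdef pcompose_smult pcompose_hom.hom_power pcompose_pCons)
 then have "pcompose r N = pcompose q N - [:lead_coeff q:] * N ^ degree q" unfolding r_def by (simp add: pcompose_diff)
 then have rN: "pcompose r N : polys_over D"
  using less(2) const_polys_over[OF D lD] N(1) by (simp only:) (intro subringD(3,4)[OF P] subring_power[OF P])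
 have "r : polys_over D"
 proof (cases "degree q = 0")
  case True
  then obtain c where "q = [:c:]" by (rule degree_eq_zeroE)
  then have "r = 0" unfolding r_def by (simp add: monom_0)
  then show ?thesis using subringD(2)[OF P] by simp
 next
  case False
  have "coeff r (degree q) = 0" "degree r <= degree q" unfolding r_def
   by (auto intro!: degree_diff_le degree_monom_le)
  then have "degree r < degree q" using False by (intro degree_lessI) auto
  then show ?thesis using less(1) rN by blast
 qed
 then have "r + monom (lead_coeff q) (degree q) : polys_over D" by (intro subringD(6)[OF P] monom_polys_over[OF D lD])
 then show ?case by (simp add: r_def)
qed

text \<open>As \<open>G\<close> is monic, \<open>G * q\<close> and \<open>q\<close> have the same
  leading coefficient. It therefore lies in \<open>I\<close>, and the leading term of
  \<open>q\<close> can be removed.\<close>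

lemma monic_mult_mem_ideal:
 fixes G :: "'a :: idom poly"
 assumes D: "subring_set D" and I: "submod D I" and G: "G : polys_over D" "lead_coeff G = 1"
  and q: "q : polys_over D" "G * q : polys_over I"
 shows "q : polys_over I"
 using q
proof (induction "degree q" arbitrary: q rule: less_induct)
 case less
 note P = subring_polys_over[OF D]
 have "lead_coeff (G * q) = lead_coeff q" using G by (simp add: lead_coeff_mult)
 then have lI: "lead_coeff q : I" using polys_overD[OF less(3), of "degree (G * q)"] by simp
 have lD: "lead_coeff q : D" using polys_overD[OF less(2)] by blast
 define m where "m = monom (lead_coeff q) (degree q)"
 define r where "r = q - m"
 have mI: "m : polys_over I" using lI submodD(1)[OF I] by (auto simp: m_def polys_over_def)
 have mD: "m : polys_over D" unfolding m_def by (rule monom_polys_over[OF D lD])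
 have rD: "r : polys_over D" unfolding r_def using less(2) mD by (rule subringD(3)[OF P])
 have diffI: "x - y : polys_over I" if "x : polys_over I" "y : polys_over I" for x y
  using that submod_diff[OF D I] by (auto simp: polys_over_def)
 have "G * m : polys_over I"
  using G(1) mI by (auto simp: polys_over_def coeff_mult intro!: submod_sum[OF I] submodD(3)[OF I])
 then have rI: "G * r : polys_over I" unfolding r_def right_diff_distrib by (rule diffI[OF less(3)])
 have "r : polys_over I"
 proof (cases "degree q = 0")
  case True
  then obtain c where "q = [:c:]" by (rule degree_eq_zeroE)
  then have "r = 0" unfolding r_def m_def by (simp add: monom_0)
  then show ?thesis using submodD(1)[OF I] by (auto simp: polys_over_def)
 next
  case False
  have "coeff r (degree q) = 0" "degree r <= degree q" unfolding r_def m_def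
   by (auto intro!: degree_diff_le degree_monom_le)
  then have "degree r < degree q" using False by (intro degree_lessI) auto
  then show ?thesis using less(1) rD rI by blast
 qed
 then have "coeff r i + coeff m i : I" for i using mI submodD(2)[OF I] polys_overD by blast
 then show ?case by (auto simp: polys_over_def r_def)
qed

section \<open>Invariants of a group diagonal in the basis \<open>X\<close>, \<open>Y + u X\<close>\<close>

text \<open>Passage to the coordinates \<open>X\<close>, \<open>Y + u X\<close> in which the group
  is diagonal. The scalar \<open>u\<close> is allowed to lie outside \<open>V\<close>.\<close>

definition shear :: "'a :: comm_ring_1 => 'a poly poly => 'a poly poly" where
 "shear u = subst_XY var_X (var_Y + cc u * var_X)"

lemma comm_ring_hom_shear: "comm_ring_hom (shear u)"
 unfolding shear_def by (rule comm_ring_hom_subst_XY)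

interpretation shear: comm_ring_hom "shear u" for u by (rule comm_ring_hom_shear)

interpretation diag_act: comm_ring_hom "diag_act a b" for a b by (rule comm_ring_hom_diag_act)

lemma shear_simps [simp]: "shear u (cc c) = cc c" "shear u var_X = var_X" "shear u var_Y = var_Y + cc u * var_X"
 by (simp_all add: shear_def)

lemma diag_act_simps [simp]:
 "diag_act a b (cc c) = cc c" "diag_act a b var_X = cc a * var_X" "diag_act a b var_Y = cc b * var_Y"
 by (simp_all add: diag_act_def)

lemma shear_shear: "shear u (shear v f) = shear (u + v) f"
 by (rule hom2_eqI[where h = "\<lambda>f. shear u (shear v f)", OF comm_ring_hom_comp[OF comm_ring_hom_shear comm_ring_hom_shear] comm_ring_hom_shear])
  (simp_all add: shear.hom_add shear.hom_mult cc.hom_add algebra_simps)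

lemma shear_0: "shear 0 f = f"
 by (rule hom2_eqI[where h = "shear 0", OF comm_ring_hom_shear comm_ring_hom_id]) simp_all

lemma shear_inverse: "shear u (shear (- u) f) = f" "shear (- u) (shear u f) = f"
 by (simp_all add: shear_shear shear_0)

lemma diag_scalar_shear: "diag_act t t (shear u f) = shear u (diag_act t t f)"
 by (rule hom2_eqI[where h = "\<lambda>f. diag_act t t (shear u f)" and h' = "\<lambda>f. shear u (diag_act t t f)",
    OF comm_ring_hom_comp[OF comm_ring_hom_diag_act comm_ring_hom_shear] comm_ring_hom_comp[OF comm_ring_hom_shear comm_ring_hom_diag_act]])
  (simp_all add: diag_act.hom_add diag_act.hom_mult shear.hom_mult shear.hom_add algebra_simps)

lemma diag_act_res_part: "diag_act a b (res_part p i j f) = res_part p i j (diag_act a b f)"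
 by (rule poly2_eqI) (simp add: coeff_diag_act res_part_def coeff_part)

lemma res_part_diff: "res_part p i j (f - g) = res_part p i j f - res_part p i j (g :: 'a :: comm_ring_1 poly poly)"
 by (rule poly2_eqI) (simp add: res_part_def coeff_part)

lemma diag_act_pth_polys:
 assumes "a ^ p = 1" "b ^ p = 1" "w : pth_polys p"
 shows "diag_act a b w = w"
proof (rule poly2_eqI)
 fix k l
 show "coeff (coeff (diag_act a b w) l) k = coeff (coeff w l) k"
 proof (cases "coeff (coeff w l) k = 0")
  case False
  then have "p dvd k" "p dvd l" using assms(3) unfolding pth_polys_def by blast+
  then have "a ^ k = 1" "b ^ l = 1" using assms(1,2) by (auto simp: power_mult elim!: dvdE)
  then show ?thesis by (simp add: coeff_diag_act)
 qed (simp add: coeff_diag_act)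
qed

lemma power_eq_1_mod_cong:
 fixes x :: "'a :: field"
 assumes "x ^ p = 1" "k mod p = l mod p"
 shows "x ^ k = x ^ l"
proof -
 have "x ^ k = x ^ (k mod p)" for k
  by (subst mult_div_mod_eq[of p k, symmetric], subst power_add) (simp add: power_mult assms(1))
 then show ?thesis using assms(2) by metis
qed

lemma power_eq_imp_mod_eq:
 fixes x :: "'a :: field"
 assumes p: "prime (p :: nat)" and x: "x ^ p = 1" "x ~= 1" and eq: "x ^ k = x ^ l"
 shows "k mod p = l mod p"
proof -
 have x0: "x ~= 0" using x(1) prime_gt_0_nat[OF p] by (cases "x = 0") (auto simp: power_0_left)
 have *: "k mod p = l mod p" if le: "k <= l" and e: "x ^ k = x ^ l" for k l
 proof -
  have "x ^ k * x ^ (l - k) = x ^ l" using le by (simp flip: power_add)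
  also have "x ^ l = x ^ k * 1" using e by simp
  finally have e1: "x ^ (l - k) = 1" using x0 by simp
  have "p dvd l - k"
  proof (rule ccontr)
   assume "\<not> p dvd l - k"
   then have "coprime p (l - k)" by (rule prime_imp_coprime[OF p])
   moreover have "l - k ~= 0" using `\<not> p dvd l - k` by (metis dvd_0_right)
   ultimately obtain a b where "(l - k) * a = p * b + 1"
    using coprime_bezout_strong[of "l - k" p] prime_gt_1_nat[OF p] by (auto simp: coprime_commute)
   then have "x ^ ((l - k) * a) = x ^ (p * b + 1)" by simp
   then show False using e1 x by (simp add: power_mult power_add)
  qed
  then show ?thesis using le by (metis mod_eq_dvd_iff_nat)
 qed
 show ?thesis
 proof (cases "k <= l")
  case True
  then show ?thesis using eq by (rule *)
 next
  case False
  then have "l mod p = k mod p" by (intro * eq[symmetric]) simp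
  then show ?thesis by simp
 qed
qed

text \<open>A shear preserves total degree. In the proof the components by degree modulo
  \<open>p\<close> are the eigencomponents of the scalar \<open>x\<close>, which has order
  \<open>p\<close>, and scalars commute with the shear.\<close>

lemma deg_part_shear:
 fixes f :: "'a :: field_char_0 poly poly" and x :: 'a
 assumes p: "prime (p :: nat)" and x: "x ^ p = 1" "x ~= 1" and d: "d < p"
 shows "deg_part p d (shear u f) = shear u (deg_part p d f)"
proof -
 have eig: "diag_act x x (deg_part p d f) = cc (x ^ d) * deg_part p d f" for d f
 proof (rule poly2_eqI)
  fix k l
  have "x ^ k * x ^ l = x ^ d" if "(k + l) mod p = d"
   using power_eq_1_mod_cong[OF x(1), of "k + l" d] that by (auto simp: power_add)
  then show "coeff (coeff (diag_act x x (deg_part p d f)) l) k = coeff (coeff (cc (x ^ d) * deg_part p d f) l) k"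
   by (cases "(k + l) mod p = d") (simp_all add: coeff_diag_act deg_part_def coeff_part)
 qed
 have part: "deg_part p d g = (if d = e then g else 0)" if "diag_act x x g = cc (x ^ e) * g" "e < p" "d < p" for d e g
 proof -
  have *: "(k + l) mod p = e" if nz: "coeff (coeff g l) k ~= 0" for k l
  proof -
   have "coeff (coeff (diag_act x x g) l) k = x ^ e * coeff (coeff g l) k"
    using `diag_act x x g = cc (x ^ e) * g` by simp
   then have "x ^ (k + l) = x ^ e" using nz by (simp add: coeff_diag_act power_add)
   from power_eq_imp_mod_eq[OF p x this] show ?thesis using `e < p` by simp
  qed
  show ?thesis
   by (rule poly2_eqI) (use * in "auto simp: deg_part_def coeff_part")
 qed
 have "deg_part p d (shear u f) = deg_part p d (\<Sum>e<p. shear u (deg_part p e f))"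
  using sum_deg_part[OF prime_gt_0_nat[OF p], of f] by (simp flip: shear.hom_sum)
 also have "\<dots> = (\<Sum>e<p. if d = e then shear u (deg_part p e f) else 0)"
  unfolding deg_part_def[of p d] part_sum unfolding deg_part_def[of p d, symmetric]
  by (intro sum.cong refl part) (auto simp: d diag_scalar_shear eig shear.hom_mult)
 also have "\<dots> = shear u (deg_part p d f)" using d by simp
 finally show ?thesis .
qed

lemma of_int_poly_mem:
 assumes "subring_set D"
 shows "map_poly of_int F : polys_over D"
 using assms by (auto simp: polys_over_def coeff_map_poly subring_of_int)

text \<open>What is available over \<open>V\<close> when \<open>P\<close> is diagonal in
  \<open>X\<close>, \<open>Y + u X\<close>. These forms need not be a basis over \<open>V\<close>,
  so integrality of the norm and of the components of invariants are conditions of their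
  own.\<close>

locale sheared_torus = valuation_subring V for V :: "'a :: field_char_0 set" +
 fixes p :: nat and u :: 'a and P :: "('a^2^2) set"
 assumes p: "prime p"
  and diag: "M : P ==> \<exists>a b. a ^ p = 1 & b ^ p = 1 & (\<forall>f. act M f = shear u (diag_act a b (shear (- u) f)))"
  and norm_integral: "(var_Y + cc u * var_X) ^ p - cc (u ^ p) * var_X ^ p : polys2 V"
  and res_integral: "f : polys2 V ==> (!!M. M : P ==> act M f = f) ==> i < p ==> j < p ==>
   shear u (res_part p i j (shear (- u) f)) : polys2 V"
begin

definition inv_ring where "inv_ring = {f : polys2 V. \<forall>M\<in>P. act M f = f}"

definition nrm where "nrm = (var_Y + cc u * var_X) ^ p - cc (u ^ p) * var_X ^ p"

lemma p_pos: "p > 0"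
 using p by (rule prime_gt_0_nat)

lemma subring_inv_ring: "subring_set inv_ring"
 by (rule subringI) (auto simp: inv_ring_def act.hom_minus act.hom_mult intro!: subring_intros[OF subring_polys2[OF V]])

lemma pth_invariant: "w : pth_polys p ==> M : P ==> act M (shear u w) = shear u w"
 using diag[of M] by (auto simp: shear_inverse diag_act_pth_polys)

lemma nrm_eq: "nrm = shear u (var_Y ^ p - cc (u ^ p) * var_X ^ p)"
 by (simp add: nrm_def shear.hom_minus shear.hom_mult shear.hom_power)

lemma X_pow_eq: "var_X ^ p = shear u (var_X ^ p)"
 by (simp add: shear.hom_power)

lemma XY_pth: "var_X ^ p : pth_polys p" "var_Y ^ p : pth_polys p" "cc c : pth_polys p"
 using monomial_pth_polys[of p p 0 1] monomial_pth_polys[of p 0 p 1] monomial_pth_polys[of p 0 0 c] by simp_all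

lemma pth_nrm: "var_Y ^ p - cc (u ^ p) * var_X ^ p : pth_polys p"
 using XY_pth by (intro subringD(3,4)[OF subring_pth_polys])

lemma X_pow_inv: "var_X ^ p : inv_ring"
proof -
 have "act M (shear u (var_X ^ p)) = shear u (var_X ^ p)" if "M : P" for M
  by (rule pth_invariant[OF XY_pth(1) that])
 then show ?thesis unfolding inv_ring_def X_pow_eq[symmetric] using var_polys2[OF V] by (auto intro: subring_power[OF subring_polys2[OF V]])
qed

lemma nrm_inv: "nrm : inv_ring"
proof -
 have "act M nrm = nrm" if "M : P" for M unfolding nrm_eq by (rule pth_invariant[OF pth_nrm that])
 then show ?thesis unfolding inv_ring_def using norm_integral by (simp add: nrm_def)
qed

text \<open>\<open>base\<close> is \<open>V[X^p]\<close> and \<open>base'\<close> is the same ring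
  over the whole field, both inside the polynomials in \<open>X\<close>. Polynomials over them
  receive \<open>nrm\<close> for the outer variable, so \<open>pcompose q nrm\<close> runs through
  \<open>V[X^p, N]\<close> when \<open>q\<close> is over \<open>base\<close>.\<close>

definition base :: "'a poly set" where
 "base = {r : polys_over V. \<forall>k. coeff r k ~= 0 --> p dvd k}"

definition base' :: "'a poly set" where
 "base' = {r. \<forall>k. coeff r k ~= 0 --> p dvd k}"

lemma base_eq: "base = polys_over V \<inter> base'"
 by (auto simp: base_def base'_def)

lemma subring_base': "subring_set base'"
proof -
 have *: "r : base' \<longleftrightarrow> [:r:] : pth_polys p" for r
  by (auto simp: base'_def pth_polys_def coeff_pCons split: nat.splits)
 have "[:1 :: 'a poly:] : pth_polys p" using subringD(1)[OF subring_pth_polys, of p] by (simp add: one_pCons)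
 moreover have "[:r - s:] : pth_polys p" "[:r * s:] : pth_polys p" if "[:r:] : pth_polys p" "[:s:] : pth_polys p" for r s :: "'a poly"
  using subringD(3,4)[OF subring_pth_polys that] by (simp_all add: mult.commute)
 ultimately show ?thesis by (intro subringI) (simp_all add: *)
qed

lemma subring_base: "subring_set base"
 unfolding base_eq using subringD[OF subring_base'] subringD[OF subring_polys_over[OF V]]
 by (intro subringI) auto

lemma nrm_degree: "lead_coeff nrm = 1" "degree nrm = p" "lead_coeff nrm = 1"
proof -
 have Y: "var_Y + cc u * var_X = [:[:0, u:], 1:]" by (simp add: var_Y_def var_X_def cc_def one_pCons)
 have d: "degree ((var_Y + cc u * var_X) ^ p) = p" unfolding Y by (simp add: degree_power_eq)
 have "var_X ^ p = [:[:0, 1:] ^ p :: 'a poly:]"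
 proof -
  have "var_X ^ i = [:[:0, 1:] ^ i :: 'a poly:]" for i by (induction i) (auto simp: var_X_def one_pCons)
  then show ?thesis .
 qed
 then have c: "cc (u ^ p) * var_X ^ p = [:[:u ^ p:] * [:0, 1:] ^ p:]" by (simp add: cc_def)
 have d2: "degree (- (cc (u ^ p) * var_X ^ p)) < degree ((var_Y + cc u * var_X) ^ p)"
  unfolding d unfolding c using p_pos by simp
 have n: "nrm = (var_Y + cc u * var_X) ^ p + - (cc (u ^ p) * var_X ^ p)" by (simp add: nrm_def)
 show dn: "degree nrm = p" unfolding n using degree_add_eq_left[OF d2] d by simp
 have "lead_coeff ((var_Y + cc u * var_X) ^ p) = 1" unfolding Y by (simp add: lead_coeff_power)
 then show "lead_coeff nrm = 1" unfolding n using lead_coeff_add_le[OF d2] by (simp add: add.commute)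
 then show "lead_coeff nrm = 1" .
qed

lemma pcompose_nrm_mem:
 assumes "subring_set S" "q : polys_over base" "!!c. c : V ==> cc c : S" "var_X ^ p : S" "nrm : S"
 shows "pcompose q nrm : S"
proof -
 have r: "[:r:] : S" if rb: "r : base" for r
 proof -
  have eq: "[:r:] = (\<Sum>k\<le>degree r. cc (coeff r k) * var_X ^ k)"
   using poly2_expand[of "[:r:]"] by simp
  have mem: "cc (coeff r k) * var_X ^ k : S" for k
  proof (cases "coeff r k = 0")
   case True
   then show ?thesis using subringD(2)[OF assms(1)] by simp
  next
   case False
   then have "p dvd k" using rb unfolding base_def by blast
   then obtain m where "k = p * m" by blast
   then have "var_X ^ k : S" using subring_power[OF assms(1,4)] by (simp add: power_mult)
   moreover have "coeff r k : V" using rb unfolding base_def polys_over_def by blast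
   ultimately show ?thesis using assms(3) subringD(4)[OF assms(1)] by blast
  qed
  show ?thesis by (subst eq, intro subring_sum[OF assms(1)] mem)
 qed
 have "pcompose q nrm = (\<Sum>i\<le>degree q. [:coeff q i:] * nrm ^ i)" by (simp add: pcompose_altdef poly_altdef coeff_map_poly degree_map_poly)
 then show ?thesis using r polys_overD[OF assms(2)] assms(5)
  by (auto intro!: subring_sum[OF assms(1)] subring_power[OF assms(1)] simp del: mult_pCons_left intro: subringD(4)[OF assms(1)])
qed

lemma pcompose_nrm_inv: "q : polys_over base ==> pcompose q nrm : inv_ring"
 using X_pow_inv nrm_inv cc_polys2[OF V] by (intro pcompose_nrm_mem subring_inv_ring) (auto simp: inv_ring_def)

text \<open>The shear fixes \<open>X^p\<close> and sends \<open>Y^p\<close> to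
  \<open>(Y + u X)^p = N + u^p X^p\<close>.\<close>

lemma shear_pth_polys_pcompose:
 assumes "w : pth_polys p"
 shows "\<exists>q\<in>polys_over base'. shear u w = pcompose q nrm"
proof -
 let ?S = "(\<lambda>q. pcompose q nrm) ` polys_over base'"
 note B = subring_polys_over[OF subring_base']
 have S: "subring_set ?S"
 proof (rule subringI)
  show "1 : ?S" using subringD(1)[OF B] by (intro image_eqI[of _ _ 1]) (simp_all add: pcompose_1)
  fix x y assume "x : ?S" "y : ?S"
  then obtain q r where qr: "x = pcompose q nrm" "y = pcompose r nrm" "q : polys_over base'" "r : polys_over base'" by blast
  show "x - y : ?S" using qr subringD(3)[OF B] by (intro image_eqI[of _ _ "q - r"]) (simp_all add: pcompose_diff)
  show "x * y : ?S" using qr subringD(4)[OF B] by (intro image_eqI[of _ _ "q * r"]) (simp_all add: pcompose_mult)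
 qed
 have const: "[:r:] : ?S" if "r : base'" for r
  using const_polys_over[OF subring_base' that] by (intro image_eqI[of _ _ "[:r:]"]) (simp_all add: pcompose_const)
 have cX: "cc c * var_X ^ k : ?S" if "p dvd k" for c k
 proof -
  have "var_X ^ k = [:[:0, 1:] ^ k :: 'a poly:]" by (induction k) (auto simp: var_X_def one_pCons)
  then have "cc c * var_X ^ k = [:monom c k:]" by (simp add: cc_def monom_altdef)
  moreover have "monom c k : base'" using that by (auto simp: base'_def)
  ultimately show ?thesis using const by simp
 qed
 have "nrm : ?S"
  using subringD(1,2)[OF subring_base'] subringD(2)[OF B] subringD(1)[OF B]
  by (intro image_eqI[of _ _ "[:0, 1:]"]) (simp_all add: pcompose_pCons pCons_polys_over[OF subring_base'])
 from subringD(6)[OF S this cX[of p "u ^ p"]]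
 have "nrm + cc (u ^ p) * var_X ^ p : ?S" by simp
 then have Yp: "(var_Y + cc u * var_X) ^ p : ?S" unfolding nrm_def diff_add_cancel .
 have "shear u (cc c * var_X ^ k * var_Y ^ l) : ?S" if k: "p dvd k" and l: "p dvd l" for c k l
 proof -
  obtain m where "l = p * m" using l by blast
  then have "(var_Y + cc u * var_X) ^ l : ?S" using subring_power[OF S Yp, of m] by (simp add: power_mult)
  then show ?thesis using subringD(4)[OF S cX[OF k]] by (simp add: shear.hom_mult shear.hom_power)
 qed
 then have mon: "shear u (cc (coeff (coeff w l) k) * var_X ^ k * var_Y ^ l) : ?S" for k l
  using assms subringD(2)[OF S] unfolding pth_polys_def by (cases "coeff (coeff w l) k = 0") auto
 have "shear u w : ?S"
  by (subst poly2_expand) (simp only: shear.hom_sum, intro subring_sum[OF S] mon)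
 then show ?thesis by auto
qed

text \<open>In \<open>V[X^p][N]\<close> the factor \<open>G(N)\<close> is monic, while
  \<open>F(X^p)\<close> and \<open>p\<close> are constants from \<open>V[X^p]\<close>.
  Multiplication by a monic polynomial is injective modulo the ideal that these constants
  generate.\<close>

lemma pth_polys_regular:
 fixes F G :: "int poly"
 assumes w: "w1 : pth_polys p" "w2 : pth_polys p" "w3 : pth_polys p"
  and int: "shear u w1 : polys2 V" "shear u w2 : polys2 V" "shear u w3 : polys2 V"
  and G: "lead_coeff G = 1"
  and eq: "poly (map_poly of_int G) nrm * shear u w1 - poly (map_poly of_int F) (var_X ^ p) * shear u w2 = of_nat p * shear u w3"
 shows "\<exists>q1\<in>polys_over base. \<exists>q2\<in>polys_over base.
  shear u w1 = poly (map_poly of_int F) (var_X ^ p) * pcompose q1 nrm + of_nat p * pcompose q2 nrm"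
proof -
 have nrm2: "nrm : polys2 V" using nrm_inv by (simp add: inv_ring_def)
 have dn: "degree nrm > 0" using nrm_degree p_pos by simp
 have ex: "\<exists>q\<in>polys_over base. shear u w = pcompose q nrm" if w: "w : pth_polys p" and wV: "shear u w : polys2 V" for w
 proof -
  obtain q where q: "q : polys_over base'" "shear u w = pcompose q nrm" using shear_pth_polys_pcompose[OF w] by blast
  have "q : polys_over (polys_over V)"
   by (rule monic_pcompose_integral[OF subring_polys_over[OF V] nrm2 nrm_degree(1) dn]) (use wV q(2) in simp)
  then show ?thesis using q unfolding base_eq polys_over_def by (intro bexI[of _ q]) auto
 qed
 obtain q1 q2 q3 where q: "q1 : polys_over base" "q2 : polys_over base" "q3 : polys_over base"
  "shear u w1 = pcompose q1 nrm" "shear u w2 = pcompose q2 nrm" "shear u w3 = pcompose q3 nrm"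
  using ex[OF w(1) int(1)] ex[OF w(2) int(2)] ex[OF w(3) int(3)] by blast
 define GG where "GG = (map_poly of_int G :: 'a poly poly)"
 have GG: "GG : polys_over base" "lead_coeff GG = 1"
  unfolding GG_def using of_int_poly_mem[OF subring_base] G by auto
 have Gn: "poly (map_poly of_int G) nrm = pcompose GG nrm"
 proof -
  have "map_poly (\<lambda>x. [:x:]) GG = map_poly of_int G"
   unfolding GG_def by (rule poly_eqI) (simp add: coeff_map_poly of_int_poly)
  then show ?thesis by (simp add: pcompose_altdef)
 qed
 define r where "r = poly (map_poly of_int F) (monom 1 p :: 'a poly)"
 have "monom 1 p : base'" "monom 1 p : polys_over V" using monom_polys_over[OF V subringD(1)[OF V]] by (auto simp: base'_def)
 then have rb: "r : base" unfolding r_def using poly_in_subring[OF subring_base of_int_poly_mem[OF subring_base]] by (simp add: base_eq)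
 have Xp: "var_X ^ p = [:monom 1 p :: 'a poly:]"
 proof -
  have "var_X ^ i = [:[:0, 1:] ^ i :: 'a poly:]" for i by (induction i) (auto simp: var_X_def one_pCons)
  then show ?thesis by (simp add: monom_altdef)
 qed
 have Fr: "poly (map_poly of_int F) (var_X ^ p) = [:r:]"
 proof -
  have pw: "[:s:] ^ i = [:s ^ i :: 'a poly:]" for s i by (induction i) (auto simp: one_pCons)
  have "(\<Sum>i\<in>I. [:f i :: 'a poly:]) = [:sum f I:]" for f :: "nat => 'a poly" and I
   by (induction I rule: infinite_finite_induct) auto
  then show ?thesis unfolding r_def Xp poly_altdef
   by (simp add: coeff_map_poly degree_map_poly pw of_int_poly)
 qed
 have "pcompose (GG * q1 - smult r q2 - smult (of_nat p) q3) nrm = 0"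
  using eq unfolding q(4-6) Gn Fr by (simp add: pcompose_diff pcompose_mult pcompose_smult of_nat_poly)
 then have eq': "GG * q1 = smult r q2 + smult (of_nat p) q3" using dn by (simp add: pcompose_eq_0_iff algebra_simps)
 define I where "I = {r * d + of_nat p * e | d e. d : base & e : base}"
 have I: "submod base I" unfolding submod_def
 proof (intro conjI ballI)
  show "0 : I" unfolding I_def using subringD(2)[OF subring_base] by (intro CollectI exI[of _ 0]) simp
  fix x y assume "x : I" "y : I"
  then obtain d e d' e' where "x = r * d + of_nat p * e" "y = r * d' + of_nat p * e'" "d : base" "e : base" "d' : base" "e' : base"
   unfolding I_def by blast
  then show "x + y : I" unfolding I_def using subringD(6)[OF subring_base]
   by (intro CollectI exI[of _ "d + d'"] exI[of _ "e + e'"]) (simp add: algebra_simps)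
 next
  fix b x assume b: "b : base" and "x : I"
  then obtain d e where "x = r * d + of_nat p * e" "d : base" "e : base" unfolding I_def by blast
  then have "b * x = r * (b * d) + of_nat p * (b * e)" "b * d : base" "b * e : base"
   using subringD(4)[OF subring_base b] by (simp add: algebra_simps, blast+)
  then show "b * x : I" unfolding I_def by blast
 qed
 have "GG * q1 : polys_over I" unfolding eq' polys_over_def I_def
  using polys_overD[OF q(2)] polys_overD[OF q(3)] by auto
 then have "q1 : polys_over I" by (rule monic_mult_mem_ideal[OF subring_base I GG q(1)])
 then have "\<forall>i. \<exists>d e. d : base & e : base & coeff q1 i = r * d + of_nat p * e" unfolding polys_over_def I_def by blast
 then obtain d e where de: "!!i. d i : base" "!!i. e i : base" "!!i. coeff q1 i = r * d i + of_nat p * e i" by metis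
 define s1 s2 where "s1 = (\<Sum>i\<le>degree q1. monom (d i) i)" and "s2 = (\<Sum>i\<le>degree q1. monom (e i) i)"
 have s: "s1 : polys_over base" "s2 : polys_over base" unfolding s1_def s2_def
  using de by (auto intro!: subring_sum[OF subring_polys_over[OF subring_base]] monom_polys_over[OF subring_base])
 have "q1 = smult r s1 + smult (of_nat p) s2"
 proof -
  have "q1 = (\<Sum>i\<le>degree q1. monom (coeff q1 i) i)" by (simp add: poly_as_sum_of_monoms)
  also have "\<dots> = smult r s1 + smult (of_nat p) s2"
   unfolding s1_def s2_def by (simp add: de(3) smult_sum2 smult_monom sum.distrib[symmetric] add_monom)
  finally show ?thesis .
 qed
 then have "shear u w1 = poly (map_poly of_int F) (var_X ^ p) * pcompose s1 nrm + of_nat p * pcompose s2 nrm"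
  unfolding q(4) Fr by (simp add: pcompose_add pcompose_smult of_nat_poly)
 then show ?thesis using s by blast
qed

lemma of_nat_cc: "(of_nat n :: 'a poly poly) = cc (of_nat n)"
 by (simp add: cc.hom_of_nat)

lemma poly_int_mem: "subring_set S ==> x : S ==> poly (map_poly of_int F) x : S"
 by (rule poly_in_subring[OF _ of_int_poly_mem])

text \<open>The projections onto the components are linear over the polynomials in
  \<open>X^p\<close> and \<open>N\<close>, so every component satisfies the equation. A component is
  \<open>X^i (Y + u X)^j\<close> times such a polynomial; once the first factor is scaled to be
  primitive, Gauss's lemma makes the cofactors integral and \<open>pth_polys_regular\<close> applies
  to them.\<close>

theorem inv_ring_regular:
 fixes F G :: "int poly"
 assumes G: "lead_coeff G = 1"
  and a: "a1 : inv_ring" "a2 : inv_ring" "a3 : polys2 V"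
  and eq: "poly (map_poly of_int G) nrm * a1 - poly (map_poly of_int F) (var_X ^ p) * a2 = of_nat p * a3"
 shows "\<exists>b\<in>inv_ring. \<exists>c\<in>inv_ring. a1 = poly (map_poly of_int F) (var_X ^ p) * b + of_nat p * c"
proof -
 let ?F = "poly (map_poly of_int F) (var_X ^ p) :: 'a poly poly"
 let ?G = "poly (map_poly of_int G) nrm"
 have p0: "(of_nat p :: 'a poly poly) ~= 0" using p_pos by simp
 note S = subring_inv_ring
 have FS: "?F : inv_ring" and GS: "?G : inv_ring"
  by (rule poly_int_mem[OF S X_pow_inv], rule poly_int_mem[OF S nrm_inv])
 have pa3: "of_nat p * a3 : inv_ring" unfolding eq[symmetric]
  using a FS GS by (intro subringD(3,4)[OF S])
 have "act M a3 = a3" if "M : P" for M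
 proof -
  have "act M (of_nat p * a3) = of_nat p * a3" using pa3 that by (simp add: inv_ring_def)
  then show ?thesis using p0 by (simp add: act.hom_mult act.hom_of_nat)
 qed
 then have a3: "a3 : inv_ring" using a(3) by (simp add: inv_ring_def)
 define cmp where "cmp i j f = shear u (res_part p i j (shear (- u) f))" for i j f
 have cmp_int: "cmp i j f : polys2 V" if "f : inv_ring" "i < p" "j < p" for i j f
  unfolding cmp_def using res_integral[of f i j] that by (auto simp: inv_ring_def)
 have cmp_inv: "act M (cmp i j f) = cmp i j f" if f: "f : inv_ring" and M: "M : P" for i j f M
 proof -
  obtain x y where xy: "!!f. act M f = shear u (diag_act x y (shear (- u) f))" using diag[OF M] by blast
  have "shear (- u) (act M f) = shear (- u) f" using f M by (simp add: inv_ring_def)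
  then have "diag_act x y (shear (- u) f) = shear (- u) f" unfolding xy by (simp add: shear_inverse)
  then show ?thesis unfolding cmp_def xy by (simp add: shear_inverse diag_act_res_part)
 qed
 have cmp_diff: "cmp i j (f - g) = cmp i j f - cmp i j g" for i j f g
  unfolding cmp_def by (simp add: shear.hom_minus res_part_diff)
 have cmp_mult: "cmp i j (shear u w * f) = shear u w * cmp i j f" if "w : pth_polys p" for i j w f
  unfolding cmp_def by (simp add: shear.hom_mult shear_inverse res_part_mult[OF that])
 have sh_poly: "poly (map_poly of_int H) (shear u w) = shear u (poly (map_poly of_int H) w)" for H :: "int poly" and w
  by (simp add: poly_altdef coeff_map_poly degree_map_poly shear.hom_sum shear.hom_mult shear.hom_power shear.hom_of_int)
 have cmp_F: "cmp i j (?F * f) = ?F * cmp i j f" for i j f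
 proof -
  have "shear u ?F = ?F" using sh_poly[of F "var_X ^ p"] by (simp add: shear.hom_power)
  then show ?thesis using cmp_mult[OF poly_int_mem[OF subring_pth_polys XY_pth(1)], of i j F f] by simp
 qed
 have cmp_G: "cmp i j (?G * f) = ?G * cmp i j f" for i j f
  unfolding nrm_eq sh_poly by (rule cmp_mult[OF poly_int_mem[OF subring_pth_polys pth_nrm]])
 have cmp_p: "cmp i j (of_nat p * f) = of_nat p * cmp i j f" for i j f
  using cmp_mult[OF XY_pth(3)[of "of_nat p"], of i j f] by (simp add: of_nat_cc)
 have sum_cmp: "(\<Sum>i<p. \<Sum>j<p. cmp i j f) = f" for f
  unfolding cmp_def by (simp add: shear.hom_sum[symmetric] sum_res_part[OF p_pos] shear_inverse)
 have comp: "\<exists>b\<in>inv_ring. \<exists>c\<in>inv_ring. cmp i j a1 = ?F * b + of_nat p * c" if ij: "i < p" "j < p" for i j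
 proof (cases "cmp i j a1 = 0")
  case True
  then show ?thesis using subringD(2)[OF S] by (intro bexI[of _ 0]) auto
 next
  case False
  let ?e = "shear u (var_X ^ i * var_Y ^ j)"
  have "\<exists>w\<in>pth_polys p. cmp i j f = ?e * shear u w" for f
   using res_part_divide[OF ij, of "shear (- u) f"] unfolding cmp_def by (auto simp: shear.hom_mult)
  then obtain w1 w2 w3 where w: "w1 : pth_polys p" "w2 : pth_polys p" "w3 : pth_polys p"
   "cmp i j a1 = ?e * shear u w1" "cmp i j a2 = ?e * shear u w2" "cmp i j a3 = ?e * shear u w3" by metis
  have "?e ~= 0" using False w(4) by auto
  then obtain c where c: "c ~= 0" "primitive (cc c * ?e)" using exists_primitive_multiple by blast
  define f0 where "f0 = cc c * ?e"
  define v where "v w = cc (1 / c) * w" for w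
  have v: "v w : pth_polys p" "cmp i j f = f0 * shear u (v w)" if "w : pth_polys p" "cmp i j f = ?e * shear u w" for w f
  proof -
   show "v w : pth_polys p" unfolding v_def by (rule subringD(4)[OF subring_pth_polys XY_pth(3) that(1)])
   have "cc c * cc (1 / c) = 1" using c(1) by (simp flip: cc.hom_mult)
   then have "f0 * shear u (v w) = ?e * shear u w"
    unfolding f0_def v_def by (simp add: shear.hom_mult)
   then show "cmp i j f = f0 * shear u (v w)" using that(2) by simp
  qed
  note v1 = v[OF w(1) w(4)] and v2 = v[OF w(2) w(5)] and v3 = v[OF w(3) w(6)]
  have prim: "primitive f0" using c(2) by (simp add: f0_def)
  have int: "shear u (v w1) : polys2 V" "shear u (v w2) : polys2 V" "shear u (v w3) : polys2 V"
   using gauss_lemma[OF prim] cmp_int[OF a(1) ij] cmp_int[OF a(2) ij] cmp_int[OF a3 ij] v1(2) v2(2) v3(2) by auto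
  have f0: "f0 ~= 0" using c `?e ~= 0` by (simp add: f0_def)
  have "?G * cmp i j a1 - ?F * cmp i j a2 = of_nat p * cmp i j a3"
   using arg_cong[OF eq, of "cmp i j"] by (simp add: cmp_diff cmp_F cmp_G cmp_p)
  then have "f0 * (?G * shear u (v w1) - ?F * shear u (v w2)) = f0 * (of_nat p * shear u (v w3))"
   unfolding v1(2) v2(2) v3(2) by (simp add: algebra_simps)
  then have "?G * shear u (v w1) - ?F * shear u (v w2) = of_nat p * shear u (v w3)" using f0 by simp
  from pth_polys_regular[OF v1(1) v2(1) v3(1) int G this]
  obtain q1 q2 where q: "q1 : polys_over base" "q2 : polys_over base"
   "shear u (v w1) = ?F * pcompose q1 nrm + of_nat p * pcompose q2 nrm" by blast
  \<comment> \<open>The component and its nonzero cofactor are both invariant, hence so is the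
    remaining factor \<open>f0\<close>.\<close>
  have f0_inv: "f0 : inv_ring"
  proof -
   have "act M f0 = f0" if M: "M : P" for M
   proof -
    have "act M (f0 * shear u (v w1)) = f0 * shear u (v w1)" using cmp_inv[OF a(1) M, of i j] unfolding v1(2) .
    then have "act M f0 * shear u (v w1) = f0 * shear u (v w1)" by (simp add: act.hom_mult pth_invariant[OF v1(1) M])
    moreover have "shear u (v w1) ~= 0" using False v1(2) by auto
    ultimately show ?thesis by simp
   qed
   then show ?thesis using prim by (simp add: inv_ring_def primitive_def)
  qed
  have "cmp i j a1 = ?F * (f0 * pcompose q1 nrm) + of_nat p * (f0 * pcompose q2 nrm)"
   unfolding v1(2) q(3) by (simp add: algebra_simps)
  moreover have "f0 * pcompose q1 nrm : inv_ring" "f0 * pcompose q2 nrm : inv_ring"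
   using f0_inv pcompose_nrm_inv q(1,2) subringD(4)[OF S] by auto
  ultimately show ?thesis by blast
 qed
 then have "\<forall>i j. \<exists>b c. i < p --> j < p --> b : inv_ring & c : inv_ring & cmp i j a1 = ?F * b + of_nat p * c" by blast
 then obtain b c where bc: "!!i j. i < p ==> j < p ==> b i j : inv_ring & c i j : inv_ring & cmp i j a1 = ?F * b i j + of_nat p * c i j"
  by metis
 have "a1 = (\<Sum>i<p. \<Sum>j<p. cmp i j a1)" by (rule sum_cmp[symmetric])
 also have "\<dots> = (\<Sum>i<p. \<Sum>j<p. ?F * b i j + of_nat p * c i j)" using bc by (intro sum.cong refl) auto
 also have "\<dots> = ?F * (\<Sum>i<p. \<Sum>j<p. b i j) + of_nat p * (\<Sum>i<p. \<Sum>j<p. c i j)"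
  by (simp add: sum.distrib sum_distrib_left)
 finally have "a1 = ?F * (\<Sum>i<p. \<Sum>j<p. b i j) + of_nat p * (\<Sum>i<p. \<Sum>j<p. c i j)" .
 moreover have "(\<Sum>i<p. \<Sum>j<p. b i j) : inv_ring" "(\<Sum>i<p. \<Sum>j<p. c i j) : inv_ring"
  using bc by (auto intro!: subring_sum[OF S])
 ultimately show ?thesis by blast
qed

text \<open>By Gauss's lemma this makes \<open>F(X^p)\<close> a nonzerodivisor modulo
  \<open>p\<close>.\<close>

lemma primitive_poly_X_pow:
 fixes F :: "int poly"
 assumes "lead_coeff F = 1"
 shows "primitive (poly (map_poly of_int F) (var_X ^ p))"
proof (rule primitiveI)
 show "poly (map_poly of_int F) (var_X ^ p) : polys2 V"
  using poly_int_mem[OF subring_inv_ring X_pow_inv] by (simp add: inv_ring_def)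
 have "poly (map_poly of_int F) (var_X ^ p) = (\<Sum>i\<le>degree F. cc (of_int (coeff F i)) * var_X ^ (p * i) * var_Y ^ 0 :: 'a poly poly)"
  by (simp add: poly_altdef coeff_map_poly degree_map_poly power_mult cc.hom_of_int)
 then have "coeff (coeff (poly (map_poly of_int F) (var_X ^ p)) 0) (p * degree F)
   = (\<Sum>i\<le>degree F. if i = degree F then of_int (coeff F i) else (0 :: 'a))"
  unfolding coeff_sum using p_pos by (simp only: coeff_sum coeff_monomial) (auto intro!: sum.cong)
 then show "coeff (coeff (poly (map_poly of_int F) (var_X ^ p)) 0) (p * degree F) = (1 :: 'a)"
  using assms by simp
qed

end

section \<open>Roots of unity\<close>

text \<open>Evaluate at \<open>T = 1\<close> the polynomial \<open>1 + T + ... + T^(p-1)\<close>,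
  which is the product of the \<open>T - w^k\<close> for \<open>0 < k < p\<close>.\<close>

lemma prod_one_minus_roots_of_unity:
 fixes w :: "'a :: field_char_0"
 assumes p: "prime (p :: nat)" and w: "w ^ p = 1" "w ~= 1"
 shows "of_nat p = (\<Prod>k\<in>{1..<p}. 1 - w ^ k)"
proof -
 have p0: "p > 0" by (rule prime_gt_0_nat[OF p])
 define Q where "Q = (\<Prod>k<p. [:- (w ^ k), 1:])"
 define R where "R = (\<Sum>k<p. monom 1 k :: 'a poly)"
 have R: "monom 1 p - 1 = [:-1, 1:] * R"
 proof -
  have "[:-1, 1:] * R = (\<Sum>k<p. monom 1 (Suc k) - monom 1 k)"
   unfolding R_def sum_distrib_left by (intro sum.cong refl) (simp add: monom_Suc)
  also have "\<dots> = monom 1 p - monom 1 0" by (rule sum_lessThan_telescope)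
  finally show ?thesis by (simp add: monom_0 one_pCons)
 qed
 have degQ: "degree Q = p" "lead_coeff Q = 1"
  unfolding Q_def by (simp add: degree_prod_eq_sum_degree) (simp only: lead_coeff_prod, simp)
 define T where "T = monom 1 p - (1 :: 'a poly)"
 have degT: "degree T <= p" "coeff T p = 1" unfolding T_def using p0
  by (auto intro!: degree_diff_le degree_monom_le simp: coeff_1)
 \<comment> \<open>Both are monic of degree \<open>p\<close> and vanish at the \<open>p\<close>
   distinct powers of \<open>w\<close>.\<close>
 have "T = Q"
 proof (rule ccontr)
  assume "T ~= Q"
  then have nz: "T - Q ~= 0" by simp
  have "degree (T - Q) < p" using degT degQ p0 by (intro degree_lessI) (auto intro: degree_diff_le)
  moreover have "p <= card {x. poly (T - Q) x = 0}"
  proof -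
   have inj: "inj_on (\<lambda>k. w ^ k) {..<p}"
    by (rule inj_onI) (use power_eq_imp_mod_eq[OF p w] in fastforce)
   have "(\<lambda>k. w ^ k) ` {..<p} <= {x. poly (T - Q) x = 0}"
   proof
    fix x assume "x : (\<lambda>k. w ^ k) ` {..<p}"
    then obtain k where k: "k < p" "x = w ^ k" by auto
    have "poly Q x = 0" unfolding Q_def poly_prod k(2) using k(1) by (intro prod_zero) auto
    moreover have "x ^ p = 1" using w(1) unfolding k(2) by (simp add: power_mult[symmetric] mult.commute[of k]) (simp add: power_mult)
    ultimately show "x : {x. poly (T - Q) x = 0}" by (simp add: T_def poly_monom)
   qed
   from card_mono[OF poly_roots_finite[OF nz] this] show ?thesis by (simp add: card_image[OF inj])
  qed
  ultimately show False using card_poly_roots_bound[OF nz] by simp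
 qed
 moreover have "Q = [:-1, 1:] * (\<Prod>k\<in>{1..<p}. [:- (w ^ k), 1:])"
  unfolding Q_def using p0 by (simp add: lessThan_atLeast0 prod.atLeast_Suc_lessThan)
 ultimately have "[:-1, 1:] * R = [:-1, 1:] * (\<Prod>k\<in>{1..<p}. [:- (w ^ k), 1:])"
  using R by (simp add: T_def)
 then have "R = (\<Prod>k\<in>{1..<p}. [:- (w ^ k), 1:])" by (subst (asm) mult_left_cancel) simp_all
 then have "poly R 1 = poly (\<Prod>k\<in>{1..<p}. [:- (w ^ k), 1:]) 1" by simp
 then show ?thesis by (simp add: R_def poly_sum poly_monom poly_prod)
qed

context valuation_subring
begin

lemma root_of_unity_mem:
 assumes "w ^ p = 1" "p > 0"
 shows "w : V"
proof (cases "w : V")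
 case False
 then have "inverse w : V" using val by blast
 moreover have "w = inverse w ^ (p - 1)"
 proof -
  have "w ~= 0" using assms by (auto simp: power_0_left)
  obtain q where "p = Suc q" using assms(2) by (cases p) auto
  then have "w * w ^ q = 1" using assms(1) by simp
  then show ?thesis using `w ~= 0` `p = Suc q` by (simp add: power_inverse field_simps)
 qed
 ultimately show ?thesis using subring_power[OF V] by metis
qed

text \<open>The binomial coefficient contributes a factor \<open>p\<close>. If \<open>u\<close> is
  not in \<open>V\<close>, then \<open>p u^i\<close> is \<open>p u^(p-1)\<close> times a power of
  the integral element \<open>1 / u\<close>.\<close>

lemma binomial_term_mem:
 fixes u :: 'a
 assumes p: "prime p" and pu: "of_nat p * u ^ (p - 1) : V" and i: "0 < i" "i < p"
 shows "of_nat (p choose i) * u ^ i : V"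
proof -
 have "p dvd p choose i" using i p by (intro dvd_choose_prime) auto
 then obtain m where m: "p choose i = p * m" by blast
 have "of_nat p * u ^ i : V"
 proof (cases "u : V")
  case True
  then show ?thesis by (rule subringD(4)[OF V subring_of_nat[OF V] subring_power[OF V]])
 next
  case False
  then have "u ~= 0" "inverse u : V" using val subringD(2)[OF V] by auto
  then have "(of_nat p * u ^ (p - 1)) * inverse u ^ (p - 1 - i) : V"
   by (intro subringD(4)[OF V pu] subring_power[OF V])
  moreover have "u ^ (p - 1) = u ^ i * u ^ (p - 1 - i)" using i by (simp add: power_add[symmetric])
  moreover have "u ^ (p - 1 - i) * inverse u ^ (p - 1 - i) = 1"
   using `u ~= 0` by (simp flip: power_mult_distrib)
  ultimately show ?thesis by (simp add: mult.assoc)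
 qed
 then have "of_nat m * (of_nat p * u ^ i) : V" by (rule subringD(4)[OF V subring_of_nat[OF V]])
 then show ?thesis by (simp add: m mult_ac)
qed

end

lemma (in valuation_subring) norm_polys2:
 fixes u :: 'a
 assumes p: "prime p" and pu: "of_nat p * u ^ (p - 1) : V"
 shows "(var_Y + cc u * var_X) ^ p - cc (u ^ p) * var_X ^ p : polys2 V"
proof -
 have "(cc u * var_X + var_Y) ^ p = (\<Sum>k\<le>p. of_nat (p choose k) * (cc u * var_X) ^ k * var_Y ^ (p - k))"
  by (rule binomial_ring)
 also have "\<dots> = (\<Sum>k<p. of_nat (p choose k) * (cc u * var_X) ^ k * var_Y ^ (p - k)) + (cc u * var_X) ^ p"
  by (simp add: lessThan_Suc_atMost[symmetric])
 finally have "(var_Y + cc u * var_X) ^ p - cc (u ^ p) * var_X ^ p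
   = (\<Sum>k<p. of_nat (p choose k) * (cc u * var_X) ^ k * var_Y ^ (p - k))"
  by (simp add: add.commute power_mult_distrib cc.hom_power)
 also have "\<dots> = (\<Sum>k<p. cc (of_nat (p choose k) * u ^ k) * (var_X ^ k * var_Y ^ (p - k)))"
  by (simp add: power_mult_distrib cc.hom_power cc.hom_mult cc.hom_of_nat mult.assoc)
 also have "\<dots> : polys2 V"
 proof (intro subring_sum[OF subring_polys2[OF V]] subringD(4)[OF subring_polys2[OF V]] subring_power[OF subring_polys2[OF V]] var_polys2[OF V])
  fix k assume "k : {..<p}"
  then have "of_nat (p choose k) * u ^ k : V"
   using binomial_term_mem[OF p pu, of k] subringD(1)[OF V] by (cases "k = 0") auto
  then show "cc (of_nat (p choose k) * u ^ k) : polys2 V" by (simp add: cc_polys2[OF V])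
 qed
 finally show ?thesis .
qed

section \<open>Finite groups of prime exponent in dimension two\<close>

definition mpow :: "'a :: comm_ring_1^2^2 => nat => 'a^2^2" where
 "mpow M n = ((**) M ^^ n) (mat 1)"

lemma mpow_simps [simp]: "mpow M 0 = mat 1" "mpow M (Suc n) = M ** mpow M n"
 by (simp_all add: mpow_def)

lemma mpow_add: "mpow M (m + n) = mpow M m ** mpow M n"
 by (induction m) (simp_all add: matrix_mul_assoc)

lemma matrix2_eq_iff: "M = N \<longleftrightarrow> M $ 1 $ 1 = N $ 1 $ 1 & M $ 1 $ 2 = N $ 1 $ 2 & M $ 2 $ 1 = N $ 2 $ 1 & M $ 2 $ 2 = N $ 2 $ (2 :: 2)"
 for M N :: "'a^2^2"
 by (simp add: Finite_Cartesian_Product.vec_eq_iff forall_2 conj_assoc)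

lemma mult2_nth: "(M ** N) $ i $ j = M $ i $ 1 * N $ 1 $ j + M $ i $ 2 * N $ 2 $ j" for M N :: "'a :: comm_ring_1^2^2"
 by (simp add: matrix_matrix_mult_def sum_2)

lemma mat1_nth: "(mat 1 :: 'a :: comm_ring_1^2^2) $ i $ j = (if i = j then 1 else 0)"
 by (simp add: Finite_Cartesian_Product.mat_def)

definition scalar_matrix :: "'a :: comm_ring_1^2^2 => bool" where
 "scalar_matrix M \<longleftrightarrow> M $ 1 $ 2 = 0 & M $ 2 $ 1 = 0 & M $ 1 $ 1 = M $ 2 $ 2"

lemma mpow_upper:
 assumes "M $ 2 $ 1 = (0 :: 'a :: comm_ring_1)"
 shows "mpow M n $ 2 $ 1 = 0" "mpow M n $ 1 $ 1 = (M $ 1 $ 1) ^ n" "mpow M n $ 2 $ 2 = (M $ 2 $ 2) ^ n"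
 using assms by (induction n) (auto simp: mult2_nth mat1_nth)

text \<open>In characteristic zero this shows that an invertible triangular matrix of finite order
  with equal diagonal entries is diagonal.\<close>

lemma mpow_upper_unipotent:
 assumes "M $ 2 $ 1 = (0 :: 'a :: comm_ring_1)" "M $ 1 $ 1 = M $ 2 $ 2"
 shows "mpow M (Suc n) $ 1 $ 2 = of_nat (Suc n) * (M $ 1 $ 1) ^ n * M $ 1 $ 2"
 using assms by (induction n) (auto simp: mult2_nth mat1_nth mpow_upper[OF assms(1)] algebra_simps)

text \<open>A matrix with nonzero discriminant commutes only with combinations of itself and the
  identity. So the trace-free part of the second matrix is \<open>y\<close> times that of the first,
  and equal trace and determinant force \<open>y^2 = 1\<close>. The sign \<open>-1\<close> exchanges
  the two eigenvalues.\<close>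

lemma commuting_conjugates:
 fixes a b c d :: "'a :: field"
 assumes comm: "b * c' = b' * c" "b * (a' - d') = b' * (a - d)" "c * (a' - d') = c' * (a - d)"
  and tr: "a' + d' = a + d" and det: "a' * d' - b' * c' = a * d - b * c"
  and disc: "(a - d)\<^sup>2 + 4 * b * c ~= 0" and two: "(2 :: 'a) ~= 0"
 shows "(a' = a & b' = b & c' = c & d' = d) \<or> (a' = d & b' = - b & c' = - c & d' = a)"
proof -
 define e e' where "e = a - d" and "e' = a' - d'"
 have q: "e'\<^sup>2 + 4 * b' * c' = e\<^sup>2 + 4 * b * c"
 proof -
  have "e'\<^sup>2 + 4 * b' * c' = (a' + d')\<^sup>2 - 4 * (a' * d' - b' * c')" by (simp add: e'_def power2_eq_square algebra_simps)
  also have "\<dots> = e\<^sup>2 + 4 * b * c" unfolding tr det by (simp add: e_def power2_eq_square algebra_simps)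
  finally show ?thesis .
 qed
 have "\<exists>y. e' = y * e & b' = y * b & c' = y * c"
 proof (cases "b = 0")
  case False
  then show ?thesis using comm by (intro exI[of _ "b' / b"]) (auto simp: e_def e'_def field_simps)
 next
  case b: True
  then have e: "e ~= 0" using disc by (auto simp: e_def)
  then have "b' = 0" using comm(2) b by (simp add: e_def)
  then show ?thesis using comm(3) b e by (intro exI[of _ "e' / e"]) (auto simp: e_def e'_def field_simps)
 qed
 then obtain y where y: "e' = y * e" "b' = y * b" "c' = y * c" by blast
 then have "(y\<^sup>2 - 1) * (e\<^sup>2 + 4 * b * c) = 0" using q by (simp add: power2_eq_square algebra_simps)
 then have "y\<^sup>2 - 1 = 0" using disc unfolding e_def[symmetric] by simp
 then have "(y - 1) * (y + 1) = 0" by (simp add: power2_eq_square algebra_simps)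
 then consider "y = 1" | "y = - 1" by (auto simp: eq_neg_iff_add_eq_0)
 then show ?thesis
 proof cases
  case 1
  then have "a' - d' = a - d" using y e_def e'_def by simp
  then have "(a' - d') + (a' + d') = (a - d) + (a + d)" using tr by simp
  then have "2 * a' = 2 * a" by simp
  then show ?thesis using 1 y tr two by auto
 next
  case 2
  then have "a' - d' = d - a" using y e_def e'_def by simp
  then have "(a' - d') + (a' + d') = (d - a) + (a + d)" using tr by simp
  then have "2 * a' = 2 * d" by simp
  then show ?thesis using 2 y tr two by auto
 qed
qed

text \<open>The orbits of \<open>f\<close> have \<open>1\<close> or \<open>p\<close> elements. If
  \<open>x0\<close> were the only fixed point, the size of \<open>Om\<close> would be
  \<open>1\<close> modulo \<open>p\<close>.\<close>

lemma exists_second_fixpoint: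
 assumes fin: "finite Om" and f: "!!x. x : Om ==> f x : Om" and p: "prime (p :: nat)"
  and fp: "!!x. x : Om ==> (f ^^ p) x = x" and x0: "x0 : Om" "f x0 = x0" and dvd: "p dvd card Om"
 shows "\<exists>x\<in>Om. x ~= x0 & f x = x"
proof (rule ccontr)
 assume no: "\<not> ?thesis"
 define orb where "orb x = (\<lambda>k. (f ^^ k) x) ` {..<p}" for x
 have p0: "p > 0" by (rule prime_gt_0_nat[OF p])
 have fk: "(f ^^ k) x : Om" if "x : Om" for x k using that f by (induction k) auto
 have fpm: "(f ^^ (p * m)) x = x" if "x : Om" for x m
  using fp[OF that] by (induction m) (simp_all add: funpow_add)
 have mod: "(f ^^ k) x = (f ^^ (k mod p)) x" if "x : Om" for x k
 proof -
  have "(f ^^ k) x = (f ^^ (k mod p + p * (k div p))) x" by simp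
  also have "\<dots> = (f ^^ (k mod p)) x" unfolding funpow_add using fpm[OF that] by simp
  finally show ?thesis .
 qed
 \<comment> \<open>As \<open>d\<close> is prime to \<open>p\<close>, some multiple of
   \<open>d\<close> is one more than a multiple of \<open>p\<close>.\<close>
 have fixed: "f x = x" if x: "x : Om" and d: "0 < d" "d < p" "(f ^^ d) x = x" for x d
 proof -
  have "\<not> p dvd d" using d by (simp add: nat_dvd_not_less)
  then have "coprime d p" using prime_imp_coprime[OF p] coprime_commute by blast
  then obtain a b where ab: "d * a = p * b + 1"
   using coprime_bezout_strong[of d p] prime_gt_1_nat[OF p] by auto
  have "(f ^^ (d * a)) x = x" using d(3) by (induction a) (simp_all add: funpow_add)
  moreover have "(f ^^ (p * b + 1)) x = f x" using fpm[OF x, of b] by (simp add: funpow_swap1)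
  ultimately show ?thesis using ab by simp
 qed
 have cardorb: "card (orb x) = p" if x: "x : Om - {x0}" for x
 proof -
  have "inj_on (\<lambda>k. (f ^^ k) x) {..<p}"
  proof (rule linorder_inj_onI)
   fix i j assume ij: "i < j" "i : {..<p}" "j : {..<p}"
   show "(f ^^ i) x ~= (f ^^ j) x"
   proof
    assume "(f ^^ i) x = (f ^^ j) x"
    then have "(f ^^ (p - i)) ((f ^^ i) x) = (f ^^ (p - i)) ((f ^^ j) x)" by simp
    then have "(f ^^ (p - i + i)) x = (f ^^ (p - i + j)) x" by (simp only: funpow_add o_apply)
    moreover have "p - i + i = p" "p - i + j = (j - i) + p" using ij by auto
    ultimately have "(f ^^ p) x = (f ^^ (j - i)) ((f ^^ p) x)" by (simp only: funpow_add o_apply)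
    then have "x = (f ^^ (j - i)) x" using fp x by simp
    then have "f x = x" using fixed[of x "j - i"] ij x by auto
    then show False using no x by blast
   qed
  qed auto
  then show ?thesis unfolding orb_def by (simp add: card_image)
 qed
 have orb_sub: "orb x <= Om - {x0}" if x: "x : Om - {x0}" for x
 proof
  fix y assume "y : orb x"
  then obtain k where k: "k < p" "y = (f ^^ k) x" unfolding orb_def by auto
  have "y ~= x0"
  proof
   assume "y = x0"
   have "(f ^^ m) x0 = x0" for m by (induction m) (simp_all add: x0)
   then have "(f ^^ (p - k)) y = x0" using `y = x0` by simp
   moreover have "(f ^^ (p - k)) y = (f ^^ (p - k + k)) x" unfolding k(2) by (simp only: funpow_add o_apply)
   ultimately show False using k(1) fp[of x] x by simp
  qed
  then show "y : Om - {x0}" using fk x k by auto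
 qed
 have orb_self: "x : orb x" for x unfolding orb_def using p0 by (intro image_eqI[of _ _ 0]) auto
 have orb_eq: "orb y = orb x" if x: "x : Om" and y: "y : orb x" for x y
 proof -
  obtain k where k: "k < p" "y = (f ^^ k) x" using y unfolding orb_def by auto
  have yO: "y : Om" using fk[OF x] k by simp
  have xk: "x = (f ^^ (p - k)) y"
  proof -
   have "(f ^^ (p - k)) y = (f ^^ (p - k + k)) x" unfolding k(2) by (simp only: funpow_add o_apply)
   then show ?thesis using k(1) fp[OF x] by simp
  qed
  have sub: "orb b <= orb a" if a: "a : Om" and b: "b = (f ^^ l) a" for a b l
  proof
   fix z assume "z : orb b"
   then obtain m where "z = (f ^^ m) b" unfolding orb_def by auto
   then have "z = (f ^^ (m + l)) a" unfolding b by (simp add: funpow_add)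
   then have "z = (f ^^ ((m + l) mod p)) a" using mod[OF a] by simp
   then show "z : orb a" unfolding orb_def using p0 by auto
  qed
  show ?thesis using sub[OF x k(2)] sub[OF yO xk] by (rule equalityI)
 qed
 have "p dvd card (\<Union>(orb ` (Om - {x0})))"
 proof (rule dvd_partition)
  have un: "\<Union>(orb ` (Om - {x0})) <= Om - {x0}" using orb_sub by blast
  show "finite (\<Union>(orb ` (Om - {x0})))" by (rule finite_subset[OF un]) (use fin in auto)
  show "\<forall>c\<in>orb ` (Om - {x0}). p dvd card c" using cardorb by auto
  show "\<forall>c1\<in>orb ` (Om - {x0}). \<forall>c2\<in>orb ` (Om - {x0}). c1 ~= c2 --> c1 \<inter> c2 = {}"
  proof (intro ballI impI)
   fix c1 c2 assume c1: "c1 : orb ` (Om - {x0})" and c2: "c2 : orb ` (Om - {x0})" and ne: "c1 ~= c2"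
   obtain x y where x: "c1 = orb x" "x : Om" and y: "c2 = orb y" "y : Om" using c1 c2 by auto
   show "c1 \<inter> c2 = {}"
   proof (rule equals0I)
    fix z assume "z : c1 \<inter> c2"
    then have z: "z : orb x" "z : orb y" using x y by simp_all
    have "orb z = c1" "orb z = c2" using orb_eq[OF x(2) z(1)] orb_eq[OF y(2) z(2)] x y by simp_all
    then show False using ne by simp
   qed
  qed
 qed
 moreover have "\<Union>(orb ` (Om - {x0})) = Om - {x0}" using orb_sub orb_self by blast
 ultimately have 1: "p dvd card Om - 1" using x0(1) fin by simp
 have "card Om > 0" using x0(1) fin card_gt_0_iff[of Om] by blast
 then have "card Om - (card Om - 1) = 1" by simp
 then have "p dvd 1" using dvd_diff_nat[OF dvd 1] by simp
 then show False using prime_gt_1_nat[OF p] by simp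
qed

lemma mpow_conj:
 assumes "C ** C' = mat 1" "C' ** C = mat 1"
 shows "mpow (C' ** M ** C) n = C' ** mpow M n ** C"
proof (induction n)
 case (Suc n)
 have "mpow (C' ** M ** C) (Suc n) = C' ** M ** (C ** C') ** mpow M n ** C" using Suc by (simp add: matrix_mul_assoc)
 then show ?case using assms by (simp add: matrix_mul_assoc)
qed (use assms in simp)

text \<open>An eigenvector over the field can be scaled so that one coordinate is \<open>1\<close>
  and the other lies in \<open>V\<close>. A unit vector then completes it to a basis over
  \<open>V\<close>; these are the columns of \<open>C\<close>.\<close>

lemma (in valuation_subring) exists_triangular_conjugate:
 fixes M :: "'a^2^2"
 assumes alg: "!!q :: 'a poly. degree q > 0 ==> \<exists>x. poly q x = 0" and M: "!!i j. M $ i $ j : V"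
 shows "\<exists>C C' :: 'a^2^2. (\<forall>i j. C $ i $ j : V) & (\<forall>i j. C' $ i $ j : V) & C ** C' = mat 1 \<and>
  C' ** C = mat 1 & (C' ** M ** C) $ 2 $ 1 = 0"
proof -
 define a b c d where "a = M $ 1 $ 1" and "b = M $ 1 $ 2" and "c = M $ 2 $ 1" and "d = M $ 2 $ 2"
 note defs = a_def[symmetric] b_def[symmetric] c_def[symmetric] d_def[symmetric]
 have "\<exists>w1 w2 x. (w1 ~= 0 \<or> w2 ~= 0) & a * w1 + b * w2 = x * w1 & c * w1 + d * w2 = x * w2"
 proof (cases "b = 0")
  case True
  then show ?thesis by (intro exI[of _ 0] exI[of _ 1] exI[of _ d]) simp
 next
  case False
  \<comment> \<open>For a root \<open>x\<close> of the characteristic polynomial,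
    \<open>(b, x - a)\<close> is an eigenvector, and it is nonzero because \<open>b\<close>
    is.\<close>
  obtain x where "poly [:a * d - b * c, - (a + d), 1:] x = 0" using alg[of "[:a * d - b * c, - (a + d), 1:]"] by auto
  then have "c * b + d * (x - a) = x * (x - a)" by (simp add: algebra_simps)
  then show ?thesis using False by (intro exI[of _ b] exI[of _ "x - a"] exI[of _ x]) (simp add: algebra_simps)
 qed
 then obtain w1 w2 x where w: "w1 ~= 0 \<or> w2 ~= 0" "a * w1 + b * w2 = x * w1" "c * w1 + d * w2 = x * w2" by blast
 define mk :: "'a => 'a => 'a => 'a => 'a^2^2" where
  "mk p q r s = (\<chi> i j. if i = 1 then (if j = 1 then p else q) else (if j = 1 then r else s))" for p q r s
 have mk: "mk p q r s $ 1 $ 1 = p" "mk p q r s $ 1 $ 2 = q" "mk p q r s $ 2 $ 1 = r" "mk p q r s $ 2 $ 2 = s" for p q r s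
  by (simp_all add: mk_def)
 have mkV: "\<forall>i j. mk p q r s $ i $ j : V" if "p : V" "q : V" "r : V" "s : V" for p q r s
  using that by (simp add: mk_def)
 note v = subringD[OF V]
 show ?thesis
 proof (cases "w1 ~= 0 & w2 / w1 : V")
  case True
  define t where "t = w2 / w1"
  have "t : V" "w2 = t * w1" using True by (simp_all add: t_def)
  then have e: "a + b * t = x" "c + d * t = x * t" using w(2,3) True by (simp_all add: field_simps) (simp_all flip: mult.assoc distrib_right)
  have ce: "c = a * t + b * t * t - d * t" using e(2) unfolding e(1)[symmetric] by (simp add: algebra_simps)
  show ?thesis
   by (rule exI[of _ "mk 1 0 t 1"], rule exI[of _ "mk 1 0 (- t) 1"])
    (use `t : V` v(1,2,5) in "simp add: mkV matrix2_eq_iff mult2_nth mat1_nth mk defs, simp add: ce algebra_simps")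
 next
  case False
  define t where "t = w1 / w2"
  have w2: "w2 ~= 0"
  proof
   assume "w2 = 0"
   then show False using False w(1) v(2) by simp
  qed
  have "t : V"
  proof (cases "w1 = 0")
   case True
   then show ?thesis using v(2) by (simp add: t_def)
  next
   case w1: False
   then show ?thesis using False div_V_cases[of w1 w2] by (auto simp: t_def)
  qed
  have "w1 = t * w2" using w2 by (simp add: t_def)
  then have e: "a * t + b = x * t" "c * t + d = x" using w(2,3) w2 by (simp_all flip: mult.assoc distrib_right)
  have be: "b = c * t * t + d * t - a * t" using e(1) unfolding e(2)[symmetric] by (simp add: algebra_simps)
  show ?thesis
   by (rule exI[of _ "mk t 1 1 0"], rule exI[of _ "mk 0 1 1 (- t)"])
    (use `t : V` v(1,2,5) in "simp add: mkV matrix2_eq_iff mult2_nth mat1_nth mk defs, simp add: be algebra_simps")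
 qed
qed

text \<open>A nonscalar element of a \<open>p\<close>-group of exponent \<open>p\<close> is central: for odd \<open>p\<close>, otherwise conjugation
 by it has a second fixed point on its conjugacy class, and a conjugator \<open>g\<close> swaps the two
 eigenlines, so \<open>g\<^sup>2\<close> and hence \<open>g\<close> commutes with it.\<close>

lemma nonscalar_central:
 fixes P :: "('a :: field_char_0^2^2) set"
 assumes G: "finite_matrix_group P" and p: "prime (p :: nat)" and card: "card P = p ^ n"
  and expo: "!!M. M : P ==> mpow M p = mat 1"
  and s: "s : P" and disc: "(s $ 1 $ 1 - s $ 2 $ 2)\<^sup>2 + 4 * s $ 1 $ 2 * s $ 2 $ 1 ~= 0" and M: "M : P"
 shows "M ** s = s ** M"
proof (rule ccontr)
 assume ne: "M ** s ~= s ** M"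
 interpret finite_matrix_group P by fact
 let ?I = "mat 1 :: 'a^2^2"
 obtain p' where p': "p = Suc p'" using prime_gt_0_nat[OF p] by (cases p) auto
 define iv where "iv g = mpow g p'" for g :: "'a^2^2"
 have mpow_P: "mpow g k : P" if "g : P" for g k using that one closed by (induction k) auto
 have iv: "iv g : P" "g ** iv g = ?I" "iv g ** g = ?I" if g: "g : P" for g
 proof -
  show "iv g : P" unfolding iv_def by (rule mpow_P[OF g])
  show r: "g ** iv g = ?I" using expo[OF g] by (simp add: iv_def p')
  obtain k where k: "k ** g = ?I" using inverse[OF g] by blast
  have "iv g = k ** (g ** iv g)" using k by (simp add: matrix_mul_assoc)
  then show "iv g ** g = ?I" using r k by simp
 qed
 have canc: "g ** (iv g ** x) = x" "iv g ** (g ** x) = x" if "g : P" for g x :: "'a^2^2"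
  using iv[OF that] by (simp_all add: matrix_mul_assoc)
 show False
 proof (cases "p = 2")
  case True
  \<comment> \<open>A group of exponent two is commutative: \<open>M\<close>, \<open>s\<close> and
    \<open>M ** s\<close> are their own inverses.\<close>
  have sq: "g ** g = ?I" if "g : P" for g using expo[OF that] True by (simp add: numeral_2_eq_2)
  have "(M ** s) ** (M ** s) = ?I" by (rule sq[OF closed[OF M s]])
  then have "M ** ((M ** s) ** (M ** s)) ** s = M ** s" by simp
  moreover have "M ** ((M ** s) ** (M ** s)) ** s = (M ** M) ** (s ** M) ** (s ** s)" by (simp add: matrix_mul_assoc)
  ultimately show False using ne sq[OF M] sq[OF s] by simp
 next
  case False
  then have odd: "odd p" using p prime_odd_nat[of p] prime_ge_2_nat[OF p] by linarith
  define ph where "ph g = g ** s ** iv g" for g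
  \<comment> \<open>The conjugacy class of \<open>s\<close>. Its size divides the order of the
    group, hence is a power of \<open>p\<close>, and it exceeds \<open>1\<close> by
    assumption.\<close>
  define Om where "Om = ph ` P"
  define Z where "Z = {g : P. g ** s = s ** g}"
  have phi_eq: "ph g = ph h \<longleftrightarrow> iv h ** g : Z" if g: "g : P" and h: "h : P" for g h
  proof
   assume "ph g = ph h"
   then have "iv h ** (ph g ** g) = iv h ** (ph h ** g)" by simp
   moreover have "ph g ** g = g ** s" unfolding ph_def using iv[OF g] by (simp flip: matrix_mul_assoc)
   moreover have "iv h ** (ph h ** g) = s ** (iv h ** g)" unfolding ph_def using canc(2)[OF h] by (simp flip: matrix_mul_assoc)
   ultimately have "(iv h ** g) ** s = s ** (iv h ** g)" by (simp add: matrix_mul_assoc)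
   then show "iv h ** g : Z" unfolding Z_def using closed[OF iv(1)[OF h] g] by simp
  next
   assume "iv h ** g : Z"
   then have e: "(iv h ** g) ** s = s ** (iv h ** g)" by (simp add: Z_def)
   have "ph g = h ** (((iv h ** g) ** s) ** iv g)" unfolding ph_def using canc(1)[OF h] by (simp flip: matrix_mul_assoc)
   also have "\<dots> = ph h" unfolding e ph_def using iv(2)[OF g] by (simp flip: matrix_mul_assoc)
   finally show "ph g = ph h" .
  qed
  have fiber: "card {g : P. ph g = y} = card Z" if y: "y : Om" for y
  proof -
   obtain h where h: "h : P" "y = ph h" using y unfolding Om_def by blast
   have "bij_betw (\<lambda>z. h ** z) Z {g : P. ph g = y}"
   proof (rule bij_betwI[of _ _ _ "\<lambda>g. iv h ** g"])
    show "(\<lambda>z. h ** z) : Z \<rightarrow> {g : P. ph g = y}"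
    proof
     fix z assume z: "z : Z"
     then have "z : P" by (simp add: Z_def)
     then have "h ** z : P" by (rule closed[OF h(1)])
     then show "h ** z : {g : P. ph g = y}" using phi_eq[OF _ h(1), of "h ** z"] canc(2)[OF h(1)] z h(2) by simp
    qed
    show "(\<lambda>g. iv h ** g) : {g : P. ph g = y} \<rightarrow> Z"
    proof
     fix g assume "g : {g : P. ph g = y}"
     then show "iv h ** g : Z" using phi_eq[OF _ h(1), of g] h(2) by simp
    qed
   qed (simp_all add: canc[OF h(1)])
   then show ?thesis by (rule bij_betw_same_card[symmetric])
  qed
  have "card P = (\<Sum>y\<in>Om. card {g : P. ph g = y})"
   using sum.image_gen[OF finite, of "\<lambda>_. 1 :: nat" ph] by (simp add: Om_def)
  also have "\<dots> = card Om * card Z" using fiber by simp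
  finally have "card Om dvd p ^ n" using card by simp
  then obtain k where k: "card Om = p ^ k" using divides_primepow_nat[OF p] by blast
  have fin: "finite Om" unfolding Om_def using finite by simp
  have one_iv: "iv ?I = ?I" using iv(2)[OF one] by simp
  have sOm: "s : Om" unfolding Om_def using one one_iv by (intro image_eqI[of _ _ ?I]) (simp_all add: ph_def)
  have MOm: "ph M : Om" unfolding Om_def using M by simp
  have "ph M ~= s"
  proof
   assume "ph M = s"
   then have "ph M ** M = s ** M" by simp
   moreover have "ph M ** M = M ** s" unfolding ph_def using iv(3)[OF M] by (simp flip: matrix_mul_assoc)
   ultimately show False using ne by simp
  qed
  then have "card Om ~= 1" using sOm MOm by (auto simp: card_1_singleton_iff)
  then have dvd: "p dvd card Om" using k by (cases k) auto
  define f where "f x = s ** x ** iv s" for x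
  have "\<exists>x\<in>Om. x ~= s & f x = x"
  proof (rule exists_second_fixpoint[OF fin _ p _ sOm _ dvd])
   show "f x : Om" if x: "x : Om" for x
   proof -
    obtain h where h: "h : P" "x = ph h" using x unfolding Om_def by blast
    have sh: "s ** h : P" by (rule closed[OF s h(1)])
    have "iv (s ** h) = iv h ** iv s"
    proof -
     have "iv (s ** h) = iv h ** (iv s ** ((s ** h) ** iv (s ** h)))" using canc(2)[OF s] canc(2)[OF h(1)] by (simp flip: matrix_mul_assoc)
     then show ?thesis using iv(2)[OF sh] by simp
    qed
    then have "f x = ph (s ** h)" unfolding f_def h(2) ph_def by (simp add: matrix_mul_assoc)
    then show ?thesis unfolding Om_def using sh by blast
   qed
   show "(f ^^ p) x = x" if "x : Om" for x
   proof -
    have "(f ^^ k) x = mpow s k ** x ** mpow (iv s) k" for k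
    proof (induction k)
     case (Suc k)
     have "mpow (iv s) k ** iv s = iv s ** mpow (iv s) k"
      using mpow_add[of "iv s" k 1] mpow_add[of "iv s" 1 k] by (simp add: add.commute)
     then show ?case using Suc by (simp add: f_def matrix_mul_assoc) (metis matrix_mul_assoc)
    qed simp
    then show ?thesis using expo[OF s] expo[OF iv(1)[OF s]] by simp
   qed
   show "f s = s" unfolding f_def using iv(2)[OF s] by (simp flip: matrix_mul_assoc)
  qed
  then obtain t where t: "t : Om" "t ~= s" "f t = t" by blast
  have comm: "s ** t = t ** s"
  proof -
   have "f t ** s = s ** t" unfolding f_def using iv(3)[OF s] by (simp flip: matrix_mul_assoc)
   then show ?thesis using t(3) by simp
  qed
  obtain g where g: "g : P" "t = ph g" using t(1) unfolding Om_def by blast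
  have tg: "t ** g = g ** s" unfolding g(2) ph_def using iv(3)[OF g(1)] by (simp flip: matrix_mul_assoc)
  define dt where "dt W = W $ 1 $ 1 * W $ 2 $ 2 - W $ 1 $ 2 * W $ 2 $ 1" for W :: "'a^2^2"
  define tr where "tr W = W $ 1 $ 1 + W $ 2 $ 2" for W :: "'a^2^2"
  have dt_mult: "dt (W ** W') = dt W * dt W'" for W W' by (simp add: dt_def mult2_nth algebra_simps)
  have tr_comm: "tr (W ** W') = tr (W' ** W)" for W W' by (simp add: tr_def mult2_nth algebra_simps)
  have "dt g * dt (iv g) = 1" using iv(2)[OF g(1)] dt_mult[of g "iv g"] by (simp add: dt_def mat1_nth)
  then have "dt g ~= 0" by auto
  then have dts: "dt t = dt s" using tg dt_mult[of t g] dt_mult[of g s] by (simp add: mult.commute)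
  have trs: "tr t = tr s"
  proof -
   have "t = g ** (s ** iv g)" using g(2) by (simp add: ph_def matrix_mul_assoc)
   then have "tr t = tr ((s ** iv g) ** g)" using tr_comm by simp
   also have "(s ** iv g) ** g = s" using iv(3)[OF g(1)] by (simp flip: matrix_mul_assoc)
   finally show ?thesis .
  qed
  have cm: "(s ** t) $ i $ j = (t ** s) $ i $ j" for i j using comm by simp
  have "(t $ 1 $ 1 = s $ 1 $ 1 & t $ 1 $ 2 = s $ 1 $ 2 & t $ 2 $ 1 = s $ 2 $ 1 & t $ 2 $ 2 = s $ 2 $ 2) \<or>
   (t $ 1 $ 1 = s $ 2 $ 2 & t $ 1 $ 2 = - s $ 1 $ 2 & t $ 2 $ 1 = - s $ 2 $ 1 & t $ 2 $ 2 = s $ 1 $ 1)"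
   using cm[of 1 1] cm[of 1 2] cm[of 2 1] dts trs disc
   by (intro commuting_conjugates) (simp_all add: mult2_nth dt_def tr_def algebra_simps)
  then have t_eq: "t $ 1 $ 1 = s $ 2 $ 2" "t $ 1 $ 2 = - s $ 1 $ 2" "t $ 2 $ 1 = - s $ 2 $ 1" "t $ 2 $ 2 = s $ 1 $ 1"
   using t(2) by (auto simp: matrix2_eq_iff)
  \<comment> \<open>Here \<open>t\<close> is the trace of \<open>s\<close> times the identity minus
    \<open>s\<close>, so \<open>t ** g = g ** s\<close> can be rearranged to
    \<open>g ** t = s ** g\<close>.\<close>
  have gt: "g ** t = s ** g"
  proof -
   have *: "(t ** g) $ i $ j = (g ** s) $ i $ j" for i j using tg by simp
   show ?thesis
    using *[of 1 1] *[of 1 2] *[of 2 1] *[of 2 2]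
    by (simp add: matrix2_eq_iff mult2_nth t_eq algebra_simps)
  qed
  have g2: "(g ** g) ** s = s ** (g ** g)"
  proof -
   have "(g ** g) ** s = g ** (t ** g)" using tg by (simp flip: matrix_mul_assoc)
   also have "\<dots> = (g ** t) ** g" by (simp add: matrix_mul_assoc)
   finally show ?thesis using gt by (simp add: matrix_mul_assoc)
  qed
  obtain m where m: "p = 2 * m + 1" using odd by (elim oddE)
  have "mpow g (2 * l) ** s = s ** mpow g (2 * l)" for l
  proof (induction l)
   case (Suc l)
   have "mpow g (2 * Suc l) = (g ** g) ** mpow g (2 * l)" by (simp add: matrix_mul_assoc)
   then have "mpow g (2 * Suc l) ** s = (g ** g) ** (mpow g (2 * l) ** s)" by (simp flip: matrix_mul_assoc)
   also have "\<dots> = ((g ** g) ** s) ** mpow g (2 * l)" unfolding Suc by (simp add: matrix_mul_assoc)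
   also have "\<dots> = s ** mpow g (2 * Suc l)" unfolding g2 by (simp add: matrix_mul_assoc)
   finally show ?case .
  qed simp
  \<comment> \<open>\<open>p + 1\<close> is even, and the power of \<open>g\<close> with this
    exponent is \<open>g\<close>.\<close>
  from this[of "Suc m"] have "mpow g (Suc p) ** s = s ** mpow g (Suc p)" by (simp add: m)
  then have "g ** s = s ** g" using expo[OF g(1)] by simp
  then have "t ** g = s ** g" using tg by simp
  then have "(t ** g) ** iv g = (s ** g) ** iv g" by simp
  then have "t = s" using iv(2)[OF g(1)] by (simp flip: matrix_mul_assoc)
  then show False using t(2) by simp
 qed
qed

lemma shear_hom_eq:
 fixes a b u :: "'a :: comm_ring_1"
 assumes "act M var_X = cc a * var_X" "act M var_Y = cc b * var_Y + cc (u * (b - a)) * var_X"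
 shows "act M f = shear u (diag_act a b (shear (- u) f))"
proof (rule hom2_eqI[where h = "act M" and h' = "\<lambda>f. shear u (diag_act a b (shear (- u) f))"])
 show "comm_ring_hom (\<lambda>f. shear u (diag_act a b (shear (- u) f)))"
  by (rule comm_ring_hom_comp[OF comm_ring_hom_shear comm_ring_hom_comp[OF comm_ring_hom_diag_act comm_ring_hom_shear]])
 have "shear u (diag_act a b (shear (- u) var_Y)) = cc b * (var_Y + cc u * var_X) + cc (- u) * (cc a * var_X)"
  by (simp only: shear_simps diag_act_simps diag_act.hom_add diag_act.hom_mult shear.hom_add shear.hom_mult)
 also have "\<dots> = act M var_Y" unfolding assms(2) by (simp add: cc.hom_mult cc.hom_minus cc.hom_uminus algebra_simps)
 finally show "act M var_Y = shear u (diag_act a b (shear (- u) var_Y))" ..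
qed (simp_all add: comm_ring_hom_act assms diag_act.hom_mult shear.hom_mult)

text \<open>For a monomial \<open>X^k Y^l\<close> of \<open>f\<close> the condition
  \<open>a^k b^l = 1\<close> reads \<open>a^(k+l) w^l = 1\<close>, where \<open>w = b / a\<close>
  has order \<open>p\<close>. So \<open>k + l\<close> modulo \<open>p\<close> determines
  \<open>l\<close> modulo \<open>p\<close>, and with it \<open>k\<close>.\<close>

lemma shear_simultaneous_eigen:
 fixes f :: "'a :: field_char_0 poly poly"
 assumes p: "prime (p :: nat)" and a: "a ^ p = 1" and b: "b ^ p = 1" and ne: "a ~= b"
  and fixed: "diag_act a b f = f" and i: "i < p" and j: "j < p"
 shows "res_part p i j f = 0 \<or> res_part p i j f = deg_part p ((i + j) mod p) f"
proof (rule disjCI)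
 assume nz: "\<not> res_part p i j f = deg_part p ((i + j) mod p) f"
 define w where "w = b / a"
 have a0: "a ~= 0" using a prime_gt_0_nat[OF p] by (cases "a = 0") (auto simp: power_0_left)
 have w: "w ^ p = 1" "w ~= 1" "b = a * w" using a b ne a0 by (auto simp: w_def power_divide)
 have eig: "a ^ (k + l) * w ^ l = 1" if "coeff (coeff f l) k ~= 0" for k l
 proof -
  have "a ^ k * b ^ l * coeff (coeff f l) k = coeff (coeff f l) k"
   using fixed coeff_diag_act[of a b f l k] by simp
  then have "a ^ k * b ^ l = 1" using that by simp
  then show ?thesis by (simp add: w(3) power_mult_distrib power_add mult_ac)
 qed
 show "res_part p i j f = 0"
 proof (rule ccontr)
  assume "res_part p i j f ~= 0"
  then obtain l k where "coeff (coeff (res_part p i j f) l) k ~= 0" using poly2_eqI[of "res_part p i j f" 0] by auto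
  then have kl: "k mod p = i" "l mod p = j" "coeff (coeff f l) k ~= 0"
   by (auto simp: res_part_def coeff_part split: if_splits)
  have "res_part p i j f = deg_part p ((i + j) mod p) f"
  proof (rule poly2_eqI)
   fix l' k'
   have "k' mod p = i & l' mod p = j" if s: "(k' + l') mod p = (i + j) mod p" and c: "coeff (coeff f l') k' ~= 0"
   proof -
    have kl': "(k + l) mod p = (k' + l') mod p" using kl(1,2) s by (metis mod_add_eq)
    then have "a ^ (k + l) = a ^ (k' + l')" by (rule power_eq_1_mod_cong[OF a])
    then have "a ^ (k + l) * w ^ l = a ^ (k + l) * w ^ l'" using eig[OF c] eig[OF kl(3)] by simp
    then have "w ^ l = w ^ l'" using a0 by simp
    then have l: "l mod p = l' mod p" by (rule power_eq_imp_mod_eq[OF p w(1,2)])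
    have "int k mod int p = int k' mod int p"
    proof -
     have "(int (k + l) - int l) mod int p = (int (k' + l') - int l') mod int p"
      using kl' l by (intro mod_diff_cong) (simp_all only: zmod_int[symmetric])
     then show ?thesis by simp
    qed
    then have "k mod p = k' mod p" by (simp only: zmod_int[symmetric] of_nat_eq_iff)
    then show ?thesis using kl l by simp
   qed
   moreover have "(k' + l') mod p = (i + j) mod p" if "k' mod p = i" "l' mod p = j"
    using that by (metis mod_add_eq)
   ultimately show "coeff (coeff (res_part p i j f) l') k' = coeff (coeff (deg_part p ((i + j) mod p) f) l') k'"
    by (auto simp: res_part_def deg_part_def coeff_part)
  qed
  then show False using nz by simp
 qed
qed

lemma poly_of_int_hom:
 assumes "comm_ring_hom h"
 shows "h (poly (map_poly of_int F) x) = poly (map_poly of_int F) (h x)"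
proof -
 interpret comm_ring_hom h by fact
 show ?thesis by (induction F) (simp_all add: Polynomial.map_poly_pCons hom_add hom_mult hom_of_int hom_zero)
qed

section \<open>Integral coordinates for a group of prime exponent\<close>

context
 fixes V :: "'a :: field_char_0 set" and P :: "('a^2^2) set" and p n :: nat
 assumes valV: "valuation_subring V"
  and alg: "!!q :: 'a poly. degree q > 0 ==> \<exists>x. poly q x = 0"
  and P: "finite_matrix_group P"
  and ent: "!!M i j. M : P ==> M $ i $ j : V"
  and p: "prime p" and card: "card P = p ^ n"
  and expo: "!!M. M : P ==> mpow M p = mat 1"
begin

interpretation valuation_subring V by (rule valV)

lemmas V0 = V

lemma sheared_torus_scalar:
 assumes scalar: "!!M. M : P ==> scalar_matrix M"
 shows "sheared_torus V p 0 P"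
proof (intro sheared_torus.intro sheared_torus_axioms.intro)
 show "valuation_subring V" by (rule valV)
 show "prime p" by (rule p)
 fix M assume M: "M : P"
 define a where "a = M $ 1 $ 1"
 have s: "M $ 1 $ 2 = 0" "M $ 2 $ 1 = 0" "M $ 2 $ 2 = a" using scalar[OF M] by (simp_all add: scalar_matrix_def a_def)
 have "a ^ p = 1" using mpow_upper(2)[OF s(2), of p] expo[OF M] by (simp add: a_def mat1_nth)
 moreover have "act M f = shear 0 (diag_act a a (shear (- 0) f))" for f
  by (rule shear_hom_eq) (simp_all add: act_X act_Y s a_def[symmetric])
 ultimately show "\<exists>a b. a ^ p = 1 & b ^ p = 1 & (\<forall>f. act M f = shear 0 (diag_act a b (shear (- 0) f)))"
  by (intro exI[of _ a] conjI allI) simp_all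
next
 have "of_nat p * (0 :: 'a) ^ (p - 1) : V" using prime_gt_1_nat[OF p] subringD(2)[OF V0] by (simp add: power_0_left)
 then show "(var_Y + cc 0 * var_X) ^ p - cc (0 ^ p) * var_X ^ p : polys2 V" by (rule norm_polys2[OF p])
next
 fix f and i j :: nat assume "f : polys2 V"
 then show "shear 0 (res_part p i j (shear (- 0) f)) : polys2 V"
  unfolding minus_zero shear_0 res_part_def by (rule part_polys2[OF V0])
qed

text \<open>Make \<open>s\<close> triangular over \<open>V\<close>. Its eigenvalues differ, because
  a matrix of finite order with a double eigenvalue is scalar in characteristic zero. As
  \<open>s\<close> is central, all of \<open>P\<close> is diagonal in its eigenforms.\<close>

lemma sheared_torus_nonscalar:
 assumes s: "s : P" and ns: "\<not> scalar_matrix s"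
 shows "\<exists>C C' u. (\<forall>i j. C $ i $ j : V) & (\<forall>i j. C' $ i $ j : V) & C ** C' = mat 1 \<and>
  C' ** C = mat 1 & sheared_torus V p u ((\<lambda>M. C' ** M ** C) ` P)"
proof -
 have "\<exists>C C' :: 'a^2^2. (\<forall>i j. C $ i $ j : V) & (\<forall>i j. C' $ i $ j : V) & C ** C' = mat 1 \<and>
   C' ** C = mat 1 & (C' ** s ** C) $ 2 $ 1 = 0"
  by (rule exists_triangular_conjugate, erule alg, rule ent[OF s])
 then obtain C C' :: "'a^2^2" where C: "\<forall>i j. C $ i $ j : V" "\<forall>i j. C' $ i $ j : V" "C ** C' = mat 1"
   "C' ** C = mat 1" "(C' ** s ** C) $ 2 $ 1 = 0"
  by (elim exE conjE)
 define t where "t = C' ** s ** C"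
 define al be ga where "al = t $ 1 $ 1" and "be = t $ 2 $ 2" and "ga = t $ 1 $ 2"
 have t21: "t $ 2 $ 1 = 0" using C(5) by (simp add: t_def)
 have conjpow: "mpow (C' ** M ** C) p = mat 1" if "M : P" for M
  using mpow_conj[OF C(3,4)] expo[OF that] C(4) by simp
 have al: "al ^ p = 1" and be: "be ^ p = 1"
  using mpow_upper[OF t21, of p] conjpow[OF s] by (simp_all add: t_def[symmetric] mat1_nth al_def be_def)
 have p0: "p > 0" by (rule prime_gt_0_nat[OF p])
 have al0: "al ~= 0" using al p0 by (cases "al = 0") (auto simp: power_0_left)
 have s_eq: "s = C ** t ** C'"
 proof -
  have "C ** t ** C' = (C ** C') ** s ** (C ** C')" by (simp add: t_def matrix_mul_assoc)
  then show ?thesis using C(3) by simp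
 qed
 have ne: "al ~= be"
 proof
  assume eq: "al = be"
  obtain p' where p': "p = Suc p'" using p0 by (cases p) auto
  have "of_nat (Suc p') * al ^ p' * ga = 0"
   using mpow_upper_unipotent[OF t21, of p'] eq conjpow[OF s] by (simp add: t_def[symmetric] mat1_nth al_def be_def ga_def p')
  then have ga: "ga = 0" using al0 by (simp del: of_nat_Suc)
  have cc': "(C ** C') $ i $ j = (if i = j then 1 else 0)" for i j using C(3) by (simp add: mat1_nth)
  have "s $ i $ j = al * (C ** C') $ i $ j" for i j
   unfolding s_eq mult2_nth using ga t21 eq by (simp add: al_def be_def ga_def algebra_simps)
  then show False using ns by (simp add: scalar_matrix_def cc')
 qed
 define dt where "dt W = W $ 1 $ 1 * W $ 2 $ 2 - W $ 1 $ 2 * W $ 2 $ 1" for W :: "'a^2^2"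
 define tr where "tr W = W $ 1 $ 1 + W $ 2 $ 2" for W :: "'a^2^2"
 have dt_mult: "dt (W ** W') = dt W * dt W'" for W W' by (simp add: dt_def mult2_nth algebra_simps)
 have tr_comm: "tr (W ** W') = tr (W' ** W)" for W W' by (simp add: tr_def mult2_nth algebra_simps)
 have "tr s = tr t"
 proof -
  have "tr s = tr (C' ** (C ** t))" unfolding s_eq by (rule tr_comm)
  then show ?thesis using C(4) by (simp add: matrix_mul_assoc)
 qed
 moreover have "dt s = dt t"
 proof -
  have "dt C * dt C' = 1" using dt_mult[of C C'] C(3) by (simp add: dt_def mat1_nth)
  then show ?thesis unfolding s_eq dt_mult by (simp add: mult_ac)
 qed
 moreover have "(W $ 1 $ 1 - W $ 2 $ 2)\<^sup>2 + 4 * W $ 1 $ 2 * W $ 2 $ 1 = (tr W)\<^sup>2 - 4 * dt W" for W :: "'a^2^2"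
  by (simp add: tr_def dt_def power2_eq_square algebra_simps)
 moreover have "(tr t)\<^sup>2 - 4 * dt t = (al - be)\<^sup>2"
  by (simp add: tr_def dt_def power2_eq_square t21 al_def be_def algebra_simps)
 ultimately have disc: "(s $ 1 $ 1 - s $ 2 $ 2)\<^sup>2 + 4 * s $ 1 $ 2 * s $ 2 $ 1 ~= 0" using ne by simp
 \<comment> \<open>\<open>Y + u X\<close> is the eigenform of \<open>t\<close> for the eigenvalue
   \<open>be\<close>. The denominator \<open>be - al\<close> may be a nonunit of
   \<open>V\<close>.\<close>
 define u where "u = ga / (be - al)"
 have form: "\<exists>a b. a ^ p = 1 & b ^ p = 1 & (C' ** M ** C) $ 1 $ 1 = a & (C' ** M ** C) $ 2 $ 2 = b \<and>
   (\<forall>f. act (C' ** M ** C) f = shear u (diag_act a b (shear (- u) f)))" if M: "M : P" for M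
 proof -
  have Ms: "M ** s = s ** M" by (rule nonscalar_central[OF P p card expo s disc M])
  define N where "N = C' ** M ** C"
  have "N ** t = C' ** M ** (C ** C') ** s ** C" by (simp add: N_def t_def matrix_mul_assoc)
  also have "\<dots> = C' ** (M ** s) ** C" using C(3) by (simp add: matrix_mul_assoc)
  also have "\<dots> = C' ** s ** (C ** C') ** M ** C" unfolding Ms using C(3) by (simp add: matrix_mul_assoc)
  also have "\<dots> = t ** N" by (simp add: N_def t_def matrix_mul_assoc)
  finally have e: "(N ** t) $ i $ j = (t ** N) $ i $ j" for i j by simp
  define a b where "a = N $ 1 $ 1" and "b = N $ 2 $ 2"
  have "N $ 2 $ 1 * al = be * N $ 2 $ 1" using e[of 2 1] by (simp add: mult2_nth t21 al_def be_def)
  then have "N $ 2 $ 1 * (al - be) = 0" by (simp add: algebra_simps)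
  then have N21: "N $ 2 $ 1 = 0" using ne by simp
  have "N $ 1 $ 2 * (be - al) = ga * (b - a)"
   using e[of 1 2] by (simp add: mult2_nth a_def b_def al_def be_def ga_def algebra_simps)
  then have N12: "N $ 1 $ 2 = u * (b - a)" using ne by (simp add: u_def field_simps)
  have "a ^ p = 1" "b ^ p = 1"
   using mpow_upper[OF N21, of p] conjpow[OF M] by (simp_all add: N_def[symmetric] mat1_nth a_def b_def)
  moreover have "act N f = shear u (diag_act a b (shear (- u) f))" for f
   by (rule shear_hom_eq) (simp_all add: act_X act_Y N21 N12 a_def b_def add.commute)
  ultimately show ?thesis unfolding N_def[symmetric]
   by (intro exI[of _ a] exI[of _ b] conjI allI) (simp_all add: a_def b_def)
 qed
 define w where "w = be / al"
 have w: "w ^ p = 1" "w ~= 1" using al be ne al0 by (auto simp: w_def power_divide)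
 have wV: "w : V" by (rule root_of_unity_mem[OF w(1) p0])
 \<comment> \<open>\<open>1 - w\<close> divides each \<open>1 - w^k\<close>, so \<open>p\<close> is
   \<open>(1 - w)^(p-1)\<close> times an integral element, while \<open>u (1 - w)\<close> is
   integral. Hence the exponent \<open>p - 1\<close>.\<close>
 have pu: "of_nat p * u ^ (p - 1) : V"
 proof -
  define E where "E = (\<Prod>k\<in>{1..<p}. \<Sum>j<k. w ^ j)"
  have EV: "E : V" unfolding E_def by (intro subring_prod[OF V0] subring_sum[OF V0] subring_power[OF V0 wV])
  have "of_nat p = (\<Prod>k\<in>{1..<p}. (1 - w) * (\<Sum>j<k. w ^ j))"
   unfolding prod_one_minus_roots_of_unity[OF p w] by (intro prod.cong refl) (simp add: one_diff_power_eq)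
  then have "of_nat p = (1 - w) ^ (p - 1) * E" by (simp add: prod.distrib E_def)
  moreover have "u * (1 - w) = - (ga * inverse al)"
   using ne al0 by (simp add: u_def w_def field_simps)
  ultimately have "of_nat p * u ^ (p - 1) = E * (- (ga * inverse al)) ^ (p - 1)"
   by (metis (no_types, lifting) mult.commute mult.left_commute power_mult_distrib)
  moreover have "inverse al : V" by (rule root_of_unity_mem[OF _ p0]) (simp add: power_inverse al)
  moreover have "ga : V"
  proof -
   have "(W ** W') $ i $ j : V" if "\<forall>i j. W $ i $ j : V" "\<forall>i j. W' $ i $ j : V" for W W' :: "'a^2^2" and i j
    using that by (simp add: mult2_nth subringD[OF V0])
   then show ?thesis using C(1,2) ent[OF s] by (simp add: ga_def t_def)
  qed
  ultimately show ?thesis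
   using subringD(4)[OF V0 EV subring_power[OF V0 subringD(5)[OF V0 subringD(4)[OF V0]]]] by simp
 qed
 have "sheared_torus V p u ((\<lambda>M. C' ** M ** C) ` P)"
 proof (intro sheared_torus.intro sheared_torus_axioms.intro)
  show "valuation_subring V" by (rule valV)
  show "prime p" by (rule p)
  show "\<exists>a b. a ^ p = 1 & b ^ p = 1 & (\<forall>f. act N f = shear u (diag_act a b (shear (- u) f)))"
   if N: "N : (\<lambda>M. C' ** M ** C) ` P" for N
  proof -
   obtain M where M: "M : P" "N = C' ** M ** C" using N by (rule imageE)
   from form[OF M(1)] show ?thesis unfolding M(2) by (elim exE conjE, intro exI conjI)
  qed
  show "(var_Y + cc u * var_X) ^ p - cc (u ^ p) * var_X ^ p : polys2 V" by (rule norm_polys2[OF p pu])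
  fix f and i j assume f: "f : polys2 V" and inv: "!!M. M : (\<lambda>M. C' ** M ** C) ` P ==> act M f = f"
   and i: "i < p" and j: "j < p"
  define g where "g = shear (- u) f"
  have "act t f = shear u (diag_act al be g)"
   using form[OF s] unfolding t_def[symmetric] al_def[symmetric] be_def[symmetric] g_def by (elim exE conjE) simp
  moreover have "act t f = f" by (rule inv) (simp add: t_def s)
  ultimately have "diag_act al be g = g" unfolding g_def by (metis shear_inverse(2))
  from shear_simultaneous_eigen[OF p al be ne this i j]
  show "shear u (res_part p i j (shear (- u) f)) : polys2 V"
  proof
   assume "res_part p i j g = 0"
   then show ?thesis using subringD(2)[OF subring_polys2[OF V0]] by (simp add: g_def shear.hom_zero)
  next
   assume e: "res_part p i j g = deg_part p ((i + j) mod p) g"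
   have "shear u (res_part p i j g) = deg_part p ((i + j) mod p) (shear u g)"
    unfolding e by (rule deg_part_shear[OF p w, symmetric]) (use p0 in simp)
   also have "\<dots> = deg_part p ((i + j) mod p) f" by (simp add: g_def shear_inverse)
   also have "\<dots> : polys2 V" unfolding deg_part_def by (rule part_polys2[OF V0 f])
   finally show ?thesis by (simp add: g_def)
  qed
 qed
 then show ?thesis using C(1-4) by (intro exI[of _ C] exI[of _ C'] exI[of _ u] conjI)
qed

lemma exists_sheared_torus:
 "\<exists>C C' u. (\<forall>i j. C $ i $ j : V) & (\<forall>i j. C' $ i $ j : V) & C ** C' = mat 1 \<and>
  C' ** C = mat 1 & sheared_torus V p u ((\<lambda>M. C' ** M ** C) ` P)"
proof (cases "\<forall>M\<in>P. scalar_matrix M")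
 case True
 then have "sheared_torus V p 0 P" by (intro sheared_torus_scalar) blast
 then show ?thesis
  by (intro exI[of _ "mat 1"] exI[of _ 0] conjI)
   (simp_all add: mat1_nth subringD[OF V0])
next
 case False
 then obtain s where "s : P" "\<not> scalar_matrix s" by auto
 then show ?thesis by (rule sheared_torus_nonscalar)
qed

text \<open>The two elements are \<open>X^p\<close> and \<open>N\<close> moved back to the original
  coordinates by \<open>C\<close>. The clauses express that \<open>p\<close>, \<open>F(u0)\<close>,
  \<open>G(v0)\<close> is a regular sequence for all monic integer polynomials: the first comes from
  Gauss's lemma on \<open>V[X,Y]\<close>, the second from \<open>inv_ring_regular\<close>.\<close>

theorem regular_pair_of_orbit_norms:
 "\<exists>u0 v0. u0 : finite_matrix_group.invariants P V & v0 : finite_matrix_group.invariants P V \<and>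
  (\<forall>F a c. lead_coeff F = (1 :: int) --> c : polys2 V --> poly (map_poly of_int F) u0 * a = of_nat p * c -->
   (\<exists>d\<in>polys2 V. a = of_nat p * d)) \<and>
  (\<forall>F G a1 a2 a3. lead_coeff F = (1 :: int) --> lead_coeff G = (1 :: int) -->
   a1 : finite_matrix_group.invariants P V --> a2 : finite_matrix_group.invariants P V --> a3 : polys2 V -->
   poly (map_poly of_int G) v0 * a1 - poly (map_poly of_int F) u0 * a2 = of_nat p * a3 -->
   (\<exists>b\<in>finite_matrix_group.invariants P V. \<exists>c\<in>finite_matrix_group.invariants P V.
    a1 = poly (map_poly of_int F) u0 * b + of_nat p * c))"
proof -
 interpret G: finite_matrix_group P by (rule P)
 obtain C C' u where C: "\<forall>i j. C $ i $ j : V" "\<forall>i j. C' $ i $ j : V" "C ** C' = mat 1"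
   "C' ** C = mat 1" "sheared_torus V p u ((\<lambda>M. C' ** M ** C) ` P)"
  using exists_sheared_torus by (elim exE conjE)
 interpret T: sheared_torus V p u "(\<lambda>M. C' ** M ** C) ` P" by (rule C(5))
 have cc': "act C (act C' f) = f" "act C' (act C f) = f" for f by (simp_all flip: act_mult add: C(3,4))
 have C_inv: "act C f : G.invariants V" if "f : T.inv_ring" for f
 proof -
  have "act M (act C f) = act C f" if M: "M : P" for M
  proof -
   have "act M (act C f) = act ((C ** C') ** M ** C) f" using C(3) by (simp add: act_mult)
   also have "\<dots> = act C (act (C' ** M ** C) f)" by (simp add: act_mult)
   also have "act (C' ** M ** C) f = f" using `f : T.inv_ring` M by (simp add: T.inv_ring_def)
   finally show ?thesis .
  qed
  moreover have "act C f : polys2 V" using act_polys2[OF V0] C(1) that by (simp add: T.inv_ring_def)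
  ultimately show ?thesis by (simp add: G.invariants_def)
 qed
 have C'_inv: "act C' f : T.inv_ring" if f: "f : G.invariants V" for f
 proof -
  have "act (C' ** M ** C) (act C' f) = act C' f" if M: "M : P" for M
   using f M by (simp add: act_mult cc' G.invariants_def)
  moreover have "act C' f : polys2 V" using act_polys2[OF V0] C(2) f by (simp add: G.invariants_def)
  ultimately show ?thesis by (simp add: T.inv_ring_def)
 qed
 have pe: "act C' (poly (map_poly of_int F) (act C w)) = poly (map_poly of_int F) w"
  "act C (poly (map_poly of_int F) w) = poly (map_poly of_int F) (act C w)" for F :: "int poly" and w
  by (simp_all add: poly_of_int_hom[OF comm_ring_hom_act] cc')
 have np: "act M (of_nat p * x) = of_nat p * act M x" for M and x :: "'a poly poly" by (simp add: act.hom_mult act.hom_of_nat)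
 have c1: "\<exists>d\<in>polys2 V. a = of_nat p * d" if F: "lead_coeff F = (1 :: int)" and c: "c : polys2 V"
  and eq: "poly (map_poly of_int F) (act C (var_X ^ p)) * a = of_nat p * c" for F a c
 proof -
  have e: "poly (map_poly of_int F) (var_X ^ p) * act C' a = of_nat p * act C' c"
   using arg_cong[OF eq, of "act C'"] unfolding act.hom_mult act.hom_of_nat pe by simp
  define k where "k = cc (inverse (of_nat p)) * act C' a"
  have pp: "cc (inverse (of_nat p)) * (of_nat p * x) = x" "of_nat p * (cc (inverse (of_nat p)) * x) = x" for x :: "'a poly poly"
  proof -
   have "cc (inverse (of_nat p)) * of_nat p = cc (inverse (of_nat p) * of_nat p :: 'a)" by (simp add: cc.hom_mult cc.hom_of_nat)
   also have "\<dots> = 1" using T.p_pos by simp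
   finally show "cc (inverse (of_nat p)) * (of_nat p * x) = x" "of_nat p * (cc (inverse (of_nat p)) * x) = x"
    by (simp_all flip: mult.assoc add: mult.commute[of "of_nat p"])
  qed
  have "poly (map_poly of_int F) (var_X ^ p) * k = act C' c" using arg_cong[OF e, of "\<lambda>x. cc (inverse (of_nat p)) * x"]
   unfolding k_def pp by (simp add: mult.left_commute)
  moreover have "act C' c : polys2 V" using act_polys2[OF V0 _ c] C(2) by simp
  ultimately have "k : polys2 V" using gauss_lemma[OF T.primitive_poly_X_pow[OF F]] by simp
  then have "act C k : polys2 V" using act_polys2[OF V0] C(1) by simp
  moreover have "act C' a = of_nat p * k" unfolding k_def pp ..
  then have "a = of_nat p * act C k" using cc'(1)[of a] np by simp
  ultimately show ?thesis by (intro bexI[of _ "act C k"])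
 qed
 have c2: "\<exists>b\<in>G.invariants V. \<exists>c\<in>G.invariants V. a1 = poly (map_poly of_int F) (act C (var_X ^ p)) * b + of_nat p * c"
  if G: "lead_coeff G = (1 :: int)"
  and a: "a1 : G.invariants V" "a2 : G.invariants V" "a3 : polys2 V"
  and eq: "poly (map_poly of_int G) (act C T.nrm) * a1 - poly (map_poly of_int F) (act C (var_X ^ p)) * a2 = of_nat p * a3"
  for F G :: "int poly" and a1 a2 a3
 proof -
  have e: "poly (map_poly of_int G) T.nrm * act C' a1 - poly (map_poly of_int F) (var_X ^ p) * act C' a2 = of_nat p * act C' a3"
   using arg_cong[OF eq, of "act C'"] unfolding act.hom_mult act.hom_minus act.hom_of_nat pe by simp
  have a3: "act C' a3 : polys2 V" using act_polys2[OF V0 _ a(3)] C(2) by simp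
  obtain b c where bc: "b : T.inv_ring" "c : T.inv_ring" "act C' a1 = poly (map_poly of_int F) (var_X ^ p) * b + of_nat p * c"
   using T.inv_ring_regular[OF G C'_inv[OF a(1)] C'_inv[OF a(2)] a3 e] by (elim bexE)
  have "a1 = act C (act C' a1)" by (simp add: cc')
  also have "\<dots> = poly (map_poly of_int F) (act C (var_X ^ p)) * act C b + of_nat p * act C c"
   unfolding bc(3) act.hom_add act.hom_mult act.hom_of_nat pe ..
  finally show ?thesis using C_inv[OF bc(1)] C_inv[OF bc(2)] by (intro bexI[of _ "act C b"] bexI[of _ "act C c"])
 qed
 show ?thesis
  by (intro exI[of _ "act C (var_X ^ p)"] exI[of _ "act C T.nrm"] conjI allI impI C_inv T.X_pow_inv T.nrm_inv)
   (erule (2) c1, erule (4) c2)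
qed

end

section \<open>Congruences modulo a prime ideal\<close>

lemma pseudo_division:
 fixes s f :: "'a :: idom poly"
 assumes D: "subring_set D" and s: "s : polys_over D" "degree s > 0" and f: "f : polys_over D"
 shows "\<exists>N q r. q : polys_over D & r : polys_over D & smult (lead_coeff s ^ N) f = q * s + r & degree r < degree s"
 using f
proof (induction "degree f" arbitrary: f rule: less_induct)
 case less
 note P = subring_polys_over[OF D]
 have sm: "smult c g : polys_over D" if "c : D" "g : polys_over D" for c g
  using that subringD(4)[OF D] by (auto simp: polys_over_def)
 show ?case
 proof (cases "degree f < degree s")
  case True
  then show ?thesis using less.prems subringD(2)[OF P] by (intro exI[of _ 0] exI[of _ f]) simp
 next
  case False
  define m where "m = monom (lead_coeff f) (degree f - degree s)"
  have m: "m : polys_over D" unfolding m_def by (rule monom_polys_over[OF D polys_overD[OF less.prems]])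
  have lc: "lead_coeff s : D" by (rule polys_overD[OF s(1)])
  define g where "g = smult (lead_coeff s) f - m * s"
  have g: "g : polys_over D" unfolding g_def
   by (rule subringD(3)[OF P sm[OF lc less.prems] subringD(4)[OF P m s(1)]])
  have "degree (m * s) <= degree f"
  proof -
   have "degree (m * s) <= degree m + degree s" by (rule degree_mult_le)
   also have "\<dots> <= (degree f - degree s) + degree s" unfolding m_def by (intro add_mono degree_monom_le order_refl)
   finally show ?thesis using False by simp
  qed
  then have "degree g <= degree f" unfolding g_def by (intro degree_diff_le degree_smult_le)
  moreover have "coeff g (degree f) = 0"
   using False by (simp add: g_def m_def coeff_monom_mult)
  ultimately have "degree g < degree f" using s(2) False by (intro degree_lessI) auto
  from less.hyps[OF this g] obtain N q r where *: "q : polys_over D" "r : polys_over D"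
   "smult (lead_coeff s ^ N) g = q * s + r" "degree r < degree s" by (elim exE conjE)
  have "smult (lead_coeff s ^ Suc N) f = smult (lead_coeff s ^ N) g + smult (lead_coeff s ^ N) m * s"
   by (simp add: g_def smult_diff_right mult.commute)
  also have "\<dots> = (q + smult (lead_coeff s ^ N) m) * s + r" unfolding *(3) by (simp add: algebra_simps)
  finally show ?thesis
   using * subringD(6)[OF P *(1) sm[OF subring_power[OF D lc] m]]
   by (intro exI[of _ "Suc N"] exI[of _ "q + smult (lead_coeff s ^ N) m"] exI[of _ r] conjI)
 qed
qed

text \<open>Computations in the domain \<open>E / M\<close> are carried out as congruences:
  \<open>x - y : M\<close> stands for equality of the classes.\<close>

locale mod_prime =
 fixes E M :: "'a :: idom set"
 assumes sub: "subring_set E" and prime: "prime_in E M"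
begin

lemma M_sub: "x : M ==> x : E"
 using prime_inD(1)[OF prime] by (rule subsetD)

lemma one_notin: "1 ~: M"
 by (rule prime_inD(3)[OF prime])

lemma M_prime: "x : E ==> y : E ==> x * y : M ==> x : M \<or> y : M"
 by (rule prime_inD(4)[OF prime])

lemmas M_mod = prime_inD(2)[OF prime]

lemma M_0: "0 : M"
 by (rule submodD(1)[OF M_mod])

lemma M_add: "x : M ==> y : M ==> x + y : M"
 by (rule submodD(2)[OF M_mod])

lemma M_diff: "x : M ==> y : M ==> x - y : M"
 by (rule submod_diff[OF sub M_mod])

lemma M_mult: "d : E ==> x : M ==> d * x : M"
 by (rule submodD(3)[OF M_mod])

lemma M_sum: "(!!i. i : I ==> f i : M) ==> sum f I : M"
 by (rule submod_sum[OF M_mod])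

lemma M_power: "x : E ==> x ^ n : M ==> x : M"
 by (rule prime_in_power[OF sub prime])

lemma cong_trans: "x - y : M ==> y - z : M ==> x - z : M"
 using M_add[of "x - y" "y - z"] by simp

lemma cong_sym: "x - y : M ==> y - x : M"
 using M_diff[OF M_0, of "x - y"] by simp

lemma cong_mult: "x - x' : M ==> y - y' : M ==> x' : E ==> y : E ==> x * y - x' * y' : M"
 using M_add[OF M_mult[of y "x - x'"] M_mult[of x' "y - y'"]] by (simp add: algebra_simps)

lemma cong_power:
 assumes "x - y : M" "x : E" "y : E"
 shows "x ^ n - y ^ n : M"
proof (induction n)
 case (Suc n)
 show ?case unfolding power_Suc by (rule cong_mult[OF assms(1) Suc assms(3) subring_power[OF sub assms(2)]])
qed (simp add: M_0)

lemma cong_mem: "x - y : M ==> y : M ==> x : M"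
 using M_add[of "x - y" y] by simp

lemma poly_mem_if_coeffs_mem:
 assumes "!!i. coeff f i : M" "x : E"
 shows "poly f x : M"
 unfolding poly_altdef
proof (rule M_sum)
 fix i
 show "coeff f i * x ^ i : M"
  using M_mult[OF subring_power[OF sub assms(2)] assms(1)] by (simp add: mult.commute)
qed

text \<open>A root splits off as a linear factor modulo \<open>M\<close>. The other roots differ
  from it modulo the prime \<open>M\<close>, so they remain roots of the cofactor.\<close>

lemma roots_bound:
 assumes "degree f <= n" "f : polys_over E" "finite R" "R <= E" "!!x. x : R ==> poly f x : M"
  "!!x y. x : R ==> y : R ==> x - y : M ==> x = y" "n < card R"
 shows "coeff f i : M"
 using assms
proof (induction n arbitrary: f R i)
 case 0
 then obtain r where r: "r : R" by fastforce
 obtain c where "f = [:c:]" using 0(1) degree_0_id[of f] by (metis le_zero_eq)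
 then show ?case using 0(5)[OF r] M_0 by (cases i) auto
next
 case (Suc n)
 from Suc.prems(3,7) obtain r where r: "r : R" by fastforce
 have rE: "r : E" using r Suc.prems(4) by (rule subsetD[rotated])
 define g where "g = synthetic_div f r"
 have g: "g : polys_over E"
 proof -
  have "synthetic_div h r : polys_over E" if "h : polys_over E" for h
   using that
  proof (induction h)
   case (pCons a h)
   have "h : polys_over E" using pCons(3) by (simp add: pCons_polys_over[OF sub])
   then show ?case using pCons(2) poly_in_subring[OF sub _ rE] by (simp add: pCons_polys_over[OF sub])
  qed simp
  then show ?thesis unfolding g_def using Suc.prems(2) .
 qed
 have f_eq: "f = [:-r, 1:] * g + [:poly f r:]" unfolding g_def by (rule synthetic_div_correct'[symmetric])
 have gM: "coeff g k : M" for k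
 proof (rule Suc.IH)
  show "degree g <= n" using Suc.prems(1) by (simp add: g_def degree_synthetic_div)
  show "g : polys_over E" by (rule g)
  show "finite (R - {r})" "R - {r} <= E" using Suc.prems(3,4) by auto
  show "n < card (R - {r})" using Suc.prems(3,7) r by simp
  show "x = y" if "x : R - {r}" "y : R - {r}" "x - y : M" for x y using Suc.prems(6)[of x y] that by simp
  show "poly g x : M" if x: "x : R - {r}" for x
  proof -
   have xE: "x : E" using x Suc.prems(4) by auto
   have "poly f x = (x - r) * poly g x + poly f r" by (subst f_eq) (simp add: algebra_simps)
   then have "(x - r) * poly g x = poly f x - poly f r" by simp
   also have "\<dots> : M" using x r by (intro M_diff Suc.prems(5)) simp_all
   finally have "x - r : M \<or> poly g x : M"
    by (rule M_prime[OF subringD(3)[OF sub xE rE] poly_in_subring[OF sub g xE]])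
   moreover have "x - r ~: M" using Suc.prems(6)[of x r] x r by auto
   ultimately show ?thesis by simp
  qed
 qed
 have "coeff ([:-r, 1:] * g) i : M"
 proof (cases i)
  case 0
  then show ?thesis using M_mult[OF subringD(5)[OF sub rE] gM[of 0]] by simp
 next
  case (Suc j)
  then show ?thesis using M_add[OF M_mult[OF subringD(5)[OF sub rE] gM[of "Suc j"]] gM[of j]] by (simp add: coeff_pCons)
 qed
 moreover have "coeff [:poly f r:] i : M" using Suc.prems(5)[OF r] M_0 by (cases i) auto
 ultimately show ?case by (subst f_eq) (simp only: coeff_add M_add)
qed

end

section \<open>Elements algebraic over the prime field\<close>

locale mod_prime_char = mod_prime E M for E M :: "'a :: idom set" +
 fixes p :: nat
 assumes p: "prime p" and pM: "of_nat p : M"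
begin

lemma frobenius_add:
 assumes x: "x : E" and y: "y : E"
 shows "(x + y) ^ (p ^ j) - (x ^ (p ^ j) + y ^ (p ^ j)) : M"
proof (induction j)
 case (Suc j)
 have base: "(x + y) ^ p - (x ^ p + y ^ p) : M" if x: "x : E" and y: "y : E" for x y
 proof -
  have "(x + y) ^ p = (\<Sum>k\<le>p. of_nat (p choose k) * x ^ k * y ^ (p - k))" by (rule binomial_ring)
  also have "\<dots> = (\<Sum>k\<in>{1..<p}. of_nat (p choose k) * x ^ k * y ^ (p - k)) + x ^ p + y ^ p"
  proof -
   have "{..p} = insert 0 (insert p {1..<p})" using prime_gt_0_nat[OF p] by auto
   then show ?thesis using prime_gt_0_nat[OF p] by (simp add: algebra_simps)
  qed
  finally have "(x + y) ^ p - (x ^ p + y ^ p) = (\<Sum>k\<in>{1..<p}. of_nat (p choose k) * x ^ k * y ^ (p - k))" by simp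
  also have "\<dots> : M"
  proof (rule M_sum)
   fix k assume "k : {1..<p}"
   then have "p dvd p choose k" using p by (intro dvd_choose_prime) auto
   then obtain m where m: "p choose k = p * m" by (elim dvdE)
   have "(of_nat m * x ^ k * y ^ (p - k)) * of_nat p : M"
    by (intro M_mult pM subringD(4)[OF sub] subring_of_nat[OF sub] subring_power[OF sub] x y)
   then show "of_nat (p choose k) * x ^ k * y ^ (p - k) : M" by (simp add: m mult_ac)
  qed
  finally show ?thesis .
 qed
 have E: "x ^ n : E" "y ^ n : E" "(x + y) ^ n : E" for n
  by (intro subring_power[OF sub] subringD(6)[OF sub] x y)+
 have "((x + y) ^ (p ^ j)) ^ p - (x ^ (p ^ j) + y ^ (p ^ j)) ^ p : M"
  by (rule cong_power[OF Suc E(3) subringD(6)[OF sub E(1,2)]])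
 from cong_trans[OF this base[OF E(1,2)]] show ?case
  by (simp add: power_mult[symmetric] mult.commute)
qed (simp add: M_0)

lemma frobenius_diff:
 assumes x: "x : E" and y: "y : E"
 shows "(x - y) ^ (p ^ j) - (x ^ (p ^ j) - y ^ (p ^ j)) : M"
 using cong_sym[OF frobenius_add[OF subringD(3)[OF sub x y] y, of j]] cong_sym by (simp add: algebra_simps)

lemma frobenius_sum:
 assumes "finite I" "!!i. i : I ==> f i : E"
 shows "(\<Sum>i\<in>I. f i) ^ (p ^ j) - (\<Sum>i\<in>I. f i ^ (p ^ j)) : M"
 using assms
proof (induction I)
 case (insert k F)
 have fE: "f k : E" "sum f F : E" using insert.prems by (auto intro: subring_sum[OF sub])
 have 1: "(f k + sum f F) ^ (p ^ j) - (f k ^ (p ^ j) + sum f F ^ (p ^ j)) : M" by (rule frobenius_add[OF fE])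
 have "sum f F ^ (p ^ j) - (\<Sum>i\<in>F. f i ^ (p ^ j)) : M" using insert by simp
 from M_add[OF 1 this] show ?case using insert.hyps by (simp add: algebra_simps)
qed (use M_0 prime_gt_0_nat[OF p] in "simp add: power_0_left")

text \<open>Modulo \<open>M\<close> the element lies in a finite field. Exponents \<open>j\<close>
  of several elements can be replaced by a common multiple, which yields closure under the ring
  operations.\<close>

definition fa :: "'a => bool" where
 "fa y \<longleftrightarrow> y : E & (\<exists>j>0. y ^ (p ^ j) - y : M)"

lemma frobenius_iterate:
 assumes y: "y : E" "y ^ (p ^ j) - y : M"
 shows "y ^ (p ^ (j * m)) - y : M"
proof (induction m)
 case (Suc m)
 have "(y ^ (p ^ (j * m))) ^ (p ^ j) - y ^ (p ^ j) : M"
  by (rule cong_power[OF Suc subring_power[OF sub y(1)] y(1)])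
 from cong_trans[OF this y(2)] show ?case by (simp add: power_mult[symmetric] power_add mult.commute)
qed (simp add: M_0)

lemma fa_common:
 assumes "finite F" "!!y. y : F ==> fa y"
 shows "\<exists>j>0. \<forall>y\<in>F. y ^ (p ^ j) - y : M"
 using assms
proof (induction F)
 case (insert x F)
 obtain j where j: "j > 0" "\<forall>y\<in>F. y ^ (p ^ j) - y : M" using insert.IH insert.prems by auto
 obtain k where k: "k > 0" "x ^ (p ^ k) - x : M" "x : E" using insert.prems[of x] unfolding fa_def by auto
 show ?case
 proof (intro exI[of _ "j * k"] conjI ballI)
  fix y assume y: "y : insert x F"
  show "y ^ (p ^ (j * k)) - y : M"
  proof (cases "y = x")
   case True
   then show ?thesis using frobenius_iterate[OF k(3,2), of j] by (simp add: mult.commute)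
  next
   case False
   then have "y : F" using y by simp
   then show ?thesis using frobenius_iterate[of y j k] j(2) insert.prems[of y] by (simp add: fa_def)
  qed
 qed (use j k in simp)
qed auto

lemma fa_frobenius: "j > 0 ==> y : E ==> y ^ (p ^ j) - y : M ==> fa y"
 unfolding fa_def by (intro conjI exI[of _ j])

lemma subring_fa: "subring_set {y. fa y}"
proof (rule subringI)
 show "1 : {y. fa y}" using subringD(1)[OF sub] M_0 by (auto intro: fa_frobenius[of 1])
 fix x y assume "x : {y. fa y}" "y : {y. fa y}"
 then have "!!z. z : {x, y} ==> fa z" by auto
 from fa_common[of "{x, y}", OF _ this] obtain j where j: "j > 0" "x ^ (p ^ j) - x : M" "y ^ (p ^ j) - y : M" by auto
 have E: "x : E" "y : E" using `x : {y. fa y}` `y : {y. fa y}` by (simp_all add: fa_def)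
 have "(x ^ (p ^ j) - y ^ (p ^ j)) - (x - y) : M" using M_diff[OF j(2,3)] by (simp add: algebra_simps)
 from cong_trans[OF frobenius_diff[OF E] this] show "x - y : {y. fa y}"
  using fa_frobenius[OF j(1) subringD(3)[OF sub E]] by simp
 have "(x * y) ^ (p ^ j) - x * y : M"
  unfolding power_mult_distrib by (rule cong_mult[OF j(2,3) E(1) subring_power[OF sub E(2)]])
 then show "x * y : {y. fa y}" using fa_frobenius[OF j(1) subringD(4)[OF sub E]] by simp
qed

text \<open>Choose a power \<open>q\<close> of \<open>p\<close> such that raising to it fixes the
  coefficients of \<open>f\<close> modulo \<open>M\<close>. Then all \<open>y^(q^k)\<close> are
  roots of \<open>f\<close>, so two of them coincide modulo \<open>M\<close>; Frobenius is injective
  on a domain and brings the coincidence down to \<open>y\<close> itself.\<close>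

lemma fa_root:
 assumes f: "!!i. fa (coeff f i)" and nz: "coeff f i ~: M" and y: "y : E" and root: "poly f y : M"
 shows "fa y"
proof -
 have fE: "f : polys_over E" using f by (simp add: polys_over_def fa_def)
 have "\<exists>j>0. \<forall>c\<in>coeff f ` {..degree f}. c ^ (p ^ j) - c : M" by (rule fa_common) (use f in auto)
 then obtain j where j: "j > 0" "!!i. i <= degree f ==> coeff f i ^ (p ^ j) - coeff f i : M" by auto
 define q where "q = p ^ j"
 have step: "poly f (x ^ q) : M" if x: "x : E" and r: "poly f x : M" for x
 proof -
  have "(\<Sum>i\<le>degree f. coeff f i * x ^ i) ^ q - (\<Sum>i\<le>degree f. (coeff f i * x ^ i) ^ q) : M"
   unfolding q_def by (rule frobenius_sum)
    (auto intro!: subringD(4)[OF sub] subring_power[OF sub] x polys_overD[OF fE])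
  moreover have "(\<Sum>i\<le>degree f. (coeff f i * x ^ i) ^ q) - (\<Sum>i\<le>degree f. coeff f i * (x ^ q) ^ i) : M"
   unfolding sum_subtractf[symmetric]
  proof (rule M_sum)
   fix i assume "i : {..degree f}"
   then have "x ^ (i * q) * (coeff f i ^ q - coeff f i) : M"
    unfolding q_def by (intro M_mult subring_power[OF sub x] j) simp
   then show "(coeff f i * x ^ i) ^ q - coeff f i * (x ^ q) ^ i : M"
    by (simp add: power_mult_distrib power_mult[symmetric] algebra_simps)
  qed
  ultimately have "poly f x ^ q - poly f (x ^ q) : M" unfolding poly_altdef by (rule cong_trans)
  moreover have "poly f x ^ q : M"
  proof -
   obtain q' where "q = Suc q'" using prime_gt_0_nat[OF p] unfolding q_def by (cases "p ^ j") auto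
   then show ?thesis using M_mult[OF subring_power[OF sub M_sub[OF r]] r, of q'] by (simp add: mult.commute)
  qed
  ultimately show ?thesis using cong_mem[OF cong_sym] by blast
 qed
 have E: "y ^ n : E" for n by (rule subring_power[OF sub y])
 have roots: "poly f (y ^ (q ^ k)) : M" for k
 proof (induction k)
  case (Suc k)
  show ?case using step[OF E Suc] by (simp add: power_mult[symmetric] mult.commute)
 qed (simp add: root)
 have "\<exists>k l. k < l & y ^ (q ^ l) - y ^ (q ^ k) : M"
 proof (rule ccontr)
  assume no: "\<not> ?thesis"
  have ncong: "k = l" if "y ^ (q ^ k) - y ^ (q ^ l) : M" for k l
   using no that cong_sym[OF that] by (cases k l rule: linorder_cases) blast+
  have inj: "inj_on (\<lambda>k. y ^ (q ^ k)) {..degree f}"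
  proof (rule inj_onI)
   fix k l assume "y ^ (q ^ k) = y ^ (q ^ l)"
   then show "k = l" using ncong[of k l] M_0 by simp
  qed
  have "coeff f i : M"
  proof (rule roots_bound[where R = "(\<lambda>k. y ^ (q ^ k)) ` {..degree f}" and n = "degree f"])
   show "degree f < card ((\<lambda>k. y ^ (q ^ k)) ` {..degree f})" by (simp add: card_image[OF inj])
   fix a b assume "a : (\<lambda>k. y ^ (q ^ k)) ` {..degree f}" "b : (\<lambda>k. y ^ (q ^ k)) ` {..degree f}" "a - b : M"
   then show "a = b" using ncong by auto
  qed (use fE roots E in auto)
  then show False using nz by simp
 qed
 then obtain k l where kl: "k < l" "y ^ (q ^ l) - y ^ (q ^ k) : M" by blast
 define z where "z = y ^ (q ^ (l - k))"
 have "z ^ (p ^ (j * k)) = y ^ (q ^ l)"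
  using kl(1) unfolding z_def q_def by (simp add: power_mult[symmetric] power_add[symmetric] distrib_left[symmetric])
 moreover have "y ^ (p ^ (j * k)) = y ^ (q ^ k)" by (simp add: q_def power_mult)
 moreover have "(z - y) ^ (p ^ (j * k)) - (z ^ (p ^ (j * k)) - y ^ (p ^ (j * k))) : M"
  by (rule frobenius_diff) (auto simp: z_def intro: E y)
 ultimately have "(z - y) ^ (p ^ (j * k)) : M" using cong_mem kl(2) by simp
 then have "z - y : M" by (rule M_power[rotated]) (auto simp: z_def intro: subringD(3)[OF sub E y])
 then show ?thesis using fa_frobenius[of "j * (l - k)" y] j(1) kl(1) y by (simp add: z_def q_def power_mult)
qed

lemma fa_of_int: "fa (of_int n)"
 using subring_of_int[OF subring_fa] by simp

lemma fa_if_integral: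
 assumes "lead_coeff (F :: int poly) = 1" "y : E" "poly (map_poly of_int F) y : M"
 shows "fa y"
 by (rule fa_root[of "map_poly of_int F" "degree F"]) (use assms fa_of_int one_notin in "simp_all add: coeff_map_poly")

end

lemma (in mod_prime) exists_prime_number:
 assumes "of_nat n : M" "n > 0"
 shows "\<exists>p. prime p & of_nat p : M"
 using assms
proof (induction n rule: less_induct)
 case (less n)
 have "n ~= 1" using less.prems one_notin by auto
 then obtain p where p: "prime p" "p dvd n" using prime_factor_nat by blast
 then obtain k where k: "n = p * k" by (elim dvdE)
 then have "k > 0" using less.prems by (cases k) auto
 have "of_nat p * of_nat k : M" using less.prems(1) k by simp
 then have "of_nat p : M \<or> of_nat k : M" by (rule M_prime[OF subring_of_nat[OF sub] subring_of_nat[OF sub]])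
 moreover have "k < n" using k `k > 0` prime_gt_1_nat[OF p(1)] by simp
 ultimately show ?case using less.IH[of k] `k > 0` p(1) by auto
qed

section \<open>A Nullstellensatz for polynomials over the algebraic integers\<close>

context mod_prime
begin

text \<open>\<open>goldman D t\<close>: modulo \<open>M\<close>, the localization \<open>D[1/t]\<close> is a field.\<close>

definition goldman :: "'a set => 'a => bool" where
 "goldman D t \<longleftrightarrow> t : D - M & (\<forall>d\<in>D - M. \<exists>n. \<exists>e\<in>D. d * e - t ^ n : M)"

definition adjoin :: "'a set => 'a => 'a set" where
 "adjoin D x = {poly f x | f. f : polys_over D}"

lemma goldmanD:
 assumes "goldman D t"
 shows "t : D" "t ~: M" "d : D ==> d ~: M ==> \<exists>n. \<exists>e\<in>D. d * e - t ^ n : M"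
proof -
 show "t : D" "t ~: M" using assms by (simp_all add: goldman_def)
 have all: "\<forall>d\<in>D - M. \<exists>n. \<exists>e\<in>D. d * e - t ^ n : M" using assms unfolding goldman_def by (rule conjunct2)
 show "\<exists>n. \<exists>e\<in>D. d * e - t ^ n : M" if "d : D" "d ~: M" by (rule bspec[OF all DiffI[OF that]])
qed

lemma adjoin_mem: "f : polys_over D ==> poly f x : adjoin D x"
 unfolding adjoin_def by (rule CollectI, intro exI[of _ f] conjI refl)

lemma adjoinE:
 assumes "y : adjoin D x"
 obtains f where "f : polys_over D" "y = poly f x"
 using assms unfolding adjoin_def by (elim CollectE exE conjE) simp

text \<open>Over a domain the units of the polynomial ring are constants: the product of the top
  coefficients outside \<open>M\<close> of \<open>U\<close> and \<open>W\<close> would survive in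
  positive degree.\<close>

lemma coeff_mem_if_unit:
 assumes U: "U : polys_over E" and W: "W : polys_over E" and UW: "!!i. coeff (U * W - 1) i : M" and n: "n > 0"
 shows "coeff U n : M"
proof (rule ccontr)
 assume ne: "coeff U n ~: M"
 have top: "\<exists>m\<ge>k. coeff H m ~: M & (\<forall>i>m. coeff H i : M)" if "coeff H k ~: M" for H :: "'a poly" and k
 proof -
  define S where "S = {i. coeff H i ~: M}"
  have mem: "i : S \<longleftrightarrow> coeff H i ~: M" for i by (simp add: S_def)
  have "S <= {..degree H}"
  proof
   fix i assume i: "i : S"
   show "i : {..degree H}"
   proof (rule ccontr)
    assume "i ~: {..degree H}"
    then have "coeff H i = 0" by (simp add: coeff_eq_0)
    then show False using i M_0 unfolding mem by simp
   qed
  qed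
  then have fin: "finite S" by (rule finite_subset) simp
  have kS: "k : S" unfolding mem by (rule that)
  then have "Max S : S" using Max_in[OF fin] by auto
  then have 1: "coeff H (Max S) ~: M" unfolding mem .
  have 2: "k <= Max S" by (rule Max_ge[OF fin kS])
  have 3: "coeff H i : M" if "i > Max S" for i
  proof (rule ccontr)
   assume "coeff H i ~: M"
   then have "i : S" unfolding mem .
   then show False using Max_ge[OF fin, of i] that by simp
  qed
  from 1 2 3 show ?thesis by (intro exI[of _ "Max S"] conjI allI impI)
 qed
 obtain m where m: "m \<ge> n" "coeff U m ~: M" "!!i. i > m ==> coeff U i : M" using top[OF ne] by blast
 have "\<exists>k. coeff W k ~: M"
 proof (rule ccontr)
  assume "\<not> ?thesis"
  then have "coeff (U * W) 0 : M" unfolding coeff_mult using polys_overD[OF U] by (intro M_sum M_mult) auto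
  then have "coeff (U * W) 0 - coeff (U * W - 1) 0 : M" using UW by (rule M_diff)
  then show False using one_notin by simp
 qed
 then obtain k where "coeff W k ~: M" by blast
 from top[OF this] obtain l where l: "coeff W l ~: M" "!!i. i > l ==> coeff W i : M" by blast
 have "coeff (U * W) (m + l) = (\<Sum>i\<le>m + l. coeff U i * coeff W (m + l - i))" by (rule coeff_mult)
 also have "\<dots> = (\<Sum>i\<in>{..m + l} - {m}. coeff U i * coeff W (m + l - i)) + coeff U m * coeff W l"
  by (subst sum.remove[of _ m]) auto
 finally have "coeff U m * coeff W l = coeff (U * W - 1) (m + l) - (\<Sum>i\<in>{..m + l} - {m}. coeff U i * coeff W (m + l - i))"
  using m(1) n by simp
 also have "\<dots> : M"
 proof (intro M_diff UW M_sum)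
  fix i assume i: "i : {..m + l} - {m}"
  show "coeff U i * coeff W (m + l - i) : M"
  proof (cases "i < m")
   case True
   then show ?thesis by (intro M_mult polys_overD[OF U] l(2)) simp
  next
   case False
   then have "coeff W (m + l - i) * coeff U i : M" using i by (intro M_mult polys_overD[OF W] m(3)) simp
   then show ?thesis by (simp add: mult.commute)
  qed
 qed
 finally show False using M_prime[OF polys_overD[OF U] polys_overD[OF W]] m(2) l(1) by blast
qed

text \<open>A polynomial ring over a domain does not become a field on inverting one element
  \<open>g\<close>. Otherwise \<open>1 + T g\<close> would divide a power of \<open>g\<close>; being
  prime to \<open>T g\<close> it would be a unit, hence constant, so that
  \<open>g = 0\<close>.\<close>

lemma algebraic_if_goldman_adjoin:
 assumes D: "subring_set D" and DE: "D <= E" and x: "x : E" and gold: "goldman (adjoin D x) t"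
 shows "\<exists>f\<in>polys_over D. poly f x : M & (\<exists>i. coeff f i ~: M)"
proof (rule ccontr)
 assume no: "\<not> ?thesis"
 have tr: "coeff f i : M" if "f : polys_over D" "poly f x : M" for f i using no that by blast
 note P = subring_polys_over[OF D]
 obtain g where g: "g : polys_over D" "t = poly g x" using goldmanD(1)[OF gold] by (rule adjoinE)
 have t: "t ~: M" by (rule goldmanD(2)[OF gold])
 \<comment> \<open>The factor \<open>monom 1 1\<close> keeps \<open>U\<close> nonconstant even if
   \<open>g\<close> is constant, and gives it the constant term \<open>1\<close>.\<close>
 define U where "U = 1 + monom 1 1 * g"
 have mP: "monom 1 1 : polys_over D" by (rule monom_polys_over[OF D subringD(1)[OF D]])
 have U: "U : polys_over D" unfolding U_def by (rule subringD(6)[OF P subringD(1)[OF P] subringD(4)[OF P mP g(1)]])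
 have "coeff U 0 = 1" by (simp add: U_def coeff_monom_mult)
 then have Ux: "poly U x ~: M" using tr[OF U, of 0] one_notin by auto
 obtain n e where e: "e : adjoin D x" "poly U x * e - t ^ n : M"
  using goldmanD(3)[OF gold adjoin_mem[OF U] Ux] by (elim exE bexE)
 obtain h where h: "h : polys_over D" "e = poly h x" using e(1) by (rule adjoinE)
 \<comment> \<open>Modulo \<open>U\<close> the product \<open>monom 1 1 * g\<close> is
   \<open>-1\<close>.\<close>
 have "\<exists>w\<in>polys_over D. monom 1 n * g ^ n = U * w + (- 1) ^ n"
 proof -
  define y where "y = monom 1 1 * g"
  have yP: "y : polys_over D" unfolding y_def by (rule subringD(4)[OF P mP g(1)])
  have "\<exists>w\<in>polys_over D. y ^ n = (1 + y) * w + (- 1) ^ n"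
  proof (induction n)
   case 0
   show ?case using subringD(2)[OF P] by (intro bexI[of _ 0]) simp_all
  next
   case (Suc n)
   then obtain w where w: "w : polys_over D" "y ^ n = (1 + y) * w + (- 1) ^ n" by blast
   have "y ^ Suc n = (1 + y) * (y * w + (- 1) ^ n) + (- 1) ^ Suc n" using w(2) by (simp add: algebra_simps)
   moreover have "y * w + (- 1) ^ n : polys_over D"
    by (intro subringD(6)[OF P] subringD(4)[OF P yP w(1)] subring_power[OF P] subringD(5)[OF P] subringD(1)[OF P])
   ultimately show ?case by (rule bexI)
  qed
  moreover have "y ^ n = monom 1 n * g ^ n" by (simp add: y_def power_mult_distrib monom_power)
  ultimately show ?thesis by (simp add: U_def y_def)
 qed
 then obtain w where w: "w : polys_over D" "monom 1 n * g ^ n = U * w + (- 1) ^ n" by blast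
 \<comment> \<open>If \<open>U * h\<close> equalled \<open>g ^ n\<close>, this would be an inverse
   of \<open>U\<close>. The two agree at \<open>x\<close> modulo \<open>M\<close>, and the absence
   of relations for \<open>x\<close> turns agreement at \<open>x\<close> into agreement of
   coefficients.\<close>
 define W where "W = (- 1) ^ n * (monom 1 n * h - w)"
 have mn: "monom 1 n : polys_over D" by (rule monom_polys_over[OF D subringD(1)[OF D]])
 have W: "W : polys_over D" unfolding W_def
  by (intro subringD(4)[OF P] subringD(3)[OF P] mn h(1) w(1) subring_power[OF P] subringD(5)[OF P] subringD(1)[OF P])
 have "U * W - 1 = (- 1) ^ n * (monom 1 n * (U * h - g ^ n))"
 proof -
  have sq: "(- 1) ^ n * (- 1) ^ n = (1 :: 'a poly)" by (simp flip: power_mult_distrib)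
  have "U * W = (- 1) ^ n * (monom 1 n * (U * h) - U * w)" by (simp add: W_def algebra_simps)
  also have "U * w = monom 1 n * g ^ n - (- 1) ^ n" using w(2) by simp
  also have "(- 1) ^ n * (monom 1 n * (U * h) - (monom 1 n * g ^ n - (- 1) ^ n)) =
    (- 1) ^ n * (monom 1 n * (U * h - g ^ n)) + (- 1) ^ n * (- 1) ^ n" by (simp add: algebra_simps)
  finally show ?thesis unfolding sq by simp
 qed
 then have "poly (U * W - 1) x = ((- 1) ^ n * x ^ n) * (poly U x * e - t ^ n)"
  by (simp add: h(2) g(2) poly_monom)
 also have "\<dots> : M"
  by (intro M_mult e(2) subringD(4)[OF sub] subring_power[OF sub] x subringD(5)[OF sub] subringD(1)[OF sub])
 finally have UW: "coeff (U * W - 1) i : M" for i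
  by (intro tr subringD(3)[OF P] subringD(4)[OF P] U W subringD(1)[OF P])
 have up: "H : polys_over E" if "H : polys_over D" for H using that DE by (auto simp: polys_over_def)
 have "coeff g i : M" for i
 proof -
  have "coeff U (Suc i) : M" by (rule coeff_mem_if_unit[OF up[OF U] up[OF W] UW]) simp
  then show ?thesis by (simp add: U_def coeff_monom_mult)
 qed
 then have "t : M" unfolding g(2) by (rule poly_mem_if_coeffs_mem[OF _ x])
 then show False using t by simp
qed

text \<open>Let \<open>a\<close> be the leading coefficient of a relation of least degree for
  \<open>x\<close>. A nonzero multiple of \<open>t\<close> of least degree in \<open>x\<close> is
  shown to be a constant \<open>b\<close>. Then inverting \<open>a * b\<close> suffices: an inverse
  found in \<open>D[x]\<close> is reduced by the relation, and its constant coefficient does the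
  work.\<close>

lemma goldman_if_goldman_adjoin:
 assumes D: "subring_set D" and DE: "D <= E" and x: "x : E" and gold: "goldman (adjoin D x) t"
 shows "\<exists>t'. goldman D t'"
proof -
 note P = subring_polys_over[OF D]
 have up: "H : polys_over E" if "H : polys_over D" for H using that DE by (auto simp: polys_over_def)
 have px: "poly H x : E" if "H : polys_over D" for H by (rule poly_in_subring[OF sub up[OF that] x])
 have pD: "coeff H i : D" if "H : polys_over D" for H i by (rule polys_overD[OF that])
 have pE: "coeff H i : E" if "H : polys_over D" for H i using polys_overD[OF up[OF that]] .
 define good where "good f \<longleftrightarrow> f : polys_over D & poly f x : M & (\<exists>i. coeff f i ~: M)" for f
 obtain f0 where f0: "good f0" using algebraic_if_goldman_adjoin[OF assms] unfolding good_def by blast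
 define Ph where "Ph = arg_min degree good"
 have Ph: "good Ph" unfolding Ph_def by (rule arg_min_natI[where P = good, OF f0])
 have min: "degree Ph <= degree f" if "good f" for f unfolding Ph_def by (rule arg_min_nat_le[where P = good, OF that])
 have PhD: "Ph : polys_over D" "poly Ph x : M" using Ph by (simp_all add: good_def)
 have small: "coeff f i : M" if "f : polys_over D" "poly f x : M" "degree f < degree Ph" for f i
  using min[of f] that unfolding good_def by (meson not_less)
 have drop: "\<exists>f'. f' : polys_over D & degree f' < degree f & poly f x - poly f' x : M & (\<forall>i. coeff f i - coeff f' i : M)"
  if f: "f : polys_over D" "lead_coeff f : M" "degree f > 0" for f
 proof (intro exI conjI allI)
  let ?m = "monom (lead_coeff f) (degree f)"
  show "f - ?m : polys_over D" by (rule subringD(3)[OF P f(1) monom_polys_over[OF D pD[OF f(1)]]])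
  show "degree (f - ?m) < degree f" by (rule degree_lessI) (use f(3) in "auto intro!: degree_diff_le degree_monom_le")
  show c: "coeff f i - coeff (f - ?m) i : M" for i using f(2) M_0 by (cases "degree f = i") auto
  show "poly f x - poly (f - ?m) x : M"
   using M_mult[OF subring_power[OF sub x, of "degree f"] f(2)] by (simp add: poly_monom mult.commute)
 qed
 have const: "f = [:coeff f 0:]" if "degree f = 0" for f :: "'a poly" using degree_0_id[OF that] by simp
 have d0: "degree Ph > 0"
 proof (rule ccontr)
  assume "\<not> ?thesis"
  then have c: "Ph = [:coeff Ph 0:]" using const[of Ph] by simp
  then have "poly Ph x = coeff Ph 0" by (metis poly_const_conv)
  then have "coeff Ph 0 : M" using PhD(2) by simp
  then have "coeff Ph i : M" for i using c M_0 by (cases i) (simp, metis coeff_pCons_Suc coeff_0)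
  then show False using Ph by (simp add: good_def)
 qed
 define a where "a = lead_coeff Ph"
 have a: "a : D" "a ~: M"
 proof -
  show "a : D" unfolding a_def by (rule pD[OF PhD(1)])
  show "a ~: M"
  proof
   assume "a : M"
   then obtain f' where f': "f' : polys_over D" "degree f' < degree Ph" "poly Ph x - poly f' x : M"
    "\<forall>i. coeff Ph i - coeff f' i : M" using drop[OF PhD(1) _ d0] unfolding a_def by blast
   have "poly f' x : M" by (rule cong_mem[OF cong_sym[OF f'(3)] PhD(2)])
   then have "coeff f' i : M" for i by (rule small[OF f'(1) _ f'(2)])
   then have "coeff Ph i : M" for i using cong_mem f'(4) by blast
   then show False using Ph by (simp add: good_def)
  qed
 qed
 have aE: "a : E" using a(1) DE by (rule subsetD[rotated])
 obtain g where g: "g : polys_over D" "t = poly g x" using goldmanD(1)[OF gold] by (rule adjoinE)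
 have t: "t ~: M" "t : E" using goldmanD(2)[OF gold] px[OF g(1)] g(2) by simp_all
 \<comment> \<open>Modulo \<open>M\<close>, the value \<open>poly s x\<close> is a nonzero multiple
   of \<open>t\<close>.\<close>
 define rep where "rep s \<longleftrightarrow> s : polys_over D & poly s x ~: M & (\<exists>v\<in>polys_over D. poly s x - poly v x * t : M)" for s
 obtain N1 q1 r1 where r1: "q1 : polys_over D" "r1 : polys_over D" "smult (a ^ N1) g = q1 * Ph + r1" "degree r1 < degree Ph"
  using pseudo_division[OF D PhD(1) d0 g(1)] unfolding a_def by blast
 have aN: "a ^ n : E" "a ^ n ~: M" "a ^ n : D" for n
  using subring_power[OF sub aE] subring_power[OF D a(1)] M_power[OF aE] a(2) by blast+
 have r1x: "poly r1 x - a ^ N1 * t : M"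
 proof -
  have "a ^ N1 * t = poly q1 x * poly Ph x + poly r1 x" using arg_cong[OF r1(3), of "\<lambda>f. poly f x"] by (simp add: g(2))
  then have "a ^ N1 * t - poly r1 x : M" using M_mult[OF px[OF r1(1)] PhD(2)] by simp
  then show ?thesis by (rule cong_sym)
 qed
 have "rep r1" unfolding rep_def
 proof (intro conjI bexI)
  show "r1 : polys_over D" by (rule r1(2))
  show "[:a ^ N1:] : polys_over D" by (rule const_polys_over[OF D aN(3)])
  show "poly r1 x - poly [:a ^ N1:] x * t : M" using r1x by simp
  show "poly r1 x ~: M"
  proof
   assume "poly r1 x : M"
   then have "a ^ N1 * t : M" by (rule cong_mem[OF cong_sym[OF r1x]])
   then show False using M_prime[OF aN(1) t(2)] aN(2) t(1) by blast
  qed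
 qed
 define s where "s = arg_min degree rep"
 have s: "rep s" unfolding s_def by (rule arg_min_natI[where P = rep, OF `rep r1`])
 have smin: "degree s <= degree f" if "rep f" for f unfolding s_def by (rule arg_min_nat_le[where P = rep, OF that])
 have sdeg: "degree s < degree Ph" using smin[OF `rep r1`] r1(4) by simp
 have sD: "s : polys_over D" "poly s x ~: M" using s by (simp_all add: rep_def)
 obtain v where v: "v : polys_over D" "poly s x - poly v x * t : M" using s unfolding rep_def by blast
 have "degree s = 0"
 proof (rule ccontr)
  assume "degree s ~= 0"
  then have sd: "degree s > 0" by simp
  have ls: "lead_coeff s ~: M"
  proof
   assume "lead_coeff s : M"
   then obtain f' where f': "f' : polys_over D" "degree f' < degree s" "poly s x - poly f' x : M"
    using drop[OF sD(1) _ sd] by blast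
   have "rep f'" unfolding rep_def
    using f'(1) v(1) cong_trans[OF cong_sym[OF f'(3)] v(2)] cong_mem[OF f'(3)] sD(2) by blast
   then show False using smin[of f'] f'(2) by simp
  qed
  define b where "b = lead_coeff s"
  have b: "b : D" "b : E" "b ~: M" using ls pD[OF sD(1)] pE[OF sD(1)] by (simp_all add: b_def)
  \<comment> \<open>The value of \<open>r\<close> at \<open>x\<close> is again a multiple of
    \<open>t\<close>, of smaller degree, hence zero modulo \<open>M\<close>. Then \<open>q\<close>
    vanishes at \<open>x\<close> too, and as both degrees are below that of \<open>Ph\<close>, all
    coefficients of \<open>q\<close> and \<open>r\<close> lie in \<open>M\<close>. This contradicts
    the leading coefficient of \<open>Ph\<close>.\<close>
  obtain N q r where r: "q : polys_over D" "r : polys_over D" "smult (b ^ N) Ph = q * s + r" "degree r < degree s"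
   using pseudo_division[OF D sD(1) sd PhD(1)] unfolding b_def by blast
  have rx: "b ^ N * poly Ph x = poly q x * poly s x + poly r x" using arg_cong[OF r(3), of "\<lambda>f. poly f x"] by simp
  have bN: "b ^ N : E" "b ^ N ~: M" using subring_power[OF sub b(2)] M_power[OF b(2)] b(3) by blast+
  have rM: "poly r x : M"
  proof (rule ccontr)
   assume nr: "poly r x ~: M"
   have "poly r x - poly (- (q * v)) x * t = b ^ N * poly Ph x - poly q x * (poly s x - poly v x * t)"
    using rx by (simp add: algebra_simps)
   also have "\<dots> : M" by (intro M_diff M_mult bN PhD(2) px r(1) v(2))
   finally have "rep r" unfolding rep_def
    using r(2) nr subringD(5)[OF P subringD(4)[OF P r(1) v(1)]] by blast
   then show False using smin[of r] r(4) by simp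
  qed
  have "poly q x * poly s x = b ^ N * poly Ph x - poly r x" using rx by simp
  also have "\<dots> : M" by (intro M_diff M_mult bN PhD(2) rM)
  finally have qM: "poly q x : M" using M_prime[OF px[OF r(1)] px[OF sD(1)]] sD(2) by blast
  have "degree q < degree Ph"
  proof (cases "q = 0")
   case False
   have "degree q + degree s = degree (q * s)" using False sd by (intro degree_mult_eq[symmetric]) auto
   also have "q * s = smult (b ^ N) Ph - r" using r(3) by simp
   also have "degree \<dots> <= degree Ph" using r(4) sdeg by (intro degree_diff_le degree_smult_le) simp
   finally show ?thesis using sd by simp
  qed (use d0 in simp)
  then have qc: "coeff q i : M" for i by (rule small[OF r(1) qM])
  have rc: "coeff r i : M" for i by (rule small[OF r(2) rM]) (use r(4) sdeg in simp)
  have "b ^ N * a = coeff (q * s) (degree Ph) + coeff r (degree Ph)"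
   using arg_cong[OF r(3), of "\<lambda>f. coeff f (degree Ph)"] by (simp add: a_def)
  also have "\<dots> : M"
  proof (intro M_add rc)
   have "coeff s k * coeff q l : M" for k l by (intro M_mult pE[OF sD(1)] qc)
   then show "coeff (q * s) (degree Ph) : M" unfolding coeff_mult by (intro M_sum) (simp add: mult.commute)
  qed
  finally show False using M_prime[OF bN(1) aE] bN(2) a(2) by blast
 qed
 define b where "b = coeff s 0"
 have "s = [:b:]" unfolding b_def by (rule const[OF `degree s = 0`])
 then have sx: "poly s x = b" by (metis poly_const_conv)
 have b: "b : D" "b : E" "b ~: M" using pD[OF sD(1)] pE[OF sD(1)] sD(2) sx by (simp_all add: b_def)
 have "goldman D (a * b)" unfolding goldman_def
 proof (intro conjI ballI)
  show "a * b : D - M" using subringD(4)[OF D a(1) b(1)] M_prime[OF aE b(2)] a(2) b(3) by blast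
  fix d assume d: "d : D - M"
  have dE: "d : E" using d DE by blast
  have "d = poly [:d:] x" by simp
  then have "d : adjoin D x" using d adjoin_mem[OF const_polys_over[OF D], of d] by simp
  then obtain n e where ne: "e : adjoin D x" "d * e - t ^ n : M" using goldmanD(3)[OF gold] d by (metis DiffE)
  obtain h where h: "h : polys_over D" "e = poly h x" using ne(1) by (rule adjoinE)
  define H where "H = h * v ^ n"
  have H: "H : polys_over D" unfolding H_def by (rule subringD(4)[OF P h(1) subring_power[OF P v(1)]])
  have vE: "poly v x : E" by (rule px[OF v(1)])
  have dH: "d * poly H x - b ^ n : M"
  proof -
   have "poly v x ^ n * (d * e - t ^ n) : M" by (intro M_mult subring_power[OF sub vE] ne(2))
   then have "d * poly H x - (poly v x * t) ^ n : M" by (simp add: H_def h(2) power_mult_distrib algebra_simps)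
   moreover have "(poly v x * t) ^ n - b ^ n : M"
    using cong_power[OF cong_sym[OF v(2)] subringD(4)[OF sub vE t(2)] px[OF sD(1)]] by (simp add: sx)
   ultimately show ?thesis by (rule cong_trans)
  qed
  obtain N q r where r: "q : polys_over D" "r : polys_over D" "smult (a ^ N) H = q * Ph + r" "degree r < degree Ph"
   using pseudo_division[OF D PhD(1) d0 H] unfolding a_def by blast
  have rx: "a ^ N * poly H x = poly q x * poly Ph x + poly r x" using arg_cong[OF r(3), of "\<lambda>f. poly f x"] by simp
  \<comment> \<open>It vanishes at \<open>x\<close> modulo \<open>M\<close> and has degree below
    that of \<open>Ph\<close>, so its constant coefficient lies in \<open>M\<close>:
    \<open>d\<close> times \<open>coeff r 0\<close> is \<open>a ^ N * b ^ n\<close>.\<close>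
  define f where "f = smult d r - [:a ^ N * b ^ n:]"
  have fD: "f : polys_over D"
  proof -
   have "[:d:] * r - [:a ^ N * b ^ n:] : polys_over D"
    using d by (intro subringD(3)[OF P] subringD(4)[OF P] const_polys_over[OF D] r(2) subringD(4)[OF D] aN(3) subring_power[OF D b(1)]) simp
   then show ?thesis by (simp add: f_def)
  qed
  have "poly f x = a ^ N * (d * poly H x - b ^ n) - (d * poly q x) * poly Ph x"
  proof -
   have e: "poly r x = a ^ N * poly H x - poly q x * poly Ph x" using rx by simp
   have "poly f x = d * poly r x - a ^ N * b ^ n" by (simp add: f_def)
   then show ?thesis unfolding e by (simp add: algebra_simps)
  qed
  also have "\<dots> : M" by (intro M_diff M_mult aN dH PhD(2) subringD(4)[OF sub dE px[OF r(1)]])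
  finally have fM: "poly f x : M" .
  have "degree f < degree Ph"
  proof -
   have "degree f <= degree r" unfolding f_def by (intro degree_diff_le degree_smult_le) simp
   then show ?thesis using r(4) by simp
  qed
  from small[OF fD fM this, of 0] have f0: "d * coeff r 0 - a ^ N * b ^ n : M" by (simp add: f_def)
  have "(a ^ n * b ^ N) * (d * coeff r 0 - a ^ N * b ^ n) : M"
   by (intro M_mult f0 subringD(4)[OF sub] aN subring_power[OF sub b(2)])
  then have "d * (coeff r 0 * (a ^ n * b ^ N)) - (a * b) ^ (N + n) : M"
   by (simp add: power_mult_distrib power_add algebra_simps)
  moreover have "coeff r 0 * (a ^ n * b ^ N) : D"
   by (intro subringD(4)[OF D] pD[OF r(2)] aN(3) subring_power[OF D b(1)])
  ultimately show "\<exists>n. \<exists>e\<in>D. d * e - (a * b) ^ n : M" by (intro exI bexI)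
 qed
 then show ?thesis by (rule exI)
qed

end

lemma algebraic_int_root:
 fixes c :: "'a :: field_char_0"
 assumes "algebraic_int c"
 shows "\<exists>F :: int poly. lead_coeff F = 1 & poly (map_poly of_int F) (cc c) = 0"
proof -
 obtain F :: "int poly" where F: "poly (map_poly of_int F) c = 0" "lead_coeff F = 1"
  using assms unfolding algebraic_int_altdef_ipoly by blast
 have "poly (map_poly of_int F) (cc c) = 0" using F(1) poly_of_int_hom[OF comm_ring_hom_cc, of F c, symmetric] by simp
 then show ?thesis using F(2) by blast
qed

lemma subring_cc_image:
 assumes "subring_set D"
 shows "subring_set (cc ` D)"
proof (rule subringI)
 show "1 : cc ` D" by (rule image_eqI[of _ _ 1]) (simp_all add: subringD(1)[OF assms])
 fix x y assume "x : cc ` D" "y : cc ` D"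
 then obtain a b where ab: "x = cc a" "a : D" "y = cc b" "b : D" by (elim imageE)
 show "x - y : cc ` D" by (rule image_eqI[of _ _ "a - b"]) (simp_all add: ab cc.hom_minus subringD(3)[OF assms])
 show "x * y : cc ` D" by (rule image_eqI[of _ _ "a * b"]) (simp_all add: ab cc.hom_mult subringD(4)[OF assms])
qed

context mod_prime
begin

lemma subring_adjoin:
 assumes "subring_set D"
 shows "subring_set (adjoin D x)"
proof (rule subringI)
 note P = subring_polys_over[OF assms]
 show "1 : adjoin D x" using adjoin_mem[OF subringD(1)[OF P], of x] by simp
 fix y z assume "y : adjoin D x" "z : adjoin D x"
 then obtain f g where fg: "f : polys_over D" "y = poly f x" "g : polys_over D" "z = poly g x" by (elim adjoinE)
 show "y - z : adjoin D x" "y * z : adjoin D x"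
  using adjoin_mem[OF subringD(3)[OF P fg(1,3)], of x] adjoin_mem[OF subringD(4)[OF P fg(1,3)], of x] fg(2,4) by simp_all
qed

lemma adjoin_superset:
 assumes D: "subring_set D"
 shows "D <= adjoin D x" "x : adjoin D x"
proof
 show "d : adjoin D x" if "d : D" for d using adjoin_mem[OF const_polys_over[OF D that], of x] by simp
 have "[:0, 1:] : polys_over D" by (simp add: pCons_polys_over[OF D] subringD[OF D] subringD[OF subring_polys_over[OF D]])
 from adjoin_mem[OF this, of x] show "x : adjoin D x" by simp
qed

lemma adjoin_subset:
 assumes "subring_set B" "D <= B" "x : B"
 shows "adjoin D x <= B"
proof
 fix y assume "y : adjoin D x"
 then obtain f where f: "f : polys_over D" "y = poly f x" by (rule adjoinE)
 have "f : polys_over B" using f(1) assms(2) by (auto simp: polys_over_def)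
 then show "y : B" unfolding f(2) by (rule poly_in_subring[OF assms(1) _ assms(3)])
qed

end

text \<open>Modulo \<open>M\<close> the polynomial ring is a field, so the image of the algebraic
  integers becomes a field on inverting one element. If \<open>M\<close> contained no prime number,
  that image would be the full ring of algebraic integers, where infinitely many prime numbers would
  have to become units. Once \<open>p\<close> lies in \<open>M\<close>, algebraic integers are
  algebraic over the prime field, and then so are \<open>X\<close> and \<open>Y\<close> in
  turn.\<close>

theorem nullstellensatz_algebraic_ints:
 fixes A :: "'a :: field_char_0 set"
 defines "A \<equiv> {x. algebraic_int x}"
 assumes M: "prime_in (polys2 A) M" and max: "!!d. d : polys2 A ==> d ~: M ==> \<exists>e\<in>polys2 A. d * e - 1 : M"
 shows "\<exists>p. prime p & of_nat p : M & mod_prime_char.fa (polys2 A) M p var_X & mod_prime_char.fa (polys2 A) M p var_Y"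
proof -
 have A: "subring_set A" unfolding A_def by (rule subring_algebraic_ints)
 note E = subring_polys2[OF A]
 interpret mod_prime "polys2 A" M by unfold_locales (rule E, rule M)
 define D0 where "D0 = cc ` A"
 define D1 where "D1 = adjoin D0 var_X"
 have D0: "subring_set D0" unfolding D0_def by (rule subring_cc_image[OF A])
 have D1: "subring_set D1" unfolding D1_def by (rule subring_adjoin[OF D0])
 have D0E: "D0 <= polys2 A" unfolding D0_def by (auto simp: cc_polys2[OF A])
 have D1E: "D1 <= polys2 A" unfolding D1_def by (rule adjoin_subset[OF E D0E var_polys2(1)[OF A]])
 have top: "adjoin D1 var_Y = polys2 A"
 proof (rule equalityI)
  show "adjoin D1 var_Y <= polys2 A" by (rule adjoin_subset[OF E D1E var_polys2(2)[OF A]])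
  show "polys2 A <= adjoin D1 var_Y"
  proof
   fix f assume "f : polys2 A"
   then show "f : adjoin D1 var_Y"
   proof (rule polys2_induct[OF _ subring_adjoin[OF D1]])
    fix c assume "c : A"
    then have "cc c : D0" by (simp add: D0_def)
    then have "cc c : D1" unfolding D1_def by (rule subsetD[OF adjoin_superset(1)[OF D0]])
    then show "cc c : adjoin D1 var_Y" by (rule subsetD[OF adjoin_superset(1)[OF D1]])
   next
    have "var_X : D1" unfolding D1_def by (rule adjoin_superset(2)[OF D0])
    then show "var_X : adjoin D1 var_Y" by (rule subsetD[OF adjoin_superset(1)[OF D1]])
   qed (rule adjoin_superset(2)[OF D1])
  qed
 qed
 have g2: "goldman (adjoin D1 var_Y) 1" unfolding goldman_def top
 proof (intro conjI ballI)
  show "1 : polys2 A - M" using subringD(1)[OF E] one_notin by simp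
  fix d assume "d : polys2 A - M"
  then show "\<exists>n. \<exists>e\<in>polys2 A. d * e - 1 ^ n : M" using max[of d] by simp
 qed
 obtain t1 where g1: "goldman (adjoin D0 var_X) t1"
  using goldman_if_goldman_adjoin[OF D1 D1E var_polys2(2)[OF A] g2] unfolding D1_def by (elim exE)
 obtain t0 where g0: "goldman D0 t0"
  using goldman_if_goldman_adjoin[OF D0 D0E var_polys2(1)[OF A] g1] by (elim exE)
 obtain ta where ta: "t0 = cc ta" "ta : A" using goldmanD(1)[OF g0] unfolding D0_def by (rule imageE)
 have ccA: "cc c : polys2 A" if "c : A" for c using that by (simp add: cc_polys2[OF A])
 have "\<exists>p. prime p & of_nat p : M"
 proof (rule ccontr)
  assume no: "\<not> ?thesis"
  have noint: "n = 0" if "of_int n : M" for n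
  proof (rule ccontr)
   assume "n ~= 0"
   have "of_nat (nat \<bar>n\<bar>) : M"
    using that M_diff[OF M_0 that] by (cases "n \<ge> 0") (simp_all add: abs_if)
   then show False using exists_prime_number[of "nat \<bar>n\<bar>"] `n ~= 0` no by simp
  qed
  have nocc: "c = 0" if c: "c : A" "cc c : M" for c
  proof (rule ccontr)
   assume "c ~= 0"
   then obtain n y where n: "n ~= (0 :: int)" "algebraic_int y" "of_int n = c * y"
    using nonzero_int_multiple c(1) unfolding A_def by blast
   have "y : A" using n(2) by (simp add: A_def)
   have "cc y * cc c : M" by (rule M_mult[OF ccA[OF `y : A`] c(2)])
   also have "cc y * cc c = cc (c * y)" by (simp add: cc.hom_mult mult.commute)
   also have "\<dots> = of_int n" unfolding n(3)[symmetric] by (rule cc.hom_of_int)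
   finally have "of_int n : M" .
   then show False using noint n(1) by simp
  qed
  have "ta ~= 0" using goldmanD(2)[OF g0] ta(1) M_0 by (auto simp: cc.hom_zero)
  then obtain n y where n: "n ~= (0 :: int)" "algebraic_int y" "of_int n = ta * y"
   using nonzero_int_multiple ta(2) unfolding A_def by blast
  \<comment> \<open>A prime that does not divide the integer multiple \<open>n\<close> of
    \<open>ta\<close>. If it divided a power of \<open>ta\<close> among the algebraic integers, it
    would divide the same power of \<open>n\<close>.\<close>
  obtain l where l: "prime l" "l > nat \<bar>n\<bar>" using bigger_prime by blast
  have "of_nat l = cc (of_nat l :: 'a)" by (simp add: cc.hom_of_nat)
  then have lD: "of_nat l : D0" unfolding D0_def by (rule image_eqI) (rule subring_of_nat[OF A])
  have lM: "of_nat l ~: M" using no l(1) by blast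
  obtain k e where e: "e : D0" "of_nat l * e - t0 ^ k : M" using goldmanD(3)[OF g0 lD lM] by (elim exE bexE)
  obtain ep where ep: "e = cc ep" "ep : A" using e(1) unfolding D0_def by (rule imageE)
  have "cc (of_nat l * ep - ta ^ k) : M"
   using e(2) unfolding ep(1) ta(1) by (simp add: cc.hom_minus cc.hom_mult cc.hom_power cc.hom_of_nat)
  then have "of_nat l * ep - ta ^ k = 0"
   by (rule nocc[rotated]) (intro subringD(3)[OF A] subringD(4)[OF A] subring_of_nat[OF A] subring_power[OF A] ep(2) ta(2))
  then have "of_nat l * (ep * y ^ k) = (of_int n :: 'a) ^ k" unfolding n(3) by (simp add: power_mult_distrib mult.assoc[symmetric])
  moreover have l0: "(of_nat l :: 'a) ~= 0" using prime_gt_0_nat[OF l(1)] by simp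
  ultimately have eq: "ep * y ^ k = of_int (n ^ k) / of_nat l" by (simp add: field_simps)
  have "y : A" using n(2) by (simp add: A_def)
  have "ep * y ^ k : A" by (rule subringD(4)[OF A ep(2) subring_power[OF A `y : A`]])
  then have "algebraic_int (ep * y ^ k)" by (simp add: A_def)
  moreover have "ep * y ^ k : \<rat>" unfolding eq by simp
  ultimately have "ep * y ^ k : \<int>" by (rule rational_algebraic_int_is_int)
  then obtain m where "ep * y ^ k = of_int m" by (rule Ints_cases)
  then have "(of_int (n ^ k) :: 'a) = of_int (int l * m)" using eq l0 by (simp add: field_simps)
  then have "n ^ k = int l * m" by (simp only: of_int_eq_iff)
  then have "int l dvd n ^ k" by simp
  moreover have "prime (int l)" using l(1) by simp
  ultimately have "int l dvd n" using prime_dvd_power by blast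
  then have "\<bar>int l\<bar> <= \<bar>n\<bar>" by (rule dvd_imp_le_int[OF n(1)])
  then show False using l(2) by simp
 qed
 then obtain p where p: "prime p" "of_nat p : M" by (elim exE conjE)
 interpret mod_prime_char "polys2 A" M p by unfold_locales (rule p(1), rule p(2))
 have fa0: "fa (cc c)" if cA: "c : A" for c
 proof -
  obtain F :: "int poly" where F: "lead_coeff F = 1" "poly (map_poly of_int F) (cc c) = 0"
   using algebraic_int_root[OF CollectD[OF cA[unfolded A_def]]] by (elim exE conjE)
  show ?thesis by (rule fa_if_integral[OF F(1) ccA[OF cA]]) (simp add: F(2) M_0)
 qed
 have fD0: "fa d" if d: "d : D0" for d
 proof -
  obtain c where "d = cc c" "c : A" using d unfolding D0_def by (rule imageE)
  then show ?thesis using fa0 by simp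
 qed
 obtain f i where f: "f : polys_over D0" "poly f var_X : M" "coeff f i ~: M"
  using algebraic_if_goldman_adjoin[OF D0 D0E var_polys2(1)[OF A] g1] by (elim bexE conjE exE)
 have X: "fa var_X" by (rule fa_root[OF fD0[OF polys_overD[OF f(1)]] f(3) var_polys2(1)[OF A] f(2)])
 have fD1: "fa d" if "d : D1" for d
 proof -
  have "D1 <= {y. fa y}" unfolding D1_def by (rule adjoin_subset[OF subring_fa]) (use fD0 X in auto)
  then show ?thesis using that by auto
 qed
 obtain g j where g: "g : polys_over D1" "poly g var_Y : M" "coeff g j ~: M"
  using algebraic_if_goldman_adjoin[OF D1 D1E var_polys2(2)[OF A] g2] by (elim bexE conjE exE)
 have "fa var_Y" by (rule fa_root[OF fD1[OF polys_overD[OF g(1)]] g(3) var_polys2(2)[OF A] g(2)])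
 then show ?thesis using p pM X by (intro exI[of _ p] conjI)
qed

section \<open>Integrality over the algebra generated by the regular sequence\<close>

text \<open>The element \<open>X + Y\<^sup>2\<close> is chosen so that an invertible linear form and a translate of it together
 generate \<open>X\<close> and \<open>Y\<close> algebraically.\<close>

definition orbit_frob :: "('a :: field^2^2) set => nat => 'a poly poly => 'a poly poly" where
 "orbit_frob G q th = (\<Prod>N\<in>G. (act N th) ^ q - act N th)"

lemma poly_of_int_mem: "subring_set S ==> x : S ==> poly (map_poly of_int F) x : S"
 by (rule poly_in_subring[OF _ of_int_poly_mem])

text \<open>Otherwise a prime over \<open>(f, g, p)\<close> would miss all monic integer polynomials
  in \<open>w\<close>. A prime of \<open>V[X,Y]\<close> above it contains a factor of
  \<open>f\<close> and a factor of \<open>g\<close>, which makes \<open>X\<close> and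
  \<open>Y\<close> algebraic over the prime field; then \<open>w^(p^k) = w\<close> for some
  \<open>k\<close>, and this is a monic relation.\<close>

lemma exists_monic_relation:
 fixes V :: "'a :: field_char_0 set" and G P :: "('a^2^2) set"
 assumes G: "finite_matrix_group G" and Gint: "!!N i j. N : G ==> algebraic_int (N $ i $ j)"
  and P: "finite_matrix_group P" and PG: "P <= G"
  and V: "subring_set V" and VA: "!!x. algebraic_int x ==> x : V"
  and frac: "!!v. v : V ==> \<exists>x s. algebraic_int x & algebraic_int s & s * v = x & s ~= 0 & inverse s : V"
  and p: "prime p" and j: "j > 0" and q: "q = p ^ j"
  and w: "w : finite_matrix_group.invariants P V"
 shows "\<exists>F :: int poly. lead_coeff F = 1 & (\<exists>al\<in>finite_matrix_group.invariants P V. \<exists>be\<in>finite_matrix_group.invariants P V.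
  \<exists>ga\<in>finite_matrix_group.invariants P V. poly (map_poly of_int F) w =
   al * orbit_frob G q var_X + be * orbit_frob G q (var_X + var_Y ^ 2) + ga * of_nat p)"
proof -
 interpret P: finite_matrix_group P by (rule P)
 interpret G: finite_matrix_group G by (rule G)
 define S where "S = P.invariants V"
 have S: "subring_set S" unfolding S_def by (rule P.subring_invariants[OF V])
 note E = subring_polys2[OF V]
 have SE: "S <= polys2 V" by (auto simp: S_def P.invariants_def)
 have GV: "N $ i $ j : V" if "N : G" for N i j using VA Gint[OF that] by simp
 define f where "f = orbit_frob G q var_X"
 define g where "g = orbit_frob G q (var_X + var_Y ^ 2)"
 have orb: "orbit_frob G q th : S" if th: "th : polys2 V" for th
 proof -
  have "orbit_frob G q th : polys2 V" unfolding orbit_frob_def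
   by (intro subring_prod[OF E] subringD(3)[OF E] subring_power[OF E] act_polys2[OF V] GV th)
  moreover have "act M (orbit_frob G q th) = orbit_frob G q th" if "M : P" for M
   unfolding orbit_frob_def
   by (rule G.act_prod_orbit[where ph = "\<lambda>x. x ^ q - x"]) (use that PG in "auto simp: act.hom_minus act.hom_power")
  ultimately show ?thesis by (simp add: S_def P.invariants_def)
 qed
 note var = var_polys2[OF V]
 have thV: "var_X + var_Y ^ 2 : polys2 V" by (intro subringD(6)[OF E] subring_power[OF E] var)
 have fS: "f : S" and gS: "g : S" unfolding f_def g_def by (rule orb[OF var(1)], rule orb[OF thV])
 have pS: "of_nat p : S" by (rule subring_of_nat[OF S])
 define I where "I = {al * f + be * g + ga * of_nat p | al be ga. al : S & be : S & ga : S}"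
 have I_mem: "al * f + be * g + ga * of_nat p : I" if "al : S" "be : S" "ga : S" for al be ga
  unfolding I_def by (rule CollectI, intro exI[of _ al] exI[of _ be] exI[of _ ga] conjI that refl)
 have I_E: "\<exists>al\<in>S. \<exists>be\<in>S. \<exists>ga\<in>S. x = al * f + be * g + ga * of_nat p" if "x : I" for x
  using that unfolding I_def by blast
 have I: "ideal_in S I" unfolding ideal_in_def submod_def
 proof (intro conjI ballI subsetI)
  show "0 : I" using I_mem[OF subringD(2)[OF S] subringD(2)[OF S] subringD(2)[OF S]] by simp
  fix x assume "x : I"
  then obtain al be ga where x: "al : S" "be : S" "ga : S" "x = al * f + be * g + ga * of_nat p" using I_E[OF `x : I`] by (elim bexE)
  show "x : S" unfolding x(4) by (intro subringD(6)[OF S] subringD(4)[OF S] x fS gS pS)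
  show "x + y : I" if yI: "y : I" for y
  proof -
   obtain al' be' ga' where y: "al' : S" "be' : S" "ga' : S" "y = al' * f + be' * g + ga' * of_nat p" using I_E[OF yI] by (elim bexE)
   have "x + y = (al + al') * f + (be + be') * g + (ga + ga') * of_nat p" by (simp add: x(4) y(4) algebra_simps)
   then show ?thesis using I_mem[OF subringD(6)[OF S x(1) y(1)] subringD(6)[OF S x(2) y(2)] subringD(6)[OF S x(3) y(3)]] by simp
  qed
  show "d * x : I" if "d : S" for d
  proof -
   have "d * x = (d * al) * f + (d * be) * g + (d * ga) * of_nat p" by (simp add: x(4) algebra_simps)
   then show ?thesis using I_mem[OF subringD(4)[OF S that x(1)] subringD(4)[OF S that x(2)] subringD(4)[OF S that x(3)]] by simp
  qed
 qed
 define T where "T = {poly (map_poly of_int F) w | F :: int poly. lead_coeff F = 1}"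
 have wS: "w : S" using w by (simp add: S_def)
 have T_mem: "poly (map_poly of_int F) w : T" if "lead_coeff (F :: int poly) = 1" for F
  unfolding T_def by (rule CollectI, intro exI[of _ F] conjI that refl)
 have TE: "\<exists>F :: int poly. lead_coeff F = 1 & x = poly (map_poly of_int F) w" if "x : T" for x using that unfolding T_def by (elim CollectE exE conjE, intro exI conjI)
 have "I \<inter> T ~= {}"
 proof
  assume IT: "I \<inter> T = {}"
  have TS: "T <= S"
  proof
   fix x assume "x : T"
   then obtain F :: "int poly" where "x = poly (map_poly of_int F) w" using TE[OF `x : T`] by (elim exE conjE)
   then show "x : S" using poly_of_int_mem[OF S wS] by simp
  qed
  have T1: "1 : T" using T_mem[of 1] by simp
  have Tm: "x * y : T" if xy: "x : T" "y : T" for x y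
  proof -
   obtain F F' :: "int poly" where F: "lead_coeff F = 1" "x = poly (map_poly of_int F) w"
    "lead_coeff F' = 1" "y = poly (map_poly of_int F') w" using TE[OF xy(1)] TE[OF xy(2)] by (elim exE conjE)
   have "x * y = poly (map_poly of_int (F * F')) w" unfolding F(2,4) by (simp add: of_int_poly_hom.hom_mult)
   moreover have "lead_coeff (F * F') = 1" using F(1,3) by (simp add: lead_coeff_mult)
   ultimately show ?thesis using T_mem by simp
  qed
  have "\<exists>Q. prime_in S Q & I <= Q & Q \<inter> T = {} & (\<forall>x\<in>S - Q. \<exists>q\<in>Q. \<exists>r\<in>S. q + r * x : T)"
   by (rule exists_prime_in_avoiding[OF S I TS T1 _ IT], rule Tm)
  then obtain Q0 where Q0: "prime_in S Q0" "I <= Q0" "Q0 \<inter> T = {}"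
   by (elim exE conjE)
  have PV: "N $ i $ j : V" if "N : P" for N i j by (rule GV[OF subsetD[OF PG that]])
  have int: "integral_over S x" if x: "x : polys2 V" for x
   unfolding S_def by (rule P.integral_over_invariants[OF V PV x])
  have "\<exists>Q. prime_in (polys2 V) Q & Q \<inter> S = Q0"
   by (rule lying_over[OF S E SE _ Q0(1)], rule int)
  then obtain Q where Q: "prime_in (polys2 V) Q" "Q \<inter> S = Q0" by (elim exE conjE)
  have "I <= Q" using Q0(2) Q(2) by blast
  then have fQ: "f : Q" and gQ: "g : Q" and pQ: "of_nat p : Q"
   using I_mem[OF subringD(1)[OF S] subringD(2)[OF S] subringD(2)[OF S]]
    I_mem[OF subringD(2)[OF S] subringD(1)[OF S] subringD(2)[OF S]]
    I_mem[OF subringD(2)[OF S] subringD(2)[OF S] subringD(1)[OF S]] by auto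
  interpret mod_prime_char "polys2 V" Q p by unfold_locales (rule E, rule Q(1), rule p, rule pQ)
  have faV0: "fa (cc c)" if c: "algebraic_int c" for c
  proof -
   obtain F :: "int poly" where F: "lead_coeff F = 1" "poly (map_poly of_int F) (cc c) = 0"
    using algebraic_int_root[OF c] by (elim exE conjE)
   show ?thesis by (rule fa_if_integral[OF F(1)]) (simp_all add: F(2) M_0 cc_polys2[OF V] VA c)
  qed
  have factor: "\<exists>N\<in>G. fa (act N th)" if th: "th : polys2 V" "orbit_frob G q th : Q" for th
  proof -
   have a: "act N th : polys2 V" if "N : G" for N by (rule act_polys2[OF V GV[OF that] th(1)])
   have "\<exists>N\<in>G. (act N th) ^ q - act N th : Q"
    by (rule prime_in_prod[OF E Q(1) _ th(2)[unfolded orbit_frob_def]]) (intro subringD(3)[OF E] subring_power[OF E] a)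
   then obtain N where N: "N : G" "(act N th) ^ q - act N th : Q" by (elim bexE)
   have "fa (act N th)" by (rule fa_frobenius[OF j a[OF N(1)]]) (use N(2) in "simp add: q")
   then show ?thesis using N(1) by (rule bexI)
  qed
  obtain N1 where N1: "N1 : G" "fa (act N1 var_X)" using factor[OF var(1) fQ[unfolded f_def]] by (elim bexE)
  obtain N2 where N2: "N2 : G" "fa (act N2 (var_X + var_Y ^ 2))" using factor[OF thV gQ[unfolded g_def]] by (elim bexE)
  obtain N2' where N2': "N2' : G" "N2' ** N2 = mat 1" "N2 ** N2' = mat 1"
   using G.inverse[OF N2(1)] by (elim bexE conjE)
  define K where "K = N2' ** N1"
  have K: "K : G" unfolding K_def by (rule G.closed[OF N2'(1) N1(1)])
  have N1K: "N1 = N2 ** K" unfolding K_def by (simp add: matrix_mul_assoc N2'(3))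
  obtain W where W: "W : G" "W ** K = mat 1" using G.inverse[OF K] by (elim bexE conjE)
  define x y a c where "x = act N2 var_X" and "y = act N2 var_Y" and "a = cc (K $ 1 $ 1)" and "c = cc (K $ 2 $ 1)"
  have xyV: "x : polys2 V" "y : polys2 V" unfolding x_def y_def by (intro act_polys2[OF V GV[OF N2(1)]] var)+
  have fac: "fa a" "fa c" unfolding a_def c_def by (intro faV0 Gint[OF K])+
  define s where "s = a * x + c * y"
  define sg where "sg = x + y ^ 2"
  have fs: "fa s"
  proof -
   have "act N1 var_X = act N2 (act K var_X)" unfolding N1K by (rule act_mult)
   also have "\<dots> = s" unfolding act_X[of K] by (simp add: act.hom_add act.hom_mult s_def a_def c_def x_def y_def)
   finally have "act N1 var_X = s" .
   then show ?thesis using N1(2) by simp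
  qed
  have fsg: "fa sg" using N2(2) by (simp add: sg_def x_def y_def act.hom_add act.hom_power)
  note F = subring_fa
  have Fin: "a : {y. fa y}" "c : {y. fa y}" "s : {y. fa y}" "sg : {y. fa y}" using fac fs fsg by simp_all
  have Fm: "a * sg - s : {y. fa y}" "- a : {y. fa y}" "c : {y. fa y}"
   by (rule subringD(3)[OF F subringD(4)[OF F Fin(1,4)] Fin(3)], rule subringD(5)[OF F Fin(1)], rule Fin(2))
  \<comment> \<open>Eliminating \<open>x\<close> between \<open>s = a x + c y\<close> and
    \<open>sg = x + y^2\<close> gives this quadratic equation for \<open>y\<close>. It is nontrivial
    modulo \<open>Q\<close> because \<open>(a, c)\<close> is a column of an invertible
    matrix.\<close>
  define h where "h = [:a * sg - s, c, - a:]"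
  have hfa: "fa (coeff h i)" for i
  proof -
   have "fa 0" using subringD(2)[OF F] by simp
   then show ?thesis using Fm unfolding h_def by (auto simp: coeff_pCons split: nat.splits)
  qed
  have "poly h y = 0" unfolding h_def s_def sg_def by (simp add: algebra_simps power2_eq_square)
  then have root: "poly h y : Q" by (simp add: M_0)
  have "\<exists>i. coeff h i ~: Q"
  proof (rule ccontr)
   assume "\<not> ?thesis"
   then have "coeff h 1 : Q" "coeff h 2 : Q" by simp_all
   then have cQ: "c : Q" "- a : Q" by (simp_all add: h_def numeral_2_eq_2)
   have "W $ 1 $ 1 * K $ 1 $ 1 + W $ 1 $ 2 * K $ 2 $ 1 = 1"
    using W(2) mult2_nth[of W K 1 1] by (simp add: mat1_nth)
   then have "cc (W $ 1 $ 1) * a + cc (W $ 1 $ 2) * c = 1" unfolding a_def c_def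
    by (simp flip: cc.hom_mult cc.hom_add)
   moreover have "cc (W $ 1 $ 2) * c - cc (W $ 1 $ 1) * (- a) : Q"
    by (intro M_diff M_mult cQ) (simp_all add: cc_polys2[OF V] GV[OF W(1)])
   ultimately show False using one_notin by (simp add: add.commute)
  qed
  then obtain i where "coeff h i ~: Q" by (elim exE)
  then have fy: "fa y" by (rule fa_root[OF hfa _ xyV(2) root])
  have fx: "fa x"
  proof -
   have "sg - y ^ 2 : {y. fa y}" by (rule subringD(3)[OF F _ subring_power[OF F]]) (simp_all add: fsg fy)
   then show ?thesis by (simp add: sg_def)
  qed
  have lin: "fa (cc b * x + cc d * y)" if "algebraic_int b" "algebraic_int d" for b d
  proof -
   have m: "cc b : {y. fa y}" "cc d : {y. fa y}" "x : {y. fa y}" "y : {y. fa y}" using faV0 that fx fy by simp_all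
   have "cc b * x + cc d * y : {y. fa y}"
    by (rule subringD(6)[OF F subringD(4)[OF F m(1,3)] subringD(4)[OF F m(2,4)]])
   then show ?thesis by simp
  qed
  have "act N2 (act N2' z) = z" for z by (simp add: act_mult[symmetric] N2'(3))
  then have XY: "var_X = act N2 (act N2' var_X)" "var_Y = act N2 (act N2' var_Y)" by simp_all
  have fX: "fa var_X"
  proof -
   have e: "var_X = cc (N2' $ 1 $ 1) * x + cc (N2' $ 2 $ 1) * y"
    by (subst XY(1)) (simp add: act_X[of N2'] act.hom_add act.hom_mult x_def y_def)
   show ?thesis by (subst e, rule lin[OF Gint[OF N2'(1)] Gint[OF N2'(1)]])
  qed
  have fY: "fa var_Y"
  proof -
   have e: "var_Y = cc (N2' $ 1 $ 2) * x + cc (N2' $ 2 $ 2) * y"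
    by (subst XY(2)) (simp add: act_Y[of N2'] act.hom_add act.hom_mult x_def y_def)
   show ?thesis by (subst e, rule lin[OF Gint[OF N2'(1)] Gint[OF N2'(1)]])
  qed
  have fV: "fa (cc v)" if v: "v : V" for v
  proof -
   obtain x s where xs: "algebraic_int x" "algebraic_int s" "s * v = x" "s ~= 0" "inverse s : V" using frac[OF v] by (elim exE conjE)
   show ?thesis
   proof (rule fa_root[of "[:- cc x, cc s:]" 1])
    show "fa (coeff [:- cc x, cc s:] i)" for i
    proof -
     have "- cc x : {y. fa y}" by (rule subringD(5)[OF F]) (simp add: faV0 xs)
     moreover have "fa 0" using subringD(2)[OF F] by simp
     ultimately show ?thesis using faV0[OF xs(2)] by (auto simp: coeff_pCons split: nat.splits)
    qed
    have "cc (inverse s) * cc s = 1" using xs(4) by (simp flip: cc.hom_mult)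
    then show "coeff [:- cc x, cc s:] 1 ~: Q"
     using M_mult[of "cc (inverse s)" "cc s"] xs(5) one_notin by (auto simp: cc_polys2[OF V])
    show "cc v : polys2 V" using v by (simp add: cc_polys2[OF V])
    show "poly [:- cc x, cc s:] (cc v) : Q" using M_0 by (simp add: xs(3)[symmetric] cc.hom_mult mult.commute)
   qed
  qed
  have "w : {y. fa y}"
   by (rule polys2_induct[OF subsetD[OF SE wS] F]) (simp_all add: fV fX fY)
  then obtain k where k: "k > 0" "w ^ (p ^ k) - w : Q" unfolding fa_def by auto
  define F where "F = monom (1 :: int) (p ^ k) - monom 1 1"
  have pk: "p ^ k > 1" by (rule one_less_power[OF prime_gt_1_nat[OF p] k(1)])
  have cF: "coeff F (p ^ k) = 1" unfolding F_def coeff_diff coeff_monom using pk by simp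
  have "degree F = p ^ k"
  proof (rule antisym)
   have "degree (monom (1 :: int) 1) <= p ^ k" using degree_monom_le[of "1 :: int" 1] pk by linarith
   then show "degree F <= p ^ k" unfolding F_def by (intro degree_diff_le degree_monom_le)
   show "p ^ k <= degree F" by (rule le_degree) (simp add: cF)
  qed
  then have lF: "lead_coeff F = 1" using cF by simp
  have "map_poly of_int F = monom (1 :: 'a poly poly) (p ^ k) - monom 1 1"
   by (rule poly_eqI) (auto simp: F_def coeff_map_poly)
  then have "poly (map_poly of_int F) w = w ^ (p ^ k) - w" by (simp add: poly_monom)
  then have "w ^ (p ^ k) - w : T" using T_mem[OF lF] by simp
  moreover have "w ^ (p ^ k) - w : Q0"
   unfolding Q(2)[symmetric] using k(2) by (intro IntI subringD(3)[OF S] subring_power[OF S] wS)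
  ultimately show False using Q0(3) by auto
 qed
 then obtain z where z: "z : I" "z : T" by auto
 obtain F :: "int poly" where F: "lead_coeff F = 1" "z = poly (map_poly of_int F) w" using TE[OF z(2)] by (elim exE conjE)
 obtain al be ga where abc: "al : S" "be : S" "ga : S" "z = al * f + be * g + ga * of_nat p" using I_E[OF z(1)] by (elim bexE)
 show ?thesis unfolding S_def[symmetric] f_def[symmetric] g_def[symmetric]
  by (intro exI[of _ F] conjI bexI[of _ al] bexI[of _ be] bexI[of _ ga] F(1) abc(1-3)) (use F(2) abc(4) in simp)
qed

section \<open>Regularity over a valuation ring\<close>

text \<open>With \<open>l\<close> the image of \<open>X\<close>, the factor is \<open>- l\<close>
  times \<open>1 - l^(q-1)\<close>. The coefficients of \<open>l\<close> form a column of an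
  invertible matrix over \<open>V\<close>, and the second factor has constant term
  \<open>1\<close>.\<close>

lemma (in valuation_subring) orbit_frob_factor_primitive:
 assumes G: "finite_matrix_group G" and GV: "!!N i j. N : G ==> N $ i $ j : V" and N: "N : G" and q: "q > 1"
 shows "primitive ((act N var_X) ^ q - act N var_X)"
proof -
 interpret G: finite_matrix_group G by (rule G)
 note E = subring_polys2[OF V]
 note mm = prime_inD(2)[OF prime_mV]
 define l where "l = act N var_X"
 have lV: "l : polys2 V" unfolding l_def by (rule act_polys2[OF V GV[OF N] var_polys2(1)[OF V]])
 obtain W where W: "W : G" "W ** N = mat 1" using G.inverse[OF N] by (elim bexE conjE)
 have l: "l = cc (N $ 1 $ 1) * var_X ^ 1 * var_Y ^ 0 + cc (N $ 2 $ 1) * var_X ^ 0 * var_Y ^ 1" by (simp add: l_def act_X)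
 have "primitive (- l)" unfolding primitive_def
 proof
  show "- l : polys2 V" by (rule subringD(5)[OF E lV])
  show "- l ~: polys2 mV"
  proof
   assume "- l : polys2 mV"
   then have c: "coeff (coeff (- l) j) i : mV" for i j unfolding polys2_iff by blast
   have "- N $ 1 $ 1 : mV" "- N $ 2 $ 1 : mV"
    using c[of 0 1] c[of 1 0] unfolding l coeff_minus coeff_add coeff_monomial by simp_all
   then have "W $ 1 $ 1 * (- N $ 1 $ 1) + W $ 1 $ 2 * (- N $ 2 $ 1) : mV"
    by (intro submodD(2)[OF mm] submodD(3)[OF mm] GV[OF W(1)])
   then have "- (W $ 1 $ 1 * N $ 1 $ 1 + W $ 1 $ 2 * N $ 2 $ 1) : mV" by (simp add: algebra_simps)
   moreover have "W $ 1 $ 1 * N $ 1 $ 1 + W $ 1 $ 2 * N $ 2 $ 1 = 1"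
    using W(2) mult2_nth[of W N 1 1] by (simp add: mat1_nth)
   then have e: "- (W $ 1 $ 1 * N $ 1 $ 1 + W $ 1 $ 2 * N $ 2 $ 1) = - 1" by (simp only:)
   ultimately have "- 1 : mV" by (simp only:)
   then have "- 1 * - 1 : mV" by (rule submodD(3)[OF mm subringD(5)[OF V subringD(1)[OF V]]])
   then show False using prime_inD(3)[OF prime_mV] by simp
  qed
 qed
 moreover have "primitive (1 - l ^ (q - 1))"
 proof (rule primitiveI[where i = 0 and j = 0])
  show "1 - l ^ (q - 1) : polys2 V" by (rule subringD(3)[OF E subringD(1)[OF E] subring_power[OF E lV]])
  have "poly (poly l 0) 0 = 0" unfolding l by (simp add: var_X_def var_Y_def cc_def)
  then have "poly (poly (1 - l ^ (q - 1)) 0) 0 = 1" using q by (simp add: poly_power power_0_left)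
  then show "coeff (coeff (1 - l ^ (q - 1)) 0) 0 = 1" by (simp add: poly_0_coeff_0)
 qed
 ultimately have "primitive ((- l) * (1 - l ^ (q - 1)))" by (rule primitive_mult)
 moreover have "(- l) * (1 - l ^ (q - 1)) = l ^ q - l"
  using q by (cases q) (simp_all add: algebra_simps)
 ultimately show ?thesis by (simp add: l_def)
qed

lemma (in valuation_subring) divide_by_nat:
 assumes n: "n > 0" and char: "(of_nat n :: 'a) ~= 0" and h: "primitive h" and eq: "h * k = of_nat n * c" and c: "c : polys2 V"
 shows "\<exists>d\<in>polys2 V. k = of_nat n * d"
proof -
 have nn: "cc (inverse (of_nat n)) * of_nat n = (1 :: 'a poly poly)"
 proof -
  have "cc (inverse (of_nat n)) * of_nat n = cc (inverse (of_nat n) * of_nat n :: 'a)" by (simp only: cc.hom_mult cc.hom_of_nat)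
  then show ?thesis using char by simp
 qed
 define d where "d = cc (inverse (of_nat n)) * k"
 have "h * d = cc (inverse (of_nat n)) * (h * k)" by (simp add: d_def mult_ac)
 also have "\<dots> = (cc (inverse (of_nat n)) * of_nat n) * c" unfolding eq by (simp add: mult.assoc)
 finally have "h * d = c" unfolding nn by simp
 then have "d : polys2 V" using gauss_lemma[OF h] c by simp
 moreover have "of_nat n * d = (cc (inverse (of_nat n)) * of_nat n) * k" by (simp add: d_def mult_ac)
 then have "k = of_nat n * d" unfolding nn by simp
 ultimately show ?thesis by (rule bexI[rotated])
qed

text \<open>Both \<open>F(u\<^sub>0)\<close> and \<open>G(v\<^sub>0)\<close> lie in the ideal \<open>(p, f, g)\<close>, and \<open>p, F(u\<^sub>0), G(v\<^sub>0)\<close> is a regular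
 sequence; this forces \<open>p, f, g\<close> to be regular as well.\<close>

lemma orbit_frob_regular:
 fixes V :: "'a :: field_char_0 set" and G P :: "('a^2^2) set"
 assumes valV: "valuation_subring V"
  and alg: "!!q :: 'a poly. degree q > 0 ==> \<exists>x. poly q x = 0"
  and G: "finite_matrix_group G" and Gint: "!!N i j. N : G ==> algebraic_int (N $ i $ j)"
  and P: "finite_matrix_group P" and PG: "P <= G" and card: "card P = p ^ n"
  and expo: "!!M. M : P ==> mpow M p = mat 1"
  and VA: "!!x. algebraic_int x ==> x : V"
  and frac: "!!v. v : V ==> \<exists>x s. algebraic_int x & algebraic_int s & s * v = x & s ~= 0 & inverse s : V"
  and p: "prime p" and j: "j > 0" and q: "q = p ^ j"
  and a: "a : finite_matrix_group.invariants P V" and b: "b : finite_matrix_group.invariants P V"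
  and c: "c : finite_matrix_group.invariants P V"
  and eq: "orbit_frob G q (var_X + var_Y ^ 2) * a = of_nat p * b + orbit_frob G q var_X * c"
 shows "\<exists>b'\<in>finite_matrix_group.invariants P V. \<exists>c'\<in>finite_matrix_group.invariants P V.
  a = of_nat p * b' + orbit_frob G q var_X * c'"
proof -
 interpret valuation_subring V by (rule valV)
 interpret P: finite_matrix_group P by (rule P)
 interpret G: finite_matrix_group G by (rule G)
 let ?S = "P.invariants V"
 note S = P.subring_invariants[OF V]
 have SV: "x : polys2 V" if "x : ?S" for x using that by (simp add: P.invariants_def)
 have GV: "N $ i $ j : V" if "N : G" for N i j by (rule VA[OF Gint[OF that]])
 have PV: "M $ i $ j : V" if "M : P" for M i j using GV that PG by blast
 have q1: "q > 1" unfolding q by (rule one_less_power[OF prime_gt_1_nat[OF p] j])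
 define f where "f = orbit_frob G q var_X"
 define g where "g = orbit_frob G q (var_X + var_Y ^ 2)"
 note eq = eq[folded f_def g_def]
 have fprim: "primitive f" unfolding f_def orbit_frob_def
  by (rule primitive_prod, rule orbit_frob_factor_primitive[OF G GV _ q1])
 have f_inv: "act M f = f" if "M : P" for M unfolding f_def orbit_frob_def
  by (rule G.act_prod_orbit[where ph = "\<lambda>x. x ^ q - x"]) (use that PG in "auto simp: act.hom_minus act.hom_power")
 have fS: "f : ?S" using fprim f_inv by (simp add: P.invariants_def primitive_def)
 have pS: "of_nat p : ?S" by (rule subring_of_nat[OF S])
 have reg: "\<exists>u0 v0. u0 : ?S & v0 : ?S \<and>
  (\<forall>F a c. lead_coeff F = (1 :: int) --> c : polys2 V --> poly (map_poly of_int F) u0 * a = of_nat p * c -->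
   (\<exists>d\<in>polys2 V. a = of_nat p * d)) \<and>
  (\<forall>F G a1 a2 a3. lead_coeff F = (1 :: int) --> lead_coeff G = (1 :: int) -->
   a1 : ?S --> a2 : ?S --> a3 : polys2 V -->
   poly (map_poly of_int G) v0 * a1 - poly (map_poly of_int F) u0 * a2 = of_nat p * a3 -->
   (\<exists>b\<in>?S. \<exists>c\<in>?S. a1 = poly (map_poly of_int F) u0 * b + of_nat p * c))"
  by (rule regular_pair_of_orbit_norms[OF valV _ P _ p card], erule alg, erule PV, erule expo)
 then obtain u0 v0 where uv: "u0 : ?S" "v0 : ?S"
  and c1: "\<forall>F a c. lead_coeff F = (1 :: int) --> c : polys2 V --> poly (map_poly of_int F) u0 * a = of_nat p * c -->
   (\<exists>d\<in>polys2 V. a = of_nat p * d)"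
  and c2: "\<forall>F G a1 a2 a3. lead_coeff F = (1 :: int) --> lead_coeff G = (1 :: int) -->
   a1 : ?S --> a2 : ?S --> a3 : polys2 V -->
   poly (map_poly of_int G) v0 * a1 - poly (map_poly of_int F) u0 * a2 = of_nat p * a3 -->
   (\<exists>b\<in>?S. \<exists>c\<in>?S. a1 = poly (map_poly of_int F) u0 * b + of_nat p * c)"
  by (elim exE conjE)
 have rel: "\<exists>F :: int poly. lead_coeff F = 1 & (\<exists>al\<in>?S. \<exists>be\<in>?S. \<exists>ga\<in>?S. poly (map_poly of_int F) w = al * f + be * g + ga * of_nat p)"
  if w: "w : ?S" for w
  unfolding f_def g_def
  by (rule exists_monic_relation[OF G _ P PG V _ _ p j q w], erule Gint, erule VA, erule frac)
 obtain F al1 be1 ga1 where F: "lead_coeff F = (1 :: int)" "al1 : ?S" "be1 : ?S" "ga1 : ?S"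
  "poly (map_poly of_int F) u0 = al1 * f + be1 * g + ga1 * of_nat p" using rel[OF uv(1)] by (elim exE conjE bexE)
 obtain H al2 be2 ga2 where H: "lead_coeff H = (1 :: int)" "al2 : ?S" "be2 : ?S" "ga2 : ?S"
  "poly (map_poly of_int H) v0 = al2 * f + be2 * g + ga2 * of_nat p" using rel[OF uv(2)] by (elim exE conjE bexE)
 define F1 where "F1 = poly (map_poly of_int F) u0"
 define H1 where "H1 = poly (map_poly of_int H) v0"
 have FHS: "F1 : ?S" "H1 : ?S" unfolding F1_def H1_def by (rule poly_of_int_mem[OF S uv(1)], rule poly_of_int_mem[OF S uv(2)])
 \<comment> \<open>Obtained by multiplying the relations for \<open>F(u0)\<close> and
   \<open>H(v0)\<close> with \<open>a\<close> and replacing \<open>g * a\<close> by means of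
   \<open>eq\<close>.\<close>
 define a1 k1 a2 k2 where "a1 = al1 * a + be1 * c" and "k1 = be1 * b + ga1 * a"
  and "a2 = al2 * a + be2 * c" and "k2 = be2 * b + ga2 * a"
 have S4: "a1 : ?S" "k1 : ?S" "a2 : ?S" "k2 : ?S" unfolding a1_def k1_def a2_def k2_def
  by (intro subringD(6)[OF S] subringD(4)[OF S] F H a b c)+
 have e1: "F1 * a = f * a1 + of_nat p * k1"
 proof -
  have "F1 * a = f * (al1 * a) + be1 * (g * a) + of_nat p * (ga1 * a)" unfolding F1_def F(5) by (simp add: algebra_simps)
  then show ?thesis unfolding eq a1_def k1_def by (simp add: algebra_simps)
 qed
 have e2: "H1 * a = f * a2 + of_nat p * k2"
 proof -
  have "H1 * a = f * (al2 * a) + be2 * (g * a) + of_nat p * (ga2 * a)" unfolding H1_def H(5) by (simp add: algebra_simps)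
  then show ?thesis unfolding eq a2_def k2_def by (simp add: algebra_simps)
 qed
 \<comment> \<open>Two expressions of \<open>F1 * H1 * a\<close> are compared. Since
   \<open>f\<close> is primitive, the bracket is divisible by \<open>p\<close>.\<close>
 have "f * (H1 * a1 - F1 * a2) = H1 * (f * a1 + of_nat p * k1) - F1 * (f * a2 + of_nat p * k2) + of_nat p * (F1 * k2 - H1 * k1)"
  by (simp add: algebra_simps)
 also have "\<dots> = of_nat p * (F1 * k2 - H1 * k1)" unfolding e1[symmetric] e2[symmetric] by (simp add: algebra_simps)
 finally have fe: "f * (H1 * a1 - F1 * a2) = of_nat p * (F1 * k2 - H1 * k1)" .
 have "F1 * k2 - H1 * k1 : ?S" by (intro subringD(3)[OF S] subringD(4)[OF S] FHS S4)
 from SV[OF this] have "\<exists>d\<in>polys2 V. H1 * a1 - F1 * a2 = of_nat p * d"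
  using prime_gt_0_nat[OF p] by (intro divide_by_nat[OF _ _ fprim fe]) simp_all
 then obtain a3 where a3: "a3 : polys2 V" "H1 * a1 - F1 * a2 = of_nat p * a3" by (elim bexE)
 obtain x y where xy: "x : ?S" "y : ?S" "a1 = F1 * x + of_nat p * y"
  using c2[rule_format, OF F(1) H(1) S4(1,3) a3(1) a3(2)[unfolded F1_def H1_def], folded F1_def] by (elim bexE)
 have "F1 * (a - f * x) = F1 * a - f * (F1 * x)" by (simp add: algebra_simps)
 also have "\<dots> = of_nat p * (f * y + k1)" unfolding e1 xy(3) by (simp add: algebra_simps)
 finally have "F1 * (a - f * x) = of_nat p * (f * y + k1)" .
 note fin = this
 have fy: "f * y + k1 : polys2 V" by (rule SV) (intro subringD(6)[OF S] subringD(4)[OF S] fS xy S4)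
 obtain d where d: "d : polys2 V" "a - f * x = of_nat p * d"
  using c1[rule_format, OF F(1) fy fin[unfolded F1_def]] by (elim bexE)
 have "d : ?S"
 proof -
  have "a - f * x : ?S" by (intro subringD(3)[OF S] subringD(4)[OF S] a fS xy)
  then have "act M (of_nat p * d) = of_nat p * d" if "M : P" for M unfolding d(2)[symmetric] using that by (simp add: P.invariants_def)
  then have "of_nat p * (act M d - d) = 0" if "M : P" for M using that by (simp add: act.hom_mult act.hom_of_nat right_diff_distrib)
  then have "act M d = d" if "M : P" for M using that prime_gt_0_nat[OF p] by simp
  then show ?thesis using d(1) by (simp add: P.invariants_def)
 qed
 moreover have "a = of_nat p * d + f * x" using d(2) by (simp add: algebra_simps)
 ultimately show ?thesis using xy(1) unfolding f_def by (intro bexI)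
qed

section \<open>Transfer from a subgroup\<close>

text \<open>\<open>R\<close> represents the left cosets of \<open>P\<close>. For a
  \<open>P\<close>-invariant \<open>x\<close> the sum over all of \<open>G\<close>, which is
  invariant, is \<open>card P\<close> times the sum over \<open>R\<close>, and \<open>card P\<close>
  cancels.\<close>

lemma (in finite_matrix_group) coset_transfer:
 fixes P :: "('a^2^2) set"
 assumes P: "finite_matrix_group P" and PG: "P <= G" and char0: "(of_nat (card P) :: 'a) ~= 0"
 shows "\<exists>R. finite R & R <= G & card R * card P = card G \<and>
  (\<forall>x M. (\<forall>N\<in>P. act N x = x) --> M : G --> act M (\<Sum>N\<in>R. act N x) = (\<Sum>N\<in>R. act N x))"
proof -
 interpret P: finite_matrix_group P by (rule P)
 define ka where "ka N = (\<lambda>M. N ** M) ` P" for N :: "'a^2^2"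
 define rep where "rep C = (SOME N. N : G & ka N = C)" for C
 have rep: "rep C : G" "ka (rep C) = C" if C: "C : ka ` G" for C
 proof -
  have "\<exists>N. N : G & ka N = C" using C by (elim imageE) auto
  from someI_ex[OF this] show "rep C : G" "ka (rep C) = C" unfolding rep_def by (rule conjunct1, rule conjunct2)
 qed
 define R where "R = rep ` ka ` G"
 have RG: "R <= G" unfolding R_def using rep(1) by (rule image_subsetI)
 have finR: "finite R" by (rule finite_subset[OF RG finite])
 have inj: "inj_on rep (ka ` G)" by (rule inj_on_inverseI[of _ ka]) (rule rep(2))
 have injN: "inj_on (\<lambda>M. N ** M) P" if N: "N : G" for N
  using bij_betw_imp_inj_on[OF bij_mult[OF N]] PG by (rule inj_on_subset)
 have self: "N : ka N" for N unfolding ka_def by (rule image_eqI[OF _ P.one]) simp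
 have fiber: "{N : G. ka N = C} = C" if C: "C : ka ` G" for C
 proof (rule equalityI; rule subsetI)
  fix N assume "N : {N : G. ka N = C}"
  then show "N : C" using self[of N] by simp
 next
  fix N assume N: "N : C"
  let ?r = "rep C"
  have "N : ka ?r" using N rep(2)[OF C] by simp
  then obtain M where M: "M : P" "N = ?r ** M" unfolding ka_def by (elim imageE)
  have NG: "N : G" unfolding M(2) by (rule closed[OF rep(1)[OF C] subsetD[OF PG M(1)]])
  have "ka N = (\<lambda>L. ?r ** L) ` (\<lambda>L. M ** L) ` P" unfolding ka_def M(2) image_image by (simp add: matrix_mul_assoc)
  also have "(\<lambda>L. M ** L) ` P = P" using P.bij_mult[OF M(1)] by (rule bij_betw_imp_surj_on)
  finally have "ka N = ka ?r" by (simp only: ka_def)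
  then show "N : {N : G. ka N = C}" using NG rep(2)[OF C] by simp
 qed
 have sum: "(\<Sum>N\<in>G. ph N) = of_nat (card P) * (\<Sum>N\<in>R. ph N)"
  if ph: "!!N M. N : G ==> M : P ==> ph (N ** M) = ph N" for ph :: "'a^2^2 => 'b :: comm_ring_1"
 proof -
  have "(\<Sum>N\<in>G. ph N) = (\<Sum>C\<in>ka ` G. \<Sum>N\<in>{N : G. ka N = C}. ph N)" by (rule sum.image_gen[OF finite])
  also have "\<dots> = (\<Sum>C\<in>ka ` G. of_nat (card P) * ph (rep C))"
  proof (rule sum.cong[OF refl])
   fix C assume C: "C : ka ` G"
   have "(\<Sum>N\<in>{N : G. ka N = C}. ph N) = (\<Sum>N\<in>ka (rep C). ph N)" unfolding fiber[OF C] rep(2)[OF C] ..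
   also have "\<dots> = (\<Sum>M\<in>P. ph (rep C ** M))" unfolding ka_def by (rule sum.reindex_cong[OF injN[OF rep(1)[OF C]] refl refl])
   also have "\<dots> = (\<Sum>M\<in>P. ph (rep C))" by (rule sum.cong[OF refl ph[OF rep(1)[OF C]]])
   finally show "(\<Sum>N\<in>{N : G. ka N = C}. ph N) = of_nat (card P) * ph (rep C)" by simp
  qed
  also have "\<dots> = of_nat (card P) * (\<Sum>N\<in>R. ph N)"
   unfolding R_def by (simp add: sum.reindex[OF inj] sum_distrib_left)
  finally show ?thesis .
 qed
 have "int (card G) = int (card P) * int (card R)" using sum[of "\<lambda>_. 1 :: int"] by simp
 then have cardR: "card R * card P = card G" by (simp only: of_nat_mult[symmetric] of_nat_eq_iff mult.commute)
 have "act M (\<Sum>N\<in>R. act N x) = (\<Sum>N\<in>R. act N x)" if x: "\<forall>N\<in>P. act N x = x" and M: "M : G" for x M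
 proof -
  have s: "(\<Sum>N\<in>G. act N x) = of_nat (card P) * (\<Sum>N\<in>R. act N x)"
   by (rule sum) (use x in "simp add: act_mult")
  have "act M (\<Sum>N\<in>G. act N x) = (\<Sum>N\<in>G. act (M ** N) x)" by (simp add: act.hom_sum act_mult)
  also have "\<dots> = (\<Sum>N\<in>G. act N x)" by (rule sum.reindex_bij_betw[OF bij_mult[OF M]])
  finally have "of_nat (card P) * (act M (\<Sum>N\<in>R. act N x) - (\<Sum>N\<in>R. act N x)) = 0"
   unfolding s act.hom_mult act.hom_of_nat by (simp add: right_diff_distrib)
  moreover have "(of_nat (card P) :: 'a poly poly) ~= 0"
   using char0 by (metis cc.hom_of_nat cc_eq_0_iff)
  ultimately show ?thesis by simp
 qed
 then show ?thesis using finR RG cardR by (intro exI[of _ R] conjI allI impI)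
qed

section \<open>Maximal ideals in integral extensions\<close>

text \<open>Divide the integral equation of \<open>d\<close> by \<open>d\<close> until its constant
  term is outside \<open>M\<close>. That term is invertible modulo \<open>M\<close>, and solving for
  it inverts \<open>d\<close>. So maximality passes from \<open>D\<close> to the prime above
  it.\<close>

lemma (in mod_prime) inverse_mod_if_integral:
 assumes D: "subring_set D" "D <= E" and d: "d : E" "d ~: M" "integral_over D d"
  and inv: "!!c. c : D ==> c ~: M ==> \<exists>e\<in>D. c * e - 1 : M"
 shows "\<exists>e\<in>E. d * e - 1 : M"
proof -
 have *: "\<exists>f\<in>polys_over D. poly f d : M & coeff f 0 ~: M"
  if "f : polys_over D" "poly f d : M" "coeff f i ~: M" for f i
  using that
 proof (induction f arbitrary: i)
  case 0
  then show ?case using M_0 by simp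
 next
  case (pCons a f)
  show ?case
  proof (cases "a : M")
   case True
   have f: "f : polys_over D" using pCons.prems(1) by (simp add: pCons_polys_over[OF D(1)])
   then have fE: "f : polys_over E" using D(2) by (auto simp: polys_over_def)
   obtain k where "i = Suc k" using pCons.prems(3) True by (cases i) auto
   then have k: "coeff f k ~: M" using pCons.prems(3) by simp
   have "d * poly f d : M" using M_diff[OF pCons.prems(2) True] by simp
   then have "poly f d : M" using M_prime[OF d(1) poly_in_subring[OF sub fE d(1)]] d(2) by blast
   from pCons.IH[OF f this k] show ?thesis .
  next
   case False
   then show ?thesis using pCons.prems(1,2) by (intro bexI[of _ "pCons a f"]) simp_all
  qed
 qed
 obtain f0 where f0: "f0 : polys_over D" "lead_coeff f0 = 1" "poly f0 d = 0" using d(3) unfolding integral_over_def by (elim bexE conjE)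
 obtain f where f: "f : polys_over D" "poly f d : M" "coeff f 0 ~: M"
  using *[OF f0(1), of "degree f0"] f0(2,3) M_0 one_notin by auto
 obtain c g where cg: "f = pCons c g" by (cases f) auto
 have g: "g : polys_over D" "c : D" using f(1) by (simp_all add: cg pCons_polys_over[OF D(1)])
 then have gE: "g : polys_over E" using D(2) by (auto simp: polys_over_def)
 obtain e where e: "e : D" "c * e - 1 : M" using inv[OF g(2)] f(3) cg by auto
 have eE: "e : E" using e(1) D(2) by (rule subsetD[rotated])
 have gd: "poly g d : E" by (rule poly_in_subring[OF sub gE d(1)])
 have "(c * e - 1) - e * poly f d = d * (- (poly g d * e)) - 1" by (simp add: cg algebra_simps)
 moreover have "(c * e - 1) - e * poly f d : M" by (intro M_diff e(2) M_mult eE f(2))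
 ultimately have "d * (- (poly g d * e)) - 1 : M" by (simp only:)
 moreover have "- (poly g d * e) : E" by (intro subringD(5)[OF sub] subringD(4)[OF sub] gd eE)
 ultimately show ?thesis by (rule bexI)
qed

lemma subring_image:
 assumes h: "comm_ring_hom h" and D: "subring_set D"
 shows "subring_set (h ` D)"
proof -
 interpret comm_ring_hom h by fact
 show ?thesis
 proof (rule subringI)
  show "1 : h ` D" by (rule image_eqI[of _ _ 1]) (simp_all add: subringD(1)[OF D])
  fix x y assume "x : h ` D" "y : h ` D"
  then obtain a b where ab: "x = h a" "a : D" "y = h b" "b : D" by (elim imageE)
  show "x - y : h ` D" by (rule image_eqI[of _ _ "a - b"]) (simp_all add: ab hom_minus subringD(3)[OF D])
  show "x * y : h ` D" by (rule image_eqI[of _ _ "a * b"]) (simp_all add: ab hom_mult subringD(4)[OF D])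
 qed
qed

lemma integral_over_image:
 assumes h: "comm_ring_hom h" and x: "integral_over D x"
 shows "integral_over (h ` D) (h x)"
proof -
 interpret comm_ring_hom h by fact
 obtain f where f: "f : polys_over D" "lead_coeff f = 1" "poly f x = 0" using x unfolding integral_over_def by (elim bexE conjE)
 have c: "coeff (map_poly h f) i = h (coeff f i)" for i by (simp add: coeff_map_poly)
 have "degree (map_poly h f) = degree f"
 proof (rule antisym)
  show "degree (map_poly h f) <= degree f" by (rule degree_map_poly_le)
  show "degree f <= degree (map_poly h f)" by (rule le_degree) (simp add: c f(2))
 qed
 then have "lead_coeff (map_poly h f) = 1" using f(2) by (simp add: c)
 moreover have "map_poly h f : polys_over (h ` D)" using f(1) by (auto simp: polys_over_def c)
 moreover have "poly (map_poly h f) (h x) = h (poly f x)"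
  by (induction f) (simp_all add: Polynomial.map_poly_pCons hom_add hom_mult)
 then have "poly (map_poly h f) (h x) = 0" by (simp add: f(3))
 ultimately show ?thesis by (intro integral_overI)
qed

section \<open>Algebraic numbers\<close>

text \<open>Multiplied by a suitable power of the leading coefficient \<open>a\<close>, the equation
  \<open>f(x) = 0\<close> becomes a monic equation for \<open>a x\<close>.\<close>

lemma algebraic_int_multiple_of_root:
 fixes x :: "'a :: field_char_0"
 assumes f: "!!i. algebraic_int (coeff f i)" and root: "poly f x = 0"
 shows "algebraic_int (lead_coeff f * x)"
proof (cases "degree f")
 case 0
 then have "f = [:lead_coeff f:]" by (metis degree_0_id)
 then have "poly f x = lead_coeff f" by (metis poly_const_conv)
 then show ?thesis using root by simp
next
 case (Suc n)
 let ?A = "{y :: 'a. algebraic_int y}"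
 define a where "a = lead_coeff f"
 define g where "g = monom 1 (Suc n) + (\<Sum>i\<le>n. monom (coeff f i * a ^ (n - i)) i)"
 note A = subring_algebraic_ints[where ?'a = 'a]
 note P = subring_polys_over[OF A]
 have aA: "a : ?A" using f by (simp add: a_def)
 have gA: "g : polys_over ?A" unfolding g_def
  by (intro subringD(6)[OF P] subring_sum[OF P] monom_polys_over[OF A] subringD(1)[OF A]
    subringD(4)[OF A] subring_power[OF A] aA CollectI f)
 have cg: "coeff g i = (if i = Suc n then 1 else if i <= n then coeff f i * a ^ (n - i) else 0)" for i
  unfolding g_def coeff_add coeff_sum coeff_monom by (auto simp: sum.delta)
 have "degree g = Suc n"
 proof (rule antisym)
  show "degree g <= Suc n" by (rule degree_le) (auto simp: cg)
  show "Suc n <= degree g" by (rule le_degree) (simp add: cg)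
 qed
 then have lg: "lead_coeff g = 1" by (simp add: cg)
 have "poly g (a * x) = a ^ Suc n * x ^ Suc n + (\<Sum>i\<le>n. coeff f i * a ^ (n - i) * (a * x) ^ i)"
  by (simp only: g_def poly_add poly_sum poly_monom power_mult_distrib mult_1)
 also have "(\<Sum>i\<le>n. coeff f i * a ^ (n - i) * (a * x) ^ i) = (\<Sum>i\<le>n. a ^ n * (coeff f i * x ^ i))"
 proof (rule sum.cong[OF refl])
  fix i assume "i : {..n}"
  then have "a ^ n = a ^ (n - i) * a ^ i" by (simp flip: power_add)
  then show "coeff f i * a ^ (n - i) * (a * x) ^ i = a ^ n * (coeff f i * x ^ i)" by (simp add: power_mult_distrib)
 qed
 also have "a ^ Suc n * x ^ Suc n + (\<Sum>i\<le>n. a ^ n * (coeff f i * x ^ i)) = a ^ n * poly f x"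
  unfolding poly_altdef Suc sum_distrib_left by (simp add: a_def Suc)
 finally have "poly g (a * x) = 0" using root by simp
 from integral_overI[OF gA lg this] show ?thesis unfolding a_def by (rule algebraic_int_integral_closed)
qed

lemma int_multiple_if_root:
 fixes x :: "'a :: field_char_0"
 assumes f: "!!i. algebraic_int (coeff f i)" and "f ~= 0" and root: "poly f x = 0"
 shows "\<exists>m. m ~= (0 :: int) & algebraic_int (of_int m * x)"
proof -
 note A = subring_algebraic_ints[where ?'a = 'a]
 obtain n y where n: "n ~= (0 :: int)" "algebraic_int y" "of_int n = lead_coeff f * y"
  using nonzero_int_multiple[OF f[of "degree f"]] assms(2) by auto
 have "y * (lead_coeff f * x) : {y. algebraic_int y}"
  by (rule subringD(4)[OF A]) (simp_all add: n(2) algebraic_int_multiple_of_root[OF f root])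
 then show ?thesis using n(1) by (intro exI[of _ n]) (simp add: n(3) mult_ac)
qed

lemma number_field_int_multiple:
 assumes "number_field TYPE('k :: field_char_0)"
 shows "\<exists>m. m ~= (0 :: int) & algebraic_int (of_int m * (x :: 'k))"
proof -
 obtain B :: "'k set" where B: "finite B" "module.span (\<lambda>q x. of_rat q * x) B = UNIV"
  using assms unfolding number_field_def by (elim exE conjE)
 define n where "n = card B"
 obtain c :: "nat => int" where c: "\<forall>p. prime p --> (\<exists>i\<in>{..n}. \<not> p dvd c i)" "(\<Sum>i\<in>{..n}. of_int (c i) * x ^ i) = 0"
  using primitive_integer_relation[OF vector_space_of_rat[where ?'a = 'k], of "{..n}" B "\<lambda>i. x ^ i"] B by (auto simp: n_def)
 define f where "f = (\<Sum>i\<le>n. monom (of_int (c i) :: 'k) i)"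
 have cf: "coeff f i = (if i <= n then of_int (c i) else 0)" for i
  unfolding f_def coeff_sum coeff_monom by (auto simp: sum.delta)
 show ?thesis
 proof (rule int_multiple_if_root[of f])
  show "algebraic_int (coeff f i)" for i by (simp add: cf)
  obtain i where i: "i <= n" "\<not> 2 dvd c i" using c(1)[rule_format, of 2] by auto
  then have "coeff f i ~= 0" by (auto simp: cf)
  then show "f ~= 0" by auto
  show "poly f x = 0" using c(2) by (simp add: f_def poly_sum poly_monom)
 qed
qed

lemma comm_ring_hom_to_ac: "comm_ring_hom to_ac"
 by unfold_locales simp_all

lemma algebraic_int_hom:
 assumes h: "comm_ring_hom (h :: 'a :: field_char_0 => 'b :: field_char_0)" and x: "algebraic_int x"
 shows "algebraic_int (h x)"
proof -
 interpret comm_ring_hom h by fact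
 obtain F :: "int poly" where F: "poly (map_poly of_int F) x = 0" "lead_coeff F = 1"
  using x unfolding algebraic_int_altdef_ipoly by (elim exE conjE)
 have "poly (map_poly of_int F) (h x) = 0" using poly_of_int_hom[OF h, of F x] F(1) by simp
 then show ?thesis unfolding algebraic_int_altdef_ipoly using F(2) by (intro exI[of _ F] conjI)
qed

lemma algebraic_int_hom_iff:
 assumes h: "comm_ring_hom (h :: 'a :: field_char_0 => 'b :: field_char_0)"
 shows "algebraic_int (h x) \<longleftrightarrow> algebraic_int x"
proof
 interpret comm_ring_hom h by fact
 assume "algebraic_int (h x)"
 then obtain F :: "int poly" where F: "poly (map_poly of_int F) (h x) = 0" "lead_coeff F = 1"
  unfolding algebraic_int_altdef_ipoly by (elim exE conjE)
 have h0: "y = 0" if "h y = 0" for y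
 proof (rule ccontr)
  assume "y ~= 0"
  then have "h (y * inverse y) = 1" by simp
  then show False using that by (simp add: hom_mult)
 qed
 have "h (poly (map_poly of_int F) x) = 0" using poly_of_int_hom[OF h, of F x] F(1) by simp
 then show "algebraic_int x" unfolding algebraic_int_altdef_ipoly using F(2) h0 by (intro exI[of _ F] conjI)
qed (rule algebraic_int_hom[OF h])

lemma alg_closure_int_multiple:
 assumes "number_field TYPE('k :: field_char_0)"
 shows "\<exists>m. m ~= (0 :: int) & algebraic_int (of_int m * (x :: 'k alg_closure))"
proof -
 obtain f :: "'k poly" where f: "f ~= 0" "poly (map_poly to_ac f) x = 0" by (rule alg_closure_algebraic)
 have "\<forall>i. \<exists>m. m ~= (0 :: int) & algebraic_int (of_int m * coeff f i)"
  using number_field_int_multiple[OF assms] by blast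
 then obtain m where m: "!!i. m i ~= (0 :: int)" "!!i. algebraic_int (of_int (m i) * coeff f i)" by metis
 note A = subring_algebraic_ints[where ?'a = 'k]
 define N where "N = (\<Prod>i\<le>degree f. m i)"
 have N: "N ~= 0" using m(1) by (simp add: N_def)
 have Nf: "algebraic_int (of_int N * coeff f i)" for i
 proof (cases "i <= degree f")
  case True
  have "N = (\<Prod>k\<in>{..degree f} - {i}. m k) * m i" unfolding N_def by (subst prod.remove[of _ i]) (use True in "simp_all add: mult.commute")
  then have e: "of_int N * coeff f i = of_int (\<Prod>k\<in>{..degree f} - {i}. m k) * (of_int (m i) * coeff f i)"
   by (simp only: of_int_mult mult.assoc)
  have "of_int N * coeff f i : {y. algebraic_int y}" unfolding e
   by (rule subringD(4)[OF A]) (simp_all add: m(2) del: of_int_prod)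
  then show ?thesis by simp
 qed (simp add: coeff_eq_0)
 have cf: "coeff (map_poly to_ac (smult (of_int N) f)) i = to_ac (of_int N * coeff f i)" for i
  by (simp add: coeff_map_poly)
 show ?thesis
 proof (rule int_multiple_if_root[of "map_poly to_ac (smult (of_int N) f)"])
  show "algebraic_int (coeff (map_poly to_ac (smult (of_int N) f)) i)" for i
   unfolding cf by (rule algebraic_int_hom[OF comm_ring_hom_to_ac Nf])
  have "coeff (map_poly to_ac (smult (of_int N) f)) (degree f) ~= 0" unfolding cf using f(1) N by simp
  then show "map_poly to_ac (smult (of_int N) f) ~= 0" by auto
  have "map_poly to_ac (smult (of_int N) f) = smult (to_ac (of_int N)) (map_poly to_ac f)"
   by (rule poly_eqI) (simp add: coeff_map_poly)
  then show "poly (map_poly to_ac (smult (of_int N) f)) x = 0" using f(2) by simp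
 qed
qed

section \<open>Regular sequences at the maximal ideals of the ring of invariants\<close>

lemma map_entries_mult:
 assumes "comm_ring_hom h"
 shows "map_entries h (M ** N) = map_entries h M ** map_entries h N"
proof -
 interpret comm_ring_hom h by fact
 show ?thesis by (simp add: matrix2_eq_iff mult2_nth hom_add hom_mult)
qed

lemma map_entries_one:
 assumes "comm_ring_hom h"
 shows "map_entries h (mat 1) = mat 1"
proof -
 interpret comm_ring_hom h by fact
 show ?thesis by (simp add: matrix2_eq_iff mat1_nth)
qed

lemma map_entries_mpow:
 assumes "comm_ring_hom h"
 shows "map_entries h (mpow M n) = mpow (map_entries h M) n"
 by (induction n) (simp_all add: map_entries_one[OF assms] map_entries_mult[OF assms])

lemma finite_matrix_group_map_entries:
 assumes "comm_ring_hom h" "finite_matrix_group G"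
 shows "finite_matrix_group (map_entries h ` G)"
proof -
 interpret finite_matrix_group G by fact
 note h = map_entries_mult[OF assms(1), symmetric] map_entries_one[OF assms(1)]
 show ?thesis
 proof
  show "finite (map_entries h ` G)" using finite by (rule finite_imageI)
  show "mat 1 : map_entries h ` G" by (rule image_eqI[OF _ one]) (simp add: h)
  fix M N assume M: "M : map_entries h ` G"
  then obtain M' where M': "M = map_entries h M'" "M' : G" by (rule imageE)
  show "M ** N : map_entries h ` G" if N: "N : map_entries h ` G"
  proof -
   obtain N' where N': "N = map_entries h N'" "N' : G" using N by (rule imageE)
   show ?thesis unfolding M'(1) N'(1) h by (rule imageI[OF closed[OF M'(2) N'(2)]])
  qed
  obtain K where K: "K : G" "K ** M' = mat 1" "M' ** K = mat 1"
   using inverse[OF M'(2)] by (elim bexE conjE)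
  show "\<exists>N\<in>map_entries h ` G. N ** M = mat 1 & M ** N = mat 1"
   by (rule bexI[OF _ imageI[OF K(1)]]) (simp add: M'(1) h K)
 qed
qed

lemma (in finite_matrix_group) orbit_frob_invariants:
 assumes D: "subring_set D" and G: "!!M i j. M : G ==> M $ i $ j : D" and th: "th : polys2 D"
 shows "orbit_frob G q th : invariants D"
proof -
 note E = subring_polys2[OF D]
 have "orbit_frob G q th : polys2 D" unfolding orbit_frob_def
  by (intro subring_prod[OF E] subringD(3)[OF E] subring_power[OF E] act_polys2[OF D] G th)
 moreover have "act M (orbit_frob G q th) = orbit_frob G q th" if "M : G" for M
  unfolding orbit_frob_def
  by (rule act_prod_orbit[where ph = "\<lambda>x. x ^ q - x", OF that]) (simp add: act.hom_minus act.hom_power)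
 ultimately show ?thesis by (simp add: invariants_def)
qed

lemma prime_in_image:
 assumes h: "comm_ring_hom h" and inj: "inj h" and D: "subring_set D" and Q: "prime_in D Q"
 shows "prime_in (h ` D) (h ` Q)"
proof -
 interpret comm_ring_hom h by fact
 note q = prime_inD(2)[OF Q]
 show ?thesis unfolding prime_in_def ideal_in_def submod_def
 proof (intro conjI ballI impI)
  show "h ` Q <= h ` D" by (rule image_mono[OF prime_inD(1)[OF Q]])
  show "0 : h ` Q" by (rule image_eqI[OF _ submodD(1)[OF q]]) simp
  show "1 ~: h ` Q"
  proof
   assume "1 : h ` Q"
   then obtain x where x: "1 = h x" "x : Q" by (rule imageE)
   then have "h x = h 1" by simp
   then have "x = 1" by (rule injD[OF inj])
   then show False using x(2) prime_inD(3)[OF Q] by simp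
  qed
  fix x y assume x: "x : h ` Q" and y: "y : h ` Q"
  obtain a b where ab: "x = h a" "a : Q" "y = h b" "b : Q" using x y by (elim imageE)
  show "x + y : h ` Q" by (rule image_eqI[OF _ submodD(2)[OF q ab(2,4)]]) (simp add: ab hom_add)
 next
  fix d x assume d: "d : h ` D" and x: "x : h ` Q"
  obtain a b where ab: "d = h a" "a : D" "x = h b" "b : Q" using d x by (elim imageE)
  show "d * x : h ` Q" by (rule image_eqI[OF _ submodD(3)[OF q ab(2,4)]]) (simp add: ab hom_mult)
 next
  fix x y assume x: "x : h ` D" and y: "y : h ` D" and xy: "x * y : h ` Q"
  obtain a b where ab: "x = h a" "a : D" "y = h b" "b : D" using x y by (elim imageE)
  obtain c where c: "x * y = h c" "c : Q" using xy by (rule imageE)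
  have "h (a * b) = h c" using c(1) by (simp add: ab hom_mult)
  then have "a * b = c" by (rule injD[OF inj])
  then have "a * b : Q" using c(2) by simp
  then have "a : Q \<or> b : Q" by (rule prime_inD(4)[OF Q ab(2,4)])
  then show "x : h ` Q \<or> y : h ` Q" unfolding ab(1,3) by (elim disjE) (simp_all add: imageI)
 qed
qed

lemma finite_coeffs2: "finite {coeff (coeff f j) i | i j. True}"
proof (rule finite_subset)
 show "{coeff (coeff f j) i | i j. True} \<subseteq>
  insert 0 (\<Union>j\<in>{..degree f}. (\<lambda>i. coeff (coeff f j) i) ` {..degree (coeff f j)})"
 proof
  fix x assume "x : {coeff (coeff f j) i | i j. True}"
  then obtain i j where x: "x = coeff (coeff f j) i" by (elim CollectE exE conjE)
  show "x : insert 0 (\<Union>j\<in>{..degree f}. (\<lambda>i. coeff (coeff f j) i) ` {..degree (coeff f j)})"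
  proof (cases "j <= degree f & i <= degree (coeff f j)")
   case True
   then show ?thesis unfolding x by (intro insertI2 UN_I[of j] image_eqI[of _ _ i]) simp_all
  next
   case False
   then have "x = 0" unfolding x by (cases "j <= degree f") (simp_all add: coeff_eq_0)
   then show ?thesis by simp
  qed
 qed
qed simp

lemma coeffs2_mem: "coeff (coeff f j) i : {coeff (coeff f j) i | i j. True}"
 by (rule CollectI, intro exI[of _ i] exI[of _ j] conjI refl TrueI)

lemma cohen_macaulay_local_invariants:
 fixes G :: "('k :: field_char_0^2^2) set"
 defines "A \<equiv> {x :: 'k. algebraic_int x}"
 assumes nf: "number_field TYPE('k)" and G: "finite_matrix_group G"
  and Gint: "!!M i j. M : G ==> M $ i $ j : A"
  and sylow: "!!p. prime (p :: nat) ==> \<exists>P n. finite_matrix_group P & P <= G & card P = p ^ n \<and>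
   \<not> p dvd card G div card P & (\<forall>M\<in>P. mpow M p = mat 1)"
  and m: "prime_in (finite_matrix_group.invariants G A) m"
  and max: "!!c. c : finite_matrix_group.invariants G A ==> c ~: m ==>
   \<exists>e\<in>finite_matrix_group.invariants G A. c * e - 1 : m"
 shows "cohen_macaulay_local (localization_at (RD (finite_matrix_group.invariants G A)) m)"
proof -
 interpret G: finite_matrix_group G by (rule G)
 define S where "S = G.invariants A"
 note m = m[folded S_def] and max = max[folded S_def]
 have A: "subring_set A" unfolding A_def by (rule subring_algebraic_ints)
 have S: "subring_set S" unfolding S_def by (rule G.subring_invariants[OF A])
 have S_pol: "x : polys2 A" and S_act: "M : G ==> act M x = x" if "x : S" for x M
  using that by (simp_all add: S_def G.invariants_def)
 have S_I: "x : S" if "x : polys2 A" "!!M. M : G ==> act M x = x" for x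
  using that by (simp add: S_def G.invariants_def)
 define h :: "'k => 'k alg_closure" where "h = to_ac"
 have h: "comm_ring_hom h" unfolding h_def by (rule comm_ring_hom_to_ac)
 interpret h: comm_ring_hom h by (rule h)
 define B where "B = {x :: 'k alg_closure. algebraic_int x}"
 have B: "subring_set B" unfolding B_def by (rule subring_algebraic_ints)
 have hA: "h x : B \<longleftrightarrow> x : A" for x by (simp add: A_def B_def algebraic_int_hom_iff[OF h])
 define io where "io = map_coeffs h"
 have io: "comm_ring_hom io" unfolding io_def by (rule comm_ring_hom_map_coeffs[OF h])
 interpret io: comm_ring_hom io by (rule io)
 have cio: "coeff (coeff (io f) j) i = h (coeff (coeff f j) i)" for f i j
  unfolding io_def by (rule coeff_map_coeffs) simp
 have inj: "inj io"
 proof (rule injI)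
  fix f g assume "io f = io g"
  then have "h (coeff (coeff f j) i) = h (coeff (coeff g j) i)" for i j using cio by metis
  then show "f = g" by (intro poly2_eqI) (simp add: h_def)
 qed
 have ios: "io (cc c) = cc (h c)" "io var_X = var_X" "io var_Y = var_Y" for c
  unfolding io_def by (rule map_coeffs_simps[OF h])+
 have ioact: "io (act N x) = act (map_entries h N) (io x)" for N x unfolding io_def by (rule map_coeffs_act[OF h])
 note R = subring_polys2[OF B]
 have ioR: "io f : polys2 B" if "f : polys2 A" for f using that by (simp add: polys2_iff cio hA)
 note ioS = subring_image[OF io S]
 have ioS_R: "io ` S <= polys2 B" by (rule image_subsetI, rule ioR, rule S_pol)
 \<comment> \<open>Algebraic integers are integral over the integers already, and \<open>X\<close>
   and \<open>Y\<close> are integral over the invariants through their orbit polynomials.\<close>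
 have int: "integral_over (io ` S) x" if x: "x : polys2 B" for x
 proof -
  have var: "integral_over (io ` S) (io y)" if "y : polys2 A" for y
   unfolding S_def by (rule integral_over_image[OF io], rule G.integral_over_invariants[OF A Gint that])
  have cB: "integral_over (io ` S) (cc c)" if c: "c : B" for c
  proof -
   obtain F :: "int poly" where F: "lead_coeff F = 1" "poly (map_poly of_int F) (cc c) = 0"
    using algebraic_int_root[OF CollectD[OF c[unfolded B_def]]] by (elim exE conjE)
   show ?thesis
   proof (rule integral_overI[OF of_int_poly_mem[OF ioS] _ F(2)])
    show "lead_coeff (map_poly of_int F :: 'k alg_closure poly poly poly) = 1"
     using F(1) by (simp add: degree_map_poly coeff_map_poly)
   qed
  qed
  have "x : {x. integral_over (io ` S) x}"
   by (rule polys2_induct[OF x subring_integral_closure[OF ioS]])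
    (use cB var[OF var_polys2(1)[OF A]] var[OF var_polys2(2)[OF A]] in "simp_all add: ios")
  then show ?thesis by simp
 qed
 have "\<exists>Q. prime_in (polys2 B) Q & Q \<inter> io ` S = io ` m"
  by (rule lying_over[OF ioS R ioS_R _ prime_in_image[OF io inj S m]], rule int)
 then obtain M where M: "prime_in (polys2 B) M" "M \<inter> io ` S = io ` m" by (elim exE conjE)
 interpret MP: mod_prime "polys2 B" M by unfold_locales (rule R, rule M(1))
 have mM: "x : m \<longleftrightarrow> io x : M" if x: "x : S" for x
 proof
  assume "x : m"
  then have "io x : M \<inter> io ` S" unfolding M(2) by (rule imageI)
  then show "io x : M" by simp
 next
  assume "io x : M"
  then have "io x : io ` m" unfolding M(2)[symmetric] using x by simp
  then show "x : m" using inj by (simp add: inj_image_mem_iff)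
 qed
 have maxM: "\<exists>e\<in>polys2 B. d * e - 1 : M" if d: "d : polys2 B" "d ~: M" for d
 proof (rule MP.inverse_mod_if_integral[OF ioS ioS_R d int[OF d(1)]])
  fix c assume c: "c : io ` S" "c ~: M"
  obtain c0 where c0: "c = io c0" "c0 : S" using c(1) by (rule imageE)
  have "c0 ~: m" using mM[OF c0(2)] c(2) c0(1) by simp
  from max[OF c0(2) this] obtain e where e: "e : S" "c0 * e - 1 : m" by (elim bexE)
  have "c0 * e - 1 : S" by (intro subringD(3)[OF S] subringD(4)[OF S] c0(2) e(1) subringD(1)[OF S])
  from iffD1[OF mM[OF this] e(2)] show "\<exists>e\<in>io ` S. c * e - 1 : M"
   by (intro bexI[of _ "io e"] imageI[OF e(1)]) (simp add: c0(1) io.hom_minus io.hom_mult)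
 qed
 have "\<exists>p. prime p & of_nat p : M & mod_prime_char.fa (polys2 B) M p var_X & mod_prime_char.fa (polys2 B) M p var_Y"
  unfolding B_def by (rule nullstellensatz_algebraic_ints[OF M(1)[unfolded B_def]], rule maxM[unfolded B_def])
 then obtain p where p: "prime p" and pM: "of_nat p : M"
  and fa0: "mod_prime_char.fa (polys2 B) M p var_X" "mod_prime_char.fa (polys2 B) M p var_Y" by (elim exE conjE)
 interpret MC: mod_prime_char "polys2 B" M p by unfold_locales (rule p, rule pM)
 define th where "th = (var_X + var_Y ^ 2 :: 'k poly poly)"
 have ioth: "io th = var_X + var_Y ^ 2" by (simp add: th_def io.hom_add io.hom_power ios)
 have "var_X + var_Y ^ 2 : {y. MC.fa y}"
  by (rule subringD(6)[OF MC.subring_fa _ subring_power[OF MC.subring_fa]]) (simp_all add: fa0)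
 then have "\<exists>j>0. \<forall>y\<in>{var_X, var_X + var_Y ^ 2}. y ^ (p ^ j) - y : M"
  by (intro MC.fa_common) (use fa0(1) in auto)
 then obtain j where j: "j > 0" "\<forall>y\<in>{var_X, var_X + var_Y ^ 2}. y ^ (p ^ j) - y : M" by (elim exE conjE)
 define q where "q = p ^ j"
 have qM: "var_X ^ q - var_X : M" "(var_X + var_Y ^ 2) ^ q - (var_X + var_Y ^ 2) : M" using j(2) by (simp_all add: q_def)
 define GL where "GL = map_entries h ` G"
 have GL: "finite_matrix_group GL" unfolding GL_def by (rule finite_matrix_group_map_entries[OF h G])
 interpret GL: finite_matrix_group GL by (rule GL)
 have GLB: "N $ i $ k : B" if N: "N : GL" for N i k
 proof -
  obtain N' where "N = map_entries h N'" "N' : G" using N unfolding GL_def by (rule imageE)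
  then show ?thesis using Gint hA by simp
 qed
 have inj_e: "inj (map_entries h :: 'k^2^2 => _)"
 proof (rule injI)
  fix K L :: "'k^2^2" assume "map_entries h K = map_entries h L"
  then have "h (K $ i $ k) = h (L $ i $ k)" for i k by (metis map_entries_nth)
  then show "K = L" by (simp add: matrix2_eq_iff h_def)
 qed
 have ioorb: "io (orbit_frob G q x) = orbit_frob GL q (io x)" for x
  unfolding orbit_frob_def GL_def
  by (simp add: io.hom_prod io.hom_minus io.hom_power ioact prod.reindex[OF inj_on_subset[OF inj_e subset_UNIV]])
 \<comment> \<open>The factor of the orbit product that belongs to the identity matrix is
   \<open>x ^ q - x\<close>.\<close>
 have orbM: "orbit_frob GL q x : M" if x: "x : polys2 B" "x ^ q - x : M" for x
 proof -
  have "orbit_frob GL q x = (\<Prod>N\<in>GL - {mat 1}. act N x ^ q - act N x) * (x ^ q - x)"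
   unfolding orbit_frob_def by (subst prod.remove[OF GL.finite GL.one]) (simp add: mult.commute)
  also have "\<dots> : M"
   by (intro MP.M_mult x(2) subring_prod[OF R] subringD(3)[OF R] subring_power[OF R] act_polys2[OF B GLB x(1)]) simp_all
  finally show ?thesis .
 qed
 define f where "f = orbit_frob G q var_X"
 define g where "g = orbit_frob G q th"
 have thA: "th : polys2 A" unfolding th_def
  by (intro subringD(6)[OF subring_polys2[OF A]] subring_power[OF subring_polys2[OF A]] var_polys2[OF A])
 have fS: "f : S" unfolding f_def S_def by (rule G.orbit_frob_invariants[OF A Gint var_polys2(1)[OF A]])
 have gS: "g : S" unfolding g_def S_def by (rule G.orbit_frob_invariants[OF A Gint thA])
 have pS: "of_nat p : S" by (rule subring_of_nat[OF S])
 have iof: "io f = orbit_frob GL q var_X" unfolding f_def ioorb ios ..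
 have iog: "io g = orbit_frob GL q (var_X + var_Y ^ 2)" unfolding g_def ioorb ioth ..
 have fm: "f : m" unfolding mM[OF fS] iof by (rule orbM[OF var_polys2(1)[OF B] qM(1)])
 have gm: "g : m" unfolding mM[OF gS] iog by (rule orbM[OF ioR[OF thA, unfolded ioth] qM(2)])
 have pm: "of_nat p : m" unfolding mM[OF pS] using pM by (simp add: io.hom_of_nat)
 define Q where "Q = {x : B. cc x : M}"
 have ccB: "cc x : polys2 B" if "x : B" for x using that by (simp add: cc_polys2[OF B])
 have Q: "prime_in B Q" unfolding prime_in_def ideal_in_def submod_def
 proof (intro conjI ballI impI)
  show "Q <= B" by (simp add: Q_def)
  show "0 : Q" using MP.M_0 subringD(2)[OF B] by (simp add: Q_def cc.hom_zero)
  show "1 ~: Q" using MP.one_notin by (simp add: Q_def)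
  show "x + y : Q" if "x : Q" "y : Q" for x y using that MP.M_add subringD(6)[OF B] by (simp add: Q_def cc.hom_add)
  show "d * x : Q" if "d : B" "x : Q" for d x using that MP.M_mult[OF ccB] subringD(4)[OF B] by (simp add: Q_def cc.hom_mult)
  show "x : Q \<or> y : Q" if "x : B" "y : B" "x * y : Q" for x y
   using that MP.M_prime[OF ccB ccB, of x y] by (simp add: Q_def cc.hom_mult)
 qed
 define V where "V = alg_localization Q"
 have alg: "\<exists>m. m ~= (0 :: int) & algebraic_int (of_int m * (x :: 'k alg_closure))" for x by (rule alg_closure_int_multiple[OF nf])
 have valV: "valuation_subring V" unfolding V_def by (rule alg_localization_valuation[OF alg Q[unfolded B_def]])
 have BV: "B <= V" unfolding V_def B_def by (rule alg_localization_superset[OF alg Q[unfolded B_def]])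
 interpret V: valuation_subring V by (rule valV)
 have QmV: "Q <= V.mV" unfolding V_def by (rule mem_mV_if_mem[OF alg Q[unfolded B_def]])
 have VE: "\<exists>x s. v = x / s & algebraic_int x & algebraic_int s & s ~: Q" if "v : V" for v
  using that unfolding V_def alg_localization_def by (elim CollectE)
 have VI: "x / s : V" if "algebraic_int x" "algebraic_int s" "s ~: Q" for x s
  unfolding V_def alg_localization_def by (rule CollectI, intro exI[of _ x] exI[of _ s] conjI that refl)
 have Q0: "0 : Q" by (rule submodD(1)[OF prime_inD(2)[OF Q]])
 have invV: "inverse s : V" if "algebraic_int s" "s ~: Q" for s
  using VI[of 1 s] that by (simp add: divide_inverse)
 have frac: "\<exists>x s. algebraic_int x & algebraic_int s & s * v = x & s ~= 0 & inverse s : V" if v: "v : V" for v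
 proof -
  obtain x s where xs: "v = x / s" "algebraic_int x" "algebraic_int s" "s ~: Q" using VE[OF v] by (elim exE conjE)
  have s0: "s ~= 0" using xs(4) Q0 by auto
  have "s * v = x" using s0 xs(1) by simp
  then show ?thesis using xs(2,3) s0 invV[OF xs(3,4)] by (intro exI[of _ x] exI[of _ s] conjI)
 qed
 \<comment> \<open>The trace of \<open>V\<close> on the number field. Coefficients brought down by
   the retraction lie here, and \<open>den\<close> clears their denominators by elements outside
   \<open>Q\<close>.\<close>
 define W where "W = {y. h y : V}"
 have W: "subring_set W"
 proof (rule subringI)
  show "1 : W" using subringD(1)[OF V.V] by (simp add: W_def)
  fix x y assume "x : W" "y : W"
  then show "x - y : W" "x * y : W" using subringD(3,4)[OF V.V] by (simp_all add: W_def h.hom_minus h.hom_mult)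
 qed
 have AW: "x : W" if "x : A" for x using that BV hA unfolding W_def by auto
 define qq where "qq = {x : A. h x : Q}"
 have qq: "prime_in A qq" unfolding prime_in_def ideal_in_def submod_def
 proof (intro conjI ballI impI)
  note q' = prime_inD(2)[OF Q]
  show "qq <= A" by (simp add: qq_def)
  show "0 : qq" using Q0 subringD(2)[OF A] by (simp add: qq_def)
  show "1 ~: qq" using prime_inD(3)[OF Q] by (simp add: qq_def)
  show "x + y : qq" if "x : qq" "y : qq" for x y using that submodD(2)[OF q'] subringD(6)[OF A] by (simp add: qq_def h.hom_add)
  show "d * x : qq" if "d : A" "x : qq" for d x using that submodD(3)[OF q', of "h d" "h x"] hA subringD(4)[OF A] by (simp add: qq_def h.hom_mult)
  show "x : qq \<or> y : qq" if "x : A" "y : A" "x * y : qq" for x y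
   using that prime_inD(4)[OF Q, of "h x" "h y"] hA by (simp add: qq_def h.hom_mult)
 qed
 have den1: "\<exists>b\<in>A. h b ~: Q & b * y : A" if y: "y : W" for y
 proof -
  obtain n where n: "n ~= (0 :: int)" "algebraic_int (of_int n * y)" using number_field_int_multiple[OF nf, of y] by (elim exE conjE)
  obtain b where b: "b : A" "b * y : A" "b ~: qq \<or> b * y ~: qq"
   using exists_integral_denominator[OF n qq[unfolded A_def]] unfolding A_def by (elim bexE conjE)
  \<comment> \<open>Otherwise \<open>b * y\<close> is outside \<open>Q\<close> and so a unit of
    \<open>V\<close>; but it is also a multiple in \<open>V\<close> of \<open>b\<close>, which lies
    in the maximal ideal of \<open>V\<close>.\<close>
  have "h b ~: Q"
  proof
   assume hb: "h b : Q"
   define z where "z = h (b * y)"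
   have zQ: "z ~: Q" using b hb by (simp add: qq_def z_def)
   have "algebraic_int z" using b(2) hA[of "b * y"] by (simp add: B_def z_def)
   then have iV: "inverse z : V" using zQ by (rule invV)
   have hbm: "h b : V.mV" using QmV hb by (rule subsetD)
   have "h y * h b : V.mV" by (rule V.mV_mult[OF _ hbm]) (use y in "simp add: W_def")
   then have "z : V.mV" by (simp add: z_def h.hom_mult mult.commute)
   from V.mV_mult[OF iV this] have "inverse z * z : V.mV" .
   moreover have "z ~= 0" using zQ Q0 by auto
   ultimately show False using prime_inD(3)[OF V.prime_mV] by simp
  qed
  then show ?thesis using b by (intro bexI[of _ b] conjI)
 qed
 have den: "\<exists>s\<in>A. h s ~: Q & (\<forall>y\<in>Y. s * y : A)" if "finite Y" "Y <= W" for Y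
  using that
 proof (induction Y)
  case empty
  show ?case using subringD(1)[OF A] prime_inD(3)[OF Q] by (intro bexI[of _ 1]) simp_all
 next
  case (insert y Y)
  obtain s where s: "s : A" "h s ~: Q" "\<forall>y\<in>Y. s * y : A" using insert.IH insert.prems by auto
  obtain b where b: "b : A" "h b ~: Q" "b * y : A" using den1[of y] insert.prems by auto
  show ?case
  proof (intro bexI[of _ "s * b"] conjI ballI)
   show "s * b : A" by (rule subringD(4)[OF A s(1) b(1)])
   show "h (s * b) ~: Q" using prime_inD(4)[OF Q, of "h s" "h b"] s b hA by (auto simp: h.hom_mult)
   fix z assume z: "z : insert y Y"
   show "s * b * z : A"
   proof (cases "z = y")
    case True
    then show ?thesis using subringD(4)[OF A s(1) b(3)] by (simp add: mult.assoc)
   next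
    case False
    then have "b * (s * z) : A" using z s(3) by (intro subringD(4)[OF A b(1)]) simp
    then show ?thesis by (simp add: mult_ac)
   qed
  qed
 qed
 have den2: "\<exists>s\<in>A. h s ~: Q & cc s * x : polys2 A & cc s * y : polys2 A" if x: "x : polys2 W" and y: "y : polys2 W" for x y
 proof -
  let ?C = "\<lambda>f. {coeff (coeff f j) i | i j. True}"
  have sub: "?C x \<union> ?C y <= W" using x y unfolding polys2_iff by auto
  obtain s where s: "s : A" "h s ~: Q" "\<forall>z\<in>?C x \<union> ?C y. s * z : A"
   using den[OF finite_UnI[OF finite_coeffs2 finite_coeffs2] sub] by (elim bexE conjE)
  have "s * coeff (coeff x j) i : A" "s * coeff (coeff y j) i : A" for i j
   by (rule bspec[OF s(3) UnI1[OF coeffs2_mem]], rule bspec[OF s(3) UnI2[OF coeffs2_mem]])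
  then show ?thesis using s(1,2) by (intro bexI[of _ s] conjI) (simp_all add: polys2_iff)
 qed
 \<comment> \<open>These are the multipliers that become invertible at \<open>m\<close>: the index
   of \<open>P\<close> and the denominators supplied by \<open>den\<close>.\<close>
 have unit: "of_nat n * cc s : S - m" if s: "s : A" "h s ~: Q" and n: "\<not> p dvd n" for n s
 proof
  show S0: "of_nat n * cc s : S"
   by (rule subringD(4)[OF S subring_of_nat[OF S]]) (simp add: S_def G.cc_invariants[OF A s(1)])
  show "of_nat n * cc s ~: m"
  proof
   assume "of_nat n * cc s : m"
   then have "of_nat n * cc (h s) : M" using mM[OF S0] by (simp add: io.hom_mult io.hom_of_nat ios)
   moreover have "h s : B" using s(1) hA by simp
   ultimately have "of_nat n : M \<or> cc (h s) : M" using MP.M_prime[OF subring_of_nat[OF R] ccB] by blast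
   moreover have "cc (h s) ~: M" using s(2) `h s : B` by (simp add: Q_def)
   ultimately have nM: "of_nat n : M" by simp
   have "coprime n p" using prime_imp_coprime[OF p n] by (simp add: coprime_commute)
   then obtain k l where kl: "n * k = p * l + 1" using coprime_bezout_strong[of n p] prime_gt_1_nat[OF p] by auto
   have "of_nat k * of_nat n - of_nat l * of_nat p : M"
    by (intro MP.M_diff MP.M_mult nM pM subring_of_nat[OF R])
   moreover have "of_nat k * of_nat n - of_nat l * of_nat p = (1 :: 'k alg_closure poly poly)"
   proof -
    have "(of_nat (n * k) :: 'k alg_closure poly poly) = of_nat (p * l + 1)" unfolding kl ..
    then show ?thesis by (simp add: mult.commute)
   qed
   ultimately show False using MP.one_notin by simp
  qed
 qed
 have GLV: "N $ i $ k : V" if "N : GL" for N i k using GLB[OF that] BV by blast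
 have q1: "q > 1" unfolding q_def by (rule one_less_power[OF prime_gt_1_nat[OF p] j(1)])
 have fprim: "V.primitive (io f)" unfolding iof orbit_frob_def
  by (rule V.primitive_prod, rule V.orbit_frob_factor_primitive[OF GL GLV _ q1])
 have ioV: "io x : polys2 V" if "x : S" for x using ioR[OF S_pol[OF that]] BV unfolding polys2_iff by blast
 have iop: "io (of_nat n) = of_nat n" for n by (rule io.hom_of_nat)
 have p0: "(of_nat p :: 'k) ~= 0" using prime_gt_0_nat[OF p] by simp
 \<comment> \<open>As \<open>f\<close> is primitive over \<open>V\<close>, it is a nonzerodivisor
   modulo \<open>p\<close> there. The quotient \<open>a / p\<close> has coefficients in the number
   field already, so only its denominators have to be cleared.\<close>
 have reg1: "\<exists>t\<in>S - m. \<exists>c\<in>S. t * a = of_nat p * c" if a: "a : S" and b: "b : S" and eq: "f * a = of_nat p * b" for a b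
 proof -
  have eq': "io f * io a = of_nat p * io b" using arg_cong[OF eq, of io] by (simp add: io.hom_mult iop)
  have "\<exists>d\<in>polys2 V. io a = of_nat p * d"
   using prime_gt_0_nat[OF p] by (intro V.divide_by_nat[OF _ _ fprim eq' ioV[OF b]]) simp_all
  then obtain d where d: "d : polys2 V" "io a = of_nat p * d" by (elim bexE)
  define k where "k = cc (inverse (of_nat p)) * a"
  have pk: "of_nat p * k = a"
  proof -
   have "cc (inverse (of_nat p) * of_nat p :: 'k) = cc (inverse (of_nat p)) * of_nat p" by (simp only: cc.hom_mult cc.hom_of_nat)
   then have "cc (inverse (of_nat p)) * of_nat p = (1 :: 'k poly poly)" using p0 by simp
   moreover have "of_nat p * k = (cc (inverse (of_nat p)) * of_nat p) * a" by (simp add: k_def mult_ac)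
   ultimately show ?thesis by simp
  qed
  have "of_nat p * io k = of_nat p * d" using arg_cong[OF pk, of io] d(2) by (simp add: io.hom_mult iop)
  then have "io k = d" using prime_gt_0_nat[OF p] by simp
  then have kW: "k : polys2 W" using d(1) by (auto simp: polys2_iff W_def cio[symmetric])
  obtain s where s: "s : A" "h s ~: Q" "cc s * k : polys2 A" using den2[OF kW kW] by (elim bexE conjE)
  have "cc s * k : S" by (rule S_I[OF s(3)]) (simp add: act.hom_mult k_def S_act[OF a])
  moreover have "of_nat 1 * cc s : S - m" by (rule unit[OF s(1,2)]) (use prime_gt_1_nat[OF p] in simp)
  moreover have "of_nat 1 * cc s * a = of_nat p * (cc s * k)" unfolding pk[symmetric] by (simp add: mult_ac)
  ultimately show ?thesis by (intro bexI[of _ "of_nat 1 * cc s"] bexI[of _ "cc s * k"])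
 qed
 obtain P n where P: "finite_matrix_group P" "P <= G" "card P = p ^ n" "\<not> p dvd card G div card P"
  "\<forall>N\<in>P. mpow N p = mat 1" using sylow[OF p] by (elim exE conjE)
 define PL where "PL = map_entries h ` P"
 have PL: "finite_matrix_group PL" unfolding PL_def by (rule finite_matrix_group_map_entries[OF h P(1)])
 interpret PL: finite_matrix_group PL by (rule PL)
 have PLG: "PL <= GL" unfolding PL_def GL_def by (rule image_mono[OF P(2)])
 have cardPL: "card PL = p ^ n" unfolding PL_def P(3)[symmetric] by (rule card_image[OF inj_on_subset[OF inj_e subset_UNIV]])
 have expoPL: "mpow N p = mat 1" if N: "N : PL" for N
 proof -
  obtain N' where N': "N = map_entries h N'" "N' : P" using N unfolding PL_def by (rule imageE)
  then show ?thesis using P(5) map_entries_mpow[OF h, of N' p] map_entries_one[OF h] by simp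
 qed
 have ioinv: "io x : PL.invariants V" if x: "x : S" for x
 proof -
  have "act N (io x) = io x" if N: "N : PL" for N
  proof -
   obtain N' where N': "N = map_entries h N'" "N' : P" using N unfolding PL_def by (rule imageE)
   have "act N' x = x" by (rule S_act[OF x subsetD[OF P(2) N'(2)]])
   then show ?thesis unfolding N'(1) ioact[symmetric] by simp
  qed
  then show ?thesis using ioV[OF x] by (simp add: PL.invariants_def)
 qed
 have reg2: "\<exists>t\<in>S - m. \<exists>d\<in>S. \<exists>e\<in>S. t * a = of_nat p * d + f * e"
  if a: "a : S" and b: "b : S" and c: "c : S" and eq: "g * a = of_nat p * b + f * c" for a b c
 proof -
  have eq': "orbit_frob GL q (var_X + var_Y ^ 2) * io a = of_nat p * io b + orbit_frob GL q var_X * io c"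
   using arg_cong[OF eq, of io] unfolding io.hom_mult io.hom_add iop iof iog .
  have "\<exists>b'\<in>PL.invariants V. \<exists>c'\<in>PL.invariants V. io a = of_nat p * b' + orbit_frob GL q var_X * c'"
  proof (rule orbit_frob_regular[OF valV _ GL _ PL PLG cardPL _ _ _ p j(1) q_def ioinv[OF a] ioinv[OF b] ioinv[OF c] eq'])
   show "\<exists>x. poly r x = 0" if "degree r > 0" for r :: "'k alg_closure poly" using that by (rule alg_closed_imp_poly_has_root)
   show "algebraic_int (N $ i $ k)" if "N : GL" for N i k using GLB[OF that] by (simp add: B_def)
   show "mpow N p = mat 1" if "N : PL" for N by (rule expoPL[OF that])
   show "x : V" if "algebraic_int x" for x using BV that by (auto simp: B_def)
   show "\<exists>x s. algebraic_int x & algebraic_int s & s * v = x & s ~= 0 & inverse s : V" if "v : V" for v by (rule frac[OF that])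
  qed
  then obtain b' c' where bc: "b' : PL.invariants V" "c' : PL.invariants V" "io a = io (of_nat p) * b' + io f * c'"
   unfolding iop iof by (elim bexE)
  let ?C = "\<lambda>f :: 'k alg_closure poly poly. {coeff (coeff f j) i | i j. True}"
  have FV: "?C b' \<union> ?C c' <= V" using bc(1,2) by (auto simp: PL.invariants_def polys2_iff)
  \<comment> \<open>The finite set consists of all coefficients of \<open>b'\<close> and
    \<open>c'\<close>, so their images have coefficients in \<open>W\<close>.\<close>
  obtain rh where rh: "\<forall>x y. rh (x + y) = rh x + rh y" "\<forall>c x. rh (h c * x) = c * rh x" "rh 1 = 1" "\<forall>x\<in>?C b' \<union> ?C c'. h (rh x) : V"
   using valuation_retraction[OF h valV finite_UnI[OF finite_coeffs2 finite_coeffs2] FV] by (elim exE conjE)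
  have add: "rh (x + y) = rh x + rh y" and lin: "rh (h c * x) = c * rh x" for x y c using rh(1,2) by simp_all
  have r0: "rh 0 = 0" using add[of 0 0] by simp
  note rm = map_coeffs_linear_mult[OF h add lin, folded io_def]
  define b2 c2 where "b2 = map_coeffs rh b'" and "c2 = map_coeffs rh c'"
  have aeq: "a = of_nat p * b2 + f * c2"
  proof -
   have "map_coeffs rh 1 = 1"
   proof (rule poly2_eqI)
    fix i j
    show "coeff (coeff (map_coeffs rh 1) j) i = coeff (coeff 1 j) i"
     unfolding coeff_map_coeffs[of rh, OF r0] by (cases "j = 0"; cases "i = 0") (simp_all add: coeff_1 rh(3) r0)
   qed
   then have "a = map_coeffs rh (io a * 1)" unfolding rm by simp
   also have "\<dots> = map_coeffs rh (io (of_nat p) * b' + io f * c')" using bc(3) by simp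
   also have "\<dots> = of_nat p * b2 + f * c2" unfolding map_coeffs_linear_add[OF h add lin] rm b2_def c2_def ..
   finally show ?thesis .
  qed
  have W2: "b2 : polys2 W" "c2 : polys2 W" unfolding b2_def c2_def polys2_iff coeff_map_coeffs[of rh, OF r0] W_def
   using bspec[OF rh(4) UnI1[OF coeffs2_mem]] bspec[OF rh(4) UnI2[OF coeffs2_mem]] by simp_all
  have inv2: "act N b2 = b2" "act N c2 = c2" if N: "N : P" for N
  proof -
   have "map_entries h N : PL" unfolding PL_def using N by (rule imageI)
   then have "act (map_entries h N) b' = b'" "act (map_entries h N) c' = c'" using bc(1,2) by (simp_all add: PL.invariants_def)
   then show "act N b2 = b2" "act N c2 = c2" unfolding b2_def c2_def map_coeffs_linear_act[OF h add lin, symmetric] by simp_all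
  qed
  have "(of_nat (card P) :: 'k) ~= 0" unfolding P(3) using p0 by simp
  from G.coset_transfer[OF P(1,2) this]
  obtain R where R: "finite R" "R <= G" "card R * card P = card G"
   "\<forall>x N. (\<forall>L\<in>P. act L x = x) --> N : G --> act N (\<Sum>L\<in>R. act L x) = (\<Sum>L\<in>R. act L x)" by (elim exE conjE)
  \<comment> \<open>The transfer. It multiplies the \<open>G\<close>-invariant \<open>a\<close> by
    \<open>card R\<close>, the index of \<open>P\<close>, which is prime to
    \<open>p\<close>.\<close>
  define T where "T x = (\<Sum>L\<in>R. act L x)" for x :: "'k poly poly"
  have "T a = (\<Sum>L\<in>R. a)" unfolding T_def by (rule sum.cong[OF refl], rule S_act[OF a], erule subsetD[OF R(2)])
  then have Ta: "of_nat (card R) * a = T a" by simp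
  have "T a = (\<Sum>L\<in>R. of_nat p * act L b2 + f * act L c2)" unfolding T_def
  proof (rule sum.cong[OF refl])
   fix L assume "L : R"
   then have "act L f = f" using S_act[OF fS] R(2) by blast
   then show "act L a = of_nat p * act L b2 + f * act L c2" unfolding aeq by (simp add: act.hom_add act.hom_mult act.hom_of_nat)
  qed
  then have Teq: "T a = of_nat p * T b2 + f * T c2" by (simp add: T_def sum.distrib sum_distrib_left)
  have TW: "T x : polys2 W" if "x : polys2 W" for x unfolding T_def
  proof (rule subring_sum[OF subring_polys2[OF W]])
   fix L assume "L : R"
   then have "L : G" using R(2) by blast
   then show "act L x : polys2 W" by (intro act_polys2[OF W _ that] AW Gint)
  qed
  have inv2': "\<forall>L\<in>P. act L b2 = b2" "\<forall>L\<in>P. act L c2 = c2" by (rule ballI, erule inv2)+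
  have Tinv: "act N (T b2) = T b2" "act N (T c2) = T c2" if N: "N : G" for N
   unfolding T_def by (rule mp[OF mp[OF spec[OF spec[OF R(4)]] inv2'(1)] N], rule mp[OF mp[OF spec[OF spec[OF R(4)]] inv2'(2)] N])
  obtain s where s: "s : A" "h s ~: Q" "cc s * T b2 : polys2 A" "cc s * T c2 : polys2 A"
   using den2[OF TW[OF W2(1)] TW[OF W2(2)]] by (elim bexE conjE)
  have "cc s * T b2 : S" by (rule S_I[OF s(3)]) (simp add: act.hom_mult Tinv)
  moreover have "cc s * T c2 : S" by (rule S_I[OF s(4)]) (simp add: act.hom_mult Tinv)
  moreover have "of_nat (card R) * cc s : S - m"
  proof (rule unit[OF s(1,2)])
   have "card P > 0" unfolding P(3) using prime_gt_0_nat[OF p] by simp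
   then have "card G div card P = card R" unfolding R(3)[symmetric] by simp
   then show "\<not> p dvd card R" using P(4) by simp
  qed
  moreover have "of_nat (card R) * cc s * a = of_nat p * (cc s * T b2) + f * (cc s * T c2)"
  proof -
   have "of_nat (card R) * cc s * a = cc s * T a" unfolding Ta[symmetric] by (simp add: mult_ac)
   then show ?thesis unfolding Teq by (simp add: algebra_simps)
  qed
  ultimately show ?thesis by (intro bexI[of _ "of_nat (card R) * cc s"] bexI[of _ "cc s * T b2"] bexI[of _ "cc s * T c2"])
 qed
 interpret L: domain_localization S m by unfold_locales (rule S, rule m)
 have "cohen_macaulay_local (localization_at (RD S) m)"
 proof (rule L.cohen_macaulay_local_Loc[OF _ _ pm fm gm])
  show "noeth_mod S S" unfolding S_def
   by (rule G.noeth_invariants[OF A noeth_algebraic_ints[OF nf, folded A_def] Gint])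
  show "(of_nat p :: 'k poly poly) ~= 0" using prime_gt_0_nat[OF p] by simp
  fix C assume C: "!!i. i <= 4 ==> prime_in S (C i)" "!!i. i < 4 ==> C i \<subset> C (Suc i)"
  show False by (rule no_prime_chain_of_length_4[OF nf S, where P = C], erule C(1), erule C(2))
 qed (rule reg1, assumption+, rule reg2, assumption+)
 then show ?thesis by (simp only: S_def)
qed

section \<open>Sylow subgroups and the ring of invariants\<close>

lemma group_GL2:
 fixes A :: "'a :: comm_ring_1 set"
 assumes A: "subring_set A"
 shows "group (GL2 A)"
proof (rule groupI)
 have mem: "M : carrier (GL2 A) \<longleftrightarrow> (\<forall>i j. M $ i $ j : A) \<and>
   (\<exists>N. (\<forall>i j. N $ i $ j : A) & M ** N = mat 1 & N ** M = mat 1)" for M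
  by (simp add: GL2_def)
 have ml: "monoid.mult (GL2 A) = (**)" "one (GL2 A) = mat 1" by (simp_all add: GL2_def)
 have prod: "(M ** N) $ i $ j : A" if "\<forall>i j. M $ i $ j : A" "\<forall>i j. N $ i $ j : A" for M N :: "'a^2^2" and i j
  unfolding mult2_nth using that by (intro subringD(6)[OF A] subringD(4)[OF A]) blast+
 have one_A: "\<forall>i j. (mat 1 :: 'a^2^2) $ i $ j : A" by (simp add: mat1_nth subringD(1,2)[OF A])
 show "\<one>\<^bsub>GL2 A\<^esub> : carrier (GL2 A)" unfolding mem ml using one_A
  by (intro conjI exI[of _ "mat 1"]) simp_all
 fix x assume x: "x : carrier (GL2 A)"
 then obtain x' where x': "\<forall>i j. x' $ i $ j : A" "x ** x' = mat 1" "x' ** x = mat 1"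
  unfolding mem by (elim exE conjE)
 have xA: "\<forall>i j. x $ i $ j : A" using x unfolding mem by (rule conjunct1)
 show "\<one>\<^bsub>GL2 A\<^esub> \<otimes>\<^bsub>GL2 A\<^esub> x = x" unfolding ml by simp
 have "x' : carrier (GL2 A)" unfolding mem using x' xA by (intro conjI exI[of _ x])
 then show "\<exists>y\<in>carrier (GL2 A). y \<otimes>\<^bsub>GL2 A\<^esub> x = \<one>\<^bsub>GL2 A\<^esub>" unfolding ml by (rule bexI[rotated]) (rule x'(3))
 fix y assume y: "y : carrier (GL2 A)"
 then obtain y' where y': "\<forall>i j. y' $ i $ j : A" "y ** y' = mat 1" "y' ** y = mat 1"
  unfolding mem by (elim exE conjE)
 have yA: "\<forall>i j. y $ i $ j : A" using y unfolding mem by (rule conjunct1)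
 show "x \<otimes>\<^bsub>GL2 A\<^esub> y : carrier (GL2 A)" unfolding mem ml
 proof (intro conjI allI exI[of _ "y' ** x'"])
  show "(x ** y) $ i $ j : A" "(y' ** x') $ i $ j : A" for i j by (rule prod[OF xA yA], rule prod[OF y'(1) x'(1)])
  have "(x ** y) ** (y' ** x') = x ** (y ** y') ** x'" by (simp add: matrix_mul_assoc)
  then show "(x ** y) ** (y' ** x') = mat 1" by (simp add: y'(2) x'(2))
  have "(y' ** x') ** (x ** y) = y' ** (x' ** x) ** y" by (simp add: matrix_mul_assoc)
  then show "(y' ** x') ** (x ** y) = mat 1" by (simp add: y'(3) x'(3))
 qed
 fix z assume "z : carrier (GL2 A)"
 show "x \<otimes>\<^bsub>GL2 A\<^esub> y \<otimes>\<^bsub>GL2 A\<^esub> z = x \<otimes>\<^bsub>GL2 A\<^esub> (y \<otimes>\<^bsub>GL2 A\<^esub> z)" unfolding ml by (simp add: matrix_mul_assoc)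
qed

lemma finite_matrix_group_if_group:
 fixes A :: "'a :: field set"
 assumes "group ((GL2 A)\<lparr>carrier := H\<rparr>)" "finite H"
 shows "finite_matrix_group H"
proof -
 let ?H = "(GL2 A)\<lparr>carrier := H\<rparr>"
 interpret group ?H by fact
 have ml: "monoid.mult ?H = (**)" "one ?H = mat 1" "carrier ?H = H" by (simp_all add: GL2_def)
 show ?thesis
 proof
  show "finite H" by fact
  show "mat 1 : H" using one_closed unfolding ml .
  show "M ** N : H" if "M : H" "N : H" for M N using m_closed[of M N] that unfolding ml .
  show "\<exists>N\<in>H. N ** M = mat 1 & M ** N = mat 1" if "M : H" for M
   using inv_closed[of M] l_inv[of M] r_inv[of M] that unfolding ml by blast
 qed
qed

lemma nat_pow_eq_mpow:
 assumes "group ((GL2 A)\<lparr>carrier := H\<rparr>)" "M : H"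
 shows "M [^]\<^bsub>(GL2 A)\<lparr>carrier := H\<rparr>\<^esub> (n :: nat) = mpow M n"
proof -
 let ?H = "(GL2 A)\<lparr>carrier := H\<rparr>"
 interpret group ?H by fact
 have ml: "monoid.mult ?H = (**)" "one ?H = mat 1" by (simp_all add: GL2_def)
 have comm: "mpow M n ** M = M ** mpow M n" for n
  using mpow_add[of M n 1] mpow_add[of M 1 n] by (simp add: add.commute)
 show ?thesis by (induction n) (simp_all only: nat_pow_0 nat_pow_Suc ml mpow_simps comm)
qed

text \<open>The prime found in a maximal ideal need not divide \<open>card G\<close>; in that case
  the trivial subgroup serves. For a prime divisor the exponent is read off from
  \<open>group_exponent\<close>.\<close>

lemma sylow_subgroups_of_exponent:
 fixes A :: "'k :: field_char_0 set"
 assumes A: "subring_set A" and G: "subgroup G (GL2 A)" "finite G" and p: "prime (p :: nat)"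
  and expo: "!!P. p dvd card G ==> sylow_subgroup p P ((GL2 A)\<lparr>carrier := G\<rparr>) ==>
   group_exponent ((GL2 A)\<lparr>carrier := P\<rparr>) = p"
 shows "\<exists>P n. finite_matrix_group P & P <= G & card P = p ^ n \<and>
   \<not> p dvd card G div card P & (\<forall>M\<in>P. mpow M p = mat 1)"
proof -
 let ?H = "(GL2 A)\<lparr>carrier := G\<rparr>"
 have H: "group ?H" by (rule subgroup.subgroup_is_group[OF G(1) group_GL2[OF A]])
 have order: "Coset.order ?H = card G" by (simp add: Coset.order_def)
 have G0: "card G ~= 0"
  using finite_matrix_group.one[OF finite_matrix_group_if_group[OF H G(2)]] G(2) by auto
 define n where "n = multiplicity p (card G)"
 obtain r where r: "card G = p ^ n * r" using multiplicity_dvd[of p "card G"] unfolding n_def by (elim dvdE)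
 have pr: "\<not> p dvd r"
 proof
  assume "p dvd r"
  then have "p ^ Suc n dvd card G" unfolding r power_Suc2 by (rule mult_dvd_mono[OF dvd_refl])
  then have "Suc n <= n" unfolding n_def using G0 prime_gt_1_nat[OF p] by (intro multiplicity_geI) auto
  then show False by simp
 qed
 obtain P where P: "subgroup P ?H" "card P = p ^ n"
  using sylow_thm[OF p H, of n r] G(2) order r by (auto simp: Coset.order_def)
 have PG: "P <= G" using subgroup.subset[OF P(1)] by simp
 have finP: "finite P" by (rule finite_subset[OF PG G(2)])
 have eqP: "?H\<lparr>carrier := P\<rparr> = (GL2 A)\<lparr>carrier := P\<rparr>" by simp
 have HP: "group ((GL2 A)\<lparr>carrier := P\<rparr>)" using subgroup.subgroup_is_group[OF P(1) H] unfolding eqP .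
 interpret P: group "(GL2 A)\<lparr>carrier := P\<rparr>" by (rule HP)
 have one: "\<one>\<^bsub>(GL2 A)\<lparr>carrier := P\<rparr>\<^esub> = mat 1" by (simp add: GL2_def)
 have fmP: "finite_matrix_group P" by (rule finite_matrix_group_if_group[OF HP finP])
 have ord: "Coset.order ((GL2 A)\<lparr>carrier := P\<rparr>) = card P" by (simp add: Coset.order_def)
 have "mpow M p = mat 1" if M: "M : P" for M
 proof (cases "p dvd card G")
  case True
  have "sylow_subgroup p P ?H" unfolding sylow_subgroup_def order using P by (simp add: n_def)
  from expo[OF True this] have e: "group_exponent ((GL2 A)\<lparr>carrier := P\<rparr>) = p" .
  \<comment> \<open>\<open>card P\<close> is an exponent, so the least one in
    \<open>group_exponent\<close> is attained.\<close>
  have ex: "card P > 0 & (\<forall>x\<in>carrier ((GL2 A)\<lparr>carrier := P\<rparr>).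
    x [^]\<^bsub>(GL2 A)\<lparr>carrier := P\<rparr>\<^esub> card P = \<one>\<^bsub>(GL2 A)\<lparr>carrier := P\<rparr>\<^esub>)"
   using P.pow_order_eq_1 prime_gt_0_nat[OF p] unfolding ord by (simp add: P(2))
  have "group_exponent ((GL2 A)\<lparr>carrier := P\<rparr>) > 0 & (\<forall>x\<in>carrier ((GL2 A)\<lparr>carrier := P\<rparr>).
    x [^]\<^bsub>(GL2 A)\<lparr>carrier := P\<rparr>\<^esub> group_exponent ((GL2 A)\<lparr>carrier := P\<rparr>) = \<one>\<^bsub>(GL2 A)\<lparr>carrier := P\<rparr>\<^esub>)"
   unfolding group_exponent_def by (rule LeastI[of _ "card P"]) (rule ex)
  then have "M [^]\<^bsub>(GL2 A)\<lparr>carrier := P\<rparr>\<^esub> p = \<one>\<^bsub>(GL2 A)\<lparr>carrier := P\<rparr>\<^esub>" unfolding e using M by simp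
  then show ?thesis unfolding nat_pow_eq_mpow[OF HP M] one .
 next
  case False
  then have "n = 0" unfolding n_def by (rule not_dvd_imp_multiplicity_0)
  then have "card P = 1" using P(2) by simp
  then obtain y where y: "P = {y}" by (auto simp: card_1_singleton_iff)
  then have "M = mat 1" using M finite_matrix_group.one[OF fmP] by simp
  moreover have "mpow (mat 1 :: 'k^2^2) k = mat 1" for k by (induction k) simp_all
  ultimately show ?thesis by simp
 qed
 moreover have "card G div card P = r" unfolding r P(2) using prime_gt_0_nat[OF p] by simp
 ultimately show ?thesis using fmP PG P(2) pr by (intro exI[of _ P] exI[of _ n] conjI ballI) simp_all
qed

lemma invariant_ring_eq:
 assumes "finite_matrix_group G"
 shows "invariant_ring A G = RD (finite_matrix_group.invariants G A)"
proof -
 interpret finite_matrix_group G by fact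
 have "{f. \<forall>i j. coeff (coeff f j) i : A} = polys2 A" by (auto simp: polys2_iff)
 then have "{f : carrier (poly_ring_XY A). \<forall>M\<in>G. act M f = f} = invariants A"
  by (simp add: poly_ring_XY_def invariants_def)
 then show ?thesis by (simp add: invariant_ring_def poly_ring_XY_def)
qed

text \<open>By maximality \<open>m + c S\<close> is the whole ring, and writing \<open>1\<close> in
  this form produces \<open>e\<close>.\<close>

lemma inverse_mod_maximalideal:
 assumes S: "subring_set S" and m: "maximalideal m (RD S)" and c: "c : S" "c ~: m"
 shows "\<exists>e\<in>S. c * e - 1 : m"
proof -
 interpret maximalideal m "RD S" by (rule m)
 have mi: "ideal_in S m" using ideal_axioms ideal_RD[OF S] by simp
 then have ms: "submod S m" "m <= S" by (simp_all add: ideal_in_def)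
 define J where "J = {x + c * y | x y. x : m & y : S}"
 have J_I: "x + c * y : J" if "x : m" "y : S" for x y
  unfolding J_def by (rule CollectI, intro exI[of _ x] exI[of _ y] conjI that refl)
 have J_E: "\<exists>x\<in>m. \<exists>y\<in>S. z = x + c * y" if "z : J" for z using that unfolding J_def by blast
 have "ideal_in S J" unfolding ideal_in_def submod_def
 proof (intro conjI ballI subsetI)
  show "0 : J" using J_I[OF submodD(1)[OF ms(1)] subringD(2)[OF S]] by simp
  fix z assume z: "z : J"
  obtain x y where xy: "x : m" "y : S" "z = x + c * y" using J_E[OF z] by (elim bexE)
  show "z : S" unfolding xy(3) by (intro subringD(6)[OF S] subringD(4)[OF S] c xy subsetD[OF ms(2)])
  show "z + z' : J" if z': "z' : J" for z'
  proof -
   obtain x' y' where xy': "x' : m" "y' : S" "z' = x' + c * y'" using J_E[OF z'] by (elim bexE)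
   have "z + z' = (x + x') + c * (y + y')" by (simp add: xy(3) xy'(3) algebra_simps)
   then show ?thesis using J_I[OF submodD(2)[OF ms(1) xy(1) xy'(1)] subringD(6)[OF S xy(2) xy'(2)]] by simp
  qed
  show "d * z : J" if d: "d : S" for d
  proof -
   have "d * z = d * x + c * (d * y)" by (simp add: xy(3) algebra_simps)
   then show ?thesis using J_I[OF submodD(3)[OF ms(1) d xy(1)] subringD(4)[OF S d xy(2)]] by simp
  qed
 qed
 then have J: "ideal J (RD S)" "J <= S" using ideal_RD[OF S] by (simp_all add: ideal_in_def)
 have mJ: "m <= J"
 proof
  fix x assume "x : m"
  then show "x : J" using J_I[OF _ subringD(2)[OF S], of x] by simp
 qed
 have cJ: "c : J" using J_I[OF submodD(1)[OF ms(1)] subringD(1)[OF S]] by simp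
 have "J = m \<or> J = carrier (RD S)" by (rule I_maximal[OF J(1) mJ]) (simp add: J(2))
 then have "J = S" using cJ c(2) by auto
 then have "1 : J" using subringD(1)[OF S] by simp
 then obtain x y where xy: "x : m" "y : S" "1 = x + c * y" using J_E by blast
 have "c * y - 1 = - 1 * x" using xy(3) by (simp add: algebra_simps)
 then have "c * y - 1 : m" using submodD(3)[OF ms(1) subringD(5)[OF S subringD(1)[OF S]] xy(1)] by simp
 then show ?thesis using xy(2) by (rule bexI)
qed

theorem theorem1p4:
  fixes A :: "'k :: field_char_0 set"
    and G :: "('k^2^2) set"
  assumes "number_field TYPE('k)"
    and "A = ring_of_integers"
    and "subgroup G (GL2 A)"
    and "finite G"
    and "\<And>p P. \<lbrakk>prime (p :: nat); p dvd card G;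
            sylow_subgroup p P ((GL2 A)\<lparr>carrier := G\<rparr>)\<rbrakk>
          \<Longrightarrow> group_exponent ((GL2 A)\<lparr>carrier := P\<rparr>) = p"
  shows "cohen_macaulay (invariant_ring A G)"
proof -
 have A_eq: "A = {x. algebraic_int x}" using assms(2) by (simp add: ring_of_integers_def)
 have A: "subring_set A" unfolding A_eq by (rule subring_algebraic_ints)
 have fmG: "finite_matrix_group G"
  by (rule finite_matrix_group_if_group[OF subgroup.subgroup_is_group[OF assms(3) group_GL2[OF A]] assms(4)])
 interpret G: finite_matrix_group G by (rule fmG)
 have Gint: "M $ i $ j : A" if "M : G" for M i j
  using subsetD[OF subgroup.subset[OF assms(3)] that] by (simp add: GL2_def)
 define S where "S = G.invariants A"
 have S: "subring_set S" unfolding S_def by (rule G.subring_invariants[OF A])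
 have ring: "invariant_ring A G = RD S" unfolding S_def by (rule invariant_ring_eq[OF fmG])
 have noeth: "noeth_mod S S" unfolding S_def
  by (rule G.noeth_invariants[OF A noeth_algebraic_ints[OF assms(1), folded A_eq] Gint])
 show ?thesis unfolding cohen_macaulay_def ring
 proof (intro conjI allI impI)
  show "cring (RD S)" by (rule cring_RD[OF S])
  show "noetherian_ring (RD S)" by (rule noetherian_ring_RD[OF S noeth])
  fix m assume m: "maximalideal m (RD S)"
  have pm: "prime_in S m" using cring.maximalideal_prime[OF cring_RD[OF S] m] primeideal_RD[OF S] by simp
  show "cohen_macaulay_local (localization_at (RD S) m)" unfolding S_def A_eq
  proof (rule cohen_macaulay_local_invariants[OF assms(1) fmG])
   show "M $ i $ j : {x. algebraic_int x}" if "M : G" for M i j using Gint[OF that] unfolding A_eq .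
   show "prime_in (G.invariants {x. algebraic_int x}) m" using pm unfolding S_def A_eq .
   show "\<exists>P n. finite_matrix_group P & P <= G & card P = p ^ n & \<not> p dvd card G div card P \<and>
     (\<forall>M\<in>P. mpow M p = mat 1)" if p: "prime p" for p :: nat
    by (rule sylow_subgroups_of_exponent[OF A assms(3,4) p], rule assms(5)[OF p])
   show "\<exists>e\<in>G.invariants {x. algebraic_int x}. c * e - 1 : m"
    if "c : G.invariants {x. algebraic_int x}" "c ~: m" for c
    using inverse_mod_maximalideal[OF S m, of c] that unfolding S_def A_eq by simp
  qed
 qed
qed

end
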